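(* Suppose that the following statement holds for all finite-dimensional algebras $A$ over a field: for every finitely generated left $A$-module $T$, if $T$ is self-orthogonal with finite projective dimension and $T\text{-}\operatorname{domdim}_A A=+\infty$, then $T$ is a tilting module. Then, for every finite-dimensional algebra $A$ over a field $k$ and every non-negative integer $n$, every self-orthogonal $n$-quasi-generator over $A$ has projective dimension at most $n$ over $A$.
   Context: Let $A$ be a finite-dimensional algebra over a field. All modules are finitely generated, and $\operatorname{add}_A M$ is the class of modules that are direct summands of finite direct sums of copies of $M$. A module $M$ is self-orthogonal if $\operatorname{Ext}_A^i(M,M)=0$ for all $i>0$. For $A$-modules $M,T$ and $n\ge 0$, $T\text{-}\operatorname{domdim}_A M\geq n$ means that there is an exact sequence $0\to M\to T_1\to\cdots\to T_n$ with all $T_i\in\operatorname{add}_A T$ which remains exact under $\operatorname{Hom}_A(-,T)$ (i.e. $\operatorname{Hom}_A(T_n,T)\to\cdots\to\operatorname{Hom}_A(T_1,T)\to\operatorname{Hom}_A(M,T)\to 0$ is exact); $T\text{-}\operatorname{domdim}_A M=+\infty$ means that this holds for every $n\ge 0$. A module $T$ is an $n$-tilting module ($n\geq 0$) if (a) $T$ has projective dimension at most $n$; (b) $\operatorname{Ext}_A^i(T,T)=0$ for all $i>0$; (c) there is an exact sequence $0\to A\to T_0\to\cdots\to T_n\to 0$ with all $T_i\in\operatorname{add}_A T$. A tilting module is an $n$-tilting module for some $n\ge 0$. A (left or right) $A$-module $M$ is an $n$-quasi-generator if $n\ge 0$ is the minimal integer for which there is an exact sequence $0\to A\to M_0\to\cdots\to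 M_n\to 0$, with each $M_i\in\operatorname{add}_A M$, which remains exact under $\operatorname{Hom}_A(-,M)$. *)

theory Defs
  imports "HOL-Algebra.Module" "HOL-Algebra.AbelCoset" "HOL-Algebra.Elementary_Groups"
    "HOL-Library.Extended_Nat"
begin

section \<open>Algebras and modules\<close>

text \<open>
  The library locales \<open>module\<close> and \<open>algebra\<close> require the ring of scalars, respectively the
  algebra itself, to be commutative; the following are their noncommutative counterparts on the
  same records. The fields \<open>mult\<close> and \<open>one\<close> of a record representing a mere module
  are never used.
\<close>

locale left_module = R?: ring R + M?: abelian_group M
  for R :: "('a, 'c) ring_scheme" (structure) and M :: "('a, 'm, 'd) module_scheme" (structure) +
  assumes smult_closed:
      "\<lbrakk>a \<in> carrier R; x \<in> carrier M\<rbrakk> \<Longrightarrow> a \<odot>\<^bsub>M\<^esub> x \<in> carrier M"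
    and smult_l_distr:
      "\<lbrakk>a \<in> carrier R; b \<in> carrier R; x \<in> carrier M\<rbrakk> \<Longrightarrow>
        (a \<oplus>\<^bsub>R\<^esub> b) \<odot>\<^bsub>M\<^esub> x = a \<odot>\<^bsub>M\<^esub> x \<oplus>\<^bsub>M\<^esub> b \<odot>\<^bsub>M\<^esub> x"
    and smult_r_distr:
      "\<lbrakk>a \<in> carrier R; x \<in> carrier M; y \<in> carrier M\<rbrakk> \<Longrightarrow>
        a \<odot>\<^bsub>M\<^esub> (x \<oplus>\<^bsub>M\<^esub> y) = a \<odot>\<^bsub>M\<^esub> x \<oplus>\<^bsub>M\<^esub> a \<odot>\<^bsub>M\<^esub> y"
    and smult_assoc:
      "\<lbrakk>a \<in> carrier R; b \<in> carrier R; x \<in> carrier M\<rbrakk> \<Longrightarrow>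
        (a \<otimes>\<^bsub>R\<^esub> b) \<odot>\<^bsub>M\<^esub> x = a \<odot>\<^bsub>M\<^esub> (b \<odot>\<^bsub>M\<^esub> x)"
    and smult_one: "x \<in> carrier M \<Longrightarrow> \<one>\<^bsub>R\<^esub> \<odot>\<^bsub>M\<^esub> x = x"

definition finitely_generated ::
  "('a, 'c) ring_scheme \<Rightarrow> ('a, 'm, 'd) module_scheme \<Rightarrow> bool" where
  "finitely_generated R M \<longleftrightarrow>
     (\<exists>B. finite B \<and> B \<subseteq> carrier M \<and>
        (\<forall>x \<in> carrier M. \<exists>c \<in> B \<rightarrow> carrier R. x = (\<Oplus>\<^bsub>M\<^esub>b \<in> B. c b \<odot>\<^bsub>M\<^esub> b)))"

definition fd_algebra :: "'k ring \<Rightarrow> ('k, 'a) module \<Rightarrow> bool" where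
  "fd_algebra K A \<longleftrightarrow>
     field K \<and> ring A \<and> left_module K A \<and> finitely_generated K A \<and>
     (\<forall>c \<in> carrier K. \<forall>x \<in> carrier A. \<forall>y \<in> carrier A.
        (c \<odot>\<^bsub>A\<^esub> x) \<otimes>\<^bsub>A\<^esub> y = c \<odot>\<^bsub>A\<^esub> (x \<otimes>\<^bsub>A\<^esub> y) \<and>
        x \<otimes>\<^bsub>A\<^esub> (c \<odot>\<^bsub>A\<^esub> y) = c \<odot>\<^bsub>A\<^esub> (x \<otimes>\<^bsub>A\<^esub> y))"

definition regular_module :: "('a, 'c) ring_scheme \<Rightarrow> ('a, 'a) module" where
  "regular_module A =
     \<lparr>carrier = carrier A, monoid.mult = (\<otimes>\<^bsub>A\<^esub>), one = \<one>\<^bsub>A\<^esub>,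
      ring.zero = \<zero>\<^bsub>A\<^esub>, ring.add = (\<oplus>\<^bsub>A\<^esub>), smult = (\<otimes>\<^bsub>A\<^esub>)\<rparr>"

text \<open>Right modules over \<open>A\<close> are left modules over the opposite of \<open>A\<close>.\<close>

definition opposite :: "('a, 'c) ring_scheme \<Rightarrow> ('a, 'c) ring_scheme" where
  "opposite A = A\<lparr>monoid.mult := (\<lambda>x y. y \<otimes>\<^bsub>A\<^esub> x)\<rparr>"

text \<open>Homomorphisms are extensional, so that \<open>Hom A M N\<close> is the actual set of them.\<close>

definition Hom ::
  "('a, 'c) ring_scheme \<Rightarrow> ('a, 'm) module \<Rightarrow> ('a, 'n) module \<Rightarrow> ('m \<Rightarrow> 'n) set" where
  "Hom A M N = {f \<in> carrier M \<rightarrow>\<^sub>E carrier N.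
     (\<forall>x \<in> carrier M. \<forall>y \<in> carrier M. f (x \<oplus>\<^bsub>M\<^esub> y) = f x \<oplus>\<^bsub>N\<^esub> f y) \<and>
     (\<forall>a \<in> carrier A. \<forall>x \<in> carrier M. f (a \<odot>\<^bsub>M\<^esub> x) = a \<odot>\<^bsub>N\<^esub> f x)}"

definition zero_hom :: "('a, 'm) module \<Rightarrow> ('a, 'n) module \<Rightarrow> 'm \<Rightarrow> 'n" where
  "zero_hom M N = (\<lambda>x \<in> carrier M. \<zero>\<^bsub>N\<^esub>)"

definition Hom_group ::
  "('a, 'c) ring_scheme \<Rightarrow> ('a, 'm) module \<Rightarrow> ('a, 'n) module \<Rightarrow> ('m \<Rightarrow> 'n) monoid" where
  "Hom_group A M N =
     \<lparr>carrier = Hom A M N,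
      monoid.mult = (\<lambda>f g. \<lambda>x \<in> carrier M. f x \<oplus>\<^bsub>N\<^esub> g x),
      one = zero_hom M N\<rparr>"

definition direct_power :: "('a, 'm) module \<Rightarrow> nat \<Rightarrow> ('a, nat \<Rightarrow> 'm) module" where
  "direct_power M r =
     \<lparr>carrier = {..<r} \<rightarrow>\<^sub>E carrier M, monoid.mult = undefined, one = undefined,
      ring.zero = (\<lambda>i \<in> {..<r}. \<zero>\<^bsub>M\<^esub>),
      ring.add = (\<lambda>f g. \<lambda>i \<in> {..<r}. f i \<oplus>\<^bsub>M\<^esub> g i),
      smult = (\<lambda>a f. \<lambda>i \<in> {..<r}. a \<odot>\<^bsub>M\<^esub> f i)\<rparr>"

text \<open>\<open>X\<close> is isomorphic to a submodule \<open>U\<close> with a complement \<open>V\<close> in some finite power of \<open>M\<close>.\<close>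

definition in_add ::
  "('a, 'c) ring_scheme \<Rightarrow> ('a, 'm) module \<Rightarrow> ('a, 'x) module \<Rightarrow> bool" where
  "in_add A M X \<longleftrightarrow> left_module A X \<and>
     (\<exists>r U V h.
        submodule U A (direct_power M r) \<and> submodule V A (direct_power M r) \<and>
        U \<inter> V = {\<zero>\<^bsub>direct_power M r\<^esub>} \<and>
        U <+>\<^bsub>direct_power M r\<^esub> V = carrier (direct_power M r) \<and>
        h \<in> Hom A X (direct_power M r) \<and> bij_betw h (carrier X) U)"


section \<open>Projective resolutions, projective dimension and Ext\<close>

text \<open>
  The finitely generated projective modules are the direct summands of the free modules
  \<open>A\<^sup>r\<close>. Every such module has an isomorphic copy carried by the type \<open>nat \<Rightarrow> 'a\<close>, so that
  drawing the terms of resolutions from this type is no restriction. More generally, every object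
  of \<open>add M\<close> has an isomorphic copy carried by the type \<open>nat \<Rightarrow> 'm\<close>; this is used below for the
  terms of the other exact sequences.
\<close>

definition projective_resolution ::
  "('a, 'c) ring_scheme \<Rightarrow> ('a, 'm) module \<Rightarrow> (nat \<Rightarrow> ('a, nat \<Rightarrow> 'a) module) \<Rightarrow>
   ((nat \<Rightarrow> 'a) \<Rightarrow> 'm) \<Rightarrow> (nat \<Rightarrow> (nat \<Rightarrow> 'a) \<Rightarrow> (nat \<Rightarrow> 'a)) \<Rightarrow> bool" where
  "projective_resolution A M P \<epsilon> \<delta> \<longleftrightarrow>
     (\<forall>i. in_add A (regular_module A) (P i)) \<and>
     \<epsilon> \<in> Hom A (P 0) M \<and> \<epsilon> ` carrier (P 0) = carrier M \<and>
     (\<forall>i. \<delta> i \<in> Hom A (P (Suc i)) (P i)) \<and>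
     a_kernel (P 0) M \<epsilon> = \<delta> 0 ` carrier (P 1) \<and>
     (\<forall>i. a_kernel (P (Suc i)) (P i) (\<delta> i) = \<delta> (Suc i) ` carrier (P (Suc (Suc i))))"

text \<open>The value is \<open>\<infinity>\<close> if there is no finite projective resolution.\<close>

definition proj_dim :: "('a, 'c) ring_scheme \<Rightarrow> ('a, 'm) module \<Rightarrow> enat" where
  "proj_dim A M =
     Inf {enat n | n. \<exists>P \<epsilon> \<delta>. projective_resolution A M P \<epsilon> \<delta> \<and>
                        (\<forall>i > n. carrier (P i) = {\<zero>\<^bsub>P i\<^esub>})}"

definition cocycles ::
  "('a, 'c) ring_scheme \<Rightarrow> (nat \<Rightarrow> ('a, 'p) module) \<Rightarrow> (nat \<Rightarrow> 'p \<Rightarrow> 'p) \<Rightarrow> ('a, 'n) module \<Rightarrow>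
   nat \<Rightarrow> ('p \<Rightarrow> 'n) set" where
  "cocycles A P \<delta> N i =
     {f \<in> Hom A (P i) N. compose (carrier (P (Suc i))) f (\<delta> i) = zero_hom (P (Suc i)) N}"

fun coboundaries ::
  "('a, 'c) ring_scheme \<Rightarrow> (nat \<Rightarrow> ('a, 'p) module) \<Rightarrow> (nat \<Rightarrow> 'p \<Rightarrow> 'p) \<Rightarrow> ('a, 'n) module \<Rightarrow>
   nat \<Rightarrow> ('p \<Rightarrow> 'n) set" where
  "coboundaries A P \<delta> N 0 = {zero_hom (P 0) N}"
| "coboundaries A P \<delta> N (Suc i) =
     (\<lambda>g. compose (carrier (P (Suc i))) g (\<delta> i)) ` Hom A (P i) N"

definition Hom_cohomology ::
  "('a, 'c) ring_scheme \<Rightarrow> (nat \<Rightarrow> ('a, 'p) module) \<Rightarrow> (nat \<Rightarrow> 'p \<Rightarrow> 'p) \<Rightarrow> ('a, 'n) module \<Rightarrow>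
   nat \<Rightarrow> ('p \<Rightarrow> 'n) set monoid" where
  "Hom_cohomology A P \<delta> N i =
     Hom_group A (P i) N\<lparr>carrier := cocycles A P \<delta> N i\<rparr> Mod coboundaries A P \<delta> N i"

text \<open>
  \<open>Ext A i M N\<close> is computed from a chosen projective resolution of \<open>M\<close> by finitely generated
  modules. It is only meaningful if there is one, which is the case whenever \<open>M\<close> is a finitely
  generated module over a finite-dimensional algebra \<open>A\<close>.
\<close>

definition chosen_resolution ::
  "('a, 'c) ring_scheme \<Rightarrow> ('a, 'm) module \<Rightarrow>
   (nat \<Rightarrow> ('a, nat \<Rightarrow> 'a) module) \<times> (nat \<Rightarrow> (nat \<Rightarrow> 'a) \<Rightarrow> (nat \<Rightarrow> 'a))" where
  "chosen_resolution A M = (SOME (P, \<delta>). \<exists>\<epsilon>. projective_resolution A M P \<epsilon> \<delta>)"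

definition Ext ::
  "('a, 'c) ring_scheme \<Rightarrow> nat \<Rightarrow> ('a, 'm) module \<Rightarrow> ('a, 'n) module \<Rightarrow>
   ((nat \<Rightarrow> 'a) \<Rightarrow> 'n) set monoid" where
  "Ext A i M N = (case chosen_resolution A M of (P, \<delta>) \<Rightarrow> Hom_cohomology A P \<delta> N i)"

definition self_orthogonal :: "('a, 'c) ring_scheme \<Rightarrow> ('a, 'm) module \<Rightarrow> bool" where
  "self_orthogonal A M \<longleftrightarrow> (\<forall>i > 0. trivial_group (Ext A i M M))"


section \<open>Relative dominant dimension, tilting modules, quasi-generators\<close>

text \<open>
  We consider sequences
  \<open>0 \<rightarrow> M \<rightarrow> X 0 \<rightarrow> \<dots> \<rightarrow> X n\<close>
  with first map \<open>e\<close> and further maps \<open>d i\<close> from \<open>X i\<close> to \<open>X (Suc i)\<close>.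
  \<open>image_in M X e d i\<close> is the image of the map with codomain \<open>X i\<close>, and
  \<open>Hom_kernel A M X e d T i\<close> is the kernel of the map induced by it on \<open>Hom A (X i) T\<close>.
\<close>

fun image_in ::
  "('a, 'm) module \<Rightarrow> (nat \<Rightarrow> ('a, 'x) module) \<Rightarrow> ('m \<Rightarrow> 'x) \<Rightarrow> (nat \<Rightarrow> 'x \<Rightarrow> 'x) \<Rightarrow>
   nat \<Rightarrow> 'x set" where
  "image_in M X e d 0 = e ` carrier M"
| "image_in M X e d (Suc i) = d i ` carrier (X i)"

fun Hom_kernel ::
  "('a, 'c) ring_scheme \<Rightarrow> ('a, 'm) module \<Rightarrow> (nat \<Rightarrow> ('a, 'x) module) \<Rightarrow> ('m \<Rightarrow> 'x) \<Rightarrow>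
   (nat \<Rightarrow> 'x \<Rightarrow> 'x) \<Rightarrow> ('a, 't) module \<Rightarrow> nat \<Rightarrow> ('x \<Rightarrow> 't) set" where
  "Hom_kernel A M X e d T 0 =
     {f \<in> Hom A (X 0) T. compose (carrier M) f e = zero_hom M T}"
| "Hom_kernel A M X e d T (Suc i) =
     {f \<in> Hom A (X (Suc i)) T. compose (carrier (X i)) f (d i) = zero_hom (X i) T}"

text \<open>Exactness at \<open>M\<close> and at \<open>X i\<close> for \<open>i < n\<close>.\<close>

definition exact_upto ::
  "('a, 'c) ring_scheme \<Rightarrow> ('a, 'm) module \<Rightarrow> (nat \<Rightarrow> ('a, 'x) module) \<Rightarrow> ('m \<Rightarrow> 'x) \<Rightarrow>
   (nat \<Rightarrow> 'x \<Rightarrow> 'x) \<Rightarrow> nat \<Rightarrow> bool" where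
  "exact_upto A M X e d n \<longleftrightarrow>
     e \<in> Hom A M (X 0) \<and> inj_on e (carrier M) \<and>
     (\<forall>i < n. d i \<in> Hom A (X i) (X (Suc i)) \<and>
              a_kernel (X i) (X (Suc i)) (d i) = image_in M X e d i)"

text \<open>
  Exactness of \<open>Hom A (X n) T \<rightarrow> \<dots> \<rightarrow> Hom A (X 0) T \<rightarrow> Hom A M T \<rightarrow> 0\<close>
  at \<open>Hom A M T\<close> and at \<open>Hom A (X i) T\<close> for \<open>i < n\<close>.
\<close>

definition Hom_exact_upto ::
  "('a, 'c) ring_scheme \<Rightarrow> ('a, 'm) module \<Rightarrow> (nat \<Rightarrow> ('a, 'x) module) \<Rightarrow> ('m \<Rightarrow> 'x) \<Rightarrow>
   (nat \<Rightarrow> 'x \<Rightarrow> 'x) \<Rightarrow> ('a, 't) module \<Rightarrow> nat \<Rightarrow> bool" where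
  "Hom_exact_upto A M X e d T n \<longleftrightarrow>
     (\<lambda>g. compose (carrier M) g e) ` Hom A (X 0) T = Hom A M T \<and>
     (\<forall>i < n. (\<lambda>g. compose (carrier (X i)) g (d i)) ` Hom A (X (Suc i)) T =
              Hom_kernel A M X e d T i)"

text \<open>\<open>domdim_ge A T M n\<close> says that the \<open>T\<close>-dominant dimension of \<open>M\<close> is at least \<open>n\<close>.
  The terms \<open>T\<^sub>1, \<dots>, T\<^sub>n\<close> are indexed from \<open>0\<close> here; the sequence for \<open>n = 0\<close> is just \<open>0 \<rightarrow> M\<close>,
  for which there is no condition.\<close>

fun domdim_ge ::
  "('a, 'c) ring_scheme \<Rightarrow> ('a, 't) module \<Rightarrow> ('a, 'm) module \<Rightarrow> nat \<Rightarrow> bool" where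
  "domdim_ge A T M 0 \<longleftrightarrow> True"
| "domdim_ge A T M (Suc n) \<longleftrightarrow>
     (\<exists>(X :: nat \<Rightarrow> ('a, nat \<Rightarrow> 't) module) e d.
        (\<forall>i \<le> n. in_add A T (X i)) \<and>
        exact_upto A M X e d n \<and> Hom_exact_upto A M X e d T n)"

definition domdim_infinite ::
  "('a, 'c) ring_scheme \<Rightarrow> ('a, 't) module \<Rightarrow> ('a, 'm) module \<Rightarrow> bool" where
  "domdim_infinite A T M \<longleftrightarrow> (\<forall>n. domdim_ge A T M n)"

definition n_tilting :: "('a, 'c) ring_scheme \<Rightarrow> nat \<Rightarrow> ('a, 't) module \<Rightarrow> bool" where
  "n_tilting A n T \<longleftrightarrow>
     proj_dim A T \<le> enat n \<and>
     self_orthogonal A T \<and>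
     (\<exists>(X :: nat \<Rightarrow> ('a, nat \<Rightarrow> 't) module) e d.
        (\<forall>i \<le> n. in_add A T (X i)) \<and>
        exact_upto A (regular_module A) X e d n \<and>
        image_in (regular_module A) X e d n = carrier (X n))"

definition tilting :: "('a, 'c) ring_scheme \<Rightarrow> ('a, 't) module \<Rightarrow> bool" where
  "tilting A T \<longleftrightarrow> (\<exists>n. n_tilting A n T)"

definition quasi_generating_sequence ::
  "('a, 'c) ring_scheme \<Rightarrow> nat \<Rightarrow> ('a, 'm) module \<Rightarrow> bool" where
  "quasi_generating_sequence A n M \<longleftrightarrow>
     (\<exists>(X :: nat \<Rightarrow> ('a, nat \<Rightarrow> 'm) module) e d.
        (\<forall>i \<le> n. in_add A M (X i)) \<and>
        exact_upto A (regular_module A) X e d n \<and>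
        image_in (regular_module A) X e d n = carrier (X n) \<and>
        Hom_exact_upto A (regular_module A) X e d M n \<and>
        Hom_kernel A (regular_module A) X e d M n = {zero_hom (X n) M})"

definition quasi_generator :: "('a, 'c) ring_scheme \<Rightarrow> nat \<Rightarrow> ('a, 'm) module \<Rightarrow> bool" where
  "quasi_generator A n M \<longleftrightarrow>
     quasi_generating_sequence A n M \<and> (\<forall>m < n. \<not> quasi_generating_sequence A m M)"

text \<open>
  A type variable cannot be quantified inside a formula, so a statement about all
  finite-dimensional algebras over fields and all their finitely generated modules is relativised
  to carrier types: \<open>'k\<close> for the fields and \<open>nat \<Rightarrow> 'k\<close> for the algebras and the modules. If
  \<open>K\<close> is a field carried by a subset of \<open>'k\<close>, then \<open>nat \<Rightarrow> 'k\<close> contains a copy of every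
  finite power of \<open>K\<close>, hence an isomorphic copy of every finite-dimensional \<open>K\<close>-algebra and of
  every finitely generated module over it.
\<close>

definition finite_pd_domdim_infinite_imp_tilting :: "'k itself \<Rightarrow> bool" where
  "finite_pd_domdim_infinite_imp_tilting (_ :: 'k itself) \<longleftrightarrow>
     (\<forall>(K :: 'k ring) (A :: ('k, nat \<Rightarrow> 'k) module) (T :: (nat \<Rightarrow> 'k, nat \<Rightarrow> 'k) module).
        fd_algebra K A \<longrightarrow> left_module A T \<longrightarrow> finitely_generated A T \<longrightarrow>
        self_orthogonal A T \<longrightarrow> proj_dim A T < \<infinity> \<longrightarrow>
        domdim_infinite A T (regular_module A) \<longrightarrow> tilting A T)"

end

theory Submission
  imports Defs
begin

text \<open>
  Let \<open>M\<close> be a self-orthogonal \<open>n\<close>-quasi-generator over \<open>A\<close> and let \<open>B\<close> be its endomorphism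
  algebra; write \<open>N\<close> for \<open>M\<close> regarded as a \<open>B\<close>-module. The functors \<open>D = Hom\<^sub>A(-, M)\<close> and
  \<open>D' = Hom\<^sub>B(-, N)\<close> exchange \<open>add M\<close> with the projective \<open>B\<close>-modules, and once \<open>A\<close> is known
  to be the endomorphism ring of \<open>N\<close> they exchange the projective \<open>A\<close>-modules with \<open>add N\<close>.

  The given sequence \<open>0 \<rightarrow> A \<rightarrow> X\<^sub>0 \<rightarrow> \<dots> \<rightarrow> X\<^sub>n \<rightarrow> 0\<close> becomes under \<open>D\<close> a projective resolution of
  \<open>N\<close> of length \<open>n\<close> (\<open>resol_dual\<close>). Applying \<open>D'\<close> recovers the original sequence, which gives
  the double centralizer property \<open>A = End\<^sub>B(N)\<close> and the vanishing of \<open>Ext\<^sub>B\<^sup>i(N, N)\<close> for \<open>i > 0\<close>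
  (\<open>double_centralizer\<close>, \<open>acyc_dual\<close>). A projective resolution of \<open>M\<close> over \<open>A\<close> stays exact under
  \<open>D\<close> because \<open>M\<close> is self-orthogonal; it turns into a coresolution of \<open>B\<close> in \<open>add N\<close> that is
  exact under \<open>D'\<close> (\<open>coexact_dual\<close>), so the \<open>N\<close>-dominant dimension of \<open>B\<close> is infinite. Hence the
  hypothesis applies to \<open>N\<close> and yields a finite coresolution \<open>0 \<rightarrow> B \<rightarrow> Y\<^sub>0 \<rightarrow> \<dots> \<rightarrow> Y\<^sub>m \<rightarrow> 0\<close> in
  \<open>add N\<close>. As \<open>N\<close> is self-orthogonal, shifting along this finite sequence shows that it stays
  exact under \<open>D'\<close> (\<open>hom_exact_finite_coresolution\<close>), which makes \<open>D' Y\<close> a projective resolution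
  of \<open>M\<close> of length \<open>m\<close>.

  It remains to replace \<open>m\<close> by \<open>n\<close>. Since \<open>Ext\<^sub>A\<^sup>i(M, X\<^sub>j) = 0\<close> for \<open>i > 0\<close>, the coresolution \<open>X\<close> of
  length \<open>n\<close> gives \<open>Ext\<^sub>A\<^sup>i(M, A) = 0\<close> for \<open>i > n\<close>, and a finite projective resolution then splits
  in all degrees beyond \<open>n\<close> (\<open>projective_truncation\<close>).

  The hypothesis concerns modules and algebras on the type \<open>nat \<Rightarrow> 'k\<close>, to which \<open>M\<close> and \<open>B\<close> have
  to be transported. Right modules are covered by passing to the opposite algebra.
\<close>

section \<open>Linear maps and finite sums\<close>

text \<open>
  In contrast to \<open>Hom\<close>, no extensionality is imposed, so that sums and composites of linear maps are
  plain lambda terms. \<open>Hom\<close> only enters where the set of all homomorphisms matters.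
\<close>

definition lin :: "('a, 'c) ring_scheme \<Rightarrow> ('a, 'x) module \<Rightarrow> ('a, 'y) module \<Rightarrow> ('x \<Rightarrow> 'y) \<Rightarrow> bool"
  where "lin R X Y f \<longleftrightarrow> f \<in> carrier X \<rightarrow> carrier Y \<and>
    (\<forall>x \<in> carrier X. \<forall>y \<in> carrier X. f (x \<oplus>\<^bsub>X\<^esub> y) = f x \<oplus>\<^bsub>Y\<^esub> f y) \<and>
    (\<forall>a \<in> carrier R. \<forall>x \<in> carrier X. f (a \<odot>\<^bsub>X\<^esub> x) = a \<odot>\<^bsub>Y\<^esub> f x)"

lemma left_module_closed:
  assumes "left_module R M"
  shows "\<zero>\<^bsub>M\<^esub> \<in> carrier M"
    and "\<And>x y. x \<in> carrier M \<Longrightarrow> y \<in> carrier M \<Longrightarrow> x \<oplus>\<^bsub>M\<^esub> y \<in> carrier M"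
    and "\<And>a x. a \<in> carrier R \<Longrightarrow> x \<in> carrier M \<Longrightarrow> a \<odot>\<^bsub>M\<^esub> x \<in> carrier M"
proof -
  interpret left_module R M by fact
  show "\<zero>\<^bsub>M\<^esub> \<in> carrier M" by simp
  show "\<And>x y. x \<in> carrier M \<Longrightarrow> y \<in> carrier M \<Longrightarrow> x \<oplus>\<^bsub>M\<^esub> y \<in> carrier M" by simp
  show "\<And>a x. a \<in> carrier R \<Longrightarrow> x \<in> carrier M \<Longrightarrow> a \<odot>\<^bsub>M\<^esub> x \<in> carrier M"
    by (rule smult_closed)
qed

lemma left_module_ring: "left_module R M \<Longrightarrow> ring R"
  by (simp add: left_module_def)

lemma left_module_group:
  assumes "left_module R M"
  shows "abelian_group M"
  using assms by (simp add: left_module_def)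

lemma left_module_add_ac:
  assumes "left_module R M"
  shows "\<And>x. x \<in> carrier M \<Longrightarrow> \<zero>\<^bsub>M\<^esub> \<oplus>\<^bsub>M\<^esub> x = x"
    and "\<And>x. x \<in> carrier M \<Longrightarrow> x \<oplus>\<^bsub>M\<^esub> \<zero>\<^bsub>M\<^esub> = x"
    and "\<And>x y. x \<in> carrier M \<Longrightarrow> y \<in> carrier M \<Longrightarrow> x \<oplus>\<^bsub>M\<^esub> y = y \<oplus>\<^bsub>M\<^esub> x"
    and "\<And>x y z. x \<in> carrier M \<Longrightarrow> y \<in> carrier M \<Longrightarrow> z \<in> carrier M \<Longrightarrow>
      (x \<oplus>\<^bsub>M\<^esub> y) \<oplus>\<^bsub>M\<^esub> z = x \<oplus>\<^bsub>M\<^esub> (y \<oplus>\<^bsub>M\<^esub> z)"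
    and "\<And>x y z. x \<in> carrier M \<Longrightarrow> y \<in> carrier M \<Longrightarrow> z \<in> carrier M \<Longrightarrow>
      x \<oplus>\<^bsub>M\<^esub> (y \<oplus>\<^bsub>M\<^esub> z) = y \<oplus>\<^bsub>M\<^esub> (x \<oplus>\<^bsub>M\<^esub> z)"
proof -
  interpret left_module R M by fact
  show "\<And>x. x \<in> carrier M \<Longrightarrow> \<zero>\<^bsub>M\<^esub> \<oplus>\<^bsub>M\<^esub> x = x"
    and "\<And>x. x \<in> carrier M \<Longrightarrow> x \<oplus>\<^bsub>M\<^esub> \<zero>\<^bsub>M\<^esub> = x" by simp_all
  show "\<And>x y. x \<in> carrier M \<Longrightarrow> y \<in> carrier M \<Longrightarrow> x \<oplus>\<^bsub>M\<^esub> y = y \<oplus>\<^bsub>M\<^esub> x"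
    by (rule a_comm)
  show "\<And>x y z. x \<in> carrier M \<Longrightarrow> y \<in> carrier M \<Longrightarrow> z \<in> carrier M \<Longrightarrow>
      (x \<oplus>\<^bsub>M\<^esub> y) \<oplus>\<^bsub>M\<^esub> z = x \<oplus>\<^bsub>M\<^esub> (y \<oplus>\<^bsub>M\<^esub> z)" by (rule a_assoc)
  show "\<And>x y z. x \<in> carrier M \<Longrightarrow> y \<in> carrier M \<Longrightarrow> z \<in> carrier M \<Longrightarrow>
      x \<oplus>\<^bsub>M\<^esub> (y \<oplus>\<^bsub>M\<^esub> z) = y \<oplus>\<^bsub>M\<^esub> (x \<oplus>\<^bsub>M\<^esub> z)" by (rule a_lcomm)
qed

lemma left_module_smult_zero:
  assumes "left_module R M"
  shows "\<And>a. a \<in> carrier R \<Longrightarrow> a \<odot>\<^bsub>M\<^esub> \<zero>\<^bsub>M\<^esub> = \<zero>\<^bsub>M\<^esub>"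
    and "\<And>x. x \<in> carrier M \<Longrightarrow> \<zero>\<^bsub>R\<^esub> \<odot>\<^bsub>M\<^esub> x = \<zero>\<^bsub>M\<^esub>"
proof -
  interpret left_module R M by fact
  show "a \<odot>\<^bsub>M\<^esub> \<zero>\<^bsub>M\<^esub> = \<zero>\<^bsub>M\<^esub>" if "a \<in> carrier R" for a
    using smult_r_distr[OF that M.zero_closed M.zero_closed] smult_closed[OF that M.zero_closed]
    by (metis M.add.r_cancel_one M.r_zero M.zero_closed)
  show "\<zero>\<^bsub>R\<^esub> \<odot>\<^bsub>M\<^esub> x = \<zero>\<^bsub>M\<^esub>" if "x \<in> carrier M" for x
    using smult_l_distr[OF R.zero_closed R.zero_closed that] smult_closed[OF R.zero_closed that]
    by (metis M.add.r_cancel_one R.r_zero R.zero_closed)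
qed

text \<open>
  The action of the scalar zero is prescribed because additive inverses are obtained as \<open>(-1) \<odot> x\<close>.
\<close>

lemma left_moduleI:
  assumes "ring R"
    and "\<zero>\<^bsub>M\<^esub> \<in> carrier M"
    and "\<And>x y. x \<in> carrier M \<Longrightarrow> y \<in> carrier M \<Longrightarrow> x \<oplus>\<^bsub>M\<^esub> y \<in> carrier M"
    and sm: "\<And>a x. a \<in> carrier R \<Longrightarrow> x \<in> carrier M \<Longrightarrow> a \<odot>\<^bsub>M\<^esub> x \<in> carrier M"
    and lz: "\<And>x. x \<in> carrier M \<Longrightarrow> \<zero>\<^bsub>M\<^esub> \<oplus>\<^bsub>M\<^esub> x = x"
    and "\<And>x y. x \<in> carrier M \<Longrightarrow> y \<in> carrier M \<Longrightarrow> x \<oplus>\<^bsub>M\<^esub> y = y \<oplus>\<^bsub>M\<^esub> x"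
    and "\<And>x y z. x \<in> carrier M \<Longrightarrow> y \<in> carrier M \<Longrightarrow> z \<in> carrier M \<Longrightarrow>
      (x \<oplus>\<^bsub>M\<^esub> y) \<oplus>\<^bsub>M\<^esub> z = x \<oplus>\<^bsub>M\<^esub> (y \<oplus>\<^bsub>M\<^esub> z)"
    and z: "\<And>x. x \<in> carrier M \<Longrightarrow> \<zero>\<^bsub>R\<^esub> \<odot>\<^bsub>M\<^esub> x = \<zero>\<^bsub>M\<^esub>"
    and l: "\<And>a b x. a \<in> carrier R \<Longrightarrow> b \<in> carrier R \<Longrightarrow> x \<in> carrier M \<Longrightarrow>
      (a \<oplus>\<^bsub>R\<^esub> b) \<odot>\<^bsub>M\<^esub> x = a \<odot>\<^bsub>M\<^esub> x \<oplus>\<^bsub>M\<^esub> b \<odot>\<^bsub>M\<^esub> x"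
    and "\<And>a x y. a \<in> carrier R \<Longrightarrow> x \<in> carrier M \<Longrightarrow> y \<in> carrier M \<Longrightarrow>
      a \<odot>\<^bsub>M\<^esub> (x \<oplus>\<^bsub>M\<^esub> y) = a \<odot>\<^bsub>M\<^esub> x \<oplus>\<^bsub>M\<^esub> a \<odot>\<^bsub>M\<^esub> y"
    and "\<And>a b x. a \<in> carrier R \<Longrightarrow> b \<in> carrier R \<Longrightarrow> x \<in> carrier M \<Longrightarrow>
      (a \<otimes>\<^bsub>R\<^esub> b) \<odot>\<^bsub>M\<^esub> x = a \<odot>\<^bsub>M\<^esub> (b \<odot>\<^bsub>M\<^esub> x)"
    and one: "\<And>x. x \<in> carrier M \<Longrightarrow> \<one>\<^bsub>R\<^esub> \<odot>\<^bsub>M\<^esub> x = x"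
  shows "left_module R M"
proof (intro left_module.intro left_module_axioms.intro)
  show "abelian_group M"
  proof (rule abelian_groupI)
    fix x assume x: "x \<in> carrier M"
    interpret ring R by fact
    have m: "\<ominus>\<^bsub>R\<^esub> \<one>\<^bsub>R\<^esub> \<in> carrier R" by simp
    have "(\<ominus>\<^bsub>R\<^esub> \<one>\<^bsub>R\<^esub>) \<odot>\<^bsub>M\<^esub> x \<oplus>\<^bsub>M\<^esub> x = (\<ominus>\<^bsub>R\<^esub> \<one>\<^bsub>R\<^esub> \<oplus>\<^bsub>R\<^esub> \<one>\<^bsub>R\<^esub>) \<odot>\<^bsub>M\<^esub> x"
      using l[OF m one_closed x] one[OF x] by simp
    also have "\<dots> = \<zero>\<^bsub>M\<^esub>" using z[OF x] by (simp add: l_neg)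
    finally show "\<exists>y \<in> carrier M. y \<oplus>\<^bsub>M\<^esub> x = \<zero>\<^bsub>M\<^esub>" using sm[OF m x] by blast
  qed (use assms in auto)
qed (use assms in auto)

text \<open>
  Subtraction is expressed through the scalar \<open>-1\<close>: this makes it visibly compatible with linear
  maps and with passing to submodules.
\<close>

definition mneg :: "('a, 'c) ring_scheme \<Rightarrow> ('a, 'x) module \<Rightarrow> 'x \<Rightarrow> 'x" where
  "mneg R X x = (\<ominus>\<^bsub>R\<^esub> \<one>\<^bsub>R\<^esub>) \<odot>\<^bsub>X\<^esub> x"

lemma minus_one_closed: "ring R \<Longrightarrow> \<ominus>\<^bsub>R\<^esub> \<one>\<^bsub>R\<^esub> \<in> carrier R"
  by (simp add: ring.is_abelian_group abelian_group.a_inv_closed ring.ring_simprules)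

lemma mneg_closed: "left_module R M \<Longrightarrow> x \<in> carrier M \<Longrightarrow> mneg R M x \<in> carrier M"
  unfolding mneg_def by (simp add: left_module_closed minus_one_closed left_module_ring)

lemma mneg_right:
  assumes "left_module R M" and x: "x \<in> carrier M"
  shows "x \<oplus>\<^bsub>M\<^esub> mneg R M x = \<zero>\<^bsub>M\<^esub>"
proof -
  interpret left_module R M by fact
  have "x \<oplus>\<^bsub>M\<^esub> mneg R M x = (\<one>\<^bsub>R\<^esub> \<oplus>\<^bsub>R\<^esub> \<ominus>\<^bsub>R\<^esub> \<one>\<^bsub>R\<^esub>) \<odot>\<^bsub>M\<^esub> x"
    using smult_l_distr[OF R.one_closed minus_one_closed[OF left_module_ring[OF assms(1)]] x]
      smult_one[OF x] unfolding mneg_def by simp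
  also have "\<dots> = \<zero>\<^bsub>M\<^esub>"
    using left_module_smult_zero(2)[OF assms(1) x] by (simp add: R.r_neg)
  finally show ?thesis .
qed

lemma mneg_left:
  assumes "left_module R M" and x: "x \<in> carrier M"
  shows "mneg R M x \<oplus>\<^bsub>M\<^esub> x = \<zero>\<^bsub>M\<^esub>"
  using mneg_right[OF assms] left_module_add_ac(3)[OF assms(1)] mneg_closed[OF assms] x by metis

lemma mneg_eq_a_inv:
  assumes "left_module R M" and x: "x \<in> carrier M"
  shows "mneg R M x = \<ominus>\<^bsub>M\<^esub> x"
  by (metis abelian_group.minus_equality assms mneg_closed mneg_left left_module_group)

lemma mneg_zero: "left_module R M \<Longrightarrow> mneg R M \<zero>\<^bsub>M\<^esub> = \<zero>\<^bsub>M\<^esub>"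
  by (simp add: mneg_def left_module_smult_zero minus_one_closed left_module_ring)

lemma mneg_add:
  assumes "left_module R M" "x \<in> carrier M" "y \<in> carrier M"
  shows "mneg R M (x \<oplus>\<^bsub>M\<^esub> y) = mneg R M x \<oplus>\<^bsub>M\<^esub> mneg R M y"
  using assms by (simp add: mneg_def left_module.smult_r_distr minus_one_closed left_module_ring)

lemma diff_eq_zero_iff:
  assumes "left_module R M" "x \<in> carrier M" "y \<in> carrier M"
  shows "x \<oplus>\<^bsub>M\<^esub> mneg R M y = \<zero>\<^bsub>M\<^esub> \<longleftrightarrow> x = y"
proof -
  interpret left_module R M by fact
  show ?thesis using assms(2,3)
    by (metis M.add.inv_closed M.add.inv_equality M.minus_minus M.r_neg assms(1) mneg_eq_a_inv)
qed

lemma add_diff_cancel: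
  assumes "left_module R M" "x \<in> carrier M" "y \<in> carrier M"
  shows "y \<oplus>\<^bsub>M\<^esub> (x \<oplus>\<^bsub>M\<^esub> mneg R M y) = x" "(x \<oplus>\<^bsub>M\<^esub> mneg R M y) \<oplus>\<^bsub>M\<^esub> y = x"
    "(x \<oplus>\<^bsub>M\<^esub> y) \<oplus>\<^bsub>M\<^esub> mneg R M y = x" "x \<oplus>\<^bsub>M\<^esub> (mneg R M x \<oplus>\<^bsub>M\<^esub> y) = y"
    "mneg R M x \<oplus>\<^bsub>M\<^esub> (x \<oplus>\<^bsub>M\<^esub> y) = y"
proof -
  note ac = left_module_add_ac[OF assms(1)] and mc = mneg_closed[OF assms(1)]
  note mr = mneg_right[OF assms(1)] and ml = mneg_left[OF assms(1)]
  note c = left_module_closed[OF assms(1)]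
  show "y \<oplus>\<^bsub>M\<^esub> (x \<oplus>\<^bsub>M\<^esub> mneg R M y) = x"
    using assms(2,3) mc by (simp add: ac(5)[of y x] mr ac)
  show "(x \<oplus>\<^bsub>M\<^esub> mneg R M y) \<oplus>\<^bsub>M\<^esub> y = x" "(x \<oplus>\<^bsub>M\<^esub> y) \<oplus>\<^bsub>M\<^esub> mneg R M y = x"
    using assms(2,3) mc by (simp_all add: ac(4) mr ml ac(2))
  show "x \<oplus>\<^bsub>M\<^esub> (mneg R M x \<oplus>\<^bsub>M\<^esub> y) = y" "mneg R M x \<oplus>\<^bsub>M\<^esub> (x \<oplus>\<^bsub>M\<^esub> y) = y"
    using assms(2,3) mc by (simp_all add: ac(4)[symmetric] mr ml ac(1))
qed

lemma lin_closed: "lin R X Y f \<Longrightarrow> x \<in> carrier X \<Longrightarrow> f x \<in> carrier Y"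
  and lin_add: "lin R X Y f \<Longrightarrow> x \<in> carrier X \<Longrightarrow> y \<in> carrier X \<Longrightarrow>
    f (x \<oplus>\<^bsub>X\<^esub> y) = f x \<oplus>\<^bsub>Y\<^esub> f y"
  and lin_smult: "lin R X Y f \<Longrightarrow> a \<in> carrier R \<Longrightarrow> x \<in> carrier X \<Longrightarrow>
    f (a \<odot>\<^bsub>X\<^esub> x) = a \<odot>\<^bsub>Y\<^esub> f x"
  unfolding lin_def by auto

lemma linI:
  assumes "\<And>x. x \<in> carrier X \<Longrightarrow> f x \<in> carrier Y"
    and "\<And>x y. x \<in> carrier X \<Longrightarrow> y \<in> carrier X \<Longrightarrow> f (x \<oplus>\<^bsub>X\<^esub> y) = f x \<oplus>\<^bsub>Y\<^esub> f y"
    and "\<And>a x. a \<in> carrier R \<Longrightarrow> x \<in> carrier X \<Longrightarrow> f (a \<odot>\<^bsub>X\<^esub> x) = a \<odot>\<^bsub>Y\<^esub> f x"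
  shows "lin R X Y f"
  using assms unfolding lin_def by auto

lemma lin_zero:
  assumes "left_module R X" "left_module R Y" "lin R X Y f"
  shows "f \<zero>\<^bsub>X\<^esub> = \<zero>\<^bsub>Y\<^esub>"
proof -
  have "f (\<zero>\<^bsub>R\<^esub> \<odot>\<^bsub>X\<^esub> \<zero>\<^bsub>X\<^esub>) = \<zero>\<^bsub>R\<^esub> \<odot>\<^bsub>Y\<^esub> f \<zero>\<^bsub>X\<^esub>"
    using assms left_module_ring[OF assms(1)] left_module_closed(1)[OF assms(1)]
    by (simp add: lin_smult ring.ring_simprules)
  then show ?thesis
    using assms by (simp add: left_module_smult_zero left_module_closed lin_closed)
qed

lemma lin_mneg:
  assumes "left_module R X" "lin R X Y f" "x \<in> carrier X"
  shows "f (mneg R X x) = mneg R Y (f x)"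
  unfolding mneg_def using assms by (simp add: lin_smult minus_one_closed left_module_ring)

lemma lin_id: "lin R X X (\<lambda>x. x)"
  by (rule linI) auto

lemma lin_comp:
  assumes "lin R Y Z g" "lin R X Y f" shows "lin R X Z (\<lambda>x. g (f x))"
  by (rule linI) (use assms in \<open>auto simp: lin_closed lin_add lin_smult\<close>)

lemma lin_zero_map: "left_module R Y \<Longrightarrow> lin R X Y (\<lambda>x. \<zero>\<^bsub>Y\<^esub>)"
  by (rule linI) (auto simp: left_module_closed left_module_add_ac left_module_smult_zero)

lemma lin_plus:
  assumes "left_module R Y" "lin R X Y f" "lin R X Y g"
  shows "lin R X Y (\<lambda>x. f x \<oplus>\<^bsub>Y\<^esub> g x)"
proof (rule linI)
  note ac = left_module_add_ac[OF assms(1)] and c = left_module_closed[OF assms(1)]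
  fix x y assume "x \<in> carrier X" "y \<in> carrier X"
  then show "f (x \<oplus>\<^bsub>X\<^esub> y) \<oplus>\<^bsub>Y\<^esub> g (x \<oplus>\<^bsub>X\<^esub> y) = f x \<oplus>\<^bsub>Y\<^esub> g x \<oplus>\<^bsub>Y\<^esub> (f y \<oplus>\<^bsub>Y\<^esub> g y)"
    using assms by (simp add: lin_add lin_closed c ac(4) ac(5)[of "g x" "f y"])
qed (use assms in \<open>auto simp: lin_closed lin_smult left_module_closed left_module.smult_r_distr\<close>)

lemma lin_mneg_map:
  assumes "left_module R X" "left_module R Y" "lin R X Y f"
  shows "lin R X Y (\<lambda>x. mneg R Y (f x))"
proof (rule linI)
  fix a x assume a: "a \<in> carrier R" and x: "x \<in> carrier X"
  have r: "\<ominus>\<^bsub>R\<^esub> \<one>\<^bsub>R\<^esub> \<otimes>\<^bsub>R\<^esub> a = a \<otimes>\<^bsub>R\<^esub> \<ominus>\<^bsub>R\<^esub> \<one>\<^bsub>R\<^esub>"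
  proof -
    interpret ring R using assms(1) by (rule left_module_ring)
    show ?thesis using a l_minus[of "\<one>\<^bsub>R\<^esub>" a] r_minus[of a "\<one>\<^bsub>R\<^esub>"] by simp
  qed
  show "mneg R Y (f (a \<odot>\<^bsub>X\<^esub> x)) = a \<odot>\<^bsub>Y\<^esub> mneg R Y (f x)"
    using assms a x minus_one_closed[OF left_module_ring[OF assms(1)]]
    by (simp add: mneg_def lin_smult lin_closed left_module.smult_assoc[symmetric] r)
qed (use assms in \<open>auto simp: lin_closed lin_add mneg_closed mneg_add\<close>)

lemma lin_diff:
  assumes "left_module R X" "left_module R Y" "lin R X Y f" "lin R X Y g"
  shows "lin R X Y (\<lambda>x. f x \<oplus>\<^bsub>Y\<^esub> mneg R Y (g x))"
  using assms by (intro lin_plus lin_mneg_map)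

lemma lin_cong:
  assumes "lin R X Y f" "\<And>x. x \<in> carrier X \<Longrightarrow> f x = g x" "left_module R X"
  shows "lin R X Y g"
proof (rule linI)
  fix x y assume "x \<in> carrier X" "y \<in> carrier X"
  then show "g (x \<oplus>\<^bsub>X\<^esub> y) = g x \<oplus>\<^bsub>Y\<^esub> g y"
    using assms(2)[of "x \<oplus>\<^bsub>X\<^esub> y"] assms by (simp add: left_module_closed lin_add)
next
  fix a x assume "a \<in> carrier R" "x \<in> carrier X"
  then show "g (a \<odot>\<^bsub>X\<^esub> x) = a \<odot>\<^bsub>Y\<^esub> g x"
    using assms(2)[of "a \<odot>\<^bsub>X\<^esub> x"] assms by (simp add: left_module_closed lin_smult)
qed (use assms(1) assms(2)[symmetric] in \<open>auto simp: lin_closed\<close>)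

lemma lin_eq_if_diff_zero:
  assumes "left_module R X" "left_module R Y" "lin R X Y f" "x \<in> carrier X" "y \<in> carrier X"
  shows "f (x \<oplus>\<^bsub>X\<^esub> mneg R X y) = \<zero>\<^bsub>Y\<^esub> \<longleftrightarrow> f x = f y"
  using assms by (simp add: lin_add lin_mneg mneg_closed diff_eq_zero_iff lin_closed)

text \<open>
  Recursion on the number of summands, so that the sum can be unfolded without side conditions on them.
\<close>

primrec msum :: "('a, 'x) module \<Rightarrow> (nat \<Rightarrow> 'x) \<Rightarrow> nat \<Rightarrow> 'x" where
  "msum X f 0 = \<zero>\<^bsub>X\<^esub>"
| "msum X f (Suc r) = msum X f r \<oplus>\<^bsub>X\<^esub> f r"

lemma msum_closed:
  "left_module R X \<Longrightarrow> (\<And>j. j < r \<Longrightarrow> f j \<in> carrier X) \<Longrightarrow> msum X f r \<in> carrier X"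
  by (induction r) (auto simp: left_module_closed)

lemma msum_cong: "(\<And>j. j < r \<Longrightarrow> f j = g j) \<Longrightarrow> msum X f r = msum X g r"
  by (induction r) auto

lemma lin_msum:
  assumes "left_module R X" "left_module R Y" "lin R X Y f"
  shows "(\<And>j. j < r \<Longrightarrow> x j \<in> carrier X) \<Longrightarrow> f (msum X x r) = msum Y (\<lambda>j. f (x j)) r"
  by (induction r) (use assms in \<open>auto simp: lin_zero lin_add msum_closed\<close>)

lemma lin_msum_map:
  assumes "left_module R Y"
  shows "(\<And>j. j < r \<Longrightarrow> lin R X Y (f j)) \<Longrightarrow> lin R X Y (\<lambda>x. msum Y (\<lambda>j. f j x) r)"
  by (induction r) (use assms in \<open>auto intro: lin_zero_map lin_plus\<close>)

lemma msum_zero: "left_module R X \<Longrightarrow> (\<And>j. j < r \<Longrightarrow> f j = \<zero>\<^bsub>X\<^esub>) \<Longrightarrow> msum X f r = \<zero>\<^bsub>X\<^esub>"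
  by (induction r) (auto simp: left_module_add_ac left_module_closed)

lemma regular_module_simps [simp]:
  "carrier (regular_module R) = carrier R" "\<zero>\<^bsub>regular_module R\<^esub> = \<zero>\<^bsub>R\<^esub>"
  "x \<oplus>\<^bsub>regular_module R\<^esub> y = x \<oplus>\<^bsub>R\<^esub> y" "a \<odot>\<^bsub>regular_module R\<^esub> x = a \<otimes>\<^bsub>R\<^esub> x"
  by (simp_all add: regular_module_def)

lemma left_module_regular:
  assumes "ring R" shows "left_module R (regular_module R)"
proof -
  interpret ring R by fact
  show ?thesis
    by (rule left_moduleI) (simp_all add: assms l_distr r_distr m_assoc a_ac)
qed

lemma lin_regular:
  assumes "left_module R X" "x \<in> carrier X"
  shows "lin R (regular_module R) X (\<lambda>a. a \<odot>\<^bsub>X\<^esub> x)"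
  by (rule linI) (use assms left_module.smult_l_distr left_module.smult_assoc in
      \<open>fastforce simp: left_module_closed\<close>)+

lemma lin_regular_eq:
  assumes "ring R" "lin R (regular_module R) X f" "a \<in> carrier R"
  shows "f a = a \<odot>\<^bsub>X\<^esub> f \<one>\<^bsub>R\<^esub>"
proof -
  interpret ring R by fact
  show ?thesis using lin_smult[OF assms(2), of a "\<one>\<^bsub>R\<^esub>"] assms(3) by simp
qed

lemma left_module_carrier_update:
  assumes "left_module R M" "U \<subseteq> carrier M" "\<zero>\<^bsub>M\<^esub> \<in> U"
    "\<And>x y. x \<in> U \<Longrightarrow> y \<in> U \<Longrightarrow> x \<oplus>\<^bsub>M\<^esub> y \<in> U"
    "\<And>a x. a \<in> carrier R \<Longrightarrow> x \<in> U \<Longrightarrow> a \<odot>\<^bsub>M\<^esub> x \<in> U"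
  shows "left_module R (M\<lparr>carrier := U\<rparr>)"
proof -
  interpret left_module R M by fact
  have U: "\<And>x. x \<in> U \<Longrightarrow> x \<in> carrier M" using assms(2) by auto
  show ?thesis
    by (rule left_moduleI)
      (use assms(3-) U left_module_smult_zero[OF assms(1)] in
        \<open>auto simp: left_module_ring[OF assms(1)] M.a_ac smult_l_distr smult_r_distr smult_assoc smult_one\<close>)
qed

lemma left_module_kernel:
  assumes "left_module R X" "left_module R Y" "lin R X Y f"
  shows "left_module R (X\<lparr>carrier := {x \<in> carrier X. f x = \<zero>\<^bsub>Y\<^esub>}\<rparr>)"
  by (rule left_module_carrier_update)
    (use assms in \<open>auto simp: left_module_closed lin_zero lin_add lin_smult left_module_add_ac left_module_smult_zero\<close>)

lemma left_module_image:
  assumes "left_module R X" "left_module R Y" "lin R X Y f"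
  shows "left_module R (Y\<lparr>carrier := f ` carrier X\<rparr>)"
proof (rule left_module_carrier_update)
  show "\<zero>\<^bsub>Y\<^esub> \<in> f ` carrier X"
    using lin_zero[OF assms] left_module_closed(1)[OF assms(1)] by (metis imageI)
  show "x \<oplus>\<^bsub>Y\<^esub> y \<in> f ` carrier X" if "x \<in> f ` carrier X" "y \<in> f ` carrier X" for x y
    using that assms by (auto simp: lin_add[symmetric] left_module_closed)
  show "a \<odot>\<^bsub>Y\<^esub> x \<in> f ` carrier X" if "a \<in> carrier R" "x \<in> f ` carrier X" for a x
    using that assms by (auto simp: lin_smult[symmetric] left_module_closed)
qed (use assms in \<open>auto simp: lin_closed\<close>)

lemma left_module_zero:
  assumes "left_module R X"
  shows "left_module R (X\<lparr>carrier := {\<zero>\<^bsub>X\<^esub>}\<rparr>)"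
  by (rule left_module_carrier_update)
    (use assms in \<open>auto simp: left_module_closed left_module_add_ac left_module_smult_zero\<close>)

text \<open>
  The induced map is evaluated at any preimage; two preimages differ by an element of the kernel of \<open>f\<close>.
\<close>

lemma lin_factor:
  assumes X: "left_module R X" and Y: "left_module R Y" and Z: "left_module R Z"
    and f: "lin R X Y f" and g: "lin R X Z g"
    and k: "\<And>x. x \<in> carrier X \<Longrightarrow> f x = \<zero>\<^bsub>Y\<^esub> \<Longrightarrow> g x = \<zero>\<^bsub>Z\<^esub>"
  shows "\<exists>h. lin R (Y\<lparr>carrier := f ` carrier X\<rparr>) Z h \<and> (\<forall>x \<in> carrier X. h (f x) = g x)"
proof -
  define h where "h y = g (SOME x. x \<in> carrier X \<and> f x = y)" for y
  have h: "h (f x) = g x" if x: "x \<in> carrier X" for x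
  proof -
    let ?x = "SOME x'. x' \<in> carrier X \<and> f x' = f x"
    have "?x \<in> carrier X \<and> f ?x = f x" by (rule someI[of _ x]) (use x in auto)
    then have "f (?x \<oplus>\<^bsub>X\<^esub> mneg R X x) = \<zero>\<^bsub>Y\<^esub>" "?x \<in> carrier X"
      using lin_eq_if_diff_zero[OF X Y f _ x] by auto
    then have "g ?x = g x"
      using k[of "?x \<oplus>\<^bsub>X\<^esub> mneg R X x"] lin_eq_if_diff_zero[OF X Z g _ x] x X
      by (simp add: left_module_closed mneg_closed)
    then show ?thesis by (simp add: h_def)
  qed
  have "lin R (Y\<lparr>carrier := f ` carrier X\<rparr>) Z h"
  proof (rule linI)
    fix x assume "x \<in> carrier (Y\<lparr>carrier := f ` carrier X\<rparr>)"
    then show "h x \<in> carrier Z" using h g by (auto simp: lin_closed)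
  next
    fix x y assume "x \<in> carrier (Y\<lparr>carrier := f ` carrier X\<rparr>)" "y \<in> carrier (Y\<lparr>carrier := f ` carrier X\<rparr>)"
    then obtain u v where "u \<in> carrier X" "v \<in> carrier X" "x = f u" "y = f v" by auto
    then show "h (x \<oplus>\<^bsub>Y\<lparr>carrier := f ` carrier X\<rparr>\<^esub> y) = h x \<oplus>\<^bsub>Z\<^esub> h y"
      using h[of "u \<oplus>\<^bsub>X\<^esub> v"] h[of u] h[of v] X f g by (simp add: left_module_closed lin_add)
  next
    fix a x assume a: "a \<in> carrier R" and "x \<in> carrier (Y\<lparr>carrier := f ` carrier X\<rparr>)"
    then obtain u where "u \<in> carrier X" "x = f u" by auto
    then show "h (a \<odot>\<^bsub>Y\<lparr>carrier := f ` carrier X\<rparr>\<^esub> x) = a \<odot>\<^bsub>Z\<^esub> h x"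
      using h[of "a \<odot>\<^bsub>X\<^esub> u"] h[of u] X f g a by (simp add: left_module_closed lin_smult)
  qed
  then show ?thesis using h by blast
qed

lemma Hom_iff: "f \<in> Hom R X Y \<longleftrightarrow> lin R X Y f \<and> f \<in> extensional (carrier X)"
  unfolding Hom_def lin_def by (auto simp: PiE_iff Pi_iff)

lemma Hom_lin: "f \<in> Hom R X Y \<Longrightarrow> lin R X Y f"
  by (simp add: Hom_iff)

lemma restrict_Hom:
  assumes "left_module R X" "lin R X Y f"
  shows "restrict f (carrier X) \<in> Hom R X Y"
  unfolding Hom_iff using assms by (auto intro: lin_cong)

lemma Hom_eqI:
  assumes "f \<in> Hom R X Y" "g \<in> Hom R X Y" "\<And>x. x \<in> carrier X \<Longrightarrow> f x = g x"
  shows "f = g"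
  using assms by (auto simp: Hom_iff intro: extensionalityI)

lemma zero_hom_Hom: "left_module R X \<Longrightarrow> left_module R Y \<Longrightarrow> zero_hom X Y \<in> Hom R X Y"
  unfolding zero_hom_def by (intro restrict_Hom lin_zero_map)

lemma compose_eq_zero_hom_iff:
  "compose (carrier X) f g = zero_hom X Y \<longleftrightarrow> (\<forall>x \<in> carrier X. f (g x) = \<zero>\<^bsub>Y\<^esub>)"
  by (auto simp: compose_def zero_hom_def restrict_def fun_eq_iff)

section \<open>Direct summands of powers\<close>

lemma direct_power_simps [simp]:
  "carrier (direct_power M r) = {..<r} \<rightarrow>\<^sub>E carrier M"
  "\<zero>\<^bsub>direct_power M r\<^esub> = (\<lambda>i \<in> {..<r}. \<zero>\<^bsub>M\<^esub>)"
  "f \<oplus>\<^bsub>direct_power M r\<^esub> g = (\<lambda>i \<in> {..<r}. f i \<oplus>\<^bsub>M\<^esub> g i)"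
  "a \<odot>\<^bsub>direct_power M r\<^esub> f = (\<lambda>i \<in> {..<r}. a \<odot>\<^bsub>M\<^esub> f i)"
  by (simp_all add: direct_power_def)

lemma left_module_direct_power:
  assumes "left_module R M" shows "left_module R (direct_power M r)"
proof -
  interpret left_module R M by fact
  show ?thesis
  proof (rule left_moduleI)
  qed (auto simp: left_module_ring[OF assms] left_module_smult_zero[OF assms] PiE_iff smult_l_distr
      smult_r_distr smult_assoc smult_one M.a_ac smult_closed extensional_def fun_eq_iff restrict_def)
qed

lemma lin_proj: "j < r \<Longrightarrow> lin R (direct_power M r) M (\<lambda>f. f j)"
  by (rule linI) auto

definition unit_inj :: "('a, 'm) module \<Rightarrow> nat \<Rightarrow> nat \<Rightarrow> 'm \<Rightarrow> nat \<Rightarrow> 'm" where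
  "unit_inj M r j x = (\<lambda>i \<in> {..<r}. if i = j then x else \<zero>\<^bsub>M\<^esub>)"

lemma lin_unit_inj:
  assumes "left_module R M" shows "lin R M (direct_power M r) (unit_inj M r j)"
  by (rule linI) (use assms in \<open>auto simp: unit_inj_def fun_eq_iff left_module_closed left_module_add_ac left_module_smult_zero\<close>)

lemma msum_coordinate:
  assumes "k < r"
  shows "msum (direct_power M r) f s k = msum M (\<lambda>j. f j k) s"
  using assms by (induction s) auto

lemma msum_single:
  assumes "left_module R M" "k < r" "x \<in> carrier M"
  shows "msum M (\<lambda>j. if k = j then x else \<zero>\<^bsub>M\<^esub>) r = x"
  using assms(2)
proof (induction r)
  case (Suc r)
  show ?case
  proof (cases "k = r")
    case True
    then have "msum M (\<lambda>j. if k = j then x else \<zero>\<^bsub>M\<^esub>) r = \<zero>\<^bsub>M\<^esub>"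
      using msum_zero[OF assms(1)] by simp
    then show ?thesis using True assms by (simp add: left_module_add_ac)
  next
    case False
    then show ?thesis using Suc assms by (simp add: left_module_add_ac)
  qed
qed simp

lemma direct_power_decompose:
  assumes M: "left_module R M" and x: "x \<in> carrier (direct_power M r)"
  shows "msum (direct_power M r) (\<lambda>j. unit_inj M r j (x j)) r = x"
proof (rule extensionalityI[of _ "{..<r}"])
  have "msum (direct_power M r) (\<lambda>j. unit_inj M r j (x j)) r \<in> carrier (direct_power M r)"
  proof (rule msum_closed[OF left_module_direct_power[OF M]])
    fix j assume "j < r"
    then show "unit_inj M r j (x j) \<in> carrier (direct_power M r)"
      using lin_closed[OF lin_unit_inj[OF M], of "x j" r j] x by auto
  qed
  then show "msum (direct_power M r) (\<lambda>j. unit_inj M r j (x j)) r \<in> extensional {..<r}"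
    by (simp add: PiE_iff)
  show "x \<in> extensional {..<r}" using x by (simp add: PiE_iff)
  fix k assume "k \<in> {..<r}"
  then have k: "k < r" by simp
  have "msum (direct_power M r) (\<lambda>j. unit_inj M r j (x j)) r k
      = msum M (\<lambda>j. if k = j then x k else \<zero>\<^bsub>M\<^esub>) r"
    unfolding msum_coordinate[OF k] by (rule msum_cong) (auto simp: unit_inj_def k)
  also have "\<dots> = x k" using msum_single[OF M k] x k by auto
  finally show "msum (direct_power M r) (\<lambda>j. unit_inj M r j (x j)) r k = x k" .
qed

lemma submodule_iff:
  fixes M :: "('a, 'm) module"
  assumes "left_module R M"
  shows "submodule U R M \<longleftrightarrow> U \<subseteq> carrier M \<and> \<zero>\<^bsub>M\<^esub> \<in> U \<and> (\<forall>x \<in> U. \<forall>y \<in> U. x \<oplus>\<^bsub>M\<^esub> y \<in> U) \<and>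
    (\<forall>a \<in> carrier R. \<forall>x \<in> U. a \<odot>\<^bsub>M\<^esub> x \<in> U)"
proof
  assume "submodule U R M"
  then interpret submodule U R M .
  show "U \<subseteq> carrier M \<and> \<zero>\<^bsub>M\<^esub> \<in> U \<and> (\<forall>x \<in> U. \<forall>y \<in> U. x \<oplus>\<^bsub>M\<^esub> y \<in> U) \<and>
    (\<forall>a \<in> carrier R. \<forall>x \<in> U. a \<odot>\<^bsub>M\<^esub> x \<in> U)"
    using subset one_closed m_closed by auto
next
  assume *: "U \<subseteq> carrier M \<and> \<zero>\<^bsub>M\<^esub> \<in> U \<and> (\<forall>x \<in> U. \<forall>y \<in> U. x \<oplus>\<^bsub>M\<^esub> y \<in> U) \<and>
    (\<forall>a \<in> carrier R. \<forall>x \<in> U. a \<odot>\<^bsub>M\<^esub> x \<in> U)"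
  show "submodule U R M"
  proof (intro submodule.intro subgroup.intro submodule_axioms.intro)
    fix x assume x: "x \<in> U"
    then have "mneg R M x \<in> U" unfolding mneg_def
      using * minus_one_closed[OF left_module_ring[OF assms]] by blast
    moreover have "inv\<^bsub>add_monoid M\<^esub> x = mneg R M x"
      using mneg_eq_a_inv[OF assms] * x by (auto simp: a_inv_def)
    ultimately show "inv\<^bsub>add_monoid M\<^esub> x \<in> U" by simp
  qed (use * in auto)
qed

text \<open>
  The form in which membership in \<open>add Z\<close> is used: the identity of \<open>X\<close> is a finite sum of maps
  that factor through \<open>Z\<close>. Additive functors and natural transformations visibly respect it.
\<close>

definition add_data ::
  "('a, 'c) ring_scheme \<Rightarrow> ('a, 'z) module \<Rightarrow> ('a, 'x) module \<Rightarrow> nat \<Rightarrow>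
   (nat \<Rightarrow> 'x \<Rightarrow> 'z) \<Rightarrow> (nat \<Rightarrow> 'z \<Rightarrow> 'x) \<Rightarrow> bool" where
  "add_data R Z X r i p \<longleftrightarrow>
     (\<forall>j < r. lin R X Z (i j)) \<and> (\<forall>j < r. lin R Z X (p j)) \<and>
     (\<forall>x \<in> carrier X. msum X (\<lambda>j. p j (i j x)) r = x)"

lemma add_dataD:
  assumes "add_data R Z X r i p"
  shows "\<And>j. j < r \<Longrightarrow> lin R X Z (i j)" "\<And>j. j < r \<Longrightarrow> lin R Z X (p j)"
    "\<And>x. x \<in> carrier X \<Longrightarrow> msum X (\<lambda>j. p j (i j x)) r = x"
  using assms unfolding add_data_def by blast+

text \<open>
  The maps \<open>i j\<close> embed \<open>X\<close> into \<open>Z\<^sup>r\<close>, and the sum of the \<open>p j\<close> is a retraction, whose kernel is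
  the complement that the definition asks for.
\<close>

lemma in_addI:
  assumes X: "left_module R X" and Z: "left_module R Z"
    and i: "\<And>j. j < r \<Longrightarrow> lin R X Z (i j)" and p: "\<And>j. j < r \<Longrightarrow> lin R Z X (p j)"
    and id: "\<And>x. x \<in> carrier X \<Longrightarrow> msum X (\<lambda>j. p j (i j x)) r = x"
  shows "in_add R Z X"
proof -
  let ?D = "direct_power Z r"
  note D = left_module_direct_power[OF Z, of r]
  define q where "q w = msum X (\<lambda>j. p j (w j)) r" for w
  define h where "h = (\<lambda>x \<in> carrier X. \<lambda>j \<in> {..<r}. i j x)"
  have q: "lin R ?D X q" unfolding q_def
    by (rule lin_msum_map[OF X]) (rule lin_comp[OF p lin_proj], auto)
  have hl: "lin R X ?D (\<lambda>x. \<lambda>j \<in> {..<r}. i j x)"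
    by (rule linI) (auto simp: fun_eq_iff lin_closed[OF i] lin_add[OF i] lin_smult[OF i])
  then have h: "h \<in> Hom R X ?D" unfolding h_def by (rule restrict_Hom[OF X])
  note hlin = Hom_lin[OF h]
  have qh: "q (h x) = x" if "x \<in> carrier X" for x
  proof -
    have "q (h x) = msum X (\<lambda>j. p j (i j x)) r"
      unfolding q_def by (rule msum_cong) (use that in \<open>simp add: h_def\<close>)
    then show ?thesis using id[OF that] by simp
  qed
  define U where "U = h ` carrier X"
  define V where "V = {w \<in> carrier ?D. q w = \<zero>\<^bsub>X\<^esub>}"
  have U: "submodule U R ?D"
    unfolding submodule_iff[OF D] U_def
  proof (intro conjI ballI)
    show "h ` carrier X \<subseteq> carrier ?D" using lin_closed[OF hlin] by blast
    show "\<zero>\<^bsub>?D\<^esub> \<in> h ` carrier X"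
      using lin_zero[OF X D hlin] left_module_closed(1)[OF X] by (metis imageI)
    show "x \<oplus>\<^bsub>?D\<^esub> y \<in> h ` carrier X" if "x \<in> h ` carrier X" "y \<in> h ` carrier X" for x y
      using that lin_add[OF hlin] left_module_closed(2)[OF X] by (metis (no_types, lifting) image_iff)
    show "a \<odot>\<^bsub>?D\<^esub> x \<in> h ` carrier X" if "a \<in> carrier R" "x \<in> h ` carrier X" for a x
      using that lin_smult[OF hlin] left_module_closed(3)[OF X] by (metis (no_types, lifting) image_iff)
  qed
  have V: "submodule V R ?D"
    unfolding submodule_iff[OF D] V_def
    using left_module_closed[OF D] lin_zero[OF D X q] lin_add[OF q] lin_smult[OF q]
      left_module_add_ac[OF X] left_module_smult_zero[OF X] left_module_closed[OF X]
    by (simp del: direct_power_simps)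
  have UV: "U \<inter> V = {\<zero>\<^bsub>?D\<^esub>}"
  proof -
    have "w = \<zero>\<^bsub>?D\<^esub>" if w: "w \<in> U" "w \<in> V" for w
    proof -
      obtain x where x: "x \<in> carrier X" "w = h x" using w by (auto simp: U_def)
      then have "x = \<zero>\<^bsub>X\<^esub>" using qh w by (auto simp: V_def)
      then show ?thesis using x lin_zero[OF X D hlin] by simp
    qed
    moreover have "\<zero>\<^bsub>?D\<^esub> \<in> U" "\<zero>\<^bsub>?D\<^esub> \<in> V"
      using U V unfolding submodule_iff[OF D] by blast+
    ultimately show ?thesis by blast
  qed
  have sum: "U <+>\<^bsub>?D\<^esub> V = carrier ?D"
  proof
    show "U <+>\<^bsub>?D\<^esub> V \<subseteq> carrier ?D"
      using U V left_module_closed(2)[OF D] unfolding submodule_iff[OF D] set_add_def'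
      by (auto simp del: direct_power_simps)
    show "carrier ?D \<subseteq> U <+>\<^bsub>?D\<^esub> V"
    proof
      fix w assume w: "w \<in> carrier ?D"
      have qw: "q w \<in> carrier X" by (rule lin_closed[OF q w])
      have hq: "h (q w) \<in> carrier ?D" by (rule lin_closed[OF hlin qw])
      have "q (w \<oplus>\<^bsub>?D\<^esub> mneg R ?D (h (q w))) = \<zero>\<^bsub>X\<^esub>"
        using lin_eq_if_diff_zero[OF D X q w hq] qh[OF qw] by simp
      then have "w \<oplus>\<^bsub>?D\<^esub> mneg R ?D (h (q w)) \<in> V"
        using left_module_closed(2)[OF D w mneg_closed[OF D hq]] by (simp add: V_def)
      moreover have "h (q w) \<in> U" using qw by (simp add: U_def)
      moreover have "w = h (q w) \<oplus>\<^bsub>?D\<^esub> (w \<oplus>\<^bsub>?D\<^esub> mneg R ?D (h (q w)))"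
        using add_diff_cancel(1)[OF D w hq] by simp
      ultimately show "w \<in> U <+>\<^bsub>?D\<^esub> V" unfolding set_add_def' by blast
    qed
  qed
  have "inj_on h (carrier X)" by (rule inj_on_inverseI[of _ q]) (rule qh)
  then have "bij_betw h (carrier X) U" by (simp add: bij_betw_def U_def)
  then show ?thesis unfolding in_add_def using X U V UV sum h by blast
qed

text \<open>
  The coordinates of the embedding \<open>h\<close> serve as \<open>i j\<close>. The map \<open>p j\<close> includes \<open>Z\<close> as the
  \<open>j\<close>-th coordinate, projects onto the image of \<open>X\<close> along the complement and applies the inverse of \<open>h\<close>.
\<close>

lemma in_addE:
  assumes "in_add R Z X" and Z: "left_module R Z"
  obtains r i p where "add_data R Z X r i p"
proof -
  from assms(1) obtain r U V h where X: "left_module R X"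
    and U: "submodule U R (direct_power Z r)" and V: "submodule V R (direct_power Z r)"
    and UV: "U \<inter> V = {\<zero>\<^bsub>direct_power Z r\<^esub>}"
    and S: "U <+>\<^bsub>direct_power Z r\<^esub> V = carrier (direct_power Z r)"
    and h: "h \<in> Hom R X (direct_power Z r)" and b: "bij_betw h (carrier X) U"
    unfolding in_add_def by blast
  let ?D = "direct_power Z r"
  note D = left_module_direct_power[OF Z, of r]
  note hlin = Hom_lin[OF h]
  note U' = U[unfolded submodule_iff[OF D]] and V' = V[unfolded submodule_iff[OF D]]
  note cD = left_module_closed[OF D] and acD = left_module_add_ac[OF D]
  have ex: "\<exists>u v. u \<in> U \<and> v \<in> V \<and> w = u \<oplus>\<^bsub>?D\<^esub> v" if "w \<in> carrier ?D" for w
    using that unfolding S[symmetric] set_add_def' by blast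
  have uniq: "u = u'" if u: "u \<in> U" "u' \<in> U" and v: "v \<in> V" "v' \<in> V"
    and e: "u \<oplus>\<^bsub>?D\<^esub> v = u' \<oplus>\<^bsub>?D\<^esub> v'" for u u' v v'
  proof -
    have c: "u \<in> carrier ?D" "u' \<in> carrier ?D" "v \<in> carrier ?D" "v' \<in> carrier ?D"
      using u v U' V' by blast+
    note n = mneg_closed[OF D]
    let ?m = "mneg R ?D"
    have m1: "?m u' \<in> U" "?m v \<in> V"
      using U' V' u v minus_one_closed[OF left_module_ring[OF D]] unfolding mneg_def by blast+
    have "u \<oplus>\<^bsub>?D\<^esub> ?m u' = (u \<oplus>\<^bsub>?D\<^esub> v \<oplus>\<^bsub>?D\<^esub> ?m v) \<oplus>\<^bsub>?D\<^esub> ?m u'"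
      using add_diff_cancel(3)[OF D c(1,3)] by simp
    also have "\<dots> = (u' \<oplus>\<^bsub>?D\<^esub> v' \<oplus>\<^bsub>?D\<^esub> ?m v) \<oplus>\<^bsub>?D\<^esub> ?m u'" by (simp only: e)
    also have "\<dots> = ?m u' \<oplus>\<^bsub>?D\<^esub> (u' \<oplus>\<^bsub>?D\<^esub> (v' \<oplus>\<^bsub>?D\<^esub> ?m v))"
      using c n by (simp del: direct_power_simps add: acD(3)[of _ "?m u'"] acD(4) cD(2))
    also have "\<dots> = v' \<oplus>\<^bsub>?D\<^esub> ?m v"
      using c n by (simp del: direct_power_simps add: add_diff_cancel(5)[OF D] cD(2))
    finally have "u \<oplus>\<^bsub>?D\<^esub> ?m u' \<in> U \<inter> V" using m1 U' V' u v by (metis IntI)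
    then show ?thesis using UV diff_eq_zero_iff[OF D c(1,2)] by blast
  qed
  define pr where "pr w = (SOME u. u \<in> U \<and> (\<exists>v \<in> V. w = u \<oplus>\<^bsub>?D\<^esub> v))" for w
  have prU: "pr w \<in> U \<and> (\<exists>v \<in> V. w = pr w \<oplus>\<^bsub>?D\<^esub> v)" if w: "w \<in> carrier ?D" for w
  proof -
    obtain u v where "u \<in> U" "v \<in> V" "w = u \<oplus>\<^bsub>?D\<^esub> v" using ex[OF w] by (elim exE conjE)
    then have "u \<in> U \<and> (\<exists>v \<in> V. w = u \<oplus>\<^bsub>?D\<^esub> v)" by (intro conjI bexI)
    then show ?thesis unfolding pr_def
      by (rule someI[where P = "\<lambda>u. u \<in> U \<and> (\<exists>v \<in> V. w = u \<oplus>\<^bsub>?D\<^esub> v)"])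
  qed
  have pr_eq: "pr w = u" if "u \<in> U" "v \<in> V" "w = u \<oplus>\<^bsub>?D\<^esub> v" for w u v
  proof -
    have "u \<in> carrier ?D" "v \<in> carrier ?D" using that(1,2) U' V' by blast+
    then have "w \<in> carrier ?D" unfolding that(3) by (rule cD(2))
    from prU[OF this] obtain v' where p: "pr w \<in> U" "v' \<in> V" "w = pr w \<oplus>\<^bsub>?D\<^esub> v'" by (elim conjE bexE)
    have "pr w \<oplus>\<^bsub>?D\<^esub> v' = u \<oplus>\<^bsub>?D\<^esub> v" by (rule trans[OF p(3)[symmetric] that(3)])
    then show ?thesis by (rule uniq[OF p(1) that(1) p(2) that(2)])
  qed
  define g where "g = inv_into (carrier X) h"
  have gh: "g (h x) = x" if "x \<in> carrier X" for x
    using that b by (simp add: g_def bij_betw_def)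
  have gU: "g u \<in> carrier X \<and> h (g u) = u" if "u \<in> U" for u
    using that b unfolding g_def bij_betw_def by (metis f_inv_into_f inv_into_into)
  have q: "lin R ?D X (\<lambda>w. g (pr w))"
  proof (rule linI)
    fix x assume "x \<in> carrier ?D" then show "g (pr x) \<in> carrier X" using prU gU by blast
  next
    fix x y assume x: "x \<in> carrier ?D" and y: "y \<in> carrier ?D"
    obtain v where v: "v \<in> V" "x = pr x \<oplus>\<^bsub>?D\<^esub> v" using prU[OF x] by blast
    obtain w where w: "w \<in> V" "y = pr y \<oplus>\<^bsub>?D\<^esub> w" using prU[OF y] by blast
    have c: "pr x \<in> carrier ?D" "pr y \<in> carrier ?D" "v \<in> carrier ?D" "w \<in> carrier ?D"
      using prU[OF x] prU[OF y] v w U' V' by blast+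
    have "x \<oplus>\<^bsub>?D\<^esub> y = (pr x \<oplus>\<^bsub>?D\<^esub> v) \<oplus>\<^bsub>?D\<^esub> (pr y \<oplus>\<^bsub>?D\<^esub> w)" using v w by simp
    also have "\<dots> = (pr x \<oplus>\<^bsub>?D\<^esub> pr y) \<oplus>\<^bsub>?D\<^esub> (v \<oplus>\<^bsub>?D\<^esub> w)"
      using c by (simp del: direct_power_simps add: acD(4) acD(5)[of v "pr y"] cD(2))
    finally have "pr (x \<oplus>\<^bsub>?D\<^esub> y) = pr x \<oplus>\<^bsub>?D\<^esub> pr y"
      using pr_eq prU[OF x] prU[OF y] v w U' V' by metis
    moreover have "g (pr x \<oplus>\<^bsub>?D\<^esub> pr y) = g (pr x) \<oplus>\<^bsub>X\<^esub> g (pr y)"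
      using lin_add[OF hlin, of "g (pr x)" "g (pr y)"] gU prU[OF x] prU[OF y]
        gh[of "g (pr x) \<oplus>\<^bsub>X\<^esub> g (pr y)"] left_module_closed(2)[OF X] by metis
    ultimately show "g (pr (x \<oplus>\<^bsub>?D\<^esub> y)) = g (pr x) \<oplus>\<^bsub>X\<^esub> g (pr y)" by simp
  next
    fix a x assume a: "a \<in> carrier R" and x: "x \<in> carrier ?D"
    obtain v where v: "v \<in> V" "x = pr x \<oplus>\<^bsub>?D\<^esub> v" using prU[OF x] by blast
    have c: "pr x \<in> carrier ?D" "v \<in> carrier ?D" using prU[OF x] v U' V' by blast+
    have "a \<odot>\<^bsub>?D\<^esub> x = a \<odot>\<^bsub>?D\<^esub> pr x \<oplus>\<^bsub>?D\<^esub> a \<odot>\<^bsub>?D\<^esub> v"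
      using left_module.smult_r_distr[OF D a c] v(2)[symmetric] by (simp del: direct_power_simps)
    then have "pr (a \<odot>\<^bsub>?D\<^esub> x) = a \<odot>\<^bsub>?D\<^esub> pr x"
      using pr_eq prU[OF x] v U' V' a by metis
    moreover have "g (a \<odot>\<^bsub>?D\<^esub> pr x) = a \<odot>\<^bsub>X\<^esub> g (pr x)"
      using lin_smult[OF hlin a, of "g (pr x)"] gU prU[OF x]
        gh[of "a \<odot>\<^bsub>X\<^esub> g (pr x)"] left_module_closed(3)[OF X a] by metis
    ultimately show "g (pr (a \<odot>\<^bsub>?D\<^esub> x)) = a \<odot>\<^bsub>X\<^esub> g (pr x)" by simp
  qed
  show thesis
  proof (rule that[of r "\<lambda>j x. h x j" "\<lambda>j z. g (pr (unit_inj Z r j z))"], unfold add_data_def, intro conjI allI impI ballI)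
    show "lin R X Z (\<lambda>x. h x j)" if "j < r" for j by (rule lin_comp[OF lin_proj[OF that] hlin])
    show "lin R Z X (\<lambda>z. g (pr (unit_inj Z r j z)))" if "j < r" for j
      by (rule lin_comp[OF q lin_unit_inj[OF Z]])
    fix x assume x: "x \<in> carrier X"
    have hx: "h x \<in> carrier ?D" by (rule lin_closed[OF hlin x])
    have "msum X (\<lambda>j. g (pr (unit_inj Z r j (h x j)))) r
        = g (pr (msum ?D (\<lambda>j. unit_inj Z r j (h x j)) r))"
      by (rule lin_msum[OF D X q, symmetric])
        (rule lin_closed[OF lin_unit_inj[OF Z]], use hx in auto)
    also have "\<dots> = g (pr (h x))" using direct_power_decompose[OF Z hx] by simp
    also have "pr (h x) = h x"
    proof (rule pr_eq)
      show "h x \<in> U" using b x by (auto simp: bij_betw_def)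
      show "\<zero>\<^bsub>?D\<^esub> \<in> V" using V' by blast
      show "h x = h x \<oplus>\<^bsub>?D\<^esub> \<zero>\<^bsub>?D\<^esub>" using acD(2)[OF hx] by simp
    qed
    finally show "msum X (\<lambda>j. g (pr (unit_inj Z r j (h x j)))) r = x" using gh[OF x] by simp
  qed
qed

lemma in_add_left_module: "in_add R Z X \<Longrightarrow> left_module R X"
  by (simp add: in_add_def)

lemma in_add_retract:
  assumes "in_add R Z X" "left_module R Z" "left_module R X'"
    and s: "lin R X' X s" and t: "lin R X X' t" and ts: "\<And>x. x \<in> carrier X' \<Longrightarrow> t (s x) = x"
  shows "in_add R Z X'"
proof -
  note X = in_add_left_module[OF assms(1)]
  obtain r i p where Dr: "add_data R Z X r i p"
    using in_addE[OF assms(1,2)] by blast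
  note i = add_dataD(1)[OF Dr] and p = add_dataD(2)[OF Dr] and id = add_dataD(3)[OF Dr]
  show ?thesis
  proof (rule in_addI[OF assms(3,2), of r "\<lambda>j x. i j (s x)" "\<lambda>j z. t (p j z)"])
    fix x assume x: "x \<in> carrier X'"
    note sx = lin_closed[OF s x]
    have "msum X' (\<lambda>j. t (p j (i j (s x)))) r = t (msum X (\<lambda>j. p j (i j (s x))) r)"
      using lin_closed[OF p] lin_closed[OF i] sx by (intro lin_msum[OF X assms(3) t, symmetric]) auto
    then show "msum X' (\<lambda>j. t (p j (i j (s x)))) r = x" using id[OF sx] ts[OF x] by simp
  qed (auto intro: lin_comp[OF i s] lin_comp[OF t p])
qed

lemma in_add_base_retract:
  assumes "in_add R Z X" "left_module R Z" "left_module R Z'"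
    and s: "lin R Z Z' s" and t: "lin R Z' Z t" and ts: "\<And>x. x \<in> carrier Z \<Longrightarrow> t (s x) = x"
  shows "in_add R Z' X"
proof -
  note X = in_add_left_module[OF assms(1)]
  obtain r i p where Dr: "add_data R Z X r i p"
    using in_addE[OF assms(1,2)] by blast
  note i = add_dataD(1)[OF Dr] and p = add_dataD(2)[OF Dr] and id = add_dataD(3)[OF Dr]
  show ?thesis
  proof (rule in_addI[OF X assms(3), of r "\<lambda>j x. s (i j x)" "\<lambda>j z. p j (t z)"])
    fix x assume x: "x \<in> carrier X"
    have "msum X (\<lambda>j. p j (t (s (i j x)))) r = msum X (\<lambda>j. p j (i j x)) r"
      by (rule msum_cong) (use ts lin_closed[OF i x] in auto)
    then show "msum X (\<lambda>j. p j (t (s (i j x)))) r = x" using id[OF x] by simp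
  qed (auto intro: lin_comp[OF s i] lin_comp[OF p t])
qed

lemma in_add_self: "left_module R Z \<Longrightarrow> in_add R Z Z"
  by (rule in_addI[of _ _ _ 1 "\<lambda>_ x. x" "\<lambda>_ x. x"]) (auto intro: lin_id simp: left_module_add_ac)

lemma in_add_zero:
  assumes "left_module R Z" "left_module R X" "carrier X = {\<zero>\<^bsub>X\<^esub>}"
  shows "in_add R Z X"
  by (rule in_addI[OF assms(2,1), where r = 0 and i = undefined and p = undefined]) (use assms(3) in simp_all)

lemma in_add_zero_carrier:
  assumes "left_module R Z" "left_module R X"
  shows "in_add R Z (X\<lparr>carrier := {\<zero>\<^bsub>X\<^esub>}\<rparr>)"
  by (rule in_add_zero[OF assms(1) left_module_zero[OF assms(2)]]) simp_all

text \<open>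
  Membership in \<open>add R\<close> provides linear forms \<open>i j\<close> on \<open>P\<close> and elements \<open>p j \<one>\<close> of \<open>P\<close> that constitute a
  dual basis, so it suffices to lift the elements \<open>f (p j \<one>)\<close>.
\<close>

lemma proj_lift:
  assumes P: "in_add R (regular_module R) P" and Y: "left_module R Y" and Z: "left_module R Z"
    and g: "lin R Y Z g" and f: "lin R P Z f" and sub: "f ` carrier P \<subseteq> g ` carrier Y"
  obtains h where "lin R P Y h" "\<And>x. x \<in> carrier P \<Longrightarrow> g (h x) = f x"
proof -
  have R: "ring R" by (rule left_module_ring[OF Y])
  interpret R: ring R by fact
  note RR = left_module_regular[OF R] and PM = in_add_left_module[OF P]
  obtain r i p where Dr: "add_data R (regular_module R) P r i p"
    using in_addE[OF P RR] by blast
  note i = add_dataD(1)[OF Dr] and p = add_dataD(2)[OF Dr] and id = add_dataD(3)[OF Dr]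
  have p1: "p j \<one>\<^bsub>R\<^esub> \<in> carrier P" if "j < r" for j
    using lin_closed[OF p[OF that]] by simp
  have "\<forall>j. \<exists>y. j < r \<longrightarrow> y \<in> carrier Y \<and> g y = f (p j \<one>\<^bsub>R\<^esub>)"
    using p1 sub by (metis (no_types, lifting) image_iff image_subset_iff)
  then obtain y where y: "\<And>j. j < r \<Longrightarrow> y j \<in> carrier Y" and gy: "\<And>j. j < r \<Longrightarrow> g (y j) = f (p j \<one>\<^bsub>R\<^esub>)"
    by metis
  define h where "h x = msum Y (\<lambda>j. i j x \<odot>\<^bsub>Y\<^esub> y j) r" for x
  have t: "lin R P Y (\<lambda>x. i j x \<odot>\<^bsub>Y\<^esub> y j)" if "j < r" for j
    by (rule lin_comp[OF lin_regular[OF Y y[OF that]] i[OF that]])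
  show thesis
  proof (rule that[of h])
    show "lin R P Y h" unfolding h_def by (rule lin_msum_map[OF Y t])
    fix x assume x: "x \<in> carrier P"
    have "g (h x) = msum Z (\<lambda>j. g (i j x \<odot>\<^bsub>Y\<^esub> y j)) r"
      unfolding h_def by (rule lin_msum[OF Y Z g]) (rule lin_closed[OF t x])
    also have "\<dots> = msum Z (\<lambda>j. f (p j (i j x))) r"
    proof (rule msum_cong)
      fix j assume j: "j < r"
      have ij: "i j x \<in> carrier R" using lin_closed[OF i[OF j] x] by simp
      have "f (p j (i j x)) = i j x \<odot>\<^bsub>Z\<^esub> f (p j \<one>\<^bsub>R\<^esub>)"
        using lin_regular_eq[OF R p[OF j] ij] lin_smult[OF f ij p1[OF j]] by simp
      then show "g (i j x \<odot>\<^bsub>Y\<^esub> y j) = f (p j (i j x))"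
        using lin_smult[OF g ij y[OF j]] gy[OF j] by simp
    qed
    also have "\<dots> = f (msum P (\<lambda>j. p j (i j x)) r)"
      by (rule lin_msum[OF PM Z f, symmetric]) (use lin_closed[OF p] lin_closed[OF i x] in auto)
    finally show "g (h x) = f x" using id[OF x] by simp
  qed
qed

section \<open>Projective resolutions and the vanishing of Ext\<close>

text \<open>
  The terms may have any carrier type, the maps are linear in the sense of \<open>lin\<close>, and projectivity of
  the terms is a separate condition.
\<close>

definition resol ::
  "('a, 'c) ring_scheme \<Rightarrow> ('a, 'm) module \<Rightarrow> (nat \<Rightarrow> ('a, 'p) module) \<Rightarrow>
   ('p \<Rightarrow> 'm) \<Rightarrow> (nat \<Rightarrow> 'p \<Rightarrow> 'p) \<Rightarrow> bool" where
  "resol R M P \<epsilon> \<delta> \<longleftrightarrow> left_module R M \<and> (\<forall>i. left_module R (P i)) \<and>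
     lin R (P 0) M \<epsilon> \<and> \<epsilon> ` carrier (P 0) = carrier M \<and>
     (\<forall>i. lin R (P (Suc i)) (P i) (\<delta> i)) \<and>
     (\<forall>x \<in> carrier (P 0). \<epsilon> x = \<zero>\<^bsub>M\<^esub> \<longleftrightarrow> x \<in> \<delta> 0 ` carrier (P 1)) \<and>
     (\<forall>i. \<forall>x \<in> carrier (P (Suc i)). \<delta> i x = \<zero>\<^bsub>P i\<^esub> \<longleftrightarrow> x \<in> \<delta> (Suc i) ` carrier (P (Suc (Suc i))))"

lemma resolD:
  assumes "resol R M P \<epsilon> \<delta>"
  shows "left_module R M" "\<And>i. left_module R (P i)" "lin R (P 0) M \<epsilon>"
    "\<epsilon> ` carrier (P 0) = carrier M" "\<And>i. lin R (P (Suc i)) (P i) (\<delta> i)"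
    "\<And>x. x \<in> carrier (P 0) \<Longrightarrow> \<epsilon> x = \<zero>\<^bsub>M\<^esub> \<longleftrightarrow> x \<in> \<delta> 0 ` carrier (P 1)"
    "\<And>i x. x \<in> carrier (P (Suc i)) \<Longrightarrow>
       \<delta> i x = \<zero>\<^bsub>P i\<^esub> \<longleftrightarrow> x \<in> \<delta> (Suc i) ` carrier (P (Suc (Suc i)))"
    "\<And>x. x \<in> carrier (P 1) \<Longrightarrow> \<epsilon> (\<delta> 0 x) = \<zero>\<^bsub>M\<^esub>"
    "\<And>i x. x \<in> carrier (P (Suc (Suc i))) \<Longrightarrow> \<delta> i (\<delta> (Suc i) x) = \<zero>\<^bsub>P i\<^esub>"
proof -
  note a = assms[unfolded resol_def]
  note a1 = a[THEN conjunct1] and b1 = a[THEN conjunct2]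
  note a2 = b1[THEN conjunct1] and b2 = b1[THEN conjunct2]
  note a3 = b2[THEN conjunct1] and b3 = b2[THEN conjunct2]
  note a4 = b3[THEN conjunct1] and b4 = b3[THEN conjunct2]
  note a5 = b4[THEN conjunct1] and b5 = b4[THEN conjunct2]
  note a6 = b5[THEN conjunct1] and a7 = b5[THEN conjunct2]
  show "left_module R M" "\<And>i. left_module R (P i)" "lin R (P 0) M \<epsilon>"
    "\<epsilon> ` carrier (P 0) = carrier M" and l: "\<And>i. lin R (P (Suc i)) (P i) (\<delta> i)"
    and x0: "\<And>x. x \<in> carrier (P 0) \<Longrightarrow> \<epsilon> x = \<zero>\<^bsub>M\<^esub> \<longleftrightarrow> x \<in> \<delta> 0 ` carrier (P 1)"
    and x1: "\<And>i x. x \<in> carrier (P (Suc i)) \<Longrightarrow>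
       \<delta> i x = \<zero>\<^bsub>P i\<^esub> \<longleftrightarrow> x \<in> \<delta> (Suc i) ` carrier (P (Suc (Suc i)))"
    by (rule a1, rule a2[rule_format], rule a3, rule a4, rule a5[rule_format],
      erule a6[rule_format], erule a7[rule_format])
  show "\<epsilon> (\<delta> 0 x) = \<zero>\<^bsub>M\<^esub>" if "x \<in> carrier (P 1)" for x
    using x0[of "\<delta> 0 x"] lin_closed[OF l, of x 0] that by simp
  show "\<delta> i (\<delta> (Suc i) x) = \<zero>\<^bsub>P i\<^esub>" if "x \<in> carrier (P (Suc (Suc i)))" for i x
    using x1[of "\<delta> (Suc i) x" i] lin_closed[OF l, of x "Suc i"] that by simp
qed

text \<open>
  The existence half of the comparison theorem. Each component is a lift, which exists because the
  previous component maps boundaries to boundaries (the predicate \<open>good\<close> below).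
\<close>

lemma chain_lift:
  assumes Q: "resol R Y Q \<epsilon> \<delta>" and proj: "\<And>i. in_add R (regular_module R) (Q i)"
    and P: "resol R Z P \<epsilon>' \<delta>'" and f: "lin R Y Z f"
  obtains F where "\<And>i. lin R (Q i) (P i) (F i)"
    "\<And>x. x \<in> carrier (Q 0) \<Longrightarrow> \<epsilon>' (F 0 x) = f (\<epsilon> x)"
    "\<And>i x. x \<in> carrier (Q (Suc i)) \<Longrightarrow> \<delta>' i (F (Suc i) x) = F i (\<delta> i x)"
proof -
  note q = resolD[OF Q] and p = resolD[OF P]
  define good where "good i u \<longleftrightarrow> lin R (Q i) (P i) u \<and>
    (\<forall>x \<in> carrier (Q (Suc i)). u (\<delta> i x) \<in> \<delta>' i ` carrier (P (Suc i)))" for i u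
  obtain u0 where u0: "lin R (Q 0) (P 0) u0" "\<And>x. x \<in> carrier (Q 0) \<Longrightarrow> \<epsilon>' (u0 x) = f (\<epsilon> x)"
    by (rule proj_lift[OF proj p(2) p(1) p(3) lin_comp[OF f q(3)]])
      (use p(4) lin_closed[OF f] lin_closed[OF q(3)] in auto)
  have g0: "good 0 u0"
    unfolding good_def
  proof (intro conjI ballI u0(1))
    fix x assume x: "x \<in> carrier (Q (Suc 0))"
    have d: "\<delta> 0 x \<in> carrier (Q 0)" by (rule lin_closed[OF q(5) x])
    have "\<epsilon>' (u0 (\<delta> 0 x)) = \<zero>\<^bsub>Z\<^esub>"
      using u0(2)[OF d] q(8) x lin_zero[OF q(1) p(1) f] by simp
    then show "u0 (\<delta> 0 x) \<in> \<delta>' 0 ` carrier (P (Suc 0))"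
      using p(6)[of "u0 (\<delta> 0 x)"] lin_closed[OF u0(1) d] by simp
  qed
  have step: "\<exists>v. good (Suc i) v \<and> (\<forall>x \<in> carrier (Q (Suc i)). \<delta>' i (v x) = u (\<delta> i x))"
    if u: "good i u" for i u
  proof -
    have ul: "lin R (Q i) (P i) u" using u by (simp add: good_def)
    obtain v where v: "lin R (Q (Suc i)) (P (Suc i)) v"
      "\<And>x. x \<in> carrier (Q (Suc i)) \<Longrightarrow> \<delta>' i (v x) = u (\<delta> i x)"
      by (rule proj_lift[OF proj p(2) p(2) p(5) lin_comp[OF ul q(5)]])
        (use u in \<open>auto simp: good_def\<close>)
    have "good (Suc i) v"
      unfolding good_def
    proof (intro conjI ballI v(1))
      fix x assume x: "x \<in> carrier (Q (Suc (Suc i)))"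
      have d: "\<delta> (Suc i) x \<in> carrier (Q (Suc i))" by (rule lin_closed[OF q(5) x])
      have "\<delta>' i (v (\<delta> (Suc i) x)) = \<zero>\<^bsub>P i\<^esub>"
        using v(2)[OF d] q(9)[OF x] lin_zero[OF q(2) p(2) ul] by simp
      then show "v (\<delta> (Suc i) x) \<in> \<delta>' (Suc i) ` carrier (P (Suc (Suc i)))"
        using p(7)[of "v (\<delta> (Suc i) x)"] lin_closed[OF v(1) d] by simp
    qed
    then show ?thesis using v(2) by blast
  qed
  have "\<exists>F. \<forall>i. (good i (F i) \<and> (i = 0 \<longrightarrow> F i = u0)) \<and>
      (\<forall>x \<in> carrier (Q (Suc i)). \<delta>' i (F (Suc i) x) = F i (\<delta> i x))"
    by (rule dependent_nat_choice[where P = "\<lambda>i u. good i u \<and> (i = 0 \<longrightarrow> u = u0)"])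
      (use g0 step in auto)
  then obtain F where F: "\<And>i. good i (F i)" "F 0 = u0"
    "\<And>i x. x \<in> carrier (Q (Suc i)) \<Longrightarrow> \<delta>' i (F (Suc i) x) = F i (\<delta> i x)" by blast
  show thesis by (rule that[of F]) (use F u0 in \<open>auto simp: good_def\<close>)
qed

text \<open>
  The uniqueness half of the comparison theorem: a chain map over the zero map is null-homotopic.
\<close>

lemma null_homotopy:
  assumes Q: "resol R Y Q \<epsilon> \<delta>" and proj: "\<And>i. in_add R (regular_module R) (Q i)"
    and F: "\<And>i. lin R (Q i) (Q i) (F i)"
    and F0: "\<And>x. x \<in> carrier (Q 0) \<Longrightarrow> \<epsilon> (F 0 x) = \<zero>\<^bsub>Y\<^esub>"
    and comm: "\<And>i x. x \<in> carrier (Q (Suc i)) \<Longrightarrow> \<delta> i (F (Suc i) x) = F i (\<delta> i x)"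
  obtains h where "\<And>i. lin R (Q i) (Q (Suc i)) (h i)"
    "\<And>i x. x \<in> carrier (Q (Suc i)) \<Longrightarrow>
       F (Suc i) x = \<delta> (Suc i) (h (Suc i) x) \<oplus>\<^bsub>Q (Suc i)\<^esub> h i (\<delta> i x)"
proof -
  note q = resolD[OF Q]
  define good where "good i u \<longleftrightarrow> lin R (Q i) (Q (Suc i)) u \<and>
    (\<forall>x \<in> carrier (Q (Suc i)). \<delta> i (u (\<delta> i x)) = F i (\<delta> i x))" for i u
  obtain u0 where u0: "lin R (Q 0) (Q (Suc 0)) u0" "\<And>x. x \<in> carrier (Q 0) \<Longrightarrow> \<delta> 0 (u0 x) = F 0 x"
    by (rule proj_lift[OF proj q(2) q(2) q(5)[of 0] F])
      (use q(6) F0 lin_closed[OF F] in auto)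
  have g0: "good 0 u0" unfolding good_def using u0 lin_closed[OF q(5)] by auto
  have step: "\<exists>v. good (Suc i) v \<and>
      (\<forall>x \<in> carrier (Q (Suc i)). F (Suc i) x = \<delta> (Suc i) (v x) \<oplus>\<^bsub>Q (Suc i)\<^esub> u (\<delta> i x))"
    if u: "good i u" for i u
  proof -
    have ul: "lin R (Q i) (Q (Suc i)) u" using u by (simp add: good_def)
    let ?w = "\<lambda>x. F (Suc i) x \<oplus>\<^bsub>Q (Suc i)\<^esub> mneg R (Q (Suc i)) (u (\<delta> i x))"
    have udl: "lin R (Q (Suc i)) (Q (Suc i)) (\<lambda>x. u (\<delta> i x))" by (rule lin_comp[OF ul q(5)])
    have w: "lin R (Q (Suc i)) (Q (Suc i)) ?w" by (rule lin_diff[OF q(2) q(2) F udl])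
    obtain v where v: "lin R (Q (Suc i)) (Q (Suc (Suc i))) v"
      "\<And>x. x \<in> carrier (Q (Suc i)) \<Longrightarrow> \<delta> (Suc i) (v x) = ?w x"
    proof (rule proj_lift[OF proj q(2) q(2) q(5) w])
      show "?w ` carrier (Q (Suc i)) \<subseteq> \<delta> (Suc i) ` carrier (Q (Suc (Suc i)))"
      proof (rule image_subsetI)
        fix x assume x: "x \<in> carrier (Q (Suc i))"
        have "\<delta> i (?w x) = \<zero>\<^bsub>Q i\<^esub>"
          using u lin_eq_if_diff_zero[OF q(2) q(2) q(5) lin_closed[OF F x] lin_closed[OF udl x]]
            comm[OF x] x by (simp add: good_def)
        then show "?w x \<in> \<delta> (Suc i) ` carrier (Q (Suc (Suc i)))"
          using q(7)[OF lin_closed[OF w x]] by simp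
      qed
    qed auto
    have eq: "F (Suc i) x = \<delta> (Suc i) (v x) \<oplus>\<^bsub>Q (Suc i)\<^esub> u (\<delta> i x)"
      if x: "x \<in> carrier (Q (Suc i))" for x
      using v(2)[OF x] add_diff_cancel(2)[OF q(2) lin_closed[OF F x] lin_closed[OF udl x]] by simp
    have "good (Suc i) v"
      unfolding good_def
    proof (intro conjI ballI v(1))
      fix x assume x: "x \<in> carrier (Q (Suc (Suc i)))"
      have d: "\<delta> (Suc i) x \<in> carrier (Q (Suc i))" by (rule lin_closed[OF q(5) x])
      have "u (\<delta> i (\<delta> (Suc i) x)) = \<zero>\<^bsub>Q (Suc i)\<^esub>"
        using q(9)[OF x] lin_zero[OF q(2) q(2) ul] by simp
      then show "\<delta> (Suc i) (v (\<delta> (Suc i) x)) = F (Suc i) (\<delta> (Suc i) x)"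
        using eq[OF d] left_module_add_ac(2)[OF q(2) lin_closed[OF q(5) lin_closed[OF v(1) d]]] by simp
    qed
    then show ?thesis using eq by blast
  qed
  have "\<exists>h. \<forall>i. good i (h i) \<and>
      (\<forall>x \<in> carrier (Q (Suc i)). F (Suc i) x = \<delta> (Suc i) (h (Suc i) x) \<oplus>\<^bsub>Q (Suc i)\<^esub> h i (\<delta> i x))"
    by (rule dependent_nat_choice[where P = good]) (use g0 step in auto)
  then obtain h where h: "\<And>i. good i (h i)" "\<And>i x. x \<in> carrier (Q (Suc i)) \<Longrightarrow>
     F (Suc i) x = \<delta> (Suc i) (h (Suc i) x) \<oplus>\<^bsub>Q (Suc i)\<^esub> h i (\<delta> i x)" by blast
  show thesis by (rule that[of h]) (use h in \<open>auto simp: good_def\<close>)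
qed

text \<open>
  The vanishing of cohomology of \<open>Hom(P, N)\<close> in degree \<open>i + 1\<close>. For a projective resolution this says
  \<open>Ext\<^sup>i\<^sup>+\<^sup>1 = 0\<close>; shifting the index excludes degree zero.
\<close>

definition acyc_at ::
  "('a, 'c) ring_scheme \<Rightarrow> (nat \<Rightarrow> ('a, 'p) module) \<Rightarrow> (nat \<Rightarrow> 'p \<Rightarrow> 'p) \<Rightarrow> ('a, 'n) module \<Rightarrow>
   nat \<Rightarrow> bool" where
  "acyc_at R P \<delta> N i \<longleftrightarrow> (\<forall>f. lin R (P (Suc i)) N f \<longrightarrow>
     (\<forall>x \<in> carrier (P (Suc (Suc i))). f (\<delta> (Suc i) x) = \<zero>\<^bsub>N\<^esub>) \<longrightarrow>
     (\<exists>g. lin R (P i) N g \<and> (\<forall>x \<in> carrier (P (Suc i)). f x = g (\<delta> i x))))"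

lemma acyc_atE:
  assumes "acyc_at R P \<delta> N i" "lin R (P (Suc i)) N f"
    "\<And>x. x \<in> carrier (P (Suc (Suc i))) \<Longrightarrow> f (\<delta> (Suc i) x) = \<zero>\<^bsub>N\<^esub>"
  obtains g where "lin R (P i) N g" "\<And>x. x \<in> carrier (P (Suc i)) \<Longrightarrow> f x = g (\<delta> i x)"
  using assms unfolding acyc_at_def by blast

lemma acyc_at_add:
  assumes P: "resol R Y P \<epsilon> \<delta>" and N: "left_module R N" and X: "in_add R N X"
    and a: "acyc_at R P \<delta> N k"
  shows "acyc_at R P \<delta> X k"
  unfolding acyc_at_def
proof (intro allI impI)
  note p = resolD[OF P] and XM = in_add_left_module[OF X]
  fix f assume f: "lin R (P (Suc k)) X f" and f0: "\<forall>x \<in> carrier (P (Suc (Suc k))). f (\<delta> (Suc k) x) = \<zero>\<^bsub>X\<^esub>"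
  obtain r i q where Dr: "add_data R N X r i q"
    using in_addE[OF X N] by blast
  note i = add_dataD(1)[OF Dr] and q = add_dataD(2)[OF Dr] and id = add_dataD(3)[OF Dr]
  have "\<exists>g. lin R (P k) N g \<and> (\<forall>x \<in> carrier (P (Suc k)). i j (f x) = g (\<delta> k x))" if j: "j < r" for j
  proof -
    obtain g where "lin R (P k) N g" "\<And>x. x \<in> carrier (P (Suc k)) \<Longrightarrow> i j (f x) = g (\<delta> k x)"
      by (rule acyc_atE[OF a lin_comp[OF i[OF j] f]]) (use f0 lin_zero[OF XM N i[OF j]] in auto)
    then show ?thesis by blast
  qed
  then obtain g where g: "\<And>j. j < r \<Longrightarrow> lin R (P k) N (g j)"
    "\<And>j x. j < r \<Longrightarrow> x \<in> carrier (P (Suc k)) \<Longrightarrow> i j (f x) = g j (\<delta> k x)" by metis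
  have "lin R (P k) X (\<lambda>x. msum X (\<lambda>j. q j (g j x)) r)"
    by (rule lin_msum_map[OF XM]) (rule lin_comp[OF q g(1)])
  moreover have "f x = msum X (\<lambda>j. q j (g j (\<delta> k x))) r" if x: "x \<in> carrier (P (Suc k))" for x
  proof -
    have "msum X (\<lambda>j. q j (g j (\<delta> k x))) r = msum X (\<lambda>j. q j (i j (f x))) r"
      by (rule msum_cong) (use g(2) x in simp)
    then show ?thesis using id[OF lin_closed[OF f x]] by simp
  qed
  ultimately show "\<exists>g. lin R (P k) X g \<and> (\<forall>x \<in> carrier (P (Suc k)). f x = g (\<delta> k x))" by blast
qed

text \<open>
  Independence of the resolution, together with additivity in the first argument. The chain map
  \<open>\<Sum>\<^sub>j J\<^sub>j I\<^sub>j\<close> of \<open>Q\<close> that lifts \<open>\<Sum>\<^sub>j \<pi>\<^sub>j \<iota>\<^sub>j = id\<close> is homotopic to the identity, and it sends a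
  cocycle to a sum of pulled back coboundaries.
\<close>

lemma acyc_at_in_add:
  assumes Q: "resol R Y Q \<epsilon> \<delta>" and projQ: "\<And>i. in_add R (regular_module R) (Q i)"
    and P: "resol R Z P \<epsilon>' \<delta>'" and projP: "\<And>i. in_add R (regular_module R) (P i)"
    and Y: "in_add R Z Y" and N: "left_module R N" and a: "acyc_at R P \<delta>' N k"
  shows "acyc_at R Q \<delta> N k"
  unfolding acyc_at_def
proof (intro allI impI)
  note q = resolD[OF Q] and p = resolD[OF P]
  fix f assume f: "lin R (Q (Suc k)) N f" and f0: "\<forall>x \<in> carrier (Q (Suc (Suc k))). f (\<delta> (Suc k) x) = \<zero>\<^bsub>N\<^esub>"
  obtain r \<iota> \<pi> where Dr: "add_data R Z Y r \<iota> \<pi>"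
    using in_addE[OF Y p(1)] by blast
  note \<iota> = add_dataD(1)[OF Dr] and \<pi> = add_dataD(2)[OF Dr] and id = add_dataD(3)[OF Dr]
  have "\<exists>F. (\<forall>i. lin R (Q i) (P i) (F i)) \<and> (\<forall>x \<in> carrier (Q 0). \<epsilon>' (F 0 x) = \<iota> j (\<epsilon> x)) \<and>
      (\<forall>i. \<forall>x \<in> carrier (Q (Suc i)). \<delta>' i (F (Suc i) x) = F i (\<delta> i x))" if "j < r" for j
    by (rule chain_lift[OF Q projQ P \<iota>[OF that]]) blast
  then obtain I where I: "\<And>j i. j < r \<Longrightarrow> lin R (Q i) (P i) (I j i)"
    "\<And>j x. j < r \<Longrightarrow> x \<in> carrier (Q 0) \<Longrightarrow> \<epsilon>' (I j 0 x) = \<iota> j (\<epsilon> x)"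
    "\<And>j i x. j < r \<Longrightarrow> x \<in> carrier (Q (Suc i)) \<Longrightarrow> \<delta>' i (I j (Suc i) x) = I j i (\<delta> i x)"
    by metis
  have "\<exists>F. (\<forall>i. lin R (P i) (Q i) (F i)) \<and> (\<forall>x \<in> carrier (P 0). \<epsilon> (F 0 x) = \<pi> j (\<epsilon>' x)) \<and>
      (\<forall>i. \<forall>x \<in> carrier (P (Suc i)). \<delta> i (F (Suc i) x) = F i (\<delta>' i x))" if "j < r" for j
    by (rule chain_lift[OF P projP Q \<pi>[OF that]]) blast
  then obtain J where J: "\<And>j i. j < r \<Longrightarrow> lin R (P i) (Q i) (J j i)"
    "\<And>j x. j < r \<Longrightarrow> x \<in> carrier (P 0) \<Longrightarrow> \<epsilon> (J j 0 x) = \<pi> j (\<epsilon>' x)"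
    "\<And>j i x. j < r \<Longrightarrow> x \<in> carrier (P (Suc i)) \<Longrightarrow> \<delta> i (J j (Suc i) x) = J j i (\<delta>' i x)"
    by metis
  \<comment> \<open>The chain map \<open>\<Sum>\<^sub>j J\<^sub>j I\<^sub>j\<close>; it covers \<open>\<Sum>\<^sub>j \<pi>\<^sub>j \<iota>\<^sub>j = id\<close>, so that \<open>F = id - S\<close> covers zero.\<close>
  define S where "S i x = msum (Q i) (\<lambda>j. J j i (I j i x)) r" for i x
  have JI: "lin R (Q i) (Q i) (\<lambda>x. J j i (I j i x))" if "j < r" for i j
    by (rule lin_comp[OF J(1)[OF that] I(1)[OF that]])
  have S: "lin R (Q i) (Q i) (S i)" for i
    unfolding S_def by (rule lin_msum_map[OF q(2) JI])
  have S0: "\<epsilon> (S 0 x) = \<epsilon> x" if x: "x \<in> carrier (Q 0)" for x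
  proof -
    have "\<epsilon> (S 0 x) = msum Y (\<lambda>j. \<epsilon> (J j 0 (I j 0 x))) r"
      unfolding S_def by (rule lin_msum[OF q(2) q(1) q(3)]) (rule lin_closed[OF JI x])
    also have "\<dots> = msum Y (\<lambda>j. \<pi> j (\<iota> j (\<epsilon> x))) r"
      by (rule msum_cong) (use J(2) I(2) x lin_closed[OF I(1) x] in auto)
    finally show ?thesis using id[OF lin_closed[OF q(3) x]] by simp
  qed
  have S1: "\<delta> i (S (Suc i) x) = S i (\<delta> i x)" if x: "x \<in> carrier (Q (Suc i))" for i x
  proof -
    have "\<delta> i (S (Suc i) x) = msum (Q i) (\<lambda>j. \<delta> i (J j (Suc i) (I j (Suc i) x))) r"
      unfolding S_def by (rule lin_msum[OF q(2) q(2) q(5)]) (rule lin_closed[OF JI x])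
    also have "\<dots> = msum (Q i) (\<lambda>j. J j i (I j i (\<delta> i x))) r"
      by (rule msum_cong) (use J(3) I(3) x lin_closed[OF I(1) x] in auto)
    finally show ?thesis by (simp add: S_def)
  qed
  define F where "F i x = x \<oplus>\<^bsub>Q i\<^esub> mneg R (Q i) (S i x)" for i x
  have F: "lin R (Q i) (Q i) (F i)" for i
    unfolding F_def by (rule lin_diff[OF q(2) q(2) lin_id S])
  have F0: "\<epsilon> (F 0 x) = \<zero>\<^bsub>Y\<^esub>" if x: "x \<in> carrier (Q 0)" for x
    unfolding F_def using lin_eq_if_diff_zero[OF q(2) q(1) q(3) x lin_closed[OF S x]] S0[OF x] by simp
  have F1: "\<delta> i (F (Suc i) x) = F i (\<delta> i x)" if x: "x \<in> carrier (Q (Suc i))" for i x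
    unfolding F_def using lin_add[OF q(5) x mneg_closed[OF q(2) lin_closed[OF S x]]]
      lin_mneg[OF q(2) q(5) lin_closed[OF S x]] S1[OF x] by simp
  obtain h where h: "\<And>i. lin R (Q i) (Q (Suc i)) (h i)"
    "\<And>i x. x \<in> carrier (Q (Suc i)) \<Longrightarrow>
       F (Suc i) x = \<delta> (Suc i) (h (Suc i) x) \<oplus>\<^bsub>Q (Suc i)\<^esub> h i (\<delta> i x)"
    by (rule null_homotopy[OF Q projQ F F0 F1]) auto
  have "\<exists>g. lin R (P k) N g \<and> (\<forall>x \<in> carrier (P (Suc k)). f (J j (Suc k) x) = g (\<delta>' k x))"
    if j: "j < r" for j
  proof -
    obtain g where "lin R (P k) N g" "\<And>x. x \<in> carrier (P (Suc k)) \<Longrightarrow> f (J j (Suc k) x) = g (\<delta>' k x)"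
    proof (rule acyc_atE[OF a lin_comp[OF f J(1)[OF j]]])
      fix x assume x: "x \<in> carrier (P (Suc (Suc k)))"
      show "f (J j (Suc k) (\<delta>' (Suc k) x)) = \<zero>\<^bsub>N\<^esub>"
        using J(3)[OF j x, symmetric] f0 lin_closed[OF J(1)[OF j] x] by simp
    qed auto
    then show ?thesis by blast
  qed
  then obtain g where g: "\<And>j. j < r \<Longrightarrow> lin R (P k) N (g j)"
    "\<And>j x. j < r \<Longrightarrow> x \<in> carrier (P (Suc k)) \<Longrightarrow> f (J j (Suc k) x) = g j (\<delta>' k x)" by metis
  define G where "G x = f (h k x) \<oplus>\<^bsub>N\<^esub> msum N (\<lambda>j. g j (I j k x)) r" for x
  have G: "lin R (Q k) N G" unfolding G_def
    by (rule lin_plus[OF N lin_comp[OF f h(1)] lin_msum_map[OF N]]) (rule lin_comp[OF g(1) I(1)])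
  have "f x = G (\<delta> k x)" if x: "x \<in> carrier (Q (Suc k))" for x
  proof -
    have d: "\<delta> k x \<in> carrier (Q k)" by (rule lin_closed[OF q(5) x])
    have Sx: "S (Suc k) x \<in> carrier (Q (Suc k))" by (rule lin_closed[OF S x])
    have "f (F (Suc k) x) = f (\<delta> (Suc k) (h (Suc k) x)) \<oplus>\<^bsub>N\<^esub> f (h k (\<delta> k x))"
      using h(2)[OF x] lin_add[OF f lin_closed[OF q(5) lin_closed[OF h(1) x]] lin_closed[OF h(1) d]] by simp
    also have "\<dots> = f (h k (\<delta> k x))"
      using f0 lin_closed[OF h(1) x] left_module_add_ac(1)[OF N lin_closed[OF f lin_closed[OF h(1) d]]] by simp
    finally have 1: "f (F (Suc k) x) = f (h k (\<delta> k x))" .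
    have "f (S (Suc k) x) = msum N (\<lambda>j. f (J j (Suc k) (I j (Suc k) x))) r"
      unfolding S_def by (rule lin_msum[OF q(2) N f]) (rule lin_closed[OF JI x])
    also have "\<dots> = msum N (\<lambda>j. g j (I j k (\<delta> k x))) r"
      by (rule msum_cong) (use g(2) lin_closed[OF I(1) x] I(3)[OF _ x] in auto)
    finally have 2: "f (S (Suc k) x) = msum N (\<lambda>j. g j (I j k (\<delta> k x))) r" .
    have "f x = f (F (Suc k) x \<oplus>\<^bsub>Q (Suc k)\<^esub> S (Suc k) x)"
      using add_diff_cancel(2)[OF q(2) x Sx] by (simp add: F_def)
    also have "\<dots> = f (F (Suc k) x) \<oplus>\<^bsub>N\<^esub> f (S (Suc k) x)" by (rule lin_add[OF f lin_closed[OF F x] Sx])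
    finally show ?thesis unfolding 1 2 G_def .
  qed
  then show "\<exists>g. lin R (Q k) N g \<and> (\<forall>x \<in> carrier (Q (Suc k)). f x = g (\<delta> k x))" using G by blast
qed

section \<open>Short exact sequences\<close>

definition dsum :: "('a, 'x) module \<Rightarrow> ('a, 'y) module \<Rightarrow> ('a, 'x \<times> 'y) module" where
  "dsum X Y = \<lparr>carrier = carrier X \<times> carrier Y, monoid.mult = undefined, one = undefined,
     ring.zero = (\<zero>\<^bsub>X\<^esub>, \<zero>\<^bsub>Y\<^esub>), ring.add = (\<lambda>u v. (fst u \<oplus>\<^bsub>X\<^esub> fst v, snd u \<oplus>\<^bsub>Y\<^esub> snd v)),
     smult = (\<lambda>a u. (a \<odot>\<^bsub>X\<^esub> fst u, a \<odot>\<^bsub>Y\<^esub> snd u))\<rparr>"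

lemma dsum_simps [simp]:
  "carrier (dsum X Y) = carrier X \<times> carrier Y" "\<zero>\<^bsub>dsum X Y\<^esub> = (\<zero>\<^bsub>X\<^esub>, \<zero>\<^bsub>Y\<^esub>)"
  "u \<oplus>\<^bsub>dsum X Y\<^esub> v = (fst u \<oplus>\<^bsub>X\<^esub> fst v, snd u \<oplus>\<^bsub>Y\<^esub> snd v)"
  "a \<odot>\<^bsub>dsum X Y\<^esub> u = (a \<odot>\<^bsub>X\<^esub> fst u, a \<odot>\<^bsub>Y\<^esub> snd u)"
  by (simp_all add: dsum_def)

lemma left_module_dsum:
  assumes "left_module R X" "left_module R Y" shows "left_module R (dsum X Y)"
proof -
  interpret X: left_module R X by fact
  interpret Y: left_module R Y by fact
  show ?thesis
    by (rule left_moduleI)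
      (auto simp: left_module_ring[OF assms(1)] left_module_smult_zero[OF assms(1)]
        left_module_smult_zero[OF assms(2)] X.smult_l_distr Y.smult_l_distr X.smult_r_distr
        Y.smult_r_distr X.smult_assoc Y.smult_assoc X.smult_one Y.smult_one X.M.a_ac Y.M.a_ac
        X.smult_closed Y.smult_closed)
qed

lemma lin_fst: "lin R (dsum X Y) X fst" and lin_snd: "lin R (dsum X Y) Y snd"
  by (auto intro: linI)

lemma lin_Pair: "lin R Z X f \<Longrightarrow> lin R Z Y g \<Longrightarrow> lin R Z (dsum X Y) (\<lambda>z. (f z, g z))"
  by (rule linI) (auto simp: lin_closed lin_add lin_smult)

lemma lin_inl: "left_module R Y \<Longrightarrow> lin R X (dsum X Y) (\<lambda>x. (x, \<zero>\<^bsub>Y\<^esub>))"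
  by (auto intro!: lin_Pair lin_id lin_zero_map)

lemma in_add_dsum:
  assumes X: "in_add R Z X" and Y: "in_add R Z Y" and Z: "left_module R Z"
  shows "in_add R Z (dsum X Y)"
proof -
  note XM = in_add_left_module[OF X] and YM = in_add_left_module[OF Y]
  note D = left_module_dsum[OF XM YM]
  obtain r i p where Dr: "add_data R Z X r i p"
    using in_addE[OF X Z] by blast
  note i = add_dataD(1)[OF Dr] and p = add_dataD(2)[OF Dr] and id = add_dataD(3)[OF Dr]
  obtain s i' p' where Ds: "add_data R Z Y s i' p'"
    using in_addE[OF Y Z] by blast
  note i' = add_dataD(1)[OF Ds] and p' = add_dataD(2)[OF Ds] and id' = add_dataD(3)[OF Ds]
  define I where "I j = (if j < r then (\<lambda>u. i j (fst u)) else (\<lambda>u. i' (j - r) (snd u)))" for j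
  define J where "J j = (if j < r then (\<lambda>z. (p j z, \<zero>\<^bsub>Y\<^esub>)) else (\<lambda>z. (\<zero>\<^bsub>X\<^esub>, p' (j - r) z)))" for j
  have fs: "msum (dsum X Y) f n = (msum X (\<lambda>j. fst (f j)) n, msum Y (\<lambda>j. snd (f j)) n)" for f n
    by (induction n) auto
  have zX: "msum X f (m + n) = msum X f m"
    if "\<And>j. m \<le> j \<Longrightarrow> j < m + n \<Longrightarrow> f j = \<zero>\<^bsub>X\<^esub>" "\<And>j. j < m \<Longrightarrow> f j \<in> carrier X" for f m n
    using that by (induction n) (auto simp: left_module_add_ac[OF XM] msum_closed[OF XM])
  have zY: "msum Y f (m + n) = msum Y (\<lambda>j. f (j + m)) n"
    if "\<And>j. j < m \<Longrightarrow> f j = \<zero>\<^bsub>Y\<^esub>" for f m n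
    using msum_zero[OF YM, of m f] that by (induction n) (auto simp: add.commute)
  show ?thesis
  proof (rule in_addI[OF D Z, of "r + s" I J])
    show "lin R (dsum X Y) Z (I j)" if "j < r + s" for j
    proof (cases "j < r")
      case True then show ?thesis using lin_comp[OF i lin_fst] by (simp add: I_def)
    next
      case False
      then have "j - r < s" using that by simp
      then show ?thesis using False lin_comp[OF i' lin_snd] by (simp add: I_def)
    qed
    show "lin R Z (dsum X Y) (J j)" if "j < r + s" for j
      using that p p' lin_zero_map[OF XM] lin_zero_map[OF YM] by (auto simp: J_def intro!: lin_Pair)
    fix u assume u: "u \<in> carrier (dsum X Y)"
    have "msum X (\<lambda>j. fst (J j (I j u))) (r + s) = msum X (\<lambda>j. fst (J j (I j u))) r"
      by (rule zX) (use u lin_closed[OF p] lin_closed[OF i] in \<open>auto simp: J_def I_def\<close>)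
    also have "\<dots> = msum X (\<lambda>j. p j (i j (fst u))) r" by (rule msum_cong) (simp add: J_def I_def)
    also have "\<dots> = fst u" using u by (auto intro: id)
    finally have 1: "msum X (\<lambda>j. fst (J j (I j u))) (r + s) = fst u" .
    have "msum Y (\<lambda>j. snd (J j (I j u))) (r + s) = msum Y (\<lambda>j. snd (J (j + r) (I (j + r) u))) s"
      by (rule zY) (simp add: J_def)
    also have "\<dots> = msum Y (\<lambda>j. p' j (i' j (snd u))) s" by (rule msum_cong) (simp add: J_def I_def)
    also have "\<dots> = snd u" using u by (auto intro: id')
    finally show "msum (dsum X Y) (\<lambda>j. J j (I j u)) (r + s) = u" by (simp add: fs 1)
  qed
qed

text \<open>
  The horseshoe complex has differentials that are triangular, with the given differentials on the
  diagonal and a twisting map \<open>b\<close> off it; \<open>a b' = - b c'\<close> says that two consecutive ones compose to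
  zero. Exactness of the rows is inherited. The statement covers the augmentation as well as the
  differentials.
\<close>

lemma twisted_exact:
  assumes A: "left_module R A" and P: "left_module R P"
    and a: "lin R P A a" and b: "lin R Q A b" and a': "lin R P' P a'" and b': "lin R Q' P b'"
    and c': "lin R Q' Q c'"
    and exP: "\<And>x. x \<in> carrier P \<Longrightarrow> a x = \<zero>\<^bsub>A\<^esub> \<longleftrightarrow> x \<in> a' ` carrier P'"
    and exQ: "\<And>x. x \<in> carrier Q \<Longrightarrow> c x = \<zero>\<^bsub>C\<^esub> \<longleftrightarrow> x \<in> c' ` carrier Q'"
    and tw: "\<And>x. x \<in> carrier Q' \<Longrightarrow> a (b' x) = mneg R A (b (c' x))"
    and p: "p \<in> carrier P" and q: "q \<in> carrier Q"
  shows "a p \<oplus>\<^bsub>A\<^esub> b q = \<zero>\<^bsub>A\<^esub> \<and> c q = \<zero>\<^bsub>C\<^esub> \<longleftrightarrow>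
    (p, q) \<in> (\<lambda>u. (a' (fst u) \<oplus>\<^bsub>P\<^esub> b' (snd u), c' (snd u))) ` (carrier P' \<times> carrier Q')"
proof
  assume 0: "a p \<oplus>\<^bsub>A\<^esub> b q = \<zero>\<^bsub>A\<^esub> \<and> c q = \<zero>\<^bsub>C\<^esub>"
  then obtain q' where q': "q' \<in> carrier Q'" "q = c' q'" using exQ[OF q] by auto
  have bq: "b' q' \<in> carrier P" by (rule lin_closed[OF b' q'(1)])
  have abq: "a (b' q') = mneg R A (b q)" using tw[OF q'(1)] q'(2) by simp
  have "a (p \<oplus>\<^bsub>P\<^esub> mneg R P (b' q')) = a p \<oplus>\<^bsub>A\<^esub> mneg R A (mneg R A (b q))"
    using lin_add[OF a p mneg_closed[OF P bq]] lin_mneg[OF P a bq] abq by simp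
  also have "mneg R A (mneg R A (b q)) = b q"
    using add_diff_cancel(1)[OF A left_module_closed(1)[OF A] mneg_closed[OF A lin_closed[OF b q]]]
    by (metis A abelian_group.minus_minus b left_module_group lin_closed mneg_closed mneg_eq_a_inv q)
  finally have "p \<oplus>\<^bsub>P\<^esub> mneg R P (b' q') \<in> a' ` carrier P'"
    using 0 exP[OF left_module_closed(2)[OF P p mneg_closed[OF P bq]]] by simp
  then obtain p' where p': "p' \<in> carrier P'" "p \<oplus>\<^bsub>P\<^esub> mneg R P (b' q') = a' p'" by auto
  have "p = a' p' \<oplus>\<^bsub>P\<^esub> b' q'" using add_diff_cancel(2)[OF P p bq] p'(2) by simp
  then show "(p, q) \<in> (\<lambda>u. (a' (fst u) \<oplus>\<^bsub>P\<^esub> b' (snd u), c' (snd u))) ` (carrier P' \<times> carrier Q')"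
    using p' q' by (intro image_eqI[of _ _ "(p', q')"]) auto
next
  assume "(p, q) \<in> (\<lambda>u. (a' (fst u) \<oplus>\<^bsub>P\<^esub> b' (snd u), c' (snd u))) ` (carrier P' \<times> carrier Q')"
  then obtain p' q' where u: "p' \<in> carrier P'" "q' \<in> carrier Q'" "p = a' p' \<oplus>\<^bsub>P\<^esub> b' q'" "q = c' q'"
    by auto
  have cl: "a' p' \<in> carrier P" "b' q' \<in> carrier P" "c' q' \<in> carrier Q"
    using lin_closed[OF a' u(1)] lin_closed[OF b' u(2)] lin_closed[OF c' u(2)] by auto
  have "a (a' p') = \<zero>\<^bsub>A\<^esub>" using exP[OF cl(1)] u(1) by simp
  then have "a p = mneg R A (b q)"
    using lin_add[OF a cl(1,2)] tw[OF u(2)] u(3,4) left_module_add_ac(1)[OF A mneg_closed[OF A lin_closed[OF b q]]]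
    by simp
  then show "a p \<oplus>\<^bsub>A\<^esub> b q = \<zero>\<^bsub>A\<^esub> \<and> c q = \<zero>\<^bsub>C\<^esub>"
    using mneg_left[OF A lin_closed[OF b q]] exQ[OF cl(3)] u(2,4) by simp
qed

text \<open>
  A resolution of the middle term of \<open>0 \<rightarrow> T \<rightarrow> Y \<rightarrow> Y' \<rightarrow> 0\<close> on the sums \<open>P i \<oplus> Q i\<close>. The map \<open>\<omega>\<close> lifts
  the augmentation of \<open>Q\<close> to \<open>Y\<close>. The twisting maps \<open>w i\<close>, which represent the connecting
  homomorphism, are successive lifts; they enter the statement because the extension of cocycles from
  \<open>P\<close> to the whole complex is governed by them.
\<close>

lemma horseshoe:
  assumes P: "resol R T P \<epsilon> \<delta>" and Q: "resol R Y' Q \<epsilon>' \<delta>'"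
    and projQ: "\<And>i. in_add R (regular_module R) (Q i)"
    and Y: "left_module R Y" and \<iota>: "lin R T Y \<iota>" and \<pi>: "lin R Y Y' \<pi>"
    and inj: "\<And>x. x \<in> carrier T \<Longrightarrow> \<iota> x = \<zero>\<^bsub>Y\<^esub> \<Longrightarrow> x = \<zero>\<^bsub>T\<^esub>"
    and surj: "\<pi> ` carrier Y = carrier Y'"
    and ex: "\<And>y. y \<in> carrier Y \<Longrightarrow> \<pi> y = \<zero>\<^bsub>Y'\<^esub> \<longleftrightarrow> y \<in> \<iota> ` carrier T"
  obtains \<omega> w where "lin R (Q 0) Y \<omega>" "\<And>i. lin R (Q (Suc i)) (P i) (w i)"
    "\<And>x. x \<in> carrier (Q 1) \<Longrightarrow> \<iota> (\<epsilon> (w 0 x)) = mneg R Y (\<omega> (\<delta>' 0 x))"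
    "\<And>i x. x \<in> carrier (Q (Suc (Suc i))) \<Longrightarrow> \<delta> i (w (Suc i) x) = mneg R (P i) (w i (\<delta>' (Suc i) x))"
    "resol R Y (\<lambda>i. dsum (P i) (Q i)) (\<lambda>u. \<iota> (\<epsilon> (fst u)) \<oplus>\<^bsub>Y\<^esub> \<omega> (snd u))
       (\<lambda>i u. (\<delta> i (fst u) \<oplus>\<^bsub>P i\<^esub> w i (snd u), \<delta>' i (snd u)))"
proof -
  note p = resolD[OF P] and q = resolD[OF Q]
  obtain \<omega> where \<omega>: "lin R (Q 0) Y \<omega>" and \<pi>\<omega>: "\<And>x. x \<in> carrier (Q 0) \<Longrightarrow> \<pi> (\<omega> x) = \<epsilon>' x"
    by (rule proj_lift[OF projQ Y q(1) \<pi> q(3)]) (use surj lin_closed[OF q(3)] in auto)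
  have \<iota>\<epsilon>: "lin R (P 0) Y (\<lambda>x. \<iota> (\<epsilon> x))" by (rule lin_comp[OF \<iota> p(3)])
  have ker\<iota>\<epsilon>: "\<iota> (\<epsilon> x) = \<zero>\<^bsub>Y\<^esub> \<longleftrightarrow> x \<in> \<delta> 0 ` carrier (P (Suc 0))" if x: "x \<in> carrier (P 0)" for x
    using p(6)[OF x] inj[OF lin_closed[OF p(3) x]] lin_zero[OF p(1) Y \<iota>] by auto
  have \<omega>\<delta>: "lin R (Q (Suc 0)) Y (\<lambda>x. \<omega> (\<delta>' 0 x))" by (rule lin_comp[OF \<omega> q(5)])
  obtain w0 where w0: "lin R (Q (Suc 0)) (P 0) w0"
    "\<And>x. x \<in> carrier (Q (Suc 0)) \<Longrightarrow> \<iota> (\<epsilon> (w0 x)) = mneg R Y (\<omega> (\<delta>' 0 x))"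
  proof (rule proj_lift[OF projQ p(2) Y \<iota>\<epsilon> lin_mneg_map[OF q(2) Y \<omega>\<delta>]])
    show "(\<lambda>x. mneg R Y (\<omega> (\<delta>' 0 x))) ` carrier (Q (Suc 0)) \<subseteq> (\<lambda>x. \<iota> (\<epsilon> x)) ` carrier (P 0)"
    proof (rule image_subsetI)
      fix x assume x: "x \<in> carrier (Q (Suc 0))"
      have c: "\<omega> (\<delta>' 0 x) \<in> carrier Y" by (rule lin_closed[OF \<omega>\<delta> x])
      have "\<pi> (mneg R Y (\<omega> (\<delta>' 0 x))) = \<zero>\<^bsub>Y'\<^esub>"
        using lin_mneg[OF Y \<pi> c] \<pi>\<omega>[OF lin_closed[OF q(5) x]] q(8) x mneg_zero[OF q(1)] by simp
      then have "mneg R Y (\<omega> (\<delta>' 0 x)) \<in> \<iota> ` carrier T" using ex[OF mneg_closed[OF Y c]] by simp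
      then show "mneg R Y (\<omega> (\<delta>' 0 x)) \<in> (\<lambda>x. \<iota> (\<epsilon> x)) ` carrier (P 0)"
        unfolding p(4)[symmetric] by auto
    qed
  qed auto
  define good where "good i u \<longleftrightarrow> lin R (Q (Suc i)) (P i) u \<and>
    (\<forall>x \<in> carrier (Q (Suc (Suc i))). u (\<delta>' (Suc i) x) \<in> \<delta> i ` carrier (P (Suc i)))" for i u
  have g0: "good 0 w0"
    unfolding good_def
  proof (intro conjI ballI w0(1))
    fix x assume x: "x \<in> carrier (Q (Suc (Suc 0)))"
    have d: "\<delta>' (Suc 0) x \<in> carrier (Q (Suc 0))" by (rule lin_closed[OF q(5) x])
    have "\<iota> (\<epsilon> (w0 (\<delta>' (Suc 0) x))) = \<zero>\<^bsub>Y\<^esub>"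
      using w0(2)[OF d] q(9)[OF x] lin_zero[OF q(2) Y \<omega>] mneg_zero[OF Y] by simp
    then show "w0 (\<delta>' (Suc 0) x) \<in> \<delta> 0 ` carrier (P (Suc 0))"
      using ker\<iota>\<epsilon>[OF lin_closed[OF w0(1) d]] by simp
  qed
  have step: "\<exists>v. good (Suc i) v \<and>
      (\<forall>x \<in> carrier (Q (Suc (Suc i))). \<delta> i (v x) = mneg R (P i) (u (\<delta>' (Suc i) x)))"
    if u: "good i u" for i u
  proof -
    have ul: "lin R (Q (Suc i)) (P i) u" using u by (simp add: good_def)
    note ud = lin_comp[OF ul q(5)]
    obtain v where v: "lin R (Q (Suc (Suc i))) (P (Suc i)) v"
      "\<And>x. x \<in> carrier (Q (Suc (Suc i))) \<Longrightarrow> \<delta> i (v x) = mneg R (P i) (u (\<delta>' (Suc i) x))"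
    proof (rule proj_lift[OF projQ p(2) p(2) p(5) lin_mneg_map[OF q(2) p(2) ud]])
      show "(\<lambda>x. mneg R (P i) (u (\<delta>' (Suc i) x))) ` carrier (Q (Suc (Suc i))) \<subseteq> \<delta> i ` carrier (P (Suc i))"
      proof (rule image_subsetI)
        fix x assume x: "x \<in> carrier (Q (Suc (Suc i)))"
        then obtain y where y: "y \<in> carrier (P (Suc i))" "u (\<delta>' (Suc i) x) = \<delta> i y"
          using u by (auto simp: good_def)
        then show "mneg R (P i) (u (\<delta>' (Suc i) x)) \<in> \<delta> i ` carrier (P (Suc i))"
          using lin_mneg[OF p(2) p(5) y(1)] mneg_closed[OF p(2) y(1)] by (metis image_eqI)
      qed
    qed auto
    have "good (Suc i) v"
      unfolding good_def
    proof (intro conjI ballI v(1))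
      fix x assume x: "x \<in> carrier (Q (Suc (Suc (Suc i))))"
      have d: "\<delta>' (Suc (Suc i)) x \<in> carrier (Q (Suc (Suc i)))" by (rule lin_closed[OF q(5) x])
      have "\<delta> i (v (\<delta>' (Suc (Suc i)) x)) = \<zero>\<^bsub>P i\<^esub>"
        using v(2)[OF d] q(9)[OF x] lin_zero[OF q(2) p(2) ul] mneg_zero[OF p(2)] by simp
      then show "v (\<delta>' (Suc (Suc i)) x) \<in> \<delta> (Suc i) ` carrier (P (Suc (Suc i)))"
        using p(7)[of "v (\<delta>' (Suc (Suc i)) x)"] lin_closed[OF v(1) d] by simp
    qed
    then show ?thesis using v(2) by blast
  qed
  have "\<exists>w. \<forall>i. (good i (w i) \<and> (i = 0 \<longrightarrow> w i = w0)) \<and>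
      (\<forall>x \<in> carrier (Q (Suc (Suc i))). \<delta> i (w (Suc i) x) = mneg R (P i) (w i (\<delta>' (Suc i) x)))"
    by (rule dependent_nat_choice[where P = "\<lambda>i u. good i u \<and> (i = 0 \<longrightarrow> u = w0)"])
      (use g0 step in auto)
  then obtain w where w: "\<And>i. good i (w i)" "w 0 = w0"
    "\<And>i x. x \<in> carrier (Q (Suc (Suc i))) \<Longrightarrow> \<delta> i (w (Suc i) x) = mneg R (P i) (w i (\<delta>' (Suc i) x))"
    by blast
  have wl: "lin R (Q (Suc i)) (P i) (w i)" for i using w(1) by (simp add: good_def)
  have w0': "\<iota> (\<epsilon> (w 0 x)) = mneg R Y (\<omega> (\<delta>' 0 x))" if "x \<in> carrier (Q (Suc 0))" for x
    using w0(2)[OF that] w(2) by simp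
  let ?H = "\<lambda>i. dsum (P i) (Q i)"
  let ?e = "\<lambda>u. \<iota> (\<epsilon> (fst u)) \<oplus>\<^bsub>Y\<^esub> \<omega> (snd u)"
  let ?d = "\<lambda>i u. (\<delta> i (fst u) \<oplus>\<^bsub>P i\<^esub> w i (snd u), \<delta>' i (snd u))"
  have "resol R Y ?H ?e ?d"
    unfolding resol_def
  proof (intro conjI allI ballI)
    show "left_module R (?H i)" for i by (rule left_module_dsum[OF p(2) q(2)])
    show e: "lin R (?H 0) Y ?e" by (rule lin_plus[OF Y lin_comp[OF \<iota>\<epsilon> lin_fst] lin_comp[OF \<omega> lin_snd]])
    show "lin R (?H (Suc i)) (?H i) (?d i)" for i
      by (rule lin_Pair[OF lin_plus[OF p(2) lin_comp[OF p(5) lin_fst] lin_comp[OF wl lin_snd]]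
            lin_comp[OF q(5) lin_snd]])
    show "?e ` carrier (?H 0) = carrier Y"
    proof
      show "?e ` carrier (?H 0) \<subseteq> carrier Y" using lin_closed[OF e] by blast
      show "carrier Y \<subseteq> ?e ` carrier (?H 0)"
      proof
        fix y assume y: "y \<in> carrier Y"
        then obtain q0 where q0: "q0 \<in> carrier (Q 0)" "\<pi> y = \<epsilon>' q0"
          using q(4) lin_closed[OF \<pi> y] by (metis imageE)
        have o: "\<omega> q0 \<in> carrier Y" by (rule lin_closed[OF \<omega> q0(1)])
        have "\<pi> (y \<oplus>\<^bsub>Y\<^esub> mneg R Y (\<omega> q0)) = \<zero>\<^bsub>Y'\<^esub>"
          using lin_eq_if_diff_zero[OF Y q(1) \<pi> y o] \<pi>\<omega>[OF q0(1)] q0(2) by simp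
        then obtain t where t: "t \<in> carrier T" "y \<oplus>\<^bsub>Y\<^esub> mneg R Y (\<omega> q0) = \<iota> t"
          using ex[OF left_module_closed(2)[OF Y y mneg_closed[OF Y o]]] by auto
        obtain p0 where p0: "p0 \<in> carrier (P 0)" "t = \<epsilon> p0" using p(4) t(1) by (metis imageE)
        have "y = ?e (p0, q0)" using add_diff_cancel(2)[OF Y y o] t(2) p0(2) by simp
        then show "y \<in> ?e ` carrier (?H 0)" using p0 q0 by (intro image_eqI[of _ _ "(p0, q0)"]) auto
      qed
    qed
    show "?e u = \<zero>\<^bsub>Y\<^esub> \<longleftrightarrow> u \<in> ?d 0 ` carrier (?H 1)" if "u \<in> carrier (?H 0)" for u
    proof -
      have u: "fst u \<in> carrier (P 0)" "snd u \<in> carrier (Q 0)" using that by auto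
      have "\<epsilon>' (snd u) = \<zero>\<^bsub>Y'\<^esub>" if 0: "?e u = \<zero>\<^bsub>Y\<^esub>"
      proof -
        have "\<pi> (\<iota> (\<epsilon> (fst u))) = \<zero>\<^bsub>Y'\<^esub>"
          using ex[OF lin_closed[OF \<iota>\<epsilon> u(1)]] lin_closed[OF p(3) u(1)] by simp
        moreover have "\<pi> (?e u) = \<pi> (\<iota> (\<epsilon> (fst u))) \<oplus>\<^bsub>Y'\<^esub> \<pi> (\<omega> (snd u))"
          by (rule lin_add[OF \<pi> lin_closed[OF \<iota>\<epsilon> u(1)] lin_closed[OF \<omega> u(2)]])
        ultimately show ?thesis
          using 0 lin_zero[OF Y q(1) \<pi>] \<pi>\<omega>[OF u(2)]
            left_module_add_ac(1)[OF q(1) lin_closed[OF q(3) u(2)]] by simp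
      qed
      then have "?e u = \<zero>\<^bsub>Y\<^esub> \<longleftrightarrow> ?e u = \<zero>\<^bsub>Y\<^esub> \<and> \<epsilon>' (snd u) = \<zero>\<^bsub>Y'\<^esub>" by blast
      also have "\<dots> \<longleftrightarrow> (fst u, snd u) \<in> ?d 0 ` (carrier (P (Suc 0)) \<times> carrier (Q (Suc 0)))"
        by (rule twisted_exact[OF Y p(2) \<iota>\<epsilon> \<omega> p(5) wl q(5) ker\<iota>\<epsilon> _ w0' u])
          (use q(6) in auto)
      finally show ?thesis by simp
    qed
    show "?d i u = \<zero>\<^bsub>?H i\<^esub> \<longleftrightarrow> u \<in> ?d (Suc i) ` carrier (?H (Suc (Suc i)))"
      if "u \<in> carrier (?H (Suc i))" for i u
    proof -
      have u: "fst u \<in> carrier (P (Suc i))" "snd u \<in> carrier (Q (Suc i))" using that by auto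
      have "?d i u = \<zero>\<^bsub>?H i\<^esub> \<longleftrightarrow>
          \<delta> i (fst u) \<oplus>\<^bsub>P i\<^esub> w i (snd u) = \<zero>\<^bsub>P i\<^esub> \<and> \<delta>' i (snd u) = \<zero>\<^bsub>Q i\<^esub>" by simp
      also have "\<dots> \<longleftrightarrow> (fst u, snd u) \<in> ?d (Suc i) ` (carrier (P (Suc (Suc i))) \<times> carrier (Q (Suc (Suc i))))"
        by (rule twisted_exact[OF p(2) p(2) p(5) wl p(5) wl q(5) p(7) q(7) w(3) u])
      finally show ?thesis by simp
    qed
  qed (rule Y)
  then show thesis using that[OF \<omega> wl] w0' w(3) by simp
qed

text \<open>
  The part of the long exact sequence that is used: if \<open>Ext\<^sup>i(-, N)\<close> vanishes for all \<open>i > 0\<close> on \<open>Y\<close> and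
  \<open>Y'\<close>, then it does so on \<open>T\<close>, and \<open>Hom(Y, N) \<rightarrow> Hom(T, N)\<close> is onto. A cocycle \<open>f\<close> on \<open>P\<close> composed with
  the connecting maps is a cocycle on \<open>Q\<close>, hence a coboundary \<open>g \<delta>'\<close>. Then \<open>(f, -g)\<close> is a cocycle on the
  horseshoe complex, which is a projective resolution of \<open>Y\<close>: in positive degree it is a coboundary, in
  degree zero it is a map from \<open>Y\<close>.
\<close>

lemma ext_vanish_left:
  assumes P: "resol R T P \<epsilon> \<delta>" and projP: "\<And>i. in_add R (regular_module R) (P i)"
    and Q: "resol R Y' Q \<epsilon>' \<delta>'" and projQ: "\<And>i. in_add R (regular_module R) (Q i)"
    and S: "resol R Z S \<epsilon>'' \<delta>''" and projS: "\<And>i. in_add R (regular_module R) (S i)"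
    and Y: "in_add R Z Y" and N: "left_module R N"
    and \<iota>: "lin R T Y \<iota>" and \<pi>: "lin R Y Y' \<pi>"
    and inj: "\<And>x. x \<in> carrier T \<Longrightarrow> \<iota> x = \<zero>\<^bsub>Y\<^esub> \<Longrightarrow> x = \<zero>\<^bsub>T\<^esub>"
    and surj: "\<pi> ` carrier Y = carrier Y'"
    and ex: "\<And>y. y \<in> carrier Y \<Longrightarrow> \<pi> y = \<zero>\<^bsub>Y'\<^esub> \<longleftrightarrow> y \<in> \<iota> ` carrier T"
    and aS: "\<And>k. acyc_at R S \<delta>'' N k" and aQ: "\<And>k. acyc_at R Q \<delta>' N k"
  shows "acyc_at R P \<delta> N k"
    and "lin R T N f \<Longrightarrow> \<exists>g. lin R Y N g \<and> (\<forall>x \<in> carrier T. g (\<iota> x) = f x)"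
proof -
  note p = resolD[OF P] and q = resolD[OF Q] and s = resolD[OF S]
  note YM = in_add_left_module[OF Y]
  obtain \<omega> w where \<omega>: "lin R (Q 0) Y \<omega>" and wl: "\<And>i. lin R (Q (Suc i)) (P i) (w i)"
    and w0: "\<And>x. x \<in> carrier (Q 1) \<Longrightarrow> \<iota> (\<epsilon> (w 0 x)) = mneg R Y (\<omega> (\<delta>' 0 x))"
    and w1: "\<And>i x. x \<in> carrier (Q (Suc (Suc i))) \<Longrightarrow> \<delta> i (w (Suc i) x) = mneg R (P i) (w i (\<delta>' (Suc i) x))"
    and H: "resol R Y (\<lambda>i. dsum (P i) (Q i)) (\<lambda>u. \<iota> (\<epsilon> (fst u)) \<oplus>\<^bsub>Y\<^esub> \<omega> (snd u))
       (\<lambda>i u. (\<delta> i (fst u) \<oplus>\<^bsub>P i\<^esub> w i (snd u), \<delta>' i (snd u)))"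
  proof (rule horseshoe[OF P Q projQ YM \<iota> \<pi> inj surj ex], goal_cases)
    case (4 \<omega> w)
    show ?case by (rule 4(1)[OF 4(2-)])
  qed
  let ?H = "\<lambda>i. dsum (P i) (Q i)"
  let ?e = "\<lambda>u. \<iota> (\<epsilon> (fst u)) \<oplus>\<^bsub>Y\<^esub> \<omega> (snd u)"
  let ?d = "\<lambda>i u. (\<delta> i (fst u) \<oplus>\<^bsub>P i\<^esub> w i (snd u), \<delta>' i (snd u))"
  note h = resolD[OF H]
  have projH: "in_add R (regular_module R) (?H i)" for i
    by (rule in_add_dsum[OF projP projQ left_module_regular[OF left_module_ring[OF N]]])
  have aH: "acyc_at R ?H ?d N k" for k
    by (rule acyc_at_in_add[OF H projH S projS Y N aS])
  \<comment> \<open>A cocycle on the first summand extends to one on the total complex.\<close>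
  have ext: "\<exists>g. lin R (Q k) N g \<and> (\<forall>p' \<in> carrier (P (Suc k)). \<forall>q' \<in> carrier (Q (Suc k)).
        f (\<delta> k p' \<oplus>\<^bsub>P k\<^esub> w k q') \<oplus>\<^bsub>N\<^esub> mneg R N (g (\<delta>' k q')) = \<zero>\<^bsub>N\<^esub>)"
    if f: "lin R (P k) N f" and f0: "\<And>x. x \<in> carrier (P (Suc k)) \<Longrightarrow> f (\<delta> k x) = \<zero>\<^bsub>N\<^esub>" for f k
  proof -
    have "f (w k (\<delta>' (Suc k) x)) = \<zero>\<^bsub>N\<^esub>" if x: "x \<in> carrier (Q (Suc (Suc k)))" for x
    proof -
      have c: "w k (\<delta>' (Suc k) x) \<in> carrier (P k)" by (rule lin_closed[OF wl lin_closed[OF q(5) x]])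
      have "mneg R N (f (w k (\<delta>' (Suc k) x))) = f (\<delta> k (w (Suc k) x))"
        using w1[OF x] lin_mneg[OF p(2) f c] by simp
      also have "\<dots> = \<zero>\<^bsub>N\<^esub>" by (rule f0[OF lin_closed[OF wl x]])
      finally show ?thesis using mneg_right[OF N lin_closed[OF f c]] left_module_add_ac(2)[OF N lin_closed[OF f c]] by simp
    qed
    then obtain g where g: "lin R (Q k) N g" "\<And>x. x \<in> carrier (Q (Suc k)) \<Longrightarrow> f (w k x) = g (\<delta>' k x)"
      using acyc_atE[OF aQ lin_comp[OF f wl]] by metis
    have "f (\<delta> k p' \<oplus>\<^bsub>P k\<^esub> w k q') \<oplus>\<^bsub>N\<^esub> mneg R N (g (\<delta>' k q')) = \<zero>\<^bsub>N\<^esub>"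
      if p': "p' \<in> carrier (P (Suc k))" and q': "q' \<in> carrier (Q (Suc k))" for p' q'
    proof -
      have c: "g (\<delta>' k q') \<in> carrier N" by (rule lin_closed[OF g(1) lin_closed[OF q(5) q']])
      have "f (\<delta> k p' \<oplus>\<^bsub>P k\<^esub> w k q') = g (\<delta>' k q')"
        using lin_add[OF f lin_closed[OF p(5) p'] lin_closed[OF wl q']] f0[OF p'] g(2)[OF q']
          left_module_add_ac(1)[OF N c] by simp
      then show ?thesis using mneg_right[OF N c] by simp
    qed
    then show ?thesis using g(1) by blast
  qed
  have Fl: "lin R (?H k) N (\<lambda>u. f (fst u) \<oplus>\<^bsub>N\<^esub> mneg R N (g (snd u)))"
    if "lin R (P k) N f" "lin R (Q k) N g" for f g k
    by (rule lin_diff[OF h(2) N lin_comp[OF that(1) lin_fst] lin_comp[OF that(2) lin_snd]])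
  show "acyc_at R P \<delta> N k"
    unfolding acyc_at_def
  proof (intro allI impI)
    fix f assume f: "lin R (P (Suc k)) N f"
      and f0: "\<forall>x \<in> carrier (P (Suc (Suc k))). f (\<delta> (Suc k) x) = \<zero>\<^bsub>N\<^esub>"
    obtain g where g: "lin R (Q (Suc k)) N g"
      "\<forall>p' \<in> carrier (P (Suc (Suc k))). \<forall>q' \<in> carrier (Q (Suc (Suc k))).
        f (\<delta> (Suc k) p' \<oplus>\<^bsub>P (Suc k)\<^esub> w (Suc k) q') \<oplus>\<^bsub>N\<^esub> mneg R N (g (\<delta>' (Suc k) q')) = \<zero>\<^bsub>N\<^esub>"
      using ext[OF f] f0 by blast
    obtain G where G: "lin R (?H k) N G" "\<And>u. u \<in> carrier (?H (Suc k)) \<Longrightarrow>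
        f (fst u) \<oplus>\<^bsub>N\<^esub> mneg R N (g (snd u)) = G (?d k u)"
      by (rule acyc_atE[OF aH Fl[OF f g(1)]]) (use g(2) in auto)
    have "f x = G (\<delta> k x, \<zero>\<^bsub>Q k\<^esub>)" if x: "x \<in> carrier (P (Suc k))" for x
    proof -
      have "f x \<oplus>\<^bsub>N\<^esub> mneg R N (g \<zero>\<^bsub>Q (Suc k)\<^esub>) = G (?d k (x, \<zero>\<^bsub>Q (Suc k)\<^esub>))"
        using G(2)[of "(x, \<zero>\<^bsub>Q (Suc k)\<^esub>)"] x left_module_closed(1)[OF q(2)] by simp
      then show ?thesis
        using lin_zero[OF q(2) N g(1)] mneg_zero[OF N] left_module_add_ac(2)[OF N lin_closed[OF f x]]
          lin_zero[OF q(2) p(2) wl] lin_zero[OF q(2) q(2) q(5)]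
          left_module_add_ac(2)[OF p(2) lin_closed[OF p(5) x]] by simp
    qed
    then show "\<exists>g. lin R (P k) N g \<and> (\<forall>x \<in> carrier (P (Suc k)). f x = g (\<delta> k x))"
      using lin_comp[OF G(1) lin_inl[OF q(2)]] by blast
  qed
  show "\<exists>g. lin R Y N g \<and> (\<forall>x \<in> carrier T. g (\<iota> x) = f x)" if f: "lin R T N f"
  proof -
    note f\<epsilon> = lin_comp[OF f p(3)]
    have f0: "f (\<epsilon> (\<delta> 0 x)) = \<zero>\<^bsub>N\<^esub>" if "x \<in> carrier (P (Suc 0))" for x
      using p(8) that lin_zero[OF p(1) N f] by simp
    obtain g where g: "lin R (Q 0) N g"
      "\<forall>p' \<in> carrier (P (Suc 0)). \<forall>q' \<in> carrier (Q (Suc 0)).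
        f (\<epsilon> (\<delta> 0 p' \<oplus>\<^bsub>P 0\<^esub> w 0 q')) \<oplus>\<^bsub>N\<^esub> mneg R N (g (\<delta>' 0 q')) = \<zero>\<^bsub>N\<^esub>"
      using ext[OF f\<epsilon> f0] by blast
    let ?F = "\<lambda>u. f (\<epsilon> (fst u)) \<oplus>\<^bsub>N\<^esub> mneg R N (g (snd u))"
    have F0: "?F u = \<zero>\<^bsub>N\<^esub>" if "u \<in> carrier (?H 0)" "?e u = \<zero>\<^bsub>Y\<^esub>" for u
      using h(6)[OF that(1)] that(2) g(2) by auto
    obtain t where t: "lin R (Y\<lparr>carrier := ?e ` carrier (?H 0)\<rparr>) N t"
      "\<forall>u \<in> carrier (?H 0). t (?e u) = ?F u"
      using lin_factor[OF h(2) YM N h(3) Fl[OF f\<epsilon> g(1)] F0] by blast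
    have tl: "lin R Y N t" using t(1) unfolding h(4) by simp
    have "t (\<iota> x) = f x" if x: "x \<in> carrier T" for x
    proof -
      obtain y where y: "y \<in> carrier (P 0)" "x = \<epsilon> y" using p(4) x by (metis imageE)
      have "t (?e (y, \<zero>\<^bsub>Q 0\<^esub>)) = ?F (y, \<zero>\<^bsub>Q 0\<^esub>)"
        by (rule t(2)[rule_format]) (use y left_module_closed(1)[OF q(2)] in auto)
      then show ?thesis
        using lin_zero[OF q(2) YM \<omega>] lin_zero[OF q(2) N g(1)] mneg_zero[OF N] y(2)
          left_module_add_ac(2)[OF N lin_closed[OF f x]] left_module_add_ac(2)[OF YM lin_closed[OF \<iota> x]]
        by simp
    qed
    then show ?thesis using tl by blast
  qed
qed

section \<open>Exact coresolutions\<close>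

text \<open>
  The sequences are infinite; a finite one is continued by zero modules.
\<close>

definition coexact ::
  "('a, 'c) ring_scheme \<Rightarrow> ('a, 'm) module \<Rightarrow> (nat \<Rightarrow> ('a, 'x) module) \<Rightarrow> ('m \<Rightarrow> 'x) \<Rightarrow>
   (nat \<Rightarrow> 'x \<Rightarrow> 'x) \<Rightarrow> bool" where
  "coexact R M X e d \<longleftrightarrow> left_module R M \<and> (\<forall>i. left_module R (X i)) \<and>
     lin R M (X 0) e \<and> (\<forall>x \<in> carrier M. e x = \<zero>\<^bsub>X 0\<^esub> \<longrightarrow> x = \<zero>\<^bsub>M\<^esub>) \<and>
     (\<forall>i. lin R (X i) (X (Suc i)) (d i)) \<and>
     (\<forall>x \<in> carrier (X 0). d 0 x = \<zero>\<^bsub>X 1\<^esub> \<longleftrightarrow> x \<in> e ` carrier M) \<and>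
     (\<forall>i. \<forall>x \<in> carrier (X (Suc i)). d (Suc i) x = \<zero>\<^bsub>X (Suc (Suc i))\<^esub> \<longleftrightarrow> x \<in> d i ` carrier (X i))"

definition hom_exact ::
  "('a, 'c) ring_scheme \<Rightarrow> ('a, 'm) module \<Rightarrow> (nat \<Rightarrow> ('a, 'x) module) \<Rightarrow> ('m \<Rightarrow> 'x) \<Rightarrow>
   (nat \<Rightarrow> 'x \<Rightarrow> 'x) \<Rightarrow> ('a, 't) module \<Rightarrow> bool" where
  "hom_exact R M X e d T \<longleftrightarrow>
     (\<forall>f. lin R M T f \<longrightarrow> (\<exists>g. lin R (X 0) T g \<and> (\<forall>x \<in> carrier M. f x = g (e x)))) \<and>
     (\<forall>f. lin R (X 0) T f \<longrightarrow> (\<forall>x \<in> carrier M. f (e x) = \<zero>\<^bsub>T\<^esub>) \<longrightarrow>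
        (\<exists>g. lin R (X 1) T g \<and> (\<forall>x \<in> carrier (X 0). f x = g (d 0 x)))) \<and>
     (\<forall>i f. lin R (X (Suc i)) T f \<longrightarrow> (\<forall>x \<in> carrier (X i). f (d i x) = \<zero>\<^bsub>T\<^esub>) \<longrightarrow>
        (\<exists>g. lin R (X (Suc (Suc i))) T g \<and> (\<forall>x \<in> carrier (X (Suc i)). f x = g (d (Suc i) x))))"

lemma coexactD:
  assumes "coexact R M X e d"
  shows "left_module R M" "\<And>i. left_module R (X i)" "lin R M (X 0) e"
    "\<And>x. x \<in> carrier M \<Longrightarrow> e x = \<zero>\<^bsub>X 0\<^esub> \<Longrightarrow> x = \<zero>\<^bsub>M\<^esub>" "\<And>i. lin R (X i) (X (Suc i)) (d i)"
    "\<And>x. x \<in> carrier (X 0) \<Longrightarrow> d 0 x = \<zero>\<^bsub>X 1\<^esub> \<longleftrightarrow> x \<in> e ` carrier M"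
    "\<And>i x. x \<in> carrier (X (Suc i)) \<Longrightarrow>
       d (Suc i) x = \<zero>\<^bsub>X (Suc (Suc i))\<^esub> \<longleftrightarrow> x \<in> d i ` carrier (X i)"
    "\<And>x. x \<in> carrier M \<Longrightarrow> d 0 (e x) = \<zero>\<^bsub>X 1\<^esub>"
    "\<And>i x. x \<in> carrier (X i) \<Longrightarrow> d (Suc i) (d i x) = \<zero>\<^bsub>X (Suc (Suc i))\<^esub>"
proof -
  note a = assms[unfolded coexact_def]
  note a1 = a[THEN conjunct1] and b1 = a[THEN conjunct2]
  note a2 = b1[THEN conjunct1] and b2 = b1[THEN conjunct2]
  note a3 = b2[THEN conjunct1] and b3 = b2[THEN conjunct2]
  note a4 = b3[THEN conjunct1] and b4 = b3[THEN conjunct2]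
  note a5 = b4[THEN conjunct1] and b5 = b4[THEN conjunct2]
  note a6 = b5[THEN conjunct1] and a7 = b5[THEN conjunct2]
  show "left_module R M" "\<And>i. left_module R (X i)" and el: "lin R M (X 0) e"
    and "\<And>x. x \<in> carrier M \<Longrightarrow> e x = \<zero>\<^bsub>X 0\<^esub> \<Longrightarrow> x = \<zero>\<^bsub>M\<^esub>"
    and l: "\<And>i. lin R (X i) (X (Suc i)) (d i)"
    and x0: "\<And>x. x \<in> carrier (X 0) \<Longrightarrow> d 0 x = \<zero>\<^bsub>X 1\<^esub> \<longleftrightarrow> x \<in> e ` carrier M"
    and x1: "\<And>i x. x \<in> carrier (X (Suc i)) \<Longrightarrow>
       d (Suc i) x = \<zero>\<^bsub>X (Suc (Suc i))\<^esub> \<longleftrightarrow> x \<in> d i ` carrier (X i)"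
    by (rule a1, rule a2[rule_format], rule a3, erule (1) a4[rule_format], rule a5[rule_format],
      erule a6[rule_format], erule a7[rule_format])
  show "d 0 (e x) = \<zero>\<^bsub>X 1\<^esub>" if "x \<in> carrier M" for x
    using x0[of "e x"] lin_closed[OF el that] that by simp
  show "d (Suc i) (d i x) = \<zero>\<^bsub>X (Suc (Suc i))\<^esub>" if "x \<in> carrier (X i)" for i x
    using x1[of "d i x" i] lin_closed[OF l that] that by simp
qed

lemma hom_exactD:
  assumes "hom_exact R M X e d T"
  shows "lin R M T f \<Longrightarrow> \<exists>g. lin R (X 0) T g \<and> (\<forall>x \<in> carrier M. f x = g (e x))"
    and "lin R (X 0) T h \<Longrightarrow> (\<And>x. x \<in> carrier M \<Longrightarrow> h (e x) = \<zero>\<^bsub>T\<^esub>) \<Longrightarrow>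
        \<exists>g. lin R (X 1) T g \<and> (\<forall>x \<in> carrier (X 0). h x = g (d 0 x))"
    and "lin R (X (Suc i)) T h \<Longrightarrow> (\<And>x. x \<in> carrier (X i) \<Longrightarrow> h (d i x) = \<zero>\<^bsub>T\<^esub>) \<Longrightarrow>
        \<exists>g. lin R (X (Suc (Suc i))) T g \<and> (\<forall>x \<in> carrier (X (Suc i)). h x = g (d (Suc i) x))"
  using assms unfolding hom_exact_def by auto

section \<open>Duality with respect to a bimodule\<close>

text \<open>
  Two modules on the same abelian group whose scalars commute. The notion is symmetric, so that every
  statement about duals below can be applied from either side.
\<close>

definition commuting ::
  "('a, 'c) ring_scheme \<Rightarrow> ('a, 'v) module \<Rightarrow> ('b, 'd) ring_scheme \<Rightarrow> ('b, 'v) module \<Rightarrow> bool" where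
  "commuting A M B N \<longleftrightarrow> left_module A M \<and> left_module B N \<and> carrier N = carrier M \<and>
     \<zero>\<^bsub>N\<^esub> = \<zero>\<^bsub>M\<^esub> \<and> ring.add N = ring.add M \<and>
     (\<forall>a \<in> carrier A. \<forall>b \<in> carrier B. \<forall>x \<in> carrier M. a \<odot>\<^bsub>M\<^esub> (b \<odot>\<^bsub>N\<^esub> x) = b \<odot>\<^bsub>N\<^esub> (a \<odot>\<^bsub>M\<^esub> x))"

lemma commuting_sym: "commuting A M B N \<Longrightarrow> commuting B N A M"
  unfolding commuting_def by auto

lemma commutingD:
  assumes "commuting A M B N"
  shows "left_module A M" "left_module B N" "carrier N = carrier M" "\<zero>\<^bsub>N\<^esub> = \<zero>\<^bsub>M\<^esub>"
    "ring.add N = ring.add M"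
    "\<And>a b x. a \<in> carrier A \<Longrightarrow> b \<in> carrier B \<Longrightarrow> x \<in> carrier M \<Longrightarrow>
       a \<odot>\<^bsub>M\<^esub> (b \<odot>\<^bsub>N\<^esub> x) = b \<odot>\<^bsub>N\<^esub> (a \<odot>\<^bsub>M\<^esub> x)"
  using assms unfolding commuting_def by blast+

text \<open>
  The action identifies \<open>B\<close> with the ring of \<open>A\<close>-endomorphisms of \<open>M\<close>.
\<close>

definition centralizes ::
  "('a, 'c) ring_scheme \<Rightarrow> ('a, 'v) module \<Rightarrow> ('b, 'd) ring_scheme \<Rightarrow> ('b, 'v) module \<Rightarrow> bool" where
  "centralizes A M B N \<longleftrightarrow>
     (\<forall>f. lin A M M f \<longrightarrow> (\<exists>b \<in> carrier B. \<forall>x \<in> carrier M. f x = b \<odot>\<^bsub>N\<^esub> x)) \<and>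
     (\<forall>b \<in> carrier B. (\<forall>x \<in> carrier M. b \<odot>\<^bsub>N\<^esub> x = \<zero>\<^bsub>M\<^esub>) \<longrightarrow> b = \<zero>\<^bsub>B\<^esub>)"

text \<open>
  \<open>Hom\<^sub>A(X, M)\<close>, on which \<open>B\<close> acts through the values.
\<close>

definition dual ::
  "('a, 'c) ring_scheme \<Rightarrow> ('a, 'v) module \<Rightarrow> ('b, 'v) module \<Rightarrow> ('a, 'x) module \<Rightarrow>
   ('b, 'x \<Rightarrow> 'v) module" where
  "dual A M N X = \<lparr>carrier = Hom A X M, monoid.mult = undefined, one = undefined,
     ring.zero = zero_hom X M, ring.add = (\<lambda>f g. \<lambda>x \<in> carrier X. f x \<oplus>\<^bsub>M\<^esub> g x),
     smult = (\<lambda>b f. \<lambda>x \<in> carrier X. b \<odot>\<^bsub>N\<^esub> f x)\<rparr>"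

lemma dual_simps [simp]:
  "carrier (dual A M N X) = Hom A X M" "\<zero>\<^bsub>dual A M N X\<^esub> = zero_hom X M"
  "f \<oplus>\<^bsub>dual A M N X\<^esub> g = (\<lambda>x \<in> carrier X. f x \<oplus>\<^bsub>M\<^esub> g x)"
  "b \<odot>\<^bsub>dual A M N X\<^esub> f = (\<lambda>x \<in> carrier X. b \<odot>\<^bsub>N\<^esub> f x)"
  by (simp_all add: dual_def)

lemma lin_commuting:
  assumes "commuting A M B N" "b \<in> carrier B"
  shows "lin A M M (\<lambda>x. b \<odot>\<^bsub>N\<^esub> x)"
proof (rule linI)
  note c = commutingD[OF assms(1)]
  show "b \<odot>\<^bsub>N\<^esub> x \<in> carrier M" if "x \<in> carrier M" for x
    using left_module_closed(3)[OF c(2) assms(2), of x] that by (simp add: c(3))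
  show "b \<odot>\<^bsub>N\<^esub> (x \<oplus>\<^bsub>M\<^esub> y) = b \<odot>\<^bsub>N\<^esub> x \<oplus>\<^bsub>M\<^esub> b \<odot>\<^bsub>N\<^esub> y" if "x \<in> carrier M" "y \<in> carrier M" for x y
    using left_module.smult_r_distr[OF c(2) assms(2), of x y] that by (simp add: c(3,5))
  show "b \<odot>\<^bsub>N\<^esub> (a \<odot>\<^bsub>M\<^esub> x) = a \<odot>\<^bsub>M\<^esub> (b \<odot>\<^bsub>N\<^esub> x)" if "a \<in> carrier A" "x \<in> carrier M" for a x
    using c(6)[OF that(1) assms(2) that(2)] by simp
qed

lemma left_module_dual:
  assumes c: "commuting A M B N" and X: "left_module A X"
  shows "left_module B (dual A M N X)"
proof -
  note c' = commutingD[OF c]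
  note ac = left_module_add_ac[OF c'(1)] and cl = left_module_closed[OF c'(1)]
  have v: "f x \<in> carrier M" if "f \<in> Hom A X M" "x \<in> carrier X" for f x
    using lin_closed[OF Hom_lin[OF that(1)] that(2)] .
  have add: "(\<lambda>x \<in> carrier X. f x \<oplus>\<^bsub>M\<^esub> g x) \<in> Hom A X M" if "f \<in> Hom A X M" "g \<in> Hom A X M" for f g
    by (rule restrict_Hom[OF X lin_plus[OF c'(1) Hom_lin[OF that(1)] Hom_lin[OF that(2)]]])
  have sm: "(\<lambda>x \<in> carrier X. b \<odot>\<^bsub>N\<^esub> f x) \<in> Hom A X M" if "b \<in> carrier B" "f \<in> Hom A X M" for b f
    by (rule restrict_Hom[OF X lin_comp[OF lin_commuting[OF c that(1)] Hom_lin[OF that(2)]]])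
  have u: "undefined = f x" if "f \<in> Hom A X M" "x \<notin> carrier X" for f x
    using that by (auto simp: Hom_iff extensional_def)
  have R: "ring B" by (rule left_module_ring[OF c'(2)])
  interpret N: left_module B N by (rule c'(2))
  show ?thesis
    apply (rule left_moduleI)
    apply (use v add sm zero_hom_Hom[OF X c'(1)] left_module_smult_zero[OF c'(2)] in
      \<open>auto simp: R zero_hom_def fun_eq_iff ac cl c'(3-5)[symmetric] N.smult_l_distr N.smult_r_distr
        N.smult_assoc N.smult_one N.M.a_ac restrict_def\<close>)
    apply (auto intro: u)
    done
qed

lemma lin_pull:
  assumes c: "commuting A M B N" and X: "left_module A X" and f: "lin A X Y f"
  shows "lin B (dual A M N Y) (dual A M N X) (\<lambda>g. compose (carrier X) g f)"
proof (rule linI)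
  fix g assume "g \<in> carrier (dual A M N Y)"
  then have "lin A Y M g" by (simp add: Hom_iff)
  then show "compose (carrier X) g f \<in> carrier (dual A M N X)"
    unfolding compose_def using restrict_Hom[OF X lin_comp[OF _ f]] by simp
qed (auto simp: compose_def fun_eq_iff lin_closed[OF f])

lemma lin_eval:
  assumes c: "commuting A M B N" and "x \<in> carrier X"
  shows "lin B (dual A M N X) N (\<lambda>g. g x)"
  by (rule linI)
    (use assms commutingD[OF c] lin_closed[OF Hom_lin] in \<open>auto simp: commutingD(3)[OF c] commutingD(5)[OF c]\<close>)

lemma msum_dual_apply:
  assumes "x \<in> carrier X" shows "msum (dual A M N X) f r x = msum M (\<lambda>j. f j x) r"
  using assms by (induction r) (auto simp: zero_hom_def)

text \<open>
  Pulling back along \<open>p j\<close> and \<open>i j\<close> decomposes the identity of the dual.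
\<close>

lemma dual_in_add:
  assumes c: "commuting A M B N" and Z: "left_module A Z" and X: "in_add A Z X"
  shows "in_add B (dual A M N Z) (dual A M N X)"
proof -
  note XM = in_add_left_module[OF X] and M = commutingD(1)[OF c]
  note DX = left_module_dual[OF c XM] and DZ = left_module_dual[OF c Z]
  obtain r i p where D: "add_data A Z X r i p" using in_addE[OF X Z] by blast
  note i = add_dataD(1)[OF D] and p = add_dataD(2)[OF D] and id = add_dataD(3)[OF D]
  show ?thesis
  proof (rule in_addI[OF DX DZ])
    show i': "lin B (dual A M N X) (dual A M N Z) (\<lambda>g. compose (carrier Z) g (p j))" if "j < r" for j
      by (rule lin_pull[OF c Z p[OF that]])
    show p': "lin B (dual A M N Z) (dual A M N X) (\<lambda>g. compose (carrier X) g (i j))" if "j < r" for j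
      by (rule lin_pull[OF c XM i[OF that]])
    fix g assume g: "g \<in> carrier (dual A M N X)"
    then have gl: "lin A X M g" by (simp add: Hom_iff)
    let ?s = "msum (dual A M N X) (\<lambda>j. compose (carrier X) (compose (carrier Z) g (p j)) (i j)) r"
    show "?s = g"
    proof (rule Hom_eqI)
      have "?s \<in> carrier (dual A M N X)"
        by (rule msum_closed[OF DX]) (rule lin_closed[OF p' lin_closed[OF i' g]])
      then show "?s \<in> Hom A X M" by simp
      show "g \<in> Hom A X M" using g by simp
      fix x assume x: "x \<in> carrier X"
      have "?s x = msum M (\<lambda>j. compose (carrier X) (compose (carrier Z) g (p j)) (i j) x) r"
        by (rule msum_dual_apply[OF x])
      also have "\<dots> = msum M (\<lambda>j. g (p j (i j x))) r"
        by (rule msum_cong) (use x lin_closed[OF i x] in \<open>simp add: compose_def\<close>)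
      also have "\<dots> = g (msum X (\<lambda>j. p j (i j x)) r)"
        by (rule lin_msum[OF XM M gl, symmetric]) (rule lin_closed[OF p lin_closed[OF i x]])
      finally show "?s x = g x" using id[OF x] by simp
    qed
  qed
qed

lemma dual_regular:
  assumes c: "commuting A M B N"
  shows "lin B (dual A M N (regular_module A)) N (\<lambda>g. g \<one>\<^bsub>A\<^esub>)"
    and "lin B N (dual A M N (regular_module A)) (\<lambda>x. \<lambda>a \<in> carrier A. a \<odot>\<^bsub>M\<^esub> x)"
    and "\<And>g. g \<in> Hom A (regular_module A) M \<Longrightarrow> (\<lambda>a \<in> carrier A. a \<odot>\<^bsub>M\<^esub> g \<one>\<^bsub>A\<^esub>) = g"
proof -
  note c' = commutingD[OF c]
  interpret A: ring A by (rule left_module_ring[OF c'(1)])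
  have RA: "left_module A (regular_module A)" by (rule left_module_regular) (rule A.ring_axioms)
  show "lin B (dual A M N (regular_module A)) N (\<lambda>g. g \<one>\<^bsub>A\<^esub>)"
    by (rule lin_eval[OF c]) simp
  have h: "(\<lambda>a \<in> carrier A. a \<odot>\<^bsub>M\<^esub> x) \<in> Hom A (regular_module A) M" if "x \<in> carrier M" for x
    using restrict_Hom[OF RA lin_regular[OF c'(1) that]] by simp
  show "lin B N (dual A M N (regular_module A)) (\<lambda>x. \<lambda>a \<in> carrier A. a \<odot>\<^bsub>M\<^esub> x)"
  proof (rule linI)
    show "(\<lambda>a \<in> carrier A. a \<odot>\<^bsub>M\<^esub> x) \<in> carrier (dual A M N (regular_module A))" if "x \<in> carrier N" for x
      using h that by (simp add: c'(3))
  qed (use c'(6) left_module.smult_r_distr[OF c'(1)] in \<open>auto simp: fun_eq_iff c'(3,5)\<close>)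
  show "(\<lambda>a \<in> carrier A. a \<odot>\<^bsub>M\<^esub> g \<one>\<^bsub>A\<^esub>) = g" if g: "g \<in> Hom A (regular_module A) M" for g
  proof (rule Hom_eqI[OF h g])
    show "g \<one>\<^bsub>A\<^esub> \<in> carrier M" using lin_closed[OF Hom_lin[OF g]] by simp
    fix a assume "a \<in> carrier (regular_module A)"
    then show "(\<lambda>a \<in> carrier A. a \<odot>\<^bsub>M\<^esub> g \<one>\<^bsub>A\<^esub>) a = g a"
      using lin_regular_eq[OF A.ring_axioms Hom_lin[OF g], of a] by simp
  qed
qed

text \<open>
  Evaluation at \<open>\<one>\<close> identifies the dual of \<open>A\<close> with \<open>N\<close>.
\<close>

lemma dual_in_add_regular:
  assumes c: "commuting A M B N" and X: "in_add A (regular_module A) X"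
  shows "in_add B N (dual A M N X)"
proof -
  note RA = left_module_regular[OF left_module_ring[OF commutingD(1)[OF c]]]
  show ?thesis
    by (rule in_add_base_retract[OF dual_in_add[OF c RA X] left_module_dual[OF c RA]
          commutingD(2)[OF c] dual_regular(1,2)[OF c]]) (simp add: dual_regular(3)[OF c])
qed

text \<open>
  The dual of \<open>M\<close> is \<open>End\<^sub>A(M)\<close>, which is the regular module when \<open>B\<close> is the centralizer; thus duals
  of objects of \<open>add M\<close> are projective.
\<close>

lemma dual_in_add_self:
  assumes c: "commuting A M B N" and z: "centralizes A M B N" and X: "in_add A M X"
  shows "in_add B (regular_module B) (dual A M N X)"
proof -
  note c' = commutingD[OF c]
  note RB = left_module_regular[OF left_module_ring[OF c'(2)]]
  interpret B: ring B by (rule left_module_ring[OF c'(2)])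
  interpret N: left_module B N by (rule c'(2))
  define s where "s g = (SOME b. b \<in> carrier B \<and> (\<forall>x \<in> carrier M. g x = b \<odot>\<^bsub>N\<^esub> x))" for g
  have s: "s g \<in> carrier B \<and> (\<forall>x \<in> carrier M. g x = s g \<odot>\<^bsub>N\<^esub> x)" if "lin A M M g" for g
    unfolding s_def by (rule someI_ex) (use z that in \<open>auto simp: centralizes_def\<close>)
  have uniq: "b = b'" if b: "b \<in> carrier B" "b' \<in> carrier B"
    and e: "\<And>x. x \<in> carrier M \<Longrightarrow> b \<odot>\<^bsub>N\<^esub> x = b' \<odot>\<^bsub>N\<^esub> x" for b b'
  proof -
    have "(b \<ominus>\<^bsub>B\<^esub> b') \<odot>\<^bsub>N\<^esub> x = \<zero>\<^bsub>M\<^esub>" if x: "x \<in> carrier M" for x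
    proof -
      have xN: "x \<in> carrier N" using x c'(3) by simp
      have "(b \<ominus>\<^bsub>B\<^esub> b') \<odot>\<^bsub>N\<^esub> x = b \<odot>\<^bsub>N\<^esub> x \<oplus>\<^bsub>N\<^esub> (\<ominus>\<^bsub>B\<^esub> b') \<odot>\<^bsub>N\<^esub> x"
        using b xN by (simp add: a_minus_def N.smult_l_distr)
      also have "\<dots> = (b' \<oplus>\<^bsub>B\<^esub> \<ominus>\<^bsub>B\<^esub> b') \<odot>\<^bsub>N\<^esub> x"
        using b xN e[OF x] by (simp only: N.smult_l_distr B.a_inv_closed)
      also have "\<dots> = \<zero>\<^bsub>M\<^esub>"
        using b left_module_smult_zero(2)[OF c'(2) xN] c'(4) by (simp add: B.r_neg)
      finally show ?thesis .
    qed
    then have "b \<ominus>\<^bsub>B\<^esub> b' = \<zero>\<^bsub>B\<^esub>" using z b unfolding centralizes_def by simp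
    then show ?thesis using b B.minus_equality[of b "\<ominus>\<^bsub>B\<^esub> b'"] by (simp add: a_minus_def)
  qed
  have sl: "lin B (dual A M N M) (regular_module B) s"
  proof (rule linI)
    fix f g assume f: "f \<in> carrier (dual A M N M)" and g: "g \<in> carrier (dual A M N M)"
    have fl: "lin A M M f" and gl: "lin A M M g" using f g by (auto simp: Hom_iff)
    have h: "lin A M M (f \<oplus>\<^bsub>dual A M N M\<^esub> g)"
      using left_module_closed(2)[OF left_module_dual[OF c c'(1)] f g] by (simp add: Hom_iff)
    show "s (f \<oplus>\<^bsub>dual A M N M\<^esub> g) = s f \<oplus>\<^bsub>regular_module B\<^esub> s g"
    proof (rule uniq)
      show "s (f \<oplus>\<^bsub>dual A M N M\<^esub> g) \<in> carrier B" using s[OF h] by blast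
      show "s f \<oplus>\<^bsub>regular_module B\<^esub> s g \<in> carrier B" using s[OF fl] s[OF gl] by simp
      fix x assume x: "x \<in> carrier M"
      have "s (f \<oplus>\<^bsub>dual A M N M\<^esub> g) \<odot>\<^bsub>N\<^esub> x = f x \<oplus>\<^bsub>N\<^esub> g x"
        using s[OF h, THEN conjunct2, rule_format, OF x] x c'(5) by simp
      also have "\<dots> = (s f \<oplus>\<^bsub>B\<^esub> s g) \<odot>\<^bsub>N\<^esub> x"
        using s[OF fl] s[OF gl] x by (simp add: N.smult_l_distr c'(3))
      finally show "s (f \<oplus>\<^bsub>dual A M N M\<^esub> g) \<odot>\<^bsub>N\<^esub> x = (s f \<oplus>\<^bsub>regular_module B\<^esub> s g) \<odot>\<^bsub>N\<^esub> x" by simp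
    qed
  next
    fix b f assume b: "b \<in> carrier B" and f: "f \<in> carrier (dual A M N M)"
    have fl: "lin A M M f" using f by (auto simp: Hom_iff)
    have h: "lin A M M (b \<odot>\<^bsub>dual A M N M\<^esub> f)"
      using left_module_closed(3)[OF left_module_dual[OF c c'(1)] b f] by (simp add: Hom_iff)
    show "s (b \<odot>\<^bsub>dual A M N M\<^esub> f) = b \<odot>\<^bsub>regular_module B\<^esub> s f"
    proof (rule uniq)
      show "s (b \<odot>\<^bsub>dual A M N M\<^esub> f) \<in> carrier B" using s[OF h] by blast
      show "b \<odot>\<^bsub>regular_module B\<^esub> s f \<in> carrier B" using s[OF fl] b by simp
      fix x assume x: "x \<in> carrier M"
      have "s (b \<odot>\<^bsub>dual A M N M\<^esub> f) \<odot>\<^bsub>N\<^esub> x = b \<odot>\<^bsub>N\<^esub> f x"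
        using s[OF h, THEN conjunct2, rule_format, OF x] x by simp
      also have "\<dots> = (b \<otimes>\<^bsub>B\<^esub> s f) \<odot>\<^bsub>N\<^esub> x"
        using s[OF fl] x b by (simp add: N.smult_assoc c'(3))
      finally show "s (b \<odot>\<^bsub>dual A M N M\<^esub> f) \<odot>\<^bsub>N\<^esub> x = (b \<odot>\<^bsub>regular_module B\<^esub> s f) \<odot>\<^bsub>N\<^esub> x" by simp
    qed
  next
    fix g assume "g \<in> carrier (dual A M N M)"
    then have "lin A M M g" by (simp add: Hom_iff)
    then show "s g \<in> carrier (regular_module B)" using s[of g] by simp
  qed
  have tl: "lin B (regular_module B) (dual A M N M) (\<lambda>b. \<lambda>x \<in> carrier M. b \<odot>\<^bsub>N\<^esub> x)"
  proof (rule linI)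
    show "(\<lambda>x \<in> carrier M. b \<odot>\<^bsub>N\<^esub> x) \<in> carrier (dual A M N M)" if "b \<in> carrier (regular_module B)" for b
      using restrict_Hom[OF c'(1) lin_commuting[OF c]] that by simp
  qed (auto simp: fun_eq_iff c'(3,5)[symmetric] N.smult_l_distr N.smult_assoc)
  show ?thesis
  proof (rule in_add_base_retract[OF dual_in_add[OF c c'(1) X] left_module_dual[OF c c'(1)] RB sl tl])
    fix g assume "g \<in> carrier (dual A M N M)"
    then have g: "g \<in> Hom A M M" by simp
    show "(\<lambda>x \<in> carrier M. s g \<odot>\<^bsub>N\<^esub> x) = g"
      using s[OF Hom_lin[OF g]] g by (auto simp: fun_eq_iff Hom_iff extensional_def)
  qed
qed

text \<open>
  The evaluation map \<open>X \<rightarrow> Hom\<^sub>B(Hom\<^sub>A(X, M), N)\<close> is bijective.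
\<close>

definition reflexive ::
  "('a, 'c) ring_scheme \<Rightarrow> ('a, 'v) module \<Rightarrow> ('b, 'd) ring_scheme \<Rightarrow> ('b, 'v) module \<Rightarrow>
   ('a, 'x) module \<Rightarrow> bool" where
  "reflexive A M B N X \<longleftrightarrow>
     (\<forall>x \<in> carrier X. (\<forall>g \<in> Hom A X M. g x = \<zero>\<^bsub>M\<^esub>) \<longrightarrow> x = \<zero>\<^bsub>X\<^esub>) \<and>
     (\<forall>\<xi>. lin B (dual A M N X) N \<xi> \<longrightarrow> (\<exists>x \<in> carrier X. \<forall>g \<in> Hom A X M. \<xi> g = g x))"

lemma reflexiveD:
  assumes "reflexive A M B N X"
  shows "x \<in> carrier X \<Longrightarrow> (\<And>g. g \<in> Hom A X M \<Longrightarrow> g x = \<zero>\<^bsub>M\<^esub>) \<Longrightarrow> x = \<zero>\<^bsub>X\<^esub>"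
    and "lin B (dual A M N X) N \<xi> \<Longrightarrow> \<exists>x \<in> carrier X. \<forall>g \<in> Hom A X M. \<xi> g = g x"
  using assms unfolding reflexive_def by blast+

text \<open>
  Evaluation is a natural transformation of additive functors, so its bijectivity passes to direct
  summands of powers.
\<close>

lemma reflexive_in_add:
  assumes c: "commuting A M B N" and Z: "left_module A Z" and X: "in_add A Z X"
    and r: "reflexive A M B N Z"
  shows "reflexive A M B N X"
proof -
  note XM = in_add_left_module[OF X] and c' = commutingD[OF c]
  note DX = left_module_dual[OF c XM] and DZ = left_module_dual[OF c Z]
  obtain r i p where D: "add_data A Z X r i p" using in_addE[OF X Z] by blast
  note i = add_dataD(1)[OF D] and p = add_dataD(2)[OF D] and id = add_dataD(3)[OF D]
  have pull: "compose (carrier X) g f \<in> Hom A X M" if "lin A X Z f" "g \<in> Hom A Z M" for f g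
    using lin_closed[OF lin_pull[OF c XM that(1)], of g] that(2) by simp
  have pull': "compose (carrier Z) g f \<in> Hom A Z M" if "lin A Z X f" "g \<in> Hom A X M" for f g
    using lin_closed[OF lin_pull[OF c Z that(1)], of g] that(2) by simp
  show ?thesis
    unfolding reflexive_def
  proof (intro conjI ballI impI allI)
    fix x assume x: "x \<in> carrier X" and 0: "\<forall>g \<in> Hom A X M. g x = \<zero>\<^bsub>M\<^esub>"
    have "i j x = \<zero>\<^bsub>Z\<^esub>" if j: "j < r" for j
    proof (rule reflexiveD(1)[OF assms(4) lin_closed[OF i[OF j] x]])
      fix g assume "g \<in> Hom A Z M"
      then show "g (i j x) = \<zero>\<^bsub>M\<^esub>" using 0[rule_format, OF pull[OF i[OF j]]] x by (simp add: compose_def)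
    qed
    then have "msum X (\<lambda>j. p j (i j x)) r = \<zero>\<^bsub>X\<^esub>"
      using lin_zero[OF Z XM p] by (intro msum_zero[OF XM]) auto
    then show "x = \<zero>\<^bsub>X\<^esub>" using id[OF x] by simp
  next
    fix \<xi> assume \<xi>: "lin B (dual A M N X) N \<xi>"
    have "\<exists>z \<in> carrier Z. \<forall>g \<in> Hom A Z M. \<xi> (compose (carrier X) g (i j)) = g z" if j: "j < r" for j
      by (rule reflexiveD(2)[OF assms(4) lin_comp[OF \<xi> lin_pull[OF c XM i[OF j]]]])
    then have "\<forall>j. \<exists>z. j < r \<longrightarrow> z \<in> carrier Z \<and> (\<forall>g \<in> Hom A Z M. \<xi> (compose (carrier X) g (i j)) = g z)"
      by blast
    from choice[OF this] obtain z where z: "\<And>j. j < r \<Longrightarrow> z j \<in> carrier Z"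
      "\<And>j g. j < r \<Longrightarrow> g \<in> Hom A Z M \<Longrightarrow> \<xi> (compose (carrier X) g (i j)) = g (z j)" by blast
    show "\<exists>x \<in> carrier X. \<forall>g \<in> Hom A X M. \<xi> g = g x"
    proof (intro bexI[of _ "msum X (\<lambda>j. p j (z j)) r"] ballI)
      show "msum X (\<lambda>j. p j (z j)) r \<in> carrier X"
        by (rule msum_closed[OF XM]) (rule lin_closed[OF p z(1)])
      fix g assume g: "g \<in> Hom A X M"
      let ?h = "\<lambda>j. compose (carrier X) (compose (carrier Z) g (p j)) (i j)"
      have hc: "?h j \<in> Hom A X M" if "j < r" for j by (rule pull[OF i[OF that] pull'[OF p[OF that] g]])
      have "msum (dual A M N X) ?h r = g"
      proof (rule Hom_eqI[OF _ g])
        show "msum (dual A M N X) ?h r \<in> Hom A X M" using msum_closed[OF DX, of r ?h] hc by simp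
        fix x assume x: "x \<in> carrier X"
        have "msum (dual A M N X) ?h r x = msum M (\<lambda>j. g (p j (i j x))) r"
          unfolding msum_dual_apply[OF x]
          by (rule msum_cong) (use x lin_closed[OF i x] in \<open>simp add: compose_def\<close>)
        also have "\<dots> = g (msum X (\<lambda>j. p j (i j x)) r)"
          by (rule lin_msum[OF XM c'(1) Hom_lin[OF g], symmetric]) (rule lin_closed[OF p lin_closed[OF i x]])
        finally show "msum (dual A M N X) ?h r x = g x" using id[OF x] by simp
      qed
      then have "\<xi> g = msum N (\<lambda>j. \<xi> (?h j)) r"
        using lin_msum[OF DX c'(2) \<xi>, of r ?h] hc by simp
      also have "\<dots> = msum N (\<lambda>j. g (p j (z j))) r"
      proof (rule msum_cong)
        fix j assume j: "j < r"
        show "\<xi> (?h j) = g (p j (z j))"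
          using z(2)[OF j pull'[OF p[OF j] g]] z(1)[OF j] by (simp add: compose_def)
      qed
      also have "\<dots> = msum M (\<lambda>j. g (p j (z j))) r"
      proof -
        have "msum N f k = msum M f k" for f k by (induction k) (simp_all add: c'(4,5))
        then show ?thesis .
      qed
      also have "\<dots> = g (msum X (\<lambda>j. p j (z j)) r)"
        by (rule lin_msum[OF XM c'(1) Hom_lin[OF g], symmetric]) (rule lin_closed[OF p z(1)])
      finally show "\<xi> g = g (msum X (\<lambda>j. p j (z j)) r)" .
    qed
  qed
qed

text \<open>
  Every \<open>g \<in> End\<^sub>A(M)\<close> is a scalar multiple \<open>b \<odot> I\<close> of the identity. Hence a functional \<open>\<xi>\<close> is evaluation at
  \<open>\<xi> I\<close>.
\<close>

lemma reflexive_self: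
  assumes c: "commuting A M B N" and z: "centralizes A M B N"
  shows "reflexive A M B N M"
proof -
  note c' = commutingD[OF c]
  define I where "I = (\<lambda>x \<in> carrier M. x)"
  have I: "I \<in> Hom A M M" unfolding I_def by (rule restrict_Hom[OF c'(1) lin_id])
  show ?thesis
    unfolding reflexive_def
  proof (intro conjI ballI impI allI)
    fix x assume "x \<in> carrier M" "\<forall>g \<in> Hom A M M. g x = \<zero>\<^bsub>M\<^esub>"
    then show "x = \<zero>\<^bsub>M\<^esub>" using I by (auto simp: I_def)
  next
    fix \<xi> assume \<xi>: "lin B (dual A M N M) N \<xi>"
    have \<xi>I: "\<xi> I \<in> carrier M" using lin_closed[OF \<xi>, of I] I by (simp add: c'(3))
    show "\<exists>x \<in> carrier M. \<forall>g \<in> Hom A M M. \<xi> g = g x"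
    proof (intro bexI[of _ "\<xi> I"] ballI \<xi>I)
      fix g assume g: "g \<in> Hom A M M"
      obtain b where b: "b \<in> carrier B" "\<forall>x \<in> carrier M. g x = b \<odot>\<^bsub>N\<^esub> x"
        using z Hom_lin[OF g] unfolding centralizes_def by blast
      have "g = b \<odot>\<^bsub>dual A M N M\<^esub> I"
        using b(2) g by (auto simp: I_def fun_eq_iff Hom_iff extensional_def)
      then have "\<xi> g = b \<odot>\<^bsub>N\<^esub> \<xi> I" using lin_smult[OF \<xi> b(1), of I] I by simp
      then show "\<xi> g = g (\<xi> I)" using b(2) \<xi>I by simp
    qed
  qed
qed

text \<open>
  Under the identification of the dual of \<open>A\<close> with \<open>N\<close>, a functional becomes an endomorphism of \<open>N\<close>,
  that is, the action of an element of \<open>A\<close>.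
\<close>

lemma reflexive_regular:
  assumes c: "commuting A M B N" and z: "centralizes B N A M"
  shows "reflexive A M B N (regular_module A)"
proof -
  note c' = commutingD[OF c] and d = dual_regular[OF c]
  interpret A: ring A by (rule left_module_ring[OF c'(1)])
  have h: "(\<lambda>a \<in> carrier A. a \<odot>\<^bsub>M\<^esub> x) \<in> Hom A (regular_module A) M" if "x \<in> carrier M" for x
    using lin_closed[OF d(2), of x] that by (simp add: c'(3))
  show ?thesis
    unfolding reflexive_def
  proof (intro conjI ballI impI allI)
    fix a assume a: "a \<in> carrier (regular_module A)"
      and 0: "\<forall>g \<in> Hom A (regular_module A) M. g a = \<zero>\<^bsub>M\<^esub>"
    have "a \<odot>\<^bsub>M\<^esub> x = \<zero>\<^bsub>N\<^esub>" if "x \<in> carrier N" for x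
      using 0[rule_format, OF h, of x] that a by (simp add: c'(3,4))
    then show "a = \<zero>\<^bsub>regular_module A\<^esub>" using z a unfolding centralizes_def by simp
  next
    fix \<xi> assume \<xi>: "lin B (dual A M N (regular_module A)) N \<xi>"
    obtain a where a: "a \<in> carrier A" "\<And>x. x \<in> carrier N \<Longrightarrow> \<xi> (\<lambda>a \<in> carrier A. a \<odot>\<^bsub>M\<^esub> x) = a \<odot>\<^bsub>M\<^esub> x"
      using z lin_comp[OF \<xi> d(2)] unfolding centralizes_def by blast
    show "\<exists>a \<in> carrier (regular_module A). \<forall>g \<in> Hom A (regular_module A) M. \<xi> g = g a"
    proof (intro bexI[of _ a] ballI)
      fix g assume g: "g \<in> Hom A (regular_module A) M"
      have "g \<one>\<^bsub>A\<^esub> \<in> carrier N" using lin_closed[OF Hom_lin[OF g]] by (simp add: c'(3))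
      from a(2)[OF this] have "\<xi> g = a \<odot>\<^bsub>M\<^esub> g \<one>\<^bsub>A\<^esub>" unfolding d(3)[OF g] .
      then show "\<xi> g = g a" using lin_regular_eq[OF A.ring_axioms Hom_lin[OF g] a(1)] by simp
    qed (use a in simp)
  qed
qed

text \<open>
  For a coresolution of \<open>A\<close>, exactness after applying \<open>Hom\<^sub>A(-, M)\<close> means that the duals resolve the dual
  of \<open>A\<close>, which is \<open>N\<close>; the augmentation is evaluation at the image of \<open>\<one>\<close>.
\<close>

lemma resol_dual:
  assumes c: "commuting A M B N" and X: "coexact A (regular_module A) X e d"
    and h: "hom_exact A (regular_module A) X e d M"
  shows "resol B N (\<lambda>i. dual A M N (X i)) (\<lambda>g. g (e \<one>\<^bsub>A\<^esub>)) (\<lambda>i g. compose (carrier (X i)) g (d i))"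
proof -
  note c' = commutingD[OF c] and x = coexactD[OF X]
  interpret A: ring A by (rule left_module_ring[OF c'(1)])
  have e1: "e \<one>\<^bsub>A\<^esub> \<in> carrier (X 0)" using lin_closed[OF x(3)] by simp
  have ge: "g (e a) = a \<odot>\<^bsub>M\<^esub> g (e \<one>\<^bsub>A\<^esub>)" if "lin A (X 0) M g" "a \<in> carrier A" for g a
    using lin_regular_eq[OF A.ring_axioms lin_comp[OF that(1) x(3)] that(2)] .
  show ?thesis
    unfolding resol_def
  proof (intro conjI allI ballI)
    show "left_module B (dual A M N (X i))" for i by (rule left_module_dual[OF c x(2)])
    show ev: "lin B (dual A M N (X 0)) N (\<lambda>g. g (e \<one>\<^bsub>A\<^esub>))" by (rule lin_eval[OF c e1])
    show dl: "lin B (dual A M N (X (Suc i))) (dual A M N (X i)) (\<lambda>g. compose (carrier (X i)) g (d i))" for i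
      by (rule lin_pull[OF c x(2) x(5)])
    show "(\<lambda>g. g (e \<one>\<^bsub>A\<^esub>)) ` carrier (dual A M N (X 0)) = carrier N"
    proof
      show "(\<lambda>g. g (e \<one>\<^bsub>A\<^esub>)) ` carrier (dual A M N (X 0)) \<subseteq> carrier N" using lin_closed[OF ev] by blast
      show "carrier N \<subseteq> (\<lambda>g. g (e \<one>\<^bsub>A\<^esub>)) ` carrier (dual A M N (X 0))"
      proof
        fix y assume "y \<in> carrier N"
        then have y: "y \<in> carrier M" by (simp add: c'(3))
        obtain g where g: "lin A (X 0) M g" "\<forall>a \<in> carrier (regular_module A). a \<odot>\<^bsub>M\<^esub> y = g (e a)"
          using hom_exactD(1)[OF h lin_regular[OF c'(1) y]] by blast
        have "y = g (e \<one>\<^bsub>A\<^esub>)" using g(2) left_module.smult_one[OF c'(1) y] by simp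
        then show "y \<in> (\<lambda>g. g (e \<one>\<^bsub>A\<^esub>)) ` carrier (dual A M N (X 0))"
          using restrict_Hom[OF x(2) g(1)] e1 by (intro image_eqI[of _ _ "restrict g (carrier (X 0))"]) auto
      qed
    qed
    show "g (e \<one>\<^bsub>A\<^esub>) = \<zero>\<^bsub>N\<^esub> \<longleftrightarrow>
        g \<in> (\<lambda>g. compose (carrier (X 0)) g (d 0)) ` carrier (dual A M N (X 1))"
      if "g \<in> carrier (dual A M N (X 0))" for g
    proof
      have g: "g \<in> Hom A (X 0) M" using that by simp
      assume "g (e \<one>\<^bsub>A\<^esub>) = \<zero>\<^bsub>N\<^esub>"
      then have "g (e a) = \<zero>\<^bsub>M\<^esub>" if "a \<in> carrier (regular_module A)" for a
        using ge[OF Hom_lin[OF g], of a] that left_module_smult_zero(1)[OF c'(1)] by (simp add: c'(4))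
      then obtain g' where g': "lin A (X 1) M g'" "\<forall>y \<in> carrier (X 0). g y = g' (d 0 y)"
        using hom_exactD(2)[OF h Hom_lin[OF g]] by blast
      have "g = compose (carrier (X 0)) (restrict g' (carrier (X 1))) (d 0)"
        using g g'(2) lin_closed[OF x(5), of _ 0]
        by (auto simp: fun_eq_iff compose_def Hom_iff extensional_def)
      then show "g \<in> (\<lambda>g. compose (carrier (X 0)) g (d 0)) ` carrier (dual A M N (X 1))"
        using restrict_Hom[OF x(2) g'(1)] by auto
    next
      assume "g \<in> (\<lambda>g. compose (carrier (X 0)) g (d 0)) ` carrier (dual A M N (X 1))"
      then obtain g' where g': "g' \<in> Hom A (X 1) M" "g = compose (carrier (X 0)) g' (d 0)" by auto
      then show "g (e \<one>\<^bsub>A\<^esub>) = \<zero>\<^bsub>N\<^esub>"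
        using e1 x(8)[of "\<one>\<^bsub>A\<^esub>"] lin_zero[OF x(2) c'(1) Hom_lin[OF g'(1)]] by (simp add: compose_def c'(4))
    qed
    show "compose (carrier (X i)) g (d i) = \<zero>\<^bsub>dual A M N (X i)\<^esub> \<longleftrightarrow>
        g \<in> (\<lambda>g. compose (carrier (X (Suc i))) g (d (Suc i))) ` carrier (dual A M N (X (Suc (Suc i))))"
      if "g \<in> carrier (dual A M N (X (Suc i)))" for i g
    proof
      have g: "g \<in> Hom A (X (Suc i)) M" using that by simp
      assume "compose (carrier (X i)) g (d i) = \<zero>\<^bsub>dual A M N (X i)\<^esub>"
      then have "g (d i y) = \<zero>\<^bsub>M\<^esub>" if "y \<in> carrier (X i)" for y
        using that by (simp add: compose_eq_zero_hom_iff)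
      then obtain g' where g': "lin A (X (Suc (Suc i))) M g'" "\<forall>y \<in> carrier (X (Suc i)). g y = g' (d (Suc i) y)"
        using hom_exactD(3)[OF h Hom_lin[OF g]] by blast
      have "g = compose (carrier (X (Suc i))) (restrict g' (carrier (X (Suc (Suc i))))) (d (Suc i))"
        using g g'(2) lin_closed[OF x(5), of _ "Suc i"]
        by (auto simp: fun_eq_iff compose_def Hom_iff extensional_def)
      then show "g \<in> (\<lambda>g. compose (carrier (X (Suc i))) g (d (Suc i))) ` carrier (dual A M N (X (Suc (Suc i))))"
        using restrict_Hom[OF x(2) g'(1)] by auto
    next
      assume "g \<in> (\<lambda>g. compose (carrier (X (Suc i))) g (d (Suc i))) ` carrier (dual A M N (X (Suc (Suc i))))"
      then obtain g' where g': "g' \<in> Hom A (X (Suc (Suc i))) M"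
        "g = compose (carrier (X (Suc i))) g' (d (Suc i))" by auto
      then show "compose (carrier (X i)) g (d i) = \<zero>\<^bsub>dual A M N (X i)\<^esub>"
        using x(9) lin_zero[OF x(2) c'(1) Hom_lin[OF g'(1)]] lin_closed[OF x(5)]
        by (simp add: compose_eq_zero_hom_iff) (simp add: compose_def)
    qed
  qed (rule c'(2))
qed

text \<open>
  By reflexivity, dualizing a second time gives back the sequence \<open>X\<close>, which is exact.
\<close>

lemma acyc_dual:
  assumes c: "commuting A M B N" and X: "coexact A L X e d"
    and r: "\<And>i. reflexive A M B N (X i)"
  shows "acyc_at B (\<lambda>i. dual A M N (X i)) (\<lambda>i g. compose (carrier (X i)) g (d i)) N k"
  unfolding acyc_at_def
proof (intro allI impI)
  note c' = commutingD[OF c] and x = coexactD[OF X]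
  fix f assume f: "lin B (dual A M N (X (Suc k))) N f"
    and 0: "\<forall>g \<in> carrier (dual A M N (X (Suc (Suc k)))). f (compose (carrier (X (Suc k))) g (d (Suc k))) = \<zero>\<^bsub>N\<^esub>"
  obtain y where y: "y \<in> carrier (X (Suc k))" "\<And>g. g \<in> Hom A (X (Suc k)) M \<Longrightarrow> f g = g y"
    using reflexiveD(2)[OF r f] by blast
  have "d (Suc k) y = \<zero>\<^bsub>X (Suc (Suc k))\<^esub>"
  proof (rule reflexiveD(1)[OF r lin_closed[OF x(5) y(1)]])
    fix g assume g: "g \<in> Hom A (X (Suc (Suc k))) M"
    have "compose (carrier (X (Suc k))) g (d (Suc k)) \<in> Hom A (X (Suc k)) M"
      using lin_closed[OF lin_pull[OF c x(2) x(5)], of g] g by simp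
    then show "g (d (Suc k) y) = \<zero>\<^bsub>M\<^esub>"
      using 0[rule_format, of g] g y by (simp add: compose_def c'(4))
  qed
  then obtain z where z: "z \<in> carrier (X k)" "y = d k z" using x(7)[OF y(1)] by auto
  show "\<exists>g. lin B (dual A M N (X k)) N g \<and>
      (\<forall>h \<in> carrier (dual A M N (X (Suc k))). f h = g (compose (carrier (X k)) h (d k)))"
  proof (intro exI[of _ "\<lambda>g. g z"] conjI ballI)
    show "lin B (dual A M N (X k)) N (\<lambda>g. g z)" by (rule lin_eval[OF c z(1)])
    fix h assume "h \<in> carrier (dual A M N (X (Suc k)))"
    then show "f h = compose (carrier (X k)) h (d k) z" using y(2) z by (simp add: compose_def)
  qed
qed

text \<open>
  A five lemma argument. An endomorphism \<open>\<phi>\<close> of \<open>N\<close> induces the functional \<open>g \<mapsto> \<phi> (g (e \<one>))\<close> on the dual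
  of \<open>X 0\<close>, which by reflexivity is evaluation at some \<open>y\<close>. This \<open>y\<close> is killed by \<open>d 0\<close>, hence is the
  image of an element of \<open>A\<close>, and that element acts as \<open>\<phi>\<close>.
\<close>

lemma double_centralizer:
  assumes c: "commuting A M B N" and X: "coexact A (regular_module A) X e d"
    and h: "hom_exact A (regular_module A) X e d M"
    and r: "\<And>i. reflexive A M B N (X i)"
  shows "centralizes B N A M"
proof -
  note c' = commutingD[OF c] and x = coexactD[OF X]
  interpret A: ring A by (rule left_module_ring[OF c'(1)])
  have e1: "e \<one>\<^bsub>A\<^esub> \<in> carrier (X 0)" using lin_closed[OF x(3)] by simp
  have ge: "g (e a) = a \<odot>\<^bsub>M\<^esub> g (e \<one>\<^bsub>A\<^esub>)" if "lin A (X 0) M g" "a \<in> carrier A" for g a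
    using lin_regular_eq[OF A.ring_axioms lin_comp[OF that(1) x(3)] that(2)] .
  show ?thesis
    unfolding centralizes_def
  proof (intro conjI allI impI ballI)
    fix \<phi> assume \<phi>: "lin B N N \<phi>"
    have "lin B (dual A M N (X 0)) N (\<lambda>g. \<phi> (g (e \<one>\<^bsub>A\<^esub>)))" by (rule lin_comp[OF \<phi> lin_eval[OF c e1]])
    then obtain y where y: "y \<in> carrier (X 0)" "\<And>g. g \<in> Hom A (X 0) M \<Longrightarrow> \<phi> (g (e \<one>\<^bsub>A\<^esub>)) = g y"
      using reflexiveD(2)[OF r] by blast
    have "d 0 y = \<zero>\<^bsub>X 1\<^esub>"
    proof (rule reflexiveD(1)[OF r])
      show "d 0 y \<in> carrier (X 1)" using lin_closed[OF x(5) y(1)] by simp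
      fix g assume g: "g \<in> Hom A (X 1) M"
      have "compose (carrier (X 0)) g (d 0) \<in> Hom A (X 0) M"
        using lin_closed[OF lin_pull[OF c x(2) x(5)[of 0]], of g] g by simp
      then have "g (d 0 y) = \<phi> (g (d 0 (e \<one>\<^bsub>A\<^esub>)))"
        using y e1 by (metis (no_types, lifting) compose_eq)
      also have "\<dots> = \<zero>\<^bsub>M\<^esub>"
        using x(8)[of "\<one>\<^bsub>A\<^esub>"] lin_zero[OF x(2) c'(1) Hom_lin[OF g]] lin_zero[OF c'(2,2) \<phi>]
        by (simp add: c'(4))
      finally show "g (d 0 y) = \<zero>\<^bsub>M\<^esub>" .
    qed
    then obtain a where a: "a \<in> carrier A" "y = e a" using x(6)[OF y(1)] by auto
    have "\<phi> z = a \<odot>\<^bsub>M\<^esub> z" if "z \<in> carrier N" for z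
    proof -
      have "z \<in> carrier M" using that by (simp add: c'(3))
      then obtain g where g: "lin A (X 0) M g" "\<forall>a \<in> carrier (regular_module A). a \<odot>\<^bsub>M\<^esub> z = g (e a)"
        using hom_exactD(1)[OF h lin_regular[OF c'(1)]] by blast
      have gz: "z = g (e \<one>\<^bsub>A\<^esub>)" using g(2) left_module.smult_one[OF c'(1) \<open>z \<in> carrier M\<close>] by simp
      have "\<phi> z = g y" using y(2)[OF restrict_Hom[OF x(2) g(1)]] e1 y(1) gz by simp
      then show ?thesis using ge[OF g(1) a(1)] a(2) gz by simp
    qed
    then show "\<exists>a \<in> carrier A. \<forall>z \<in> carrier N. \<phi> z = a \<odot>\<^bsub>M\<^esub> z" using a(1) by blast
  next
    fix a assume a: "a \<in> carrier A" and 0: "\<forall>z \<in> carrier N. a \<odot>\<^bsub>M\<^esub> z = \<zero>\<^bsub>N\<^esub>"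
    have "e a = \<zero>\<^bsub>X 0\<^esub>"
    proof (rule reflexiveD(1)[OF r])
      show "e a \<in> carrier (X 0)" using lin_closed[OF x(3)] a by simp
      show "g (e a) = \<zero>\<^bsub>M\<^esub>" if "g \<in> Hom A (X 0) M" for g
        using ge[OF Hom_lin[OF that] a] 0 lin_closed[OF Hom_lin[OF that] e1] by (simp add: c'(3,4))
    qed
    then show "a = \<zero>\<^bsub>A\<^esub>" using x(4)[of a] a by simp
  qed
qed

text \<open>
  Since \<open>Hom\<^sub>A(-, M)\<close> is left exact and the complex of the \<open>Hom\<^sub>A(P i, M)\<close> is exact in positive
  degrees, this complex is a coresolution of \<open>End\<^sub>A(M) = B\<close>. Applying \<open>Hom\<^sub>B(-, N)\<close> gives back the
  resolution, by reflexivity of its terms, so exactness is preserved.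
\<close>

lemma coexact_dual:
  assumes c: "commuting A M B N" and z: "centralizes A M B N"
    and P: "resol A M P \<epsilon> \<delta>" and r: "\<And>i. reflexive A M B N (P i)"
    and a: "\<And>k. acyc_at A P \<delta> M k"
  shows "coexact B (regular_module B) (\<lambda>i. dual A M N (P i)) (\<lambda>b. \<lambda>x \<in> carrier (P 0). b \<odot>\<^bsub>N\<^esub> \<epsilon> x)
      (\<lambda>i g. compose (carrier (P (Suc i))) g (\<delta> i))" (is "coexact B _ ?D ?e ?d")
    and "hom_exact B (regular_module B) (\<lambda>i. dual A M N (P i)) (\<lambda>b. \<lambda>x \<in> carrier (P 0). b \<odot>\<^bsub>N\<^esub> \<epsilon> x)
      (\<lambda>i g. compose (carrier (P (Suc i))) g (\<delta> i)) N"
proof -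
  note c' = commutingD[OF c] and p = resolD[OF P]
  interpret B: ring B by (rule left_module_ring[OF c'(2)])
  interpret N: left_module B N by (rule c'(2))
  have \<epsilon>c: "\<epsilon> x \<in> carrier N" if "x \<in> carrier (P 0)" for x
    using lin_closed[OF p(3) that] by (simp add: c'(3))
  have el: "lin B (regular_module B) (?D 0) ?e"
  proof (rule linI)
    show "?e b \<in> carrier (?D 0)" if "b \<in> carrier (regular_module B)" for b
      using restrict_Hom[OF p(2) lin_comp[OF lin_commuting[OF c] p(3)]] that by simp
  qed (use \<epsilon>c in \<open>auto simp: fun_eq_iff N.smult_l_distr N.smult_assoc c'(5)[symmetric]\<close>)
  have dl: "lin B (?D i) (?D (Suc i)) (?d i)" for i by (rule lin_pull[OF c p(2) p(5)])
  show "coexact B (regular_module B) ?D ?e ?d"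
    unfolding coexact_def
  proof (intro conjI allI ballI impI)
    show "left_module B (regular_module B)" by (rule left_module_regular[OF B.ring_axioms])
    show "left_module B (?D i)" for i by (rule left_module_dual[OF c p(2)])
    show "lin B (regular_module B) (?D 0) ?e" by (rule el)
    show "lin B (?D i) (?D (Suc i)) (?d i)" for i by (rule dl)
    show "b = \<zero>\<^bsub>regular_module B\<^esub>" if b: "b \<in> carrier (regular_module B)" and 0: "?e b = \<zero>\<^bsub>?D 0\<^esub>" for b
    proof -
      have "b \<odot>\<^bsub>N\<^esub> x = \<zero>\<^bsub>M\<^esub>" if x: "x \<in> carrier M" for x
      proof -
        obtain y where y: "y \<in> carrier (P 0)" "x = \<epsilon> y" using p(4) x by (metis imageE)
        show ?thesis using fun_cong[OF 0, of y] y by (simp add: zero_hom_def)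
      qed
      then show ?thesis using z b unfolding centralizes_def by simp
    qed
    show "?d 0 g = \<zero>\<^bsub>?D 1\<^esub> \<longleftrightarrow> g \<in> ?e ` carrier (regular_module B)" if "g \<in> carrier (?D 0)" for g
    proof
      have g: "g \<in> Hom A (P 0) M" using that by simp
      assume "?d 0 g = \<zero>\<^bsub>?D 1\<^esub>"
      then have 0: "g (\<delta> 0 y) = \<zero>\<^bsub>M\<^esub>" if "y \<in> carrier (P 1)" for y
        using that compose_eq_zero_hom_iff[of "P (Suc 0)" g "\<delta> 0" M] by simp
      have "g y = \<zero>\<^bsub>M\<^esub>" if "y \<in> carrier (P 0)" "\<epsilon> y = \<zero>\<^bsub>M\<^esub>" for y
        using p(6)[OF that(1)] that(2) 0 by auto
      then obtain f where f: "lin A (M\<lparr>carrier := \<epsilon> ` carrier (P 0)\<rparr>) M f" "\<forall>y \<in> carrier (P 0). f (\<epsilon> y) = g y"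
        using lin_factor[OF p(2) p(1) p(1) p(3) Hom_lin[OF g]] by blast
      have "lin A M M f" using f(1) unfolding p(4) by simp
      then obtain b where b: "b \<in> carrier B" "\<forall>x \<in> carrier M. f x = b \<odot>\<^bsub>N\<^esub> x"
        using z unfolding centralizes_def by blast
      have "g = ?e b"
        using g f(2) b(2) \<epsilon>c by (auto simp: fun_eq_iff Hom_iff extensional_def c'(3))
      then show "g \<in> ?e ` carrier (regular_module B)" using b(1) by simp
    next
      assume "g \<in> ?e ` carrier (regular_module B)"
      then obtain b where b: "b \<in> carrier B" "g = ?e b" by auto
      have "g (\<delta> 0 y) = \<zero>\<^bsub>M\<^esub>" if "y \<in> carrier (P 1)" for y
        using b p(8)[OF that] lin_closed[OF p(5), of y 0] that left_module_smult_zero(1)[OF c'(2) b(1)]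
        by (simp add: c'(4))
      then show "?d 0 g = \<zero>\<^bsub>?D 1\<^esub>"
        using compose_eq_zero_hom_iff[of "P (Suc 0)" g "\<delta> 0" M] by simp
    qed
    show "?d (Suc i) g = \<zero>\<^bsub>?D (Suc (Suc i))\<^esub> \<longleftrightarrow> g \<in> ?d i ` carrier (?D i)"
      if "g \<in> carrier (?D (Suc i))" for i g
    proof
      have g: "g \<in> Hom A (P (Suc i)) M" using that by simp
      assume "?d (Suc i) g = \<zero>\<^bsub>?D (Suc (Suc i))\<^esub>"
      then have 0: "g (\<delta> (Suc i) y) = \<zero>\<^bsub>M\<^esub>" if "y \<in> carrier (P (Suc (Suc i)))" for y
        using that by (simp add: compose_eq_zero_hom_iff)
      obtain g' where g': "lin A (P i) M g'" "\<And>y. y \<in> carrier (P (Suc i)) \<Longrightarrow> g y = g' (\<delta> i y)"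
        by (rule acyc_atE[OF a Hom_lin[OF g] 0]) auto
      have "g = compose (carrier (P (Suc i))) (restrict g' (carrier (P i))) (\<delta> i)"
        using g g'(2) lin_closed[OF p(5), of _ i]
        by (auto simp: fun_eq_iff compose_def Hom_iff extensional_def)
      then show "g \<in> ?d i ` carrier (?D i)" using restrict_Hom[OF p(2) g'(1)] by auto
    next
      assume "g \<in> ?d i ` carrier (?D i)"
      then obtain g' where g': "g' \<in> Hom A (P i) M" "g = compose (carrier (P (Suc i))) g' (\<delta> i)" by auto
      then show "?d (Suc i) g = \<zero>\<^bsub>?D (Suc (Suc i))\<^esub>"
        using p(9) lin_zero[OF p(2) c'(1) Hom_lin[OF g'(1)]] lin_closed[OF p(5)]
        by (simp add: compose_eq_zero_hom_iff) (simp add: compose_def)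
    qed
  qed
  show "hom_exact B (regular_module B) ?D ?e ?d N"
    unfolding hom_exact_def
  proof (intro conjI allI impI)
    fix f assume f: "lin B (regular_module B) N f"
    have "f \<one>\<^bsub>B\<^esub> \<in> carrier M" using lin_closed[OF f] by (simp add: c'(3))
    then obtain y where y: "y \<in> carrier (P 0)" "f \<one>\<^bsub>B\<^esub> = \<epsilon> y" using p(4) by (metis imageE)
    show "\<exists>g. lin B (?D 0) N g \<and> (\<forall>b \<in> carrier (regular_module B). f b = g (?e b))"
      using lin_eval[OF c y(1)] lin_regular_eq[OF B.ring_axioms f, symmetric] y
      by (intro exI[of _ "\<lambda>g. g y"]) auto
  next
    fix f assume f: "lin B (?D 0) N f" and 0: "\<forall>b \<in> carrier (regular_module B). f (?e b) = \<zero>\<^bsub>N\<^esub>"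
    obtain x where x: "x \<in> carrier (P 0)" "\<And>g. g \<in> Hom A (P 0) M \<Longrightarrow> f g = g x"
      using reflexiveD(2)[OF r f] by blast
    have "?e \<one>\<^bsub>B\<^esub> \<in> Hom A (P 0) M" using lin_closed[OF el, of "\<one>\<^bsub>B\<^esub>"] by simp
    then have "\<epsilon> x = \<zero>\<^bsub>M\<^esub>" using x(2)[of "?e \<one>\<^bsub>B\<^esub>"] 0 x(1) N.smult_one[OF \<epsilon>c[OF x(1)]] by (simp add: c'(4))
    then obtain y where y: "y \<in> carrier (P 1)" "x = \<delta> 0 y" using p(6)[OF x(1)] by auto
    show "\<exists>g. lin B (?D 1) N g \<and> (\<forall>h \<in> carrier (?D 0). f h = g (?d 0 h))"
      using lin_eval[OF c y(1)] x(2) y by (intro exI[of _ "\<lambda>g. g y"]) (auto simp: compose_def)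
  next
    fix i f assume f: "lin B (?D (Suc i)) N f" and 0: "\<forall>g \<in> carrier (?D i). f (?d i g) = \<zero>\<^bsub>N\<^esub>"
    obtain x where x: "x \<in> carrier (P (Suc i))" "\<And>g. g \<in> Hom A (P (Suc i)) M \<Longrightarrow> f g = g x"
      using reflexiveD(2)[OF r f] by blast
    have "\<delta> i x = \<zero>\<^bsub>P i\<^esub>"
    proof (rule reflexiveD(1)[OF r lin_closed[OF p(5) x(1)]])
      fix g assume g: "g \<in> Hom A (P i) M"
      have "?d i g \<in> Hom A (P (Suc i)) M" using lin_closed[OF dl, of g i] g by simp
      from x(2)[OF this] show "g (\<delta> i x) = \<zero>\<^bsub>M\<^esub>"
        using x(1) 0[rule_format, of g] g by (simp add: compose_def c'(4))
    qed
    then obtain y where y: "y \<in> carrier (P (Suc (Suc i)))" "x = \<delta> (Suc i) y" using p(7)[OF x(1)] by auto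
    show "\<exists>g. lin B (?D (Suc (Suc i))) N g \<and> (\<forall>h \<in> carrier (?D (Suc i)). f h = g (?d (Suc i) h))"
      using lin_eval[OF c y(1)] x(2) y by (intro exI[of _ "\<lambda>g. g y"]) (auto simp: compose_def)
  qed
qed

section \<open>Finite coresolutions by self-orthogonal modules\<close>

lemma lin_codomain: "lin R X Y f \<Longrightarrow> f ` carrier X \<subseteq> U \<Longrightarrow> lin R X (Y\<lparr>carrier := U\<rparr>) f"
  unfolding lin_def by auto

lemma lin_codomain_extend: "lin R X (Y\<lparr>carrier := U\<rparr>) f \<Longrightarrow> U \<subseteq> carrier Y \<Longrightarrow> lin R X Y f"
  unfolding lin_def by auto

lemma lin_domain: "lin R X Y f \<Longrightarrow> U \<subseteq> carrier X \<Longrightarrow> lin R (X\<lparr>carrier := U\<rparr>) Y f"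
  unfolding lin_def by (auto simp: subset_iff)

text \<open>
  Let \<open>T i\<close> be the image in \<open>Y i\<close>. From the short exact sequences \<open>0 \<rightarrow> T i \<rightarrow> Y i \<rightarrow> T (i + 1) \<rightarrow> 0\<close> and the
  vanishing of \<open>Ext\<close> on \<open>add Z\<close>, descending induction that starts beyond the length \<open>m\<close>, where \<open>T i = 0\<close>,
  shows that \<open>Ext\<close> into \<open>N\<close> vanishes on every \<open>T i\<close>, and that maps from \<open>T i\<close> to \<open>N\<close> extend to \<open>Y i\<close>.
\<close>

lemma hom_exact_finite_coresolution:
  fixes Y :: "nat \<Rightarrow> ('a, 'y) module"
  assumes Y: "coexact R L Y e d" and Yadd: "\<And>i. in_add R Z (Y i)"
    and Y0: "\<And>i. i > m \<Longrightarrow> carrier (Y i) = {\<zero>\<^bsub>Y i\<^esub>}"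
    and S: "resol R Z S \<epsilon>'' \<delta>''" and projS: "\<And>i. in_add R (regular_module R) (S i)"
    and aS: "\<And>k. acyc_at R S \<delta>'' N k" and N: "left_module R N"
    and res: "\<And>i U. left_module R (Y i\<lparr>carrier := U\<rparr>) \<Longrightarrow> U \<subseteq> carrier (Y i) \<Longrightarrow>
      \<exists>(P :: nat \<Rightarrow> ('a, 'p) module) \<epsilon> \<delta>. resol R (Y i\<lparr>carrier := U\<rparr>) P \<epsilon> \<delta> \<and>
        (\<forall>i. in_add R (regular_module R) (P i))"
  shows "hom_exact R L Y e d N"
proof -
  note y = coexactD[OF Y]
  define I where "I i = (case i of 0 \<Rightarrow> e ` carrier L | Suc j \<Rightarrow> d j ` carrier (Y j))" for i
  define T where "T i = Y i\<lparr>carrier := I i\<rparr>" for i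
  have Isub: "I i \<subseteq> carrier (Y i)" for i
    using lin_closed[OF y(3)] lin_closed[OF y(5)] by (auto simp: I_def split: nat.split)
  have TM: "left_module R (T i)" for i
    using left_module_image[OF y(1) y(2) y(3)] left_module_image[OF y(2) y(2) y(5)]
    by (auto simp: T_def I_def split: nat.split)
  have ker: "d i x = \<zero>\<^bsub>Y (Suc i)\<^esub> \<longleftrightarrow> x \<in> I i" if "x \<in> carrier (Y i)" for i x
    using that y(6) y(7) by (cases i) (auto simp: I_def)
  have Tcar: "carrier (T i) = I i" and Tzero: "\<zero>\<^bsub>T i\<^esub> = \<zero>\<^bsub>Y i\<^esub>" for i by (simp_all add: T_def)
  \<comment> \<open>\<open>Ext\<^sup>k(T i, N) = 0\<close> for all \<open>k > 0\<close>, expressed through some projective resolution\<close>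
  define V where "V i \<longleftrightarrow> (\<exists>(P :: nat \<Rightarrow> ('a, 'p) module) \<epsilon> \<delta>. resol R (T i) P \<epsilon> \<delta> \<and>
      (\<forall>i. in_add R (regular_module R) (P i)) \<and> (\<forall>k. acyc_at R P \<delta> N k))" for i
  have Vbig: "V i" if "i > m" for i
  proof -
    have "I i = {\<zero>\<^bsub>Y i\<^esub>}"
      using Isub[of i] Y0[OF that] left_module_closed(1)[OF TM] by (auto simp: Tcar Tzero)
    then have Tadd: "in_add R Z (T i)"
      by (intro in_add_zero[OF resolD(1)[OF S] TM]) (simp add: Tcar Tzero)
    obtain P :: "nat \<Rightarrow> ('a, 'p) module" and \<epsilon> \<delta> where P: "resol R (T i) P \<epsilon> \<delta>" "\<forall>i. in_add R (regular_module R) (P i)"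
      using res[OF TM[unfolded T_def] Isub] unfolding T_def by blast
    have "acyc_at R P \<delta> N k" for k
      by (rule acyc_at_in_add[OF P(1) P(2)[rule_format] S projS Tadd N aS])
    then show ?thesis unfolding V_def using P by blast
  qed
  have \<iota>: "lin R (T i) (Y i) (\<lambda>x. x)" for i
    unfolding T_def by (rule lin_domain[OF lin_id Isub])
  have \<pi>: "lin R (Y i) (T (Suc i)) (d i)" for i
    unfolding T_def by (rule lin_codomain[OF y(5)]) (simp add: I_def)
  have surj: "d i ` carrier (Y i) = carrier (T (Suc i))" for i by (simp add: Tcar I_def)
  have step: "V i \<and> (\<forall>f. lin R (T i) N f \<longrightarrow> (\<exists>g. lin R (Y i) N g \<and> (\<forall>x \<in> I i. g x = f x)))"
    if V: "V (Suc i)" for i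
  proof -
    obtain P :: "nat \<Rightarrow> ('a, 'p) module" and \<epsilon> \<delta> where P: "resol R (T i) P \<epsilon> \<delta>" "\<forall>i. in_add R (regular_module R) (P i)"
      using res[OF TM[unfolded T_def] Isub] unfolding T_def by blast
    obtain Q :: "nat \<Rightarrow> ('a, 'p) module" and \<epsilon>' \<delta>' where Q: "resol R (T (Suc i)) Q \<epsilon>' \<delta>'"
      "\<forall>i. in_add R (regular_module R) (Q i)" "\<forall>k. acyc_at R Q \<delta>' N k"
      using V unfolding V_def by blast
    have inj: "x = \<zero>\<^bsub>T i\<^esub>" if "x = \<zero>\<^bsub>Y i\<^esub>" for x using that by (simp add: Tzero)
    have ex: "d i x = \<zero>\<^bsub>T (Suc i)\<^esub> \<longleftrightarrow> x \<in> (\<lambda>x. x) ` carrier (T i)" if "x \<in> carrier (Y i)" for x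
      using ker[OF that] by (simp add: Tzero Tcar)
    note ev = ext_vanish_left[OF P(1) P(2)[rule_format] Q(1) Q(2)[rule_format] S projS Yadd N \<iota> \<pi> inj
        surj ex aS Q(3)[rule_format]]
    have "V i" unfolding V_def using P ev(1) by blast
    moreover have "\<exists>g. lin R (Y i) N g \<and> (\<forall>x \<in> I i. g x = f x)" if "lin R (T i) N f" for f
      using ev(2)[OF _ _ that] by (simp add: Tcar)
    ultimately show ?thesis by blast
  qed
  have Vall: "V i" for i
  proof (cases "i \<le> Suc m")
    case True
    then show ?thesis by (induction rule: inc_induct) (use Vbig step in auto)
  qed (use Vbig in auto)
  have E: "\<exists>g. lin R (Y i) N g \<and> (\<forall>x \<in> I i. g x = f x)" if "lin R (T i) N f" for i f
    using step[OF Vall] that by blast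
  \<comment> \<open>A map that vanishes on \<open>I i\<close>, the kernel of \<open>d i\<close>, factors through \<open>T (Suc i)\<close> and then extends.\<close>
  have E': "\<exists>g. lin R (Y (Suc i)) N g \<and> (\<forall>x \<in> carrier (Y i). h x = g (d i x))"
    if h: "lin R (Y i) N h" and 0: "\<And>x. x \<in> I i \<Longrightarrow> h x = \<zero>\<^bsub>N\<^esub>" for i h
  proof -
    obtain t where t: "lin R (Y (Suc i)\<lparr>carrier := d i ` carrier (Y i)\<rparr>) N t"
      "\<forall>x \<in> carrier (Y i). t (d i x) = h x"
      using lin_factor[OF y(2) y(2) N y(5) h] 0 ker by blast
    have "lin R (T (Suc i)) N t" using t(1) by (simp add: T_def I_def)
    then obtain g where "lin R (Y (Suc i)) N g" "\<forall>x \<in> I (Suc i). g x = t x" using E by blast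
    then show ?thesis using t(2) by (intro exI[of _ g]) (simp add: I_def)
  qed
  show ?thesis
    unfolding hom_exact_def
  proof (intro conjI allI impI)
    fix f assume f: "lin R L N f"
    obtain t where t: "lin R (Y 0\<lparr>carrier := e ` carrier L\<rparr>) N t" "\<forall>x \<in> carrier L. t (e x) = f x"
      using lin_factor[OF y(1) y(2) N y(3) f] y(4) lin_zero[OF y(1) N f] by blast
    have "lin R (T 0) N t" using t(1) by (simp add: T_def I_def)
    then obtain g where "lin R (Y 0) N g" "\<forall>x \<in> I 0. g x = t x" using E by blast
    then show "\<exists>g. lin R (Y 0) N g \<and> (\<forall>x \<in> carrier L. f x = g (e x))"
      using t(2) by (intro exI[of _ g]) (simp add: I_def)
  next
    fix f assume "lin R (Y 0) N f" "\<forall>x \<in> carrier L. f (e x) = \<zero>\<^bsub>N\<^esub>"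
    then show "\<exists>g. lin R (Y 1) N g \<and> (\<forall>x \<in> carrier (Y 0). f x = g (d 0 x))"
      using E'[of 0 f] by (auto simp: I_def)
  next
    fix i f assume "lin R (Y (Suc i)) N f" "\<forall>x \<in> carrier (Y i). f (d i x) = \<zero>\<^bsub>N\<^esub>"
    then show "\<exists>g. lin R (Y (Suc (Suc i))) N g \<and> (\<forall>x \<in> carrier (Y (Suc i)). f x = g (d (Suc i) x))"
      using E'[of "Suc i" f] by (auto simp: I_def)
  qed
qed

section \<open>Shortening a finite projective resolution\<close>

text \<open>
  Let \<open>U j\<close> be the kernel of \<open>d j\<close>. The claim is that \<open>Ext\<^sup>i\<^sup>+\<^sup>1(M, U j) = 0\<close> whenever \<open>i + j \<ge> n\<close>.
  As \<open>Ext\<close> from \<open>M\<close> into \<open>X j\<close> vanishes, \<open>Ext\<^sup>i\<^sup>+\<^sup>1(M, U j)\<close> is a quotient of \<open>Ext\<^sup>i(M, U (j + 1))\<close>, and the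
  induction moves \<open>j\<close> up to where \<open>U j = X j\<close>.
\<close>

lemma cocycle_lift:
  assumes W: "resol A M W \<epsilon> \<delta>" and projW: "\<And>i. in_add A (regular_module A) (W i)"
    and aM: "\<And>k. acyc_at A W \<delta> M k"
    and X: "coexact A L X e d" and Xadd: "\<And>i. in_add A M (X i)"
    and X0: "\<And>i. i > n \<Longrightarrow> carrier (X i) = {\<zero>\<^bsub>X i\<^esub>}"
    and ij: "n \<le> i + j" and f: "lin A (W (Suc i)) (X j) f"
    and f0: "\<And>x. x \<in> carrier (W (Suc (Suc i))) \<Longrightarrow> f (\<delta> (Suc i) x) = \<zero>\<^bsub>X j\<^esub>"
    and df: "\<And>x. x \<in> carrier (W (Suc i)) \<Longrightarrow> d j (f x) = \<zero>\<^bsub>X (Suc j)\<^esub>"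
  shows "\<exists>g. lin A (W i) (X j) g \<and> (\<forall>x \<in> carrier (W i). d j (g x) = \<zero>\<^bsub>X (Suc j)\<^esub>) \<and>
    (\<forall>x \<in> carrier (W (Suc i)). f x = g (\<delta> i x))"
  using ij f f0 df
proof (induction "Suc n - j" arbitrary: i j f)
  case 0
  note w = resolD[OF W] and x = coexactD[OF X]
  have "f y = \<zero>\<^bsub>X j\<^esub>" if "y \<in> carrier (W (Suc i))" for y
    using lin_closed[OF 0(3) that] X0[of j] 0(1) by auto
  then show ?case
    using lin_zero_map[OF x(2)[of j]] lin_zero[OF x(2) x(2) x(5)] by (intro exI[of _ "\<lambda>_. \<zero>\<^bsub>X j\<^esub>"]) auto
next
  case (Suc k)
  note w = resolD[OF W] and x = coexactD[OF X]
  note f = Suc(4) and f0 = Suc(5) and df = Suc(6)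
  have j: "j \<le> n" and k: "k = Suc n - Suc j" using Suc(2) by auto
  obtain g where g: "lin A (W i) (X j) g" "\<And>y. y \<in> carrier (W (Suc i)) \<Longrightarrow> f y = g (\<delta> i y)"
    by (rule acyc_atE[OF acyc_at_add[OF W w(1) Xadd aM] f f0]) auto
  have dg: "lin A (W i) (X (Suc j)) (\<lambda>y. d j (g y))" by (rule lin_comp[OF x(5) g(1)])
  show ?case
  proof (cases i)
    case 0
    then have "Suc j > n" using Suc(3) j by auto
    then have "d j (g y) = \<zero>\<^bsub>X (Suc j)\<^esub>" if "y \<in> carrier (W i)" for y
      using lin_closed[OF dg that] X0[of "Suc j"] by auto
    then show ?thesis using g by blast
  next
    case (Suc i')
    have "\<exists>h. lin A (W i') (X (Suc j)) h \<and> (\<forall>y \<in> carrier (W i'). d (Suc j) (h y) = \<zero>\<^bsub>X (Suc (Suc j))\<^esub>) \<and>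
        (\<forall>y \<in> carrier (W (Suc i')). d j (g y) = h (\<delta> i' y))"
    proof (rule Suc.hyps(1)[OF k])
      show "n \<le> i' + Suc j" using Suc.prems(1) Suc by simp
      show "lin A (W (Suc i')) (X (Suc j)) (\<lambda>y. d j (g y))" using dg Suc by simp
      show "d j (g (\<delta> (Suc i') y)) = \<zero>\<^bsub>X (Suc j)\<^esub>" if "y \<in> carrier (W (Suc (Suc i')))" for y
        using df[of y] g(2)[of y] that Suc by simp
      show "d (Suc j) (d j (g y)) = \<zero>\<^bsub>X (Suc (Suc j))\<^esub>" if "y \<in> carrier (W (Suc i'))" for y
        using x(9) lin_closed[OF g(1)] that Suc by simp
    qed
    then obtain h where h: "lin A (W i') (X (Suc j)) h"
      "\<forall>y \<in> carrier (W i'). d (Suc j) (h y) = \<zero>\<^bsub>X (Suc (Suc j))\<^esub>"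
      "\<forall>y \<in> carrier (W (Suc i')). d j (g y) = h (\<delta> i' y)" by blast
    obtain h' where h': "lin A (W i') (X j) h'" "\<And>y. y \<in> carrier (W i') \<Longrightarrow> d j (h' y) = h y"
      by (rule proj_lift[OF projW x(2) x(2) x(5) h(1)]) (use h(2) x(7) lin_closed[OF h(1)] in auto)
    have hd: "lin A (W i) (X j) (\<lambda>y. h' (\<delta> i' y))" using lin_comp[OF h'(1) w(5)] Suc by simp
    \<comment> \<open>Correcting \<open>g\<close> by a coboundary moves its values into the kernel of \<open>d j\<close>.\<close>
    let ?g = "\<lambda>y. g y \<oplus>\<^bsub>X j\<^esub> mneg A (X j) (h' (\<delta> i' y))"
    have "lin A (W i) (X j) ?g" by (rule lin_diff[OF w(2) x(2) g(1) hd])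
    moreover have "d j (?g y) = \<zero>\<^bsub>X (Suc j)\<^esub>" if y: "y \<in> carrier (W i)" for y
      using lin_eq_if_diff_zero[OF x(2) x(2) x(5) lin_closed[OF g(1) y] lin_closed[OF hd y]]
        h(3) h'(2) lin_closed[OF w(5), of y i'] y Suc by simp
    moreover have "f y = ?g (\<delta> i y)" if y: "y \<in> carrier (W (Suc i))" for y
      using w(9)[of y i'] y Suc lin_zero[OF w(2) x(2) h'(1)] mneg_zero[OF x(2)] g(2)[OF y]
        left_module_add_ac(2)[OF x(2) lin_closed[OF f y]] by simp
    ultimately show ?thesis by blast
  qed
qed

text \<open>
  By the preceding lemma every cocycle of degree greater than \<open>n\<close> with values in \<open>A\<close>, hence in any
  projective module, is a coboundary. If the image \<open>B i\<close> of \<open>\<delta> i\<close> is projective and \<open>i \<ge> n\<close>, then \<open>\<delta> i\<close>, seen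
  as a cocycle with values in \<open>B i\<close>, is a coboundary, which means that \<open>B i\<close> is a direct summand of \<open>W i\<close>.
  For \<open>i > n\<close> the complement is isomorphic to \<open>B (i - 1)\<close>, so projectivity propagates downwards from
  degree \<open>m\<close>. In degree \<open>n\<close> the complement \<open>U\<close> of \<open>B n\<close> replaces \<open>W n\<close> as the last term.
\<close>

lemma projective_truncation:
  fixes W :: "nat \<Rightarrow> ('a, 'w) module"
  assumes W: "resol A M W \<epsilon> \<delta>" and projW: "\<And>i. in_add A (regular_module A) (W i)"
    and W0: "\<And>i. i > m \<Longrightarrow> carrier (W i) = {\<zero>\<^bsub>W i\<^esub>}"
    and aM: "\<And>k. acyc_at A W \<delta> M k"
    and X: "coexact A (regular_module A) X e d" and Xadd: "\<And>i. in_add A M (X i)"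
    and X0: "\<And>i. i > n \<Longrightarrow> carrier (X i) = {\<zero>\<^bsub>X i\<^esub>}"
  obtains W' :: "nat \<Rightarrow> ('a, 'w) module" and \<delta>' where "resol A M W' \<epsilon> \<delta>'"
    "\<forall>i. in_add A (regular_module A) (W' i)" "\<forall>i > n. carrier (W' i) = {\<zero>\<^bsub>W' i\<^esub>}"
proof -
  note w = resolD[OF W] and x = coexactD[OF X]
  have aA: "acyc_at A W \<delta> (regular_module A) i" if i: "n \<le> i" for i
    unfolding acyc_at_def
  proof (intro allI impI)
    fix f assume f: "lin A (W (Suc i)) (regular_module A) f"
      and f0: "\<forall>y \<in> carrier (W (Suc (Suc i))). f (\<delta> (Suc i) y) = \<zero>\<^bsub>regular_module A\<^esub>"
    note ef = lin_comp[OF x(3) f]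
    have "\<exists>g. lin A (W i) (X 0) g \<and> (\<forall>y \<in> carrier (W i). d 0 (g y) = \<zero>\<^bsub>X (Suc 0)\<^esub>) \<and>
        (\<forall>y \<in> carrier (W (Suc i)). e (f y) = g (\<delta> i y))"
      by (rule cocycle_lift[OF W projW aM X Xadd X0 _ ef])
        (use i f0 lin_zero[OF x(1) x(2) x(3)] x(8) lin_closed[OF f] in auto)
    then obtain g where g: "lin A (W i) (X 0) g" "\<forall>y \<in> carrier (W i). d 0 (g y) = \<zero>\<^bsub>X (Suc 0)\<^esub>"
      "\<forall>y \<in> carrier (W (Suc i)). e (f y) = g (\<delta> i y)" by blast
    obtain h where h: "lin A (W i) (regular_module A) h" "\<And>y. y \<in> carrier (W i) \<Longrightarrow> e (h y) = g y"
      by (rule proj_lift[OF projW x(1) x(2) x(3) g(1)]) (use g(2) x(6) lin_closed[OF g(1)] in auto)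
    have "f y = h (\<delta> i y)" if y: "y \<in> carrier (W (Suc i))" for y
    proof -
      have c: "f y \<in> carrier (regular_module A)" "h (\<delta> i y) \<in> carrier (regular_module A)"
        by (rule lin_closed[OF f y], rule lin_closed[OF h(1) lin_closed[OF w(5) y]])
      have "e (f y) = e (h (\<delta> i y))" using g(3) h(2)[OF lin_closed[OF w(5) y]] y by simp
      then have "e (f y \<oplus>\<^bsub>regular_module A\<^esub> mneg A (regular_module A) (h (\<delta> i y))) = \<zero>\<^bsub>X 0\<^esub>"
        using lin_eq_if_diff_zero[OF x(1) x(2) x(3) c] by blast
      then show ?thesis
        using x(4)[OF left_module_closed(2)[OF x(1) c(1) mneg_closed[OF x(1) c(2)]]]
          diff_eq_zero_iff[OF x(1) c] by blast
    qed
    then show "\<exists>g. lin A (W i) (regular_module A) g \<and> (\<forall>y \<in> carrier (W (Suc i)). f y = g (\<delta> i y))"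
      using h(1) by blast
  qed
  define B where "B i = W i\<lparr>carrier := \<delta> i ` carrier (W (Suc i))\<rparr>" for i
  have BM: "left_module A (B i)" for i unfolding B_def by (rule left_module_image[OF w(2) w(2) w(5)])
  have Bsub: "\<delta> i ` carrier (W (Suc i)) \<subseteq> carrier (W i)" for i using lin_closed[OF w(5)] by blast
  \<comment> \<open>a projection of \<open>W i\<close> onto \<open>B i\<close>\<close>
  have split: "\<exists>g. lin A (W i) (B i) g \<and> (\<forall>y \<in> carrier (B i). g y = y)"
    if i: "n \<le> i" and Bi: "in_add A (regular_module A) (B i)" for i
  proof -
    have l: "lin A (W (Suc i)) (B i) (\<delta> i)" unfolding B_def by (rule lin_codomain[OF w(5)]) simp
    obtain g where "lin A (W i) (B i) g" "\<And>y. y \<in> carrier (W (Suc i)) \<Longrightarrow> \<delta> i y = g (\<delta> i y)"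
      by (rule acyc_atE[OF acyc_at_add[OF W x(1) Bi aA[OF i]] l]) (use w(9) in \<open>auto simp: B_def\<close>)
    then show ?thesis by (intro exI[of _ g]) (auto simp: B_def)
  qed
  have projB: "in_add A (regular_module A) (B i)" if "n \<le> i" for i
  proof -
    have big: "in_add A (regular_module A) (B i)" if "i \<ge> m" for i
    proof (rule in_add_zero[OF x(1) BM])
      show "carrier (B i) = {\<zero>\<^bsub>B i\<^esub>}"
        using W0[of "Suc i"] that lin_zero[OF w(2) w(2) w(5)] by (simp add: B_def)
    qed
    show ?thesis
    proof (cases "i \<le> m")
      case True
      then show ?thesis using \<open>n \<le> i\<close>
      proof (induction rule: inc_induct)
        case base then show ?case by (intro big) simp
      next
        case (step i)
        have "in_add A (regular_module A) (B (Suc i))" using step by simp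
        then obtain g where g: "lin A (W (Suc i)) (B (Suc i)) g" "\<forall>y \<in> carrier (B (Suc i)). g y = y"
          using split[of "Suc i"] step by auto
        have gW: "lin A (W (Suc i)) (W (Suc i)) g"
          using lin_codomain_extend[OF g(1)[unfolded B_def] Bsub] .
        have gim: "g y \<in> \<delta> (Suc i) ` carrier (W (Suc (Suc i)))" if "y \<in> carrier (W (Suc i))" for y
          using lin_closed[OF g(1) that] by (simp add: B_def)
        have \<delta>g: "\<delta> i (g y) = \<zero>\<^bsub>W i\<^esub>" if "y \<in> carrier (W (Suc i))" for y
          using w(7)[OF lin_closed[OF gW that]] gim[OF that] by blast
        let ?r = "\<lambda>y. y \<oplus>\<^bsub>W (Suc i)\<^esub> mneg A (W (Suc i)) (g y)"
        have r: "lin A (W (Suc i)) (W (Suc i)) ?r" by (rule lin_diff[OF w(2) w(2) lin_id gW])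
        have "?r y = \<zero>\<^bsub>W (Suc i)\<^esub>" if y: "y \<in> carrier (W (Suc i))" and 0: "\<delta> i y = \<zero>\<^bsub>W i\<^esub>" for y
        proof -
          have "g y = y" using w(7)[OF y] 0 g(2) by (auto simp: B_def)
          then show ?thesis using mneg_right[OF w(2) y] by simp
        qed
        then obtain s where s: "lin A (W i\<lparr>carrier := \<delta> i ` carrier (W (Suc i))\<rparr>) (W (Suc i)) s"
          "\<forall>y \<in> carrier (W (Suc i)). s (\<delta> i y) = ?r y"
          using lin_factor[OF w(2) w(2) w(2) w(5) r] by blast
        show ?case
        proof (rule in_add_retract[OF projW x(1) BM])
          show "lin A (B i) (W (Suc i)) s" using s(1) by (simp add: B_def)
          show "lin A (W (Suc i)) (B i) (\<delta> i)" unfolding B_def by (rule lin_codomain[OF w(5)]) simp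
          fix u assume "u \<in> carrier (B i)"
          then obtain y where y: "y \<in> carrier (W (Suc i))" "u = \<delta> i y" by (auto simp: B_def)
          have "\<delta> i (?r y) = \<delta> i y \<oplus>\<^bsub>W i\<^esub> mneg A (W i) \<zero>\<^bsub>W i\<^esub>"
            using lin_add[OF w(5) y(1) mneg_closed[OF w(2) lin_closed[OF gW y(1)]]]
              lin_mneg[OF w(2) w(5) lin_closed[OF gW y(1)]] \<delta>g[OF y(1)] by simp
          then show "\<delta> i (s u) = u"
            using s(2) y mneg_zero[OF w(2)] left_module_add_ac(2)[OF w(2) lin_closed[OF w(5) y(1)]] by simp
        qed
      qed
    qed (use big in auto)
  qed
  obtain g where g: "lin A (W n) (B n) g" "\<forall>y \<in> carrier (B n). g y = y"
    using split[OF _ projB] by blast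
  have gW: "lin A (W n) (W n) g" using lin_codomain_extend[OF g(1)[unfolded B_def] Bsub] .
  have gim: "g y \<in> \<delta> n ` carrier (W (Suc n))" if "y \<in> carrier (W n)" for y
    using lin_closed[OF g(1) that] by (simp add: B_def)
  let ?r = "\<lambda>y. y \<oplus>\<^bsub>W n\<^esub> mneg A (W n) (g y)"
  have r: "lin A (W n) (W n) ?r" by (rule lin_diff[OF w(2) w(2) lin_id gW])
  define U where "U = {y \<in> carrier (W n). g y = \<zero>\<^bsub>W n\<^esub>}"
  have rU: "?r y \<in> U" if y: "y \<in> carrier (W n)" for y
    using lin_eq_if_diff_zero[OF w(2) w(2) gW y lin_closed[OF gW y]] g(2) gim[OF y] lin_closed[OF r y]
    by (simp add: U_def B_def)
  have rid: "?r y = y" if "y \<in> U" for y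
    using that mneg_zero[OF w(2)] left_module_add_ac(2)[OF w(2)] by (simp add: U_def)
  have Usub: "U \<subseteq> carrier (W n)" by (auto simp: U_def)
  have UM: "left_module A (W n\<lparr>carrier := U\<rparr>)" unfolding U_def by (rule left_module_kernel[OF w(2) w(2) gW])
  have U0: "\<zero>\<^bsub>W n\<^esub> \<in> U" using left_module_closed(1)[OF UM] by simp
  have Uker: "y = \<zero>\<^bsub>W n\<^esub>" if "y \<in> U" "y \<in> \<delta> n ` carrier (W (Suc n))" for y
    using that g(2) by (auto simp: U_def B_def)
  have projU: "in_add A (regular_module A) (W n\<lparr>carrier := U\<rparr>)"
    by (rule in_add_retract[OF projW x(1) UM lin_domain[OF lin_id Usub] lin_codomain[OF r]])
      (use rU rid in auto)
  \<comment> \<open>A map out of \<open>W n\<close> that kills \<open>B n\<close> has the same image on the complement \<open>U\<close>; this applies to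
    \<open>\<epsilon>\<close> if \<open>n = 0\<close> and to the last differential otherwise.\<close>
  have imU: "h ` U = h ` carrier (W n)"
    if h: "lin A (W n) Y h" and Y: "left_module A Y"
      and h0: "\<And>y. y \<in> carrier (W (Suc n)) \<Longrightarrow> h (\<delta> n y) = \<zero>\<^bsub>Y\<^esub>"
    for h and Y :: "('a, 'z) module"
  proof
    show "h ` U \<subseteq> h ` carrier (W n)" using Usub by blast
    show "h ` carrier (W n) \<subseteq> h ` U"
    proof (rule image_subsetI)
      fix y assume y: "y \<in> carrier (W n)"
      have "h (g y) = \<zero>\<^bsub>Y\<^esub>" using gim[OF y] h0 by auto
      then have "h (?r y) = h y"
        using lin_add[OF h y mneg_closed[OF w(2) lin_closed[OF gW y]]]
          lin_mneg[OF w(2) h lin_closed[OF gW y]] mneg_zero[OF Y]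
          left_module_add_ac(2)[OF Y lin_closed[OF h y]] by simp
      then show "h y \<in> h ` U" using rU[OF y] by (metis imageI)
    qed
  qed
  define W' where "W' i = (if i < n then W i else if i = n then W n\<lparr>carrier := U\<rparr>
      else W n\<lparr>carrier := {\<zero>\<^bsub>W n\<^esub>}\<rparr>)" for i
  define \<delta>' where "\<delta>' i = (if i < n then \<delta> i else (\<lambda>_. \<zero>\<^bsub>W n\<^esub>))" for i
  have W'sub: "carrier (W' i) \<subseteq> carrier (W i)" if "i \<le> n" for i using that Usub by (auto simp: W'_def)
  have im: "\<delta> i ` carrier (W' (Suc i)) = \<delta> i ` carrier (W (Suc i))" if "i < n" for i
  proof (cases "Suc i = n")
    case True
    have "\<delta> i ` U = \<delta> i ` carrier (W n)"
      by (rule imU) (use w(5)[of i] w(2) w(9) True in auto)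
    then show ?thesis using True by (auto simp: W'_def)
  qed (use that in \<open>auto simp: W'_def\<close>)
  have im0: "\<epsilon> ` carrier (W' 0) = \<epsilon> ` carrier (W 0)"
  proof (cases "n = 0")
    case True
    have "\<epsilon> ` U = \<epsilon> ` carrier (W n)"
      by (rule imU) (use w(3) w(1) w(8) True in auto)
    then show ?thesis using True by (auto simp: W'_def)
  qed (auto simp: W'_def)
  have ZM: "left_module A (W n\<lparr>carrier := {\<zero>\<^bsub>W n\<^esub>}\<rparr>)" by (rule left_module_zero[OF w(2)])
  have W'M: "left_module A (W' i)" for i using w(2) UM ZM by (simp add: W'_def)
  have W'z: "\<zero>\<^bsub>W' i\<^esub> = (if i < n then \<zero>\<^bsub>W i\<^esub> else \<zero>\<^bsub>W n\<^esub>)" for i by (simp add: W'_def)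
  have W'd: "lin A (W' (Suc i)) (W i) (\<delta> i)" if "i < n" for i
    using w(5)[of i] lin_domain[OF w(5)[of i], of U] Usub that by (cases "Suc i = n") (auto simp: W'_def)
  have "resol A M W' \<epsilon> \<delta>'"
    unfolding resol_def
  proof (intro conjI allI ballI)
    show "lin A (W' 0) M \<epsilon>" using w(3) lin_domain[OF w(3), of U] Usub by (cases "n = 0") (auto simp: W'_def)
    show "\<epsilon> ` carrier (W' 0) = carrier M" using im0 w(4) by simp
    show "lin A (W' (Suc i)) (W' i) (\<delta>' i)" for i
    proof (cases "i < n")
      case True
      then show ?thesis using W'd[OF True] by (simp add: \<delta>'_def W'_def[of i])
    next
      case False
      then show ?thesis using lin_zero_map[OF W'M[of i], of "W' (Suc i)"] by (simp add: \<delta>'_def W'z)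
    qed
    show "\<epsilon> y = \<zero>\<^bsub>M\<^esub> \<longleftrightarrow> y \<in> \<delta>' 0 ` carrier (W' 1)" if y: "y \<in> carrier (W' 0)" for y
    proof (cases "n = 0")
      case True
      have "carrier (W' 1) = {\<zero>\<^bsub>W n\<^esub>}" using True by (simp add: W'_def)
      moreover have "y \<in> U" using y True by (simp add: W'_def)
      ultimately show ?thesis
        using w(6)[of y] Uker[of y] Usub True lin_zero[OF w(2) w(1) w(3)] by (auto simp: \<delta>'_def)
    next
      case False
      then show ?thesis using w(6)[of y] im[of 0] y by (simp add: \<delta>'_def W'_def[of 0])
    qed
    show "\<delta>' i y = \<zero>\<^bsub>W' i\<^esub> \<longleftrightarrow> y \<in> \<delta>' (Suc i) ` carrier (W' (Suc (Suc i)))"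
      if y: "y \<in> carrier (W' (Suc i))" for i y
    proof -
      consider "Suc i < n" | "Suc i = n" | "n < Suc i" by linarith
      then show ?thesis
      proof cases
        case 1
        then show ?thesis using w(7)[of y i] im[of "Suc i"] y by (simp add: \<delta>'_def W'_def[of i] W'_def[of "Suc i"])
      next
        case 2
        have c: "carrier (W' (Suc (Suc i))) = {\<zero>\<^bsub>W n\<^esub>}" using 2 by (simp add: W'_def)
        have yU: "y \<in> U" using y 2 by (simp add: W'_def)
        have "\<delta> i y = \<zero>\<^bsub>W i\<^esub> \<longleftrightarrow> y = \<zero>\<^bsub>W n\<^esub>"
          using w(7)[of y i] Uker[OF yU] Usub yU 2 lin_zero[OF w(2) w(2) w(5), of i] by auto
        then show ?thesis using 2 c by (simp add: \<delta>'_def W'z)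
      next
        case 3
        have c: "carrier (W' (Suc (Suc i))) = {\<zero>\<^bsub>W n\<^esub>}" "y = \<zero>\<^bsub>W n\<^esub>" using 3 y by (auto simp: W'_def)
        then show ?thesis using 3 by (auto simp: \<delta>'_def W'z)
      qed
    qed
  qed (rule w(1), rule W'M)
  moreover have "in_add A (regular_module A) (W' i)" for i
    using projW projU in_add_zero_carrier[OF x(1) w(2)] by (simp add: W'_def)
  moreover have "\<forall>i > n. carrier (W' i) = {\<zero>\<^bsub>W' i\<^esub>}" by (simp add: W'_def)
  ultimately show thesis using that by blast
qed

section \<open>Transport along isomorphisms\<close>

definition mod_iso ::
  "('a, 'c) ring_scheme \<Rightarrow> ('a, 'x) module \<Rightarrow> ('a, 'y) module \<Rightarrow> ('x \<Rightarrow> 'y) \<Rightarrow> ('y \<Rightarrow> 'x) \<Rightarrow> bool" where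
  "mod_iso R X Y h g \<longleftrightarrow> left_module R X \<and> left_module R Y \<and> lin R X Y h \<and> lin R Y X g \<and>
     (\<forall>x \<in> carrier X. g (h x) = x) \<and> (\<forall>y \<in> carrier Y. h (g y) = y)"

lemma mod_isoD:
  assumes "mod_iso R X Y h g"
  shows "left_module R X" "left_module R Y" "lin R X Y h" "lin R Y X g"
    "\<And>x. x \<in> carrier X \<Longrightarrow> g (h x) = x" "\<And>y. y \<in> carrier Y \<Longrightarrow> h (g y) = y"
  using assms unfolding mod_iso_def by blast+

lemma mod_iso_sym: "mod_iso R X Y h g \<Longrightarrow> mod_iso R Y X g h"
  unfolding mod_iso_def by blast

lemma mod_iso_image: "mod_iso R X Y h g \<Longrightarrow> h ` carrier X = carrier Y"
  using mod_isoD[of R X Y h g] lin_closed[of R X Y h] lin_closed[of R Y X g] by (auto simp: image_iff) metis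

lemma mod_iso_zero: "mod_iso R X Y h g \<Longrightarrow> x \<in> carrier X \<Longrightarrow> h x = \<zero>\<^bsub>Y\<^esub> \<longleftrightarrow> x = \<zero>\<^bsub>X\<^esub>"
  using mod_isoD[of R X Y h g] lin_zero[of R X Y h] lin_zero[of R Y X g] by metis

lemma in_add_iso: "mod_iso R X Y h g \<Longrightarrow> left_module R Z \<Longrightarrow> in_add R Z X \<Longrightarrow> in_add R Z Y"
  by (rule in_add_retract[of R Z X Y g h]) (auto dest: mod_isoD)

lemma in_add_base_iso: "mod_iso R Z Z' h g \<Longrightarrow> in_add R Z X \<Longrightarrow> in_add R Z' X"
  by (rule in_add_base_retract[of R Z X Z' h g]) (auto dest: mod_isoD)

definition copy :: "('x \<Rightarrow> 'y) \<Rightarrow> ('a, 'x) module \<Rightarrow> ('a, 'y) module" where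
  "copy h X = (let g = inv_into (carrier X) h in
     \<lparr>carrier = h ` carrier X, monoid.mult = (\<lambda>u v. h (g u \<otimes>\<^bsub>X\<^esub> g v)), one = h \<one>\<^bsub>X\<^esub>,
      ring.zero = h \<zero>\<^bsub>X\<^esub>, ring.add = (\<lambda>u v. h (g u \<oplus>\<^bsub>X\<^esub> g v)),
      smult = (\<lambda>a u. h (a \<odot>\<^bsub>X\<^esub> g u))\<rparr>)"

lemma copy_simps [simp]:
  "carrier (copy h X) = h ` carrier X" "\<one>\<^bsub>copy h X\<^esub> = h \<one>\<^bsub>X\<^esub>" "\<zero>\<^bsub>copy h X\<^esub> = h \<zero>\<^bsub>X\<^esub>"
  by (simp_all add: copy_def Let_def)

lemma copy_ops [simp]:
  assumes "inj_on h (carrier X)" "x \<in> carrier X"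
  shows "y \<in> carrier X \<Longrightarrow> h x \<oplus>\<^bsub>copy h X\<^esub> h y = h (x \<oplus>\<^bsub>X\<^esub> y)"
    "y \<in> carrier X \<Longrightarrow> h x \<otimes>\<^bsub>copy h X\<^esub> h y = h (x \<otimes>\<^bsub>X\<^esub> y)"
    "a \<odot>\<^bsub>copy h X\<^esub> h x = h (a \<odot>\<^bsub>X\<^esub> x)"
  using assms by (simp_all add: copy_def Let_def)

lemma left_module_copy:
  assumes "inj_on h (carrier X)" "left_module R X"
  shows "left_module R (copy h X)"
proof -
  interpret left_module R X by fact
  show ?thesis
    by (rule left_moduleI)
      (auto simp: assms(1) left_module_ring[OF assms(2)] left_module_smult_zero[OF assms(2)]
        smult_closed smult_l_distr smult_r_distr smult_assoc smult_one M.a_ac)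
qed

lemma mod_iso_copy:
  assumes "inj_on h (carrier X)" "left_module R X"
  shows "mod_iso R X (copy h X) h (inv_into (carrier X) h)"
  unfolding mod_iso_def
proof (intro conjI ballI)
  show "lin R X (copy h X) h" by (rule linI) (use assms in auto)
  show "lin R (copy h X) X (inv_into (carrier X) h)"
    by (rule linI) (use assms left_module_closed[OF assms(2)] in auto)
qed (use assms left_module_copy[OF assms] in auto)

lemma resol_iso:
  assumes P: "resol R M P \<epsilon> \<delta>" and i: "\<And>i. mod_iso R (P i) (P' i) (h i) (g i)"
  shows "resol R M P' (\<lambda>x. \<epsilon> (g 0 x)) (\<lambda>i x. h i (\<delta> i (g (Suc i) x)))"
proof -
  note p = resolD[OF P] and d = mod_isoD[OF i]
  have z: "y \<in> (\<lambda>x. h i (\<delta> i (g (Suc i) x))) ` carrier (P' (Suc i)) \<longleftrightarrow> g i y \<in> \<delta> i ` carrier (P (Suc i))"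
    if y: "y \<in> carrier (P' i)" for i y
  proof
    assume "y \<in> (\<lambda>x. h i (\<delta> i (g (Suc i) x))) ` carrier (P' (Suc i))"
    then obtain x where x: "x \<in> carrier (P' (Suc i))" "y = h i (\<delta> i (g (Suc i) x))" by auto
    have gx: "g (Suc i) x \<in> carrier (P (Suc i))" by (rule lin_closed[OF d(4) x(1)])
    have "g i y = \<delta> i (g (Suc i) x)" using x(2) d(5)[OF lin_closed[OF p(5) gx]] by simp
    then show "g i y \<in> \<delta> i ` carrier (P (Suc i))" using gx by simp
  next
    assume "g i y \<in> \<delta> i ` carrier (P (Suc i))"
    then obtain x where x: "x \<in> carrier (P (Suc i))" "g i y = \<delta> i x" by auto
    have "y = h i (\<delta> i (g (Suc i) (h (Suc i) x)))" using d(6)[OF y] d(5)[OF x(1)] x(2) by simp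
    then show "y \<in> (\<lambda>x. h i (\<delta> i (g (Suc i) x))) ` carrier (P' (Suc i))"
      using lin_closed[OF d(3) x(1)] by blast
  qed
  show ?thesis
    unfolding resol_def
  proof (intro conjI allI ballI)
    show "lin R (P' 0) M (\<lambda>x. \<epsilon> (g 0 x))" by (rule lin_comp[OF p(3) d(4)])
    show "lin R (P' (Suc i)) (P' i) (\<lambda>x. h i (\<delta> i (g (Suc i) x)))" for i
      by (rule lin_comp[OF d(3) lin_comp[OF p(5) d(4)]])
    have "(\<lambda>x. \<epsilon> (g 0 x)) ` carrier (P' 0) = \<epsilon> ` (g 0 ` carrier (P' 0))" by auto
    then show "(\<lambda>x. \<epsilon> (g 0 x)) ` carrier (P' 0) = carrier M"
      using mod_iso_image[OF mod_iso_sym[OF i]] p(4) by simp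
    show "\<epsilon> (g 0 x) = \<zero>\<^bsub>M\<^esub> \<longleftrightarrow> x \<in> (\<lambda>x. h 0 (\<delta> 0 (g (Suc 0) x))) ` carrier (P' 1)"
      if x: "x \<in> carrier (P' 0)" for x
      using z[OF x] p(6)[OF lin_closed[OF d(4) x]] by simp
    show "h i (\<delta> i (g (Suc i) x)) = \<zero>\<^bsub>P' i\<^esub> \<longleftrightarrow>
        x \<in> (\<lambda>x. h (Suc i) (\<delta> (Suc i) (g (Suc (Suc i)) x))) ` carrier (P' (Suc (Suc i)))"
      if x: "x \<in> carrier (P' (Suc i))" for i x
      using z[OF x] p(7)[OF lin_closed[OF d(4) x]] mod_iso_zero[OF i lin_closed[OF p(5) lin_closed[OF d(4) x]]]
      by simp
  qed (rule p(1), rule d(2))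
qed

lemma resol_augmentation_iso:
  assumes P: "resol R M P \<epsilon> \<delta>" and i: "mod_iso R M M' h g"
  shows "resol R M' P (\<lambda>x. h (\<epsilon> x)) \<delta>"
proof -
  note p = resolD[OF P] and d = mod_isoD[OF i]
  have "(\<lambda>x. h (\<epsilon> x)) ` carrier (P 0) = h ` (\<epsilon> ` carrier (P 0))" by auto
  then have im: "(\<lambda>x. h (\<epsilon> x)) ` carrier (P 0) = carrier M'"
    using mod_iso_image[OF i] p(4) by simp
  show ?thesis
    unfolding resol_def
  proof (intro conjI allI ballI)
    show "lin R (P 0) M' (\<lambda>x. h (\<epsilon> x))" by (rule lin_comp[OF d(3) p(3)])
    show "h (\<epsilon> x) = \<zero>\<^bsub>M'\<^esub> \<longleftrightarrow> x \<in> \<delta> 0 ` carrier (P 1)" if "x \<in> carrier (P 0)" for x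
      using p(6)[OF that] mod_iso_zero[OF i lin_closed[OF p(3) that]] by simp
  qed (use p(2) p(5) p(7) d(2) im in auto)
qed

lemma coexact_iso:
  assumes X: "coexact R M X e d" and i: "\<And>i. mod_iso R (X i) (X' i) (h i) (g i)"
  shows "coexact R M X' (\<lambda>x. h 0 (e x)) (\<lambda>i x. h (Suc i) (d i (g i x)))"
proof -
  note x = coexactD[OF X] and k = mod_isoD[OF i]
  have z: "y \<in> (\<lambda>x. h (Suc i) (d i (g i x))) ` carrier (X' i) \<longleftrightarrow> g (Suc i) y \<in> d i ` carrier (X i)"
    if y: "y \<in> carrier (X' (Suc i))" for i y
  proof
    assume "y \<in> (\<lambda>x. h (Suc i) (d i (g i x))) ` carrier (X' i)"
    then obtain u where u: "u \<in> carrier (X' i)" "y = h (Suc i) (d i (g i u))" by auto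
    have gu: "g i u \<in> carrier (X i)" by (rule lin_closed[OF k(4) u(1)])
    have "g (Suc i) y = d i (g i u)" using u(2) k(5)[OF lin_closed[OF x(5) gu]] by simp
    then show "g (Suc i) y \<in> d i ` carrier (X i)" using gu by simp
  next
    assume "g (Suc i) y \<in> d i ` carrier (X i)"
    then obtain u where u: "u \<in> carrier (X i)" "g (Suc i) y = d i u" by auto
    have "y = h (Suc i) (d i (g i (h i u)))" using k(6)[OF y] k(5)[OF u(1)] u(2) by simp
    then show "y \<in> (\<lambda>x. h (Suc i) (d i (g i x))) ` carrier (X' i)"
      using lin_closed[OF k(3) u(1)] by blast
  qed
  have z0: "y \<in> (\<lambda>x. h 0 (e x)) ` carrier M \<longleftrightarrow> g 0 y \<in> e ` carrier M" if y: "y \<in> carrier (X' 0)" for y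
  proof
    assume "y \<in> (\<lambda>x. h 0 (e x)) ` carrier M"
    then obtain u where u: "u \<in> carrier M" "y = h 0 (e u)" by auto
    then show "g 0 y \<in> e ` carrier M" using k(5)[OF lin_closed[OF x(3) u(1)]] by simp
  next
    assume "g 0 y \<in> e ` carrier M"
    then obtain u where u: "u \<in> carrier M" "g 0 y = e u" by auto
    then have "y = h 0 (e u)" using k(6)[OF y] by simp
    then show "y \<in> (\<lambda>x. h 0 (e x)) ` carrier M" using u(1) by blast
  qed
  show ?thesis
    unfolding coexact_def
  proof (intro conjI allI ballI impI)
    show "lin R M (X' 0) (\<lambda>x. h 0 (e x))" by (rule lin_comp[OF k(3) x(3)])
    show "lin R (X' i) (X' (Suc i)) (\<lambda>x. h (Suc i) (d i (g i x)))" for i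
      by (rule lin_comp[OF k(3) lin_comp[OF x(5) k(4)]])
    show "u = \<zero>\<^bsub>M\<^esub>" if "u \<in> carrier M" "h 0 (e u) = \<zero>\<^bsub>X' 0\<^esub>" for u
      using that x(4) mod_iso_zero[OF i lin_closed[OF x(3)]] by blast
    show "h (Suc 0) (d 0 (g 0 y)) = \<zero>\<^bsub>X' 1\<^esub> \<longleftrightarrow> y \<in> (\<lambda>x. h 0 (e x)) ` carrier M"
      if y: "y \<in> carrier (X' 0)" for y
      using z0[OF y] x(6)[OF lin_closed[OF k(4) y]] mod_iso_zero[OF i lin_closed[OF x(5) lin_closed[OF k(4) y]]] by simp
    show "h (Suc (Suc i)) (d (Suc i) (g (Suc i) y)) = \<zero>\<^bsub>X' (Suc (Suc i))\<^esub> \<longleftrightarrow>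
        y \<in> (\<lambda>x. h (Suc i) (d i (g i x))) ` carrier (X' i)"
      if y: "y \<in> carrier (X' (Suc i))" for i y
      using z[OF y] x(7)[OF lin_closed[OF k(4) y]] mod_iso_zero[OF i lin_closed[OF x(5) lin_closed[OF k(4) y]]] by simp
  qed (rule x(1), rule k(2))
qed

lemma hom_exact_iso:
  assumes X: "coexact R M X e d" and H: "hom_exact R M X e d T"
    and i: "\<And>i. mod_iso R (X i) (X' i) (h i) (g i)"
  shows "hom_exact R M X' (\<lambda>x. h 0 (e x)) (\<lambda>i x. h (Suc i) (d i (g i x))) T"
proof -
  note x = coexactD[OF X] and k = mod_isoD[OF i]
  show ?thesis
    unfolding hom_exact_def
  proof (intro conjI allI impI)
    fix f assume f: "lin R M T f"
    obtain t where t: "lin R (X 0) T t" "\<forall>y \<in> carrier M. f y = t (e y)"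
      using hom_exactD(1)[OF H f] by blast
    show "\<exists>t. lin R (X' 0) T t \<and> (\<forall>y \<in> carrier M. f y = t (h 0 (e y)))"
      using lin_comp[OF t(1) k(4)] t(2) k(5) lin_closed[OF x(3)]
      by (intro exI[of _ "\<lambda>y. t (g 0 y)"]) simp
  next
    fix f assume f: "lin R (X' 0) T f" and 0: "\<forall>y \<in> carrier M. f (h 0 (e y)) = \<zero>\<^bsub>T\<^esub>"
    obtain t where t: "lin R (X 1) T t" "\<forall>y \<in> carrier (X 0). f (h 0 y) = t (d 0 y)"
      using hom_exactD(2)[OF H lin_comp[OF f k(3)]] 0 by blast
    have "f y = t (g 1 (h 1 (d 0 (g 0 y))))" if y: "y \<in> carrier (X' 0)" for y
      using t(2)[rule_format, OF lin_closed[OF k(4) y]] k(6)[OF y] k(5)[OF lin_closed[OF x(5) lin_closed[OF k(4) y]]] by simp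
    then show "\<exists>t. lin R (X' 1) T t \<and> (\<forall>y \<in> carrier (X' 0). f y = t (h (Suc 0) (d 0 (g 0 y))))"
      using lin_comp[OF t(1) k(4)] by (intro exI[of _ "\<lambda>y. t (g 1 y)"]) simp
  next
    fix i f assume f: "lin R (X' (Suc i)) T f"
      and 0: "\<forall>y \<in> carrier (X' i). f (h (Suc i) (d i (g i y))) = \<zero>\<^bsub>T\<^esub>"
    have "f (h (Suc i) (d i y)) = \<zero>\<^bsub>T\<^esub>" if "y \<in> carrier (X i)" for y
      using 0[rule_format, OF lin_closed[OF k(3) that]] k(5)[OF that] by simp
    then obtain t where t: "lin R (X (Suc (Suc i))) T t" "\<forall>y \<in> carrier (X (Suc i)). f (h (Suc i) y) = t (d (Suc i) y)"
      using hom_exactD(3)[OF H lin_comp[OF f k(3)]] by blast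
    have "f y = t (g (Suc (Suc i)) (h (Suc (Suc i)) (d (Suc i) (g (Suc i) y))))"
      if y: "y \<in> carrier (X' (Suc i))" for y
      using t(2)[rule_format, OF lin_closed[OF k(4) y]] k(6)[OF y] k(5)[OF lin_closed[OF x(5) lin_closed[OF k(4) y]]] by simp
    then show "\<exists>t. lin R (X' (Suc (Suc i))) T t \<and>
        (\<forall>y \<in> carrier (X' (Suc i)). f y = t (h (Suc (Suc i)) (d (Suc i) (g (Suc i) y))))"
      using lin_comp[OF t(1) k(4)] by (intro exI[of _ "\<lambda>y. t (g (Suc (Suc i)) y)"]) simp
  qed
qed

lemma hom_exact_target_iso:
  assumes H: "hom_exact R M X e d T" and i: "mod_iso R T T' h g"
  shows "hom_exact R M X e d T'"
proof -
  note k = mod_isoD[OF i]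
  show ?thesis
    unfolding hom_exact_def
  proof (intro conjI allI impI)
    fix f assume f: "lin R M T' f"
    obtain t where t: "lin R (X 0) T t" "\<forall>y \<in> carrier M. g (f y) = t (e y)"
      using hom_exactD(1)[OF H lin_comp[OF k(4) f]] by blast
    show "\<exists>t. lin R (X 0) T' t \<and> (\<forall>y \<in> carrier M. f y = t (e y))"
      using lin_comp[OF k(3) t(1)] t(2)[rule_format, symmetric] k(6)[OF lin_closed[OF f]] by (intro exI[of _ "\<lambda>y. h (t y)"]) simp
  next
    fix f assume f: "lin R (X 0) T' f" and 0: "\<forall>y \<in> carrier M. f (e y) = \<zero>\<^bsub>T'\<^esub>"
    obtain t where t: "lin R (X 1) T t" "\<forall>y \<in> carrier (X 0). g (f y) = t (d 0 y)"
      using hom_exactD(2)[OF H lin_comp[OF k(4) f]] 0 lin_zero[OF k(2) k(1) k(4)] by auto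
    show "\<exists>t. lin R (X 1) T' t \<and> (\<forall>y \<in> carrier (X 0). f y = t (d 0 y))"
      using lin_comp[OF k(3) t(1)] t(2)[rule_format, symmetric] k(6)[OF lin_closed[OF f]] by (intro exI[of _ "\<lambda>y. h (t y)"]) simp
  next
    fix i f assume f: "lin R (X (Suc i)) T' f" and 0: "\<forall>y \<in> carrier (X i). f (d i y) = \<zero>\<^bsub>T'\<^esub>"
    obtain t where t: "lin R (X (Suc (Suc i))) T t" "\<forall>y \<in> carrier (X (Suc i)). g (f y) = t (d (Suc i) y)"
      using hom_exactD(3)[OF H lin_comp[OF k(4) f]] 0 lin_zero[OF k(2) k(1) k(4)] by auto
    show "\<exists>t. lin R (X (Suc (Suc i))) T' t \<and> (\<forall>y \<in> carrier (X (Suc i)). f y = t (d (Suc i) y))"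
      using lin_comp[OF k(3) t(1)] t(2)[rule_format, symmetric] k(6)[OF lin_closed[OF f]] by (intro exI[of _ "\<lambda>y. h (t y)"]) simp
  qed
qed

text \<open>
  An object of \<open>add Z\<close> embeds into a power of \<open>Z\<close>, whose elements have type \<open>nat \<Rightarrow> 'z\<close>.
\<close>

lemma in_add_standard_copy:
  fixes X :: "nat \<Rightarrow> ('a, 'x) module" and Z :: "('a, 'z) module"
  assumes X: "\<And>i. in_add R Z (X i)" and Z: "left_module R Z"
  obtains X' :: "nat \<Rightarrow> ('a, nat \<Rightarrow> 'z) module" and h g where
    "\<And>i. mod_iso R (X i) (X' i) (h i) (g i)" "\<And>i. in_add R Z (X' i)"
    "\<And>i. carrier (X i) = {\<zero>\<^bsub>X i\<^esub>} \<Longrightarrow> carrier (X' i) = {\<zero>\<^bsub>X' i\<^esub>}"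
proof -
  have "\<exists>h :: 'x \<Rightarrow> nat \<Rightarrow> 'z. inj_on h (carrier (X i))" for i
    using X[of i] unfolding in_add_def bij_betw_def by blast
  then obtain h :: "nat \<Rightarrow> 'x \<Rightarrow> nat \<Rightarrow> 'z" where h: "\<And>i. inj_on (h i) (carrier (X i))" by metis
  have i: "mod_iso R (X i) (copy (h i) (X i)) (h i) (inv_into (carrier (X i)) (h i))" for i
    by (rule mod_iso_copy[OF h in_add_left_module[OF X]])
  show thesis
    by (rule that[of "\<lambda>i. copy (h i) (X i)" h "\<lambda>i. inv_into (carrier (X i)) (h i)"])
      (use i in_add_iso[OF i Z X] in auto)
qed

section \<open>Resolutions and coresolutions in the extensional setting\<close>

lemma a_kernel_eq: "a_kernel X Y f = {x \<in> carrier X. f x = \<zero>\<^bsub>Y\<^esub>}"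
  by (simp add: a_kernel_def kernel_def)

lemma resol_projective_resolution:
  assumes "projective_resolution R M P \<epsilon> \<delta>" "left_module R M"
  shows "resol R M P \<epsilon> \<delta>" "\<And>i. in_add R (regular_module R) (P i)"
proof -
  note a = assms(1)[unfolded projective_resolution_def]
  note a1 = a[THEN conjunct1, rule_format] and b1 = a[THEN conjunct2]
  note a2 = b1[THEN conjunct1] and b2 = b1[THEN conjunct2]
  note a3 = b2[THEN conjunct1] and b3 = b2[THEN conjunct2]
  note a4 = b3[THEN conjunct1, rule_format] and b4 = b3[THEN conjunct2]
  note a5 = b4[THEN conjunct1] and a6 = b4[THEN conjunct2, rule_format]
  show i: "in_add R (regular_module R) (P i)" for i by (rule a1)
  have l: "lin R (P (Suc i)) (P i) (\<delta> i)" for i by (rule Hom_lin[OF a4])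
  have k0: "{x \<in> carrier (P 0). \<epsilon> x = \<zero>\<^bsub>M\<^esub>} = \<delta> 0 ` carrier (P 1)"
    using a5 by (simp only: a_kernel_eq)
  have k1: "{x \<in> carrier (P (Suc i)). \<delta> i x = \<zero>\<^bsub>P i\<^esub>} = \<delta> (Suc i) ` carrier (P (Suc (Suc i)))" for i
    using a6[of i] by (simp only: a_kernel_eq)
  show "resol R M P \<epsilon> \<delta>"
    unfolding resol_def
  proof (intro conjI allI ballI)
    show "lin R (P 0) M \<epsilon>" by (rule Hom_lin[OF a2])
    show "\<epsilon> ` carrier (P 0) = carrier M" by (rule a3)
    show "\<epsilon> x = \<zero>\<^bsub>M\<^esub> \<longleftrightarrow> x \<in> \<delta> 0 ` carrier (P 1)" if "x \<in> carrier (P 0)" for x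
      unfolding k0[symmetric] using that by simp
    show "\<delta> i x = \<zero>\<^bsub>P i\<^esub> \<longleftrightarrow> x \<in> \<delta> (Suc i) ` carrier (P (Suc (Suc i)))" if "x \<in> carrier (P (Suc i))" for i x
      unfolding k1[symmetric] using that by simp
  qed (use assms(2) in_add_left_module[OF i] l in auto)
qed

lemma projective_resolution_of_resol:
  fixes Q :: "nat \<Rightarrow> ('a, 'q) module"
  assumes Q: "resol R M Q \<epsilon> \<delta>" and proj: "\<And>i. in_add R (regular_module R) (Q i)"
  obtains P \<epsilon>' \<delta>' where "projective_resolution R M P \<epsilon>' \<delta>'"
    "\<And>i. carrier (Q i) = {\<zero>\<^bsub>Q i\<^esub>} \<Longrightarrow> carrier (P i) = {\<zero>\<^bsub>P i\<^esub>}"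
proof -
  note q = resolD[OF Q]
  note RR = left_module_regular[OF left_module_ring[OF q(1)]]
  obtain P :: "nat \<Rightarrow> ('a, nat \<Rightarrow> 'a) module" and h g where
    i: "\<And>i. mod_iso R (Q i) (P i) (h i) (g i)" and Padd: "\<And>i. in_add R (regular_module R) (P i)"
    and z: "\<And>i. carrier (Q i) = {\<zero>\<^bsub>Q i\<^esub>} \<Longrightarrow> carrier (P i) = {\<zero>\<^bsub>P i\<^esub>}"
    using in_add_standard_copy[of R "regular_module R" Q, OF proj RR] by metis
  obtain \<epsilon>' \<delta>' where P: "resol R M P \<epsilon>' \<delta>'" using resol_iso[OF Q i] by blast
  note p = resolD[OF P]
  have "projective_resolution R M P (restrict \<epsilon>' (carrier (P 0))) (\<lambda>i. restrict (\<delta>' i) (carrier (P (Suc i))))"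
    unfolding projective_resolution_def a_kernel_eq
  proof (intro conjI allI)
    show "restrict \<epsilon>' (carrier (P 0)) \<in> Hom R (P 0) M" by (rule restrict_Hom[OF p(2,3)])
    show "restrict (\<delta>' i) (carrier (P (Suc i))) \<in> Hom R (P (Suc i)) (P i)" for i
      by (rule restrict_Hom[OF p(2,5)])
    show "restrict \<epsilon>' (carrier (P 0)) ` carrier (P 0) = carrier M" using p(4) by simp
    show "{x \<in> carrier (P 0). restrict \<epsilon>' (carrier (P 0)) x = \<zero>\<^bsub>M\<^esub>} =
        restrict (\<delta>' 0) (carrier (P (Suc 0))) ` carrier (P 1)"
      using p(6) lin_closed[OF p(5)[of 0]] by auto
    show "{x \<in> carrier (P (Suc i)). restrict (\<delta>' i) (carrier (P (Suc i))) x = \<zero>\<^bsub>P i\<^esub>} =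
        restrict (\<delta>' (Suc i)) (carrier (P (Suc (Suc i)))) ` carrier (P (Suc (Suc i)))" for i
      using p(7) lin_closed[OF p(5)[of "Suc i"]] by auto
  qed (rule Padd)
  then show thesis using that z by blast
qed

lemma proj_dim_le:
  assumes Q: "resol R M Q \<epsilon> \<delta>" and proj: "\<And>i. in_add R (regular_module R) (Q i)"
    and z: "\<And>i. i > n \<Longrightarrow> carrier (Q i) = {\<zero>\<^bsub>Q i\<^esub>}"
  shows "proj_dim R M \<le> enat n"
  unfolding proj_dim_def
proof (rule Inf_lower)
  obtain P \<epsilon>' \<delta>' where "projective_resolution R M P \<epsilon>' \<delta>'"
    "\<And>i. carrier (Q i) = {\<zero>\<^bsub>Q i\<^esub>} \<Longrightarrow> carrier (P i) = {\<zero>\<^bsub>P i\<^esub>}"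
    using projective_resolution_of_resol[OF Q proj] by metis
  then show "enat n \<in> {enat n |n. \<exists>P \<epsilon> \<delta>. projective_resolution R M P \<epsilon> \<delta> \<and>
      (\<forall>i>n. carrier (P i) = {\<zero>\<^bsub>P i\<^esub>})}" using z by blast
qed

text \<open>
  The quotient of the cocycles by the coboundaries is trivial if and only if the two subgroups agree.
\<close>

lemma Ext_trivial_iff:
  assumes ch: "chosen_resolution R M = (P, \<delta>)" and P: "resol R M P \<epsilon> \<delta>" and N: "left_module R N"
  shows "trivial_group (Ext R (Suc i) M N) \<longleftrightarrow> acyc_at R P \<delta> N i"
proof -
  note p = resolD[OF P] and nc = left_module_closed[OF N] and nac = left_module_add_ac[OF N]
  let ?X = "P (Suc i)"
  define Z where "Z = cocycles R P \<delta> N (Suc i)"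
  define H where "H = coboundaries R P \<delta> N (Suc i)"
  define G where "G = Hom_group R ?X N\<lparr>carrier := Z\<rparr>"
  have Ziff: "f \<in> Z \<longleftrightarrow> f \<in> Hom R ?X N \<and> (\<forall>x \<in> carrier (P (Suc (Suc i))). f (\<delta> (Suc i) x) = \<zero>\<^bsub>N\<^esub>)" for f
    by (auto simp: Z_def cocycles_def compose_eq_zero_hom_iff)
  have Hiff: "f \<in> H \<longleftrightarrow> f \<in> Hom R ?X N \<and> (\<exists>g. lin R (P i) N g \<and> (\<forall>x \<in> carrier ?X. f x = g (\<delta> i x)))" for f
  proof
    assume "f \<in> H"
    then obtain g where g: "g \<in> Hom R (P i) N" "f = compose (carrier ?X) g (\<delta> i)" by (auto simp: H_def)
    then have "f \<in> Hom R ?X N" unfolding compose_def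
      using restrict_Hom[OF p(2) lin_comp[OF Hom_lin[OF g(1)] p(5)]] by simp
    then show "f \<in> Hom R ?X N \<and> (\<exists>g. lin R (P i) N g \<and> (\<forall>x \<in> carrier ?X. f x = g (\<delta> i x)))"
      using Hom_lin[OF g(1)] g(2) by (auto simp: compose_def)
  next
    assume a: "f \<in> Hom R ?X N \<and> (\<exists>g. lin R (P i) N g \<and> (\<forall>x \<in> carrier ?X. f x = g (\<delta> i x)))"
    then obtain g where g: "lin R (P i) N g" "\<forall>x \<in> carrier ?X. f x = g (\<delta> i x)" by blast
    have "f = compose (carrier ?X) (restrict g (carrier (P i))) (\<delta> i)"
      using a g(2) lin_closed[OF p(5)] by (auto simp: fun_eq_iff compose_def Hom_iff extensional_def)
    then show "f \<in> H" using restrict_Hom[OF p(2) g(1)] by (auto simp: H_def)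
  qed
  have HZ: "H \<subseteq> Z"
  proof
    fix f assume "f \<in> H"
    then obtain g where g: "f \<in> Hom R ?X N" "lin R (P i) N g" "\<forall>x \<in> carrier ?X. f x = g (\<delta> i x)"
      unfolding Hiff by blast
    then show "f \<in> Z" unfolding Ziff using lin_closed[OF p(5)] p(9) lin_zero[OF p(2) N g(2)] by simp
  qed
  have mult: "f \<otimes>\<^bsub>G\<^esub> g = (\<lambda>x \<in> carrier ?X. f x \<oplus>\<^bsub>N\<^esub> g x)" and one: "\<one>\<^bsub>G\<^esub> = zero_hom ?X N"
    and car: "carrier G = Z" for f g
    by (simp_all add: G_def Hom_group_def)
  have v: "f x \<in> carrier N" if "f \<in> Z" "x \<in> carrier ?X" for f x
    using that lin_closed[OF Hom_lin, of f R ?X N x] unfolding Ziff by blast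
  have undef: "f x = undefined" if "f \<in> Z" "x \<notin> carrier ?X" for f x
    using that unfolding Ziff by (auto simp: Hom_iff extensional_def)
  have eqI: "f = g" if "f \<in> Z" "g \<in> Z" "\<And>x. x \<in> carrier ?X \<Longrightarrow> f x = g x" for f g
    using that undef by (metis ext)
  have multZ: "f \<otimes>\<^bsub>G\<^esub> g \<in> Z" if f: "f \<in> Z" and g: "g \<in> Z" for f g
    unfolding Ziff mult
  proof (intro conjI ballI)
    show "(\<lambda>x \<in> carrier ?X. f x \<oplus>\<^bsub>N\<^esub> g x) \<in> Hom R ?X N"
      using restrict_Hom[OF p(2) lin_plus[OF N Hom_lin Hom_lin]] f g unfolding Ziff by blast
    show "(\<lambda>x \<in> carrier ?X. f x \<oplus>\<^bsub>N\<^esub> g x) (\<delta> (Suc i) x) = \<zero>\<^bsub>N\<^esub>" if "x \<in> carrier (P (Suc (Suc i)))" for x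
      using f g that lin_closed[OF p(5) that] unfolding Ziff by (simp add: nac nc)
  qed
  have multH: "f \<otimes>\<^bsub>G\<^esub> g \<in> H" if f: "f \<in> H" and g: "g \<in> H" for f g
  proof -
    obtain f' g' where f': "lin R (P i) N f'" "\<forall>x \<in> carrier ?X. f x = f' (\<delta> i x)"
      and g': "lin R (P i) N g'" "\<forall>x \<in> carrier ?X. g x = g' (\<delta> i x)"
      using f g unfolding Hiff by blast
    have "f \<otimes>\<^bsub>G\<^esub> g \<in> Hom R ?X N" using multZ HZ f g Ziff by blast
    then show ?thesis unfolding Hiff mult
      using lin_plus[OF N f'(1) g'(1)] f'(2) g'(2)
      by (intro conjI exI[of _ "\<lambda>x. f' x \<oplus>\<^bsub>N\<^esub> g' x"]) auto
  qed
  have oneH: "zero_hom ?X N \<in> H"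
    unfolding Hiff using zero_hom_Hom[OF p(2) N] lin_zero_map[OF N, of "P i"]
    by (auto simp: zero_hom_def)
  define neg where "neg f = (\<lambda>x \<in> carrier ?X. mneg R N (f x))" for f
  have negHom: "neg f \<in> Hom R ?X N" if "f \<in> Hom R ?X N" for f
    unfolding neg_def by (rule restrict_Hom[OF p(2) lin_mneg_map[OF p(2) N Hom_lin[OF that]]])
  have negZ: "neg f \<in> Z" if f: "f \<in> Z" for f
    unfolding Ziff using negHom[of f] f lin_closed[OF p(5)] mneg_zero[OF N] unfolding Ziff
    by (auto simp: neg_def)
  have negH: "neg f \<in> H" if f: "f \<in> H" for f
  proof -
    obtain g where g: "f \<in> Hom R ?X N" "lin R (P i) N g" "\<forall>x \<in> carrier ?X. f x = g (\<delta> i x)"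
      using f unfolding Hiff by blast
    show ?thesis unfolding Hiff
      using negHom[OF g(1)] lin_mneg_map[OF p(2) N g(2)] g(3)
      by (intro conjI exI[of _ "\<lambda>x. mneg R N (g x)"]) (auto simp: neg_def)
  qed
  have neg_mult: "neg f \<otimes>\<^bsub>G\<^esub> f = \<one>\<^bsub>G\<^esub>" if f: "f \<in> Z" for f
    by (rule eqI) (use multZ[OF negZ[OF f] f] oneH HZ one v[OF f] mneg_left[OF N] in
      \<open>auto simp: mult neg_def zero_hom_def\<close>)
  interpret G: comm_group G
  proof (rule comm_groupI, unfold car)
    fix f g h assume fgh: "f \<in> Z" "g \<in> Z" "h \<in> Z"
    show "f \<otimes>\<^bsub>G\<^esub> g \<otimes>\<^bsub>G\<^esub> h = f \<otimes>\<^bsub>G\<^esub> (g \<otimes>\<^bsub>G\<^esub> h)"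
      using fgh by (auto simp: mult fun_eq_iff nac v)
  next
    fix f g assume fg: "f \<in> Z" "g \<in> Z"
    show "f \<otimes>\<^bsub>G\<^esub> g \<in> Z" using multZ fg by blast
    show "f \<otimes>\<^bsub>G\<^esub> g = g \<otimes>\<^bsub>G\<^esub> f"
      using fg by (simp add: mult fun_eq_iff restrict_def nac(3) v)
  next
    show "\<one>\<^bsub>G\<^esub> \<in> Z" using oneH HZ one by auto
    fix f assume f: "f \<in> Z"
    show "\<one>\<^bsub>G\<^esub> \<otimes>\<^bsub>G\<^esub> f = f"
    proof (rule eqI[OF _ f])
      show "\<one>\<^bsub>G\<^esub> \<otimes>\<^bsub>G\<^esub> f \<in> Z" using multZ[OF _ f] oneH HZ one by auto
    qed (use v[OF f] nac one in \<open>simp add: mult zero_hom_def\<close>)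
    show "\<exists>g \<in> Z. g \<otimes>\<^bsub>G\<^esub> f = \<one>\<^bsub>G\<^esub>" using neg_mult negZ f by blast
  qed
  have sub: "subgroup H G"
  proof (rule G.subgroupI)
    show "H \<subseteq> carrier G" using HZ car by simp
    show "H \<noteq> {}" using oneH by blast
    show "inv\<^bsub>G\<^esub> f \<in> H" if "f \<in> H" for f
    proof -
      have "inv\<^bsub>G\<^esub> f = neg f"
        by (rule G.inv_equality) (use neg_mult negZ HZ car that in auto)
      then show ?thesis using negH[OF that] by simp
    qed
  qed (rule multH)
  have E: "Ext R (Suc i) M N = G Mod H"
    by (simp add: Ext_def ch Hom_cohomology_def G_def H_def Z_def)
  have grp: "group (G Mod H)" using G.abelian_FactGroup[OF sub] by (simp add: comm_group_def)
  have "trivial_group (Ext R (Suc i) M N) \<longleftrightarrow> Z \<subseteq> H"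
  proof
    assume "trivial_group (Ext R (Suc i) M N)"
    then have t: "carrier (G Mod H) = {H}" by (simp add: E trivial_group_def)
    show "Z \<subseteq> H"
    proof
      fix f assume "f \<in> Z"
      then have f: "f \<in> carrier G" by (simp add: car)
      then have "H #>\<^bsub>G\<^esub> f = H" using t by (auto simp: carrier_FactGroup)
      then show "f \<in> H" using G.rcos_self[OF f sub] by simp
    qed
  next
    assume ZH: "Z \<subseteq> H"
    have "H #>\<^bsub>G\<^esub> f = H" if "f \<in> carrier G" for f
      using G.coset_join2[OF that sub] that ZH car by blast
    then have "carrier (G Mod H) = {H}"
      using G.one_closed by (auto simp: carrier_FactGroup)
    then show "trivial_group (Ext R (Suc i) M N)" using grp by (simp add: E trivial_group_def)
  qed
  also have "\<dots> \<longleftrightarrow> acyc_at R P \<delta> N i"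
  proof
    assume ZH: "Z \<subseteq> H"
    show "acyc_at R P \<delta> N i"
      unfolding acyc_at_def
    proof (intro allI impI)
      fix f assume f: "lin R ?X N f" and 0: "\<forall>x \<in> carrier (P (Suc (Suc i))). f (\<delta> (Suc i) x) = \<zero>\<^bsub>N\<^esub>"
      have "restrict f (carrier ?X) \<in> Z"
        unfolding Ziff using restrict_Hom[OF p(2) f] 0 lin_closed[OF p(5)] by simp
      then have "restrict f (carrier ?X) \<in> H" using ZH by blast
      then show "\<exists>g. lin R (P i) N g \<and> (\<forall>x \<in> carrier ?X. f x = g (\<delta> i x))"
        unfolding Hiff by simp
    qed
  next
    assume a: "acyc_at R P \<delta> N i"
    show "Z \<subseteq> H"
    proof
      fix f assume "f \<in> Z"
      then show "f \<in> H" using a unfolding Ziff Hiff acyc_at_def by (simp add: Hom_iff)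
    qed
  qed
  finally show ?thesis .
qed

text \<open>
  The chosen resolution in the definition of \<open>Ext\<close> can be replaced by any other one, because vanishing is
  transferred between any two projective resolutions of \<open>M\<close> by \<open>acyc_at_in_add\<close>.
\<close>

lemma self_orthogonal_iff:
  assumes Q: "resol R M Q \<epsilon> \<delta>" and proj: "\<And>i. in_add R (regular_module R) (Q i)"
  shows "self_orthogonal R M \<longleftrightarrow> (\<forall>k. acyc_at R Q \<delta> M k)"
proof -
  note M = resolD(1)[OF Q]
  have "\<exists>P \<delta> \<epsilon>. projective_resolution R M P \<epsilon> \<delta>"
    using projective_resolution_of_resol[OF Q proj] by metis
  then have "\<exists>u. (case u of (P, \<delta>) \<Rightarrow> \<exists>\<epsilon>. projective_resolution R M P \<epsilon> \<delta>)" by blast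
  then have "case chosen_resolution R M of (P, \<delta>) \<Rightarrow> \<exists>\<epsilon>. projective_resolution R M P \<epsilon> \<delta>"
    unfolding chosen_resolution_def by (rule someI_ex)
  moreover obtain P \<delta>' where ch: "chosen_resolution R M = (P, \<delta>')" by (cases "chosen_resolution R M")
  ultimately obtain \<epsilon>' where "projective_resolution R M P \<epsilon>' \<delta>'" by auto
  from resol_projective_resolution[OF this M]
  have P: "resol R M P \<epsilon>' \<delta>'" and projP: "\<And>i. in_add R (regular_module R) (P i)" .
  have "self_orthogonal R M \<longleftrightarrow> (\<forall>k. trivial_group (Ext R (Suc k) M M))"
    unfolding self_orthogonal_def by (metis Suc_pred zero_less_Suc)
  also have "\<dots> \<longleftrightarrow> (\<forall>k. acyc_at R P \<delta>' M k)" using Ext_trivial_iff[OF ch P M] by simp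
  also have "\<dots> \<longleftrightarrow> (\<forall>k. acyc_at R Q \<delta> M k)"
    using acyc_at_in_add[OF P projP Q proj in_add_self[OF M] M]
      acyc_at_in_add[OF Q proj P projP in_add_self[OF M] M] by blast
  finally show ?thesis .
qed

text \<open>
  The sequence is continued by zero modules. Surjectivity onto \<open>X n\<close> is exactness at \<open>X n\<close>, and
  injectivity of the first map of the dual sequence is the corresponding condition for \<open>Hom(-, T)\<close>.
\<close>

lemma coexact_of_exact_upto:
  fixes X :: "nat \<Rightarrow> ('a, 'x) module"
  assumes M: "left_module R M" and T: "left_module R T"
    and Xadd: "\<And>i. i \<le> n \<Longrightarrow> in_add R T (X i)" and ex: "exact_upto R M X e d n"
    and onto: "image_in M X e d n = carrier (X n)"
  obtains X' :: "nat \<Rightarrow> ('a, 'x) module" and d' where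
    "coexact R M X' e d'" "\<And>i. in_add R T (X' i)" "\<And>i. i > n \<Longrightarrow> carrier (X' i) = {\<zero>\<^bsub>X' i\<^esub>}"
    "Hom_exact_upto R M X e d T n \<Longrightarrow> Hom_kernel R M X e d T n = {zero_hom (X n) T} \<Longrightarrow>
       hom_exact R M X' e d' T"
proof -
  define Z where "Z = X 0\<lparr>carrier := {\<zero>\<^bsub>X 0\<^esub>}\<rparr>"
  define X' where "X' i = (if i \<le> n then X i else Z)" for i
  define d' where "d' i = (if i < n then d i else (\<lambda>_. \<zero>\<^bsub>X 0\<^esub>))" for i
  note a = ex[unfolded exact_upto_def]
  have XM: "left_module R (X i)" if "i \<le> n" for i by (rule in_add_left_module[OF Xadd[OF that]])
  have ZM: "left_module R Z" unfolding Z_def by (rule left_module_zero[OF XM]) simp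
  have Zz: "\<zero>\<^bsub>Z\<^esub> = \<zero>\<^bsub>X 0\<^esub>" and Zc: "carrier Z = {\<zero>\<^bsub>X 0\<^esub>}" by (simp_all add: Z_def)
  have X'M: "left_module R (X' i)" for i using XM ZM by (simp add: X'_def)
  have el: "lin R M (X 0) e" using a Hom_lin by blast
  have dl: "lin R (X i) (X (Suc i)) (d i)" if "i < n" for i using a that Hom_lin by blast
  have ker: "{x \<in> carrier (X i). d i x = \<zero>\<^bsub>X (Suc i)\<^esub>} = image_in M X e d i" if "i < n" for i
    using a that by (simp add: a_kernel_eq)
  define I where "I i = (case i of 0 \<Rightarrow> e ` carrier M | Suc j \<Rightarrow> d' j ` carrier (X' j))" for i
  have I_le: "I i = image_in M X e d i" if "i \<le> n" for i
    using that by (cases i) (auto simp: I_def d'_def X'_def)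
  have I_gt: "I i = {\<zero>\<^bsub>X 0\<^esub>}" if "i > n" for i
    using that left_module_closed(1)[OF X'M[of "i - 1"]] by (cases i) (auto simp: I_def d'_def)
  have d'l: "lin R (X' i) (X' (Suc i)) (d' i)" for i
    using dl[of i] lin_zero_map[OF ZM, of "X' i"] by (auto simp: d'_def X'_def Zz)
  have ker': "d' i x = \<zero>\<^bsub>X' (Suc i)\<^esub> \<longleftrightarrow> x \<in> I i" if x: "x \<in> carrier (X' i)" for i x
  proof -
    consider "i < n" | "i = n" | "i > n" by linarith
    then show ?thesis
    proof cases
      case 1
      then show ?thesis using ker[OF 1] I_le[of i] x by (auto simp: X'_def d'_def)
    next
      case 2
      then show ?thesis using I_le[of n] onto x by (auto simp: X'_def d'_def Zz)
    next
      case 3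
      then show ?thesis using I_gt[of i] x by (auto simp: X'_def d'_def Zz Zc)
    qed
  qed
  have "coexact R M X' e d'"
    unfolding coexact_def
  proof (intro conjI allI ballI impI)
    show "lin R M (X' 0) e" using el by (simp add: X'_def)
    show "x = \<zero>\<^bsub>M\<^esub>" if "x \<in> carrier M" "e x = \<zero>\<^bsub>X' 0\<^esub>" for x
      using a that lin_zero[OF M XM el] left_module_closed(1)[OF M] by (auto simp: inj_on_def X'_def)
    show "d' 0 x = \<zero>\<^bsub>X' 1\<^esub> \<longleftrightarrow> x \<in> e ` carrier M" if "x \<in> carrier (X' 0)" for x
      using ker'[OF that] by (simp add: I_def)
    show "d' (Suc i) x = \<zero>\<^bsub>X' (Suc (Suc i))\<^esub> \<longleftrightarrow> x \<in> d' i ` carrier (X' i)" if "x \<in> carrier (X' (Suc i))" for i x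
      using ker'[OF that] by (simp add: I_def)
  qed (rule M, rule X'M, rule d'l)
  moreover have "in_add R T (X' i)" for i
    using Xadd in_add_zero[OF T ZM] by (simp add: X'_def Zz Zc)
  moreover have "carrier (X' i) = {\<zero>\<^bsub>X' i\<^esub>}" if "i > n" for i using that by (simp add: X'_def Zz Zc)
  moreover have "hom_exact R M X' e d' T"
    if H: "Hom_exact_upto R M X e d T n" and K: "Hom_kernel R M X e d T n = {zero_hom (X n) T}"
  proof -
    have Kiff: "f \<in> Hom_kernel R M X e d T i \<longleftrightarrow> f \<in> Hom R (X i) T \<and> (\<forall>x \<in> I i. f x = \<zero>\<^bsub>T\<^esub>)"
      if "i \<le> n" for f i
      using that by (cases i) (auto simp: I_def compose_eq_zero_hom_iff d'_def X'_def)
    have main: "\<exists>g. lin R (X' (Suc i)) T g \<and> (\<forall>x \<in> carrier (X' i). f x = g (d' i x))"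
      if f: "lin R (X' i) T f" and 0: "\<And>x. x \<in> I i \<Longrightarrow> f x = \<zero>\<^bsub>T\<^esub>" for i f
    proof -
      consider "i < n" | "i = n" | "i > n" by linarith
      then show ?thesis
      proof cases
        case 1
        have fl: "lin R (X i) T f" using f 1 by (simp add: X'_def)
        have "restrict f (carrier (X i)) x = \<zero>\<^bsub>T\<^esub>" if "x \<in> I i" for x
          using 0[OF that] that I_le[of i] ker[OF 1] 1 by auto
        then have "restrict f (carrier (X i)) \<in> Hom_kernel R M X e d T i"
          using Kiff[of i "restrict f (carrier (X i))"] 1 restrict_Hom[OF XM fl] by simp
        then have "restrict f (carrier (X i)) \<in> (\<lambda>g. compose (carrier (X i)) g (d i)) ` Hom R (X (Suc i)) T"
          using H 1 unfolding Hom_exact_upto_def by blast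
        then obtain g where g: "g \<in> Hom R (X (Suc i)) T" "restrict f (carrier (X i)) = compose (carrier (X i)) g (d i)"
          by blast
        have "f x = g (d i x)" if "x \<in> carrier (X i)" for x
          using fun_cong[OF g(2), of x] that by (simp add: compose_def)
        then show ?thesis using Hom_lin[OF g(1)] 1 by (auto simp: X'_def d'_def)
      next
        case 2
        have fl: "lin R (X n) T f" using f 2 by (simp add: X'_def)
        have "restrict f (carrier (X n)) \<in> Hom_kernel R M X e d T n"
          using Kiff[of n "restrict f (carrier (X n))"] 2 restrict_Hom[OF XM fl] 0 I_le[of n] onto by simp
        then have "restrict f (carrier (X n)) = zero_hom (X n) T" using K by blast
        then have "f x = \<zero>\<^bsub>T\<^esub>" if "x \<in> carrier (X n)" for x
          using that by (metis restrict_apply' zero_hom_def)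
        then show ?thesis
          using 2 lin_zero_map[OF T, of "X' (Suc i)"] by (intro exI[of _ "\<lambda>_. \<zero>\<^bsub>T\<^esub>"]) (simp add: X'_def)
      next
        case 3
        have "f x = \<zero>\<^bsub>T\<^esub>" if "x \<in> carrier (X' i)" for x
          using that 0[of x] I_gt[OF 3] 3 by (simp add: X'_def Zc)
        then show ?thesis
          using lin_zero_map[OF T, of "X' (Suc i)"] by (intro exI[of _ "\<lambda>_. \<zero>\<^bsub>T\<^esub>"]) simp
      qed
    qed
    show ?thesis
      unfolding hom_exact_def
    proof (intro conjI allI impI)
      fix f assume f: "lin R M T f"
      have "restrict f (carrier M) \<in> (\<lambda>g. compose (carrier M) g e) ` Hom R (X 0) T"
        using H restrict_Hom[OF M f] unfolding Hom_exact_upto_def by blast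
      then obtain g where g: "g \<in> Hom R (X 0) T" "restrict f (carrier M) = compose (carrier M) g e" by blast
      have "f x = g (e x)" if "x \<in> carrier M" for x
        using fun_cong[OF g(2), of x] that by (simp add: compose_def)
      then show "\<exists>g. lin R (X' 0) T g \<and> (\<forall>x \<in> carrier M. f x = g (e x))"
        using Hom_lin[OF g(1)] by (auto simp: X'_def)
    next
      fix f assume "lin R (X' 0) T f" "\<forall>x \<in> carrier M. f (e x) = \<zero>\<^bsub>T\<^esub>"
      then show "\<exists>g. lin R (X' 1) T g \<and> (\<forall>x \<in> carrier (X' 0). f x = g (d' 0 x))"
        using main[of 0 f] by (auto simp: I_def)
    next
      fix i f assume "lin R (X' (Suc i)) T f" "\<forall>x \<in> carrier (X' i). f (d' i x) = \<zero>\<^bsub>T\<^esub>"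
      then show "\<exists>g. lin R (X' (Suc (Suc i))) T g \<and> (\<forall>x \<in> carrier (X' (Suc i)). f x = g (d' (Suc i) x))"
        using main[of "Suc i" f] by (auto simp: I_def)
    qed
  qed
  ultimately show thesis by (rule that)
qed

lemma domdim_infiniteI:
  fixes X :: "nat \<Rightarrow> ('a, 'x) module" and T :: "('a, 't) module"
  assumes X: "coexact R M X e d" and H: "hom_exact R M X e d T"
    and Xadd: "\<And>i. in_add R T (X i)" and T: "left_module R T"
  shows "domdim_infinite R T M"
proof -
  obtain Y :: "nat \<Rightarrow> ('a, nat \<Rightarrow> 't) module" and h g where
    i: "\<And>i. mod_iso R (X i) (Y i) (h i) (g i)" and Yadd: "\<And>i. in_add R T (Y i)"
    using in_add_standard_copy[of R T X, OF Xadd T] by metis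
  obtain e' d' where Y: "coexact R M Y e' d'" and HY: "hom_exact R M Y e' d' T"
    using coexact_iso[OF X i] hom_exact_iso[OF X H i] by blast
  note y = coexactD[OF Y]
  let ?e = "restrict e' (carrier M)" and ?d = "\<lambda>i. restrict (d' i) (carrier (Y i))"
  define I where "I i = (case i of 0 \<Rightarrow> e' ` carrier M | Suc j \<Rightarrow> d' j ` carrier (Y j))" for i
  have Isub: "I i \<subseteq> carrier (Y i)" for i
    using lin_closed[OF y(3)] lin_closed[OF y(5)] by (auto simp: I_def split: nat.split)
  have I: "image_in M Y ?e ?d i = I i" for i by (cases i) (auto simp: I_def)
  have ker: "d' i x = \<zero>\<^bsub>Y (Suc i)\<^esub> \<longleftrightarrow> x \<in> I i" if "x \<in> carrier (Y i)" for i x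
    using that y(6) y(7) by (cases i) (auto simp: I_def)
  have ex: "exact_upto R M Y ?e ?d n" for n
    unfolding exact_upto_def I a_kernel_eq
  proof (intro conjI allI impI)
    show "?e \<in> Hom R M (Y 0)" by (rule restrict_Hom[OF y(1,3)])
    show "inj_on ?e (carrier M)"
    proof (rule inj_onI)
      fix u v assume u: "u \<in> carrier M" and v: "v \<in> carrier M" and "?e u = ?e v"
      then have "e' (u \<oplus>\<^bsub>M\<^esub> mneg R M v) = \<zero>\<^bsub>Y 0\<^esub>"
        using lin_eq_if_diff_zero[OF y(1) y(2) y(3) u v] by simp
      then show "u = v"
        using y(4)[OF left_module_closed(2)[OF y(1) u mneg_closed[OF y(1) v]]] diff_eq_zero_iff[OF y(1) u v] by simp
    qed
    show "?d i \<in> Hom R (Y i) (Y (Suc i))" for i by (rule restrict_Hom[OF y(2,5)])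
    show "{x \<in> carrier (Y i). ?d i x = \<zero>\<^bsub>Y (Suc i)\<^esub>} = I i" for i
      using ker Isub by auto
  qed
  have Kiff: "f \<in> Hom_kernel R M Y ?e ?d T i \<longleftrightarrow> f \<in> Hom R (Y i) T \<and> (\<forall>x \<in> I i. f x = \<zero>\<^bsub>T\<^esub>)" for f i
    by (cases i) (auto simp: I_def compose_eq_zero_hom_iff)
  have Hx: "Hom_exact_upto R M Y ?e ?d T n" for n
    unfolding Hom_exact_upto_def
  proof (intro conjI allI impI)
    show "(\<lambda>g. compose (carrier M) g ?e) ` Hom R (Y 0) T = Hom R M T"
    proof
      show "(\<lambda>g. compose (carrier M) g ?e) ` Hom R (Y 0) T \<subseteq> Hom R M T"
      proof (rule image_subsetI)
        fix f assume f: "f \<in> Hom R (Y 0) T"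
        have "compose (carrier M) f ?e = restrict (\<lambda>x. f (e' x)) (carrier M)" by (auto simp: compose_def)
        then show "compose (carrier M) f ?e \<in> Hom R M T"
          using restrict_Hom[OF y(1) lin_comp[OF Hom_lin[OF f] y(3)]] by simp
      qed
      show "Hom R M T \<subseteq> (\<lambda>g. compose (carrier M) g ?e) ` Hom R (Y 0) T"
      proof
        fix f assume f: "f \<in> Hom R M T"
        obtain t where t: "lin R (Y 0) T t" "\<forall>x \<in> carrier M. f x = t (e' x)"
          using hom_exactD(1)[OF HY Hom_lin[OF f]] by blast
        have "f = compose (carrier M) (restrict t (carrier (Y 0))) ?e"
          using f t(2) lin_closed[OF y(3)] by (auto simp: fun_eq_iff compose_def Hom_iff extensional_def)
        then show "f \<in> (\<lambda>g. compose (carrier M) g ?e) ` Hom R (Y 0) T"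
          using restrict_Hom[OF y(2) t(1)] by blast
      qed
    qed
    show "(\<lambda>g. compose (carrier (Y i)) g (?d i)) ` Hom R (Y (Suc i)) T = Hom_kernel R M Y ?e ?d T i" for i
    proof
      show "(\<lambda>g. compose (carrier (Y i)) g (?d i)) ` Hom R (Y (Suc i)) T \<subseteq> Hom_kernel R M Y ?e ?d T i"
      proof (rule image_subsetI)
        fix f assume f: "f \<in> Hom R (Y (Suc i)) T"
        have "compose (carrier (Y i)) f (?d i) = restrict (\<lambda>x. f (d' i x)) (carrier (Y i))"
          by (auto simp: compose_def)
        moreover have "d' i x = \<zero>\<^bsub>Y (Suc i)\<^esub>" if "x \<in> I i" for x
          using ker[of x i] that Isub by blast
        ultimately show "compose (carrier (Y i)) f (?d i) \<in> Hom_kernel R M Y ?e ?d T i"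
          unfolding Kiff
          using restrict_Hom[OF y(2) lin_comp[OF Hom_lin[OF f] y(5)]] Isub[of i] lin_zero[OF y(2) T Hom_lin[OF f]]
          by (auto simp: subset_iff)
      qed
      show "Hom_kernel R M Y ?e ?d T i \<subseteq> (\<lambda>g. compose (carrier (Y i)) g (?d i)) ` Hom R (Y (Suc i)) T"
      proof
        fix f assume "f \<in> Hom_kernel R M Y ?e ?d T i"
        then have f: "f \<in> Hom R (Y i) T" and 0: "\<forall>x \<in> I i. f x = \<zero>\<^bsub>T\<^esub>" unfolding Kiff by auto
        have "\<exists>t. lin R (Y (Suc i)) T t \<and> (\<forall>x \<in> carrier (Y i). f x = t (d' i x))"
          using hom_exactD(2)[OF HY, of f] hom_exactD(3)[OF HY, of "i - 1" f] Hom_lin[OF f] 0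
          by (cases i) (auto simp: I_def)
        then obtain t where t: "lin R (Y (Suc i)) T t" "\<forall>x \<in> carrier (Y i). f x = t (d' i x)" by blast
        have "f = compose (carrier (Y i)) (restrict t (carrier (Y (Suc i)))) (?d i)"
          using f t(2) lin_closed[OF y(5)] by (auto simp: fun_eq_iff compose_def Hom_iff extensional_def)
        then show "f \<in> (\<lambda>g. compose (carrier (Y i)) g (?d i)) ` Hom R (Y (Suc i)) T"
          using restrict_Hom[OF y(2) t(1)] by blast
      qed
    qed
  qed
  show ?thesis
    unfolding domdim_infinite_def
  proof
    fix n show "domdim_ge R T M n"
    proof (cases n)
      case (Suc n')
      have "(\<forall>i \<le> n'. in_add R T (Y i)) \<and> exact_upto R M Y ?e ?d n' \<and> Hom_exact_upto R M Y ?e ?d T n'"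
        using Yadd ex Hx by blast
      then show ?thesis unfolding Suc domdim_ge.simps by blast
    qed simp
  qed
qed

section \<open>Finite generation\<close>

text \<open>
  The submodule generated by \<open>B\<close>, as a closure instead of a set of linear combinations: inclusions are
  then proved by induction. As it refers to \<open>M\<close> only through its operations, it is the same in a
  submodule of \<open>M\<close>.
\<close>

inductive_set gen :: "('a, 'c) ring_scheme \<Rightarrow> ('a, 'm) module \<Rightarrow> 'm set \<Rightarrow> 'm set"
  for R M B where
  gen_zero: "\<zero>\<^bsub>M\<^esub> \<in> gen R M B"
| gen_base: "b \<in> B \<Longrightarrow> b \<in> gen R M B"
| gen_add: "x \<in> gen R M B \<Longrightarrow> y \<in> gen R M B \<Longrightarrow> x \<oplus>\<^bsub>M\<^esub> y \<in> gen R M B"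
| gen_smult: "a \<in> carrier R \<Longrightarrow> x \<in> gen R M B \<Longrightarrow> a \<odot>\<^bsub>M\<^esub> x \<in> gen R M B"

definition fg :: "('a, 'c) ring_scheme \<Rightarrow> ('a, 'm) module \<Rightarrow> bool" where
  "fg R M \<longleftrightarrow> (\<exists>B. finite B \<and> B \<subseteq> carrier M \<and> carrier M \<subseteq> gen R M B)"

lemma fgI: "finite B \<Longrightarrow> B \<subseteq> carrier M \<Longrightarrow> carrier M \<subseteq> gen R M B \<Longrightarrow> fg R M"
  unfolding fg_def by blast

lemma gen_subset:
  assumes "left_module R M" "B \<subseteq> carrier M" "x \<in> gen R M B"
  shows "x \<in> carrier M"
  using assms(3) by induction (use assms left_module_closed[OF assms(1)] in auto)

lemma gen_mono:
  assumes "B \<subseteq> C" "x \<in> gen R M B" shows "x \<in> gen R M C"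
  using assms(2) by induction (use assms(1) in \<open>auto intro: gen.intros\<close>)

lemma gen_trans:
  assumes "\<And>b. b \<in> B \<Longrightarrow> b \<in> gen R M C" "x \<in> gen R M B" shows "x \<in> gen R M C"
  using assms(2) by induction (use assms(1) in \<open>auto intro: gen.intros\<close>)

lemma gen_msum: "(\<And>j. j < r \<Longrightarrow> f j \<in> gen R M B) \<Longrightarrow> msum M f r \<in> gen R M B"
  by (induction r) (auto intro: gen.intros)

lemma gen_lin:
  assumes X: "left_module R X" and Y: "left_module R Y" and f: "lin R X Y f" and B: "B \<subseteq> carrier X"
    and x: "x \<in> gen R X B"
  shows "f x \<in> gen R Y (f ` B)"
  using x
proof induction
  case gen_zero then show ?case using lin_zero[OF X Y f] by (simp add: gen.gen_zero)
next
  case (gen_base b) then show ?case by (simp add: gen.gen_base)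
next
  case (gen_add x y)
  then show ?case using lin_add[OF f gen_subset[OF X B] gen_subset[OF X B]] by (simp add: gen.gen_add)
next
  case (gen_smult a x)
  then show ?case using lin_smult[OF f _ gen_subset[OF X B]] by (simp add: gen.gen_smult)
qed

lemma gen_carrier_update: "gen R (M\<lparr>carrier := U\<rparr>) B = gen R M B"
proof (rule equalityI; rule subsetI)
  show "x \<in> gen R M B" if "x \<in> gen R (M\<lparr>carrier := U\<rparr>) B" for x
    using that by induction (auto intro: gen.intros)
  show "x \<in> gen R (M\<lparr>carrier := U\<rparr>) B" if "x \<in> gen R M B" for x
    using that
  proof induction
    case gen_zero show ?case using gen.gen_zero[of "M\<lparr>carrier := U\<rparr>"] by simp
  next
    case (gen_base b) then show ?case by (rule gen.gen_base)
  next
    case (gen_add x y) then show ?case using gen.gen_add[of x R "M\<lparr>carrier := U\<rparr>"] by simp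
  next
    case (gen_smult a x) then show ?case using gen.gen_smult[of a R x "M\<lparr>carrier := U\<rparr>"] by simp
  qed
qed

lemma finitely_generated_iff:
  assumes M: "left_module R M"
  shows "finitely_generated R M \<longleftrightarrow> fg R M"
proof -
  interpret left_module R M by (rule M)
  have span: "(\<Oplus>\<^bsub>M\<^esub>b \<in> C. c b \<odot>\<^bsub>M\<^esub> b) \<in> gen R M B"
    if "finite C" "C \<subseteq> B" "B \<subseteq> carrier M" "c \<in> B \<rightarrow> carrier R" for B C c
    using that
  proof (induction C)
    case empty then show ?case by (simp add: gen.gen_zero)
  next
    case (insert b C)
    have "(\<Oplus>\<^bsub>M\<^esub>b \<in> insert b C. c b \<odot>\<^bsub>M\<^esub> b) = c b \<odot>\<^bsub>M\<^esub> b \<oplus>\<^bsub>M\<^esub> (\<Oplus>\<^bsub>M\<^esub>b \<in> C. c b \<odot>\<^bsub>M\<^esub> b)"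
      using insert by (intro M.finsum_insert) (auto intro!: smult_closed)
    moreover have "c b \<odot>\<^bsub>M\<^esub> b \<in> gen R M B" using insert by (auto intro: gen.intros)
    ultimately show ?case using insert by (auto intro: gen.intros)
  qed
  have comb: "\<exists>c \<in> B \<rightarrow> carrier R. x = (\<Oplus>\<^bsub>M\<^esub>b \<in> B. c b \<odot>\<^bsub>M\<^esub> b)"
    if fin: "finite B" and B: "B \<subseteq> carrier M" and x: "x \<in> gen R M B" for B x
    using x
  proof induction
    case gen_zero
    have "(\<Oplus>\<^bsub>M\<^esub>b \<in> B. \<zero>\<^bsub>R\<^esub> \<odot>\<^bsub>M\<^esub> b) = (\<Oplus>\<^bsub>M\<^esub>b \<in> B. \<zero>\<^bsub>M\<^esub>)"
      using B left_module_smult_zero(2)[OF M] by (intro M.finsum_cong') auto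
    then have "(\<Oplus>\<^bsub>M\<^esub>b \<in> B. \<zero>\<^bsub>R\<^esub> \<odot>\<^bsub>M\<^esub> b) = \<zero>\<^bsub>M\<^esub>" by simp
    then show ?case by (intro bexI[of _ "\<lambda>_. \<zero>\<^bsub>R\<^esub>"]) auto
  next
    case (gen_base b)
    have "(\<Oplus>\<^bsub>M\<^esub>b' \<in> B. (if b = b' then \<one>\<^bsub>R\<^esub> else \<zero>\<^bsub>R\<^esub>) \<odot>\<^bsub>M\<^esub> b') =
        (\<Oplus>\<^bsub>M\<^esub>b' \<in> B. if b = b' then b' else \<zero>\<^bsub>M\<^esub>)"
      using B left_module_smult_zero(2)[OF M] smult_one by (intro M.finsum_cong') auto
    also have "\<dots> = b" using B gen_base fin by (intro M.finsum_singleton) auto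
    finally show ?case by (intro bexI[of _ "\<lambda>b'. if b = b' then \<one>\<^bsub>R\<^esub> else \<zero>\<^bsub>R\<^esub>"]) auto
  next
    case (gen_add x y)
    then obtain c c' where c: "c \<in> B \<rightarrow> carrier R" "x = (\<Oplus>\<^bsub>M\<^esub>b \<in> B. c b \<odot>\<^bsub>M\<^esub> b)"
      and c': "c' \<in> B \<rightarrow> carrier R" "y = (\<Oplus>\<^bsub>M\<^esub>b \<in> B. c' b \<odot>\<^bsub>M\<^esub> b)" by blast
    have "(\<Oplus>\<^bsub>M\<^esub>b \<in> B. (c b \<oplus>\<^bsub>R\<^esub> c' b) \<odot>\<^bsub>M\<^esub> b) = (\<Oplus>\<^bsub>M\<^esub>b \<in> B. c b \<odot>\<^bsub>M\<^esub> b \<oplus>\<^bsub>M\<^esub> c' b \<odot>\<^bsub>M\<^esub> b)"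
      using B c(1) c'(1) by (intro M.finsum_cong') (auto simp: Pi_iff subset_iff intro!: smult_closed smult_l_distr)
    also have "\<dots> = x \<oplus>\<^bsub>M\<^esub> y"
      unfolding c(2) c'(2) using B c(1) c'(1)
      by (intro M.finsum_addf) (auto simp: Pi_iff subset_iff intro!: smult_closed)
    finally show ?case
      using c(1) c'(1) by (intro bexI[of _ "\<lambda>b. c b \<oplus>\<^bsub>R\<^esub> c' b"]) auto
  next
    case (gen_smult a x)
    then obtain c where c: "c \<in> B \<rightarrow> carrier R" "x = (\<Oplus>\<^bsub>M\<^esub>b \<in> B. c b \<odot>\<^bsub>M\<^esub> b)" by blast
    have "a \<odot>\<^bsub>M\<^esub> (\<Oplus>\<^bsub>M\<^esub>b \<in> C. c b \<odot>\<^bsub>M\<^esub> b) = (\<Oplus>\<^bsub>M\<^esub>b \<in> C. (a \<otimes>\<^bsub>R\<^esub> c b) \<odot>\<^bsub>M\<^esub> b)"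
      if "finite C" "C \<subseteq> B" for C
      using that
    proof (induction C)
      case empty
      then show ?case using left_module_smult_zero(1)[OF M] gen_smult(1) by simp
    next
      case (insert b C)
      have s: "c b' \<in> carrier R" "b' \<in> carrier M" if "b' \<in> insert b C" for b'
        using that insert(4) c(1) B by auto
      have 1: "(\<Oplus>\<^bsub>M\<^esub>b \<in> insert b C. c b \<odot>\<^bsub>M\<^esub> b) = c b \<odot>\<^bsub>M\<^esub> b \<oplus>\<^bsub>M\<^esub> (\<Oplus>\<^bsub>M\<^esub>b \<in> C. c b \<odot>\<^bsub>M\<^esub> b)"
        using insert s by (intro M.finsum_insert) (auto intro!: smult_closed)
      have 2: "(\<Oplus>\<^bsub>M\<^esub>b \<in> insert b C. (a \<otimes>\<^bsub>R\<^esub> c b) \<odot>\<^bsub>M\<^esub> b) =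
          (a \<otimes>\<^bsub>R\<^esub> c b) \<odot>\<^bsub>M\<^esub> b \<oplus>\<^bsub>M\<^esub> (\<Oplus>\<^bsub>M\<^esub>b \<in> C. (a \<otimes>\<^bsub>R\<^esub> c b) \<odot>\<^bsub>M\<^esub> b)"
        using insert s gen_smult(1) by (intro M.finsum_insert) (auto intro!: smult_closed)
      have "(\<Oplus>\<^bsub>M\<^esub>b \<in> C. c b \<odot>\<^bsub>M\<^esub> b) \<in> carrier M"
        using s by (intro M.finsum_closed) (auto intro!: smult_closed)
      then show ?case unfolding 1 2
        using insert s[of b] gen_smult(1) by (simp add: smult_r_distr smult_closed smult_assoc)
    qed
    from this[OF fin order_refl] show ?case
      unfolding c(2) using c(1) gen_smult(1) by (intro bexI[of _ "\<lambda>b. a \<otimes>\<^bsub>R\<^esub> c b"]) auto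
  qed
  show ?thesis
  proof
    assume "finitely_generated R M"
    then obtain B where B: "finite B" "B \<subseteq> carrier M"
      "\<And>x. x \<in> carrier M \<Longrightarrow> \<exists>c \<in> B \<rightarrow> carrier R. x = (\<Oplus>\<^bsub>M\<^esub>b \<in> B. c b \<odot>\<^bsub>M\<^esub> b)"
      unfolding finitely_generated_def by blast
    have "carrier M \<subseteq> gen R M B"
    proof
      fix x assume "x \<in> carrier M"
      then obtain c where "c \<in> B \<rightarrow> carrier R" "x = (\<Oplus>\<^bsub>M\<^esub>b \<in> B. c b \<odot>\<^bsub>M\<^esub> b)" using B(3) by blast
      then show "x \<in> gen R M B" using span[OF B(1) order_refl B(2)] by simp
    qed
    then show "fg R M" by (rule fgI[OF B(1,2)])
  next
    assume "fg R M"
    then obtain B where B: "finite B" "B \<subseteq> carrier M" "carrier M \<subseteq> gen R M B" unfolding fg_def by blast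
    show "finitely_generated R M"
      unfolding finitely_generated_def
    proof (intro exI[of _ B] conjI ballI B(1,2))
      fix x assume "x \<in> carrier M"
      then have "x \<in> gen R M B" using B(3) by blast
      then show "\<exists>c \<in> B \<rightarrow> carrier R. x = (\<Oplus>\<^bsub>M\<^esub>b \<in> B. c b \<odot>\<^bsub>M\<^esub> b)" by (rule comb[OF B(1,2)])
    qed
  qed
qed

text \<open>
  A vector is recovered from any family of coefficients that represents it with respect to a finite
  generating set; enumerating that set makes the family a sequence of scalars.
\<close>

lemma finitely_generated_inj:
  fixes V :: "('k, 'v) module"
  assumes V: "left_module K V" and f: "finitely_generated K V"
  obtains \<iota> :: "'v \<Rightarrow> nat \<Rightarrow> 'k" where "inj_on \<iota> (carrier V)"
proof -
  interpret left_module K V by (rule V)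
  from f[unfolded finitely_generated_def] obtain B where B': "finite B \<and> B \<subseteq> carrier V \<and>
    (\<forall>x \<in> carrier V. \<exists>c \<in> B \<rightarrow> carrier K. x = (\<Oplus>\<^bsub>V\<^esub>b \<in> B. c b \<odot>\<^bsub>V\<^esub> b))" ..
  note B = B'[THEN conjunct1] B'[THEN conjunct2, THEN conjunct1]
  from bchoice[OF B'[THEN conjunct2, THEN conjunct2, unfolded Bex_def]] obtain c where
    c': "\<forall>x \<in> carrier V. c x \<in> B \<rightarrow> carrier K \<and> x = (\<Oplus>\<^bsub>V\<^esub>b \<in> B. c x b \<odot>\<^bsub>V\<^esub> b)" ..
  note c = c'[rule_format]
  obtain e :: "nat \<Rightarrow> 'v" where e: "bij_betw e {0..<card B} B" using ex_bij_betw_nat_finite[OF B(1)] by blast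
  show thesis
  proof (rule that[of "\<lambda>x i. c x (e i)"], rule inj_onI)
    fix x y assume x: "x \<in> carrier V" and y: "y \<in> carrier V" and eq: "(\<lambda>i. c x (e i)) = (\<lambda>i. c y (e i))"
    have "c x b = c y b" if "b \<in> B" for b
    proof -
      obtain i where "b = e i" using e \<open>b \<in> B\<close> unfolding bij_betw_def by blast
      then show ?thesis using fun_cong[OF eq, of i] by simp
    qed
    then have "(\<Oplus>\<^bsub>V\<^esub>b \<in> B. c x b \<odot>\<^bsub>V\<^esub> b) = (\<Oplus>\<^bsub>V\<^esub>b \<in> B. c y b \<odot>\<^bsub>V\<^esub> b)"
      using c[OF y, THEN conjunct1] B(2) by (intro M.finsum_cong') (auto intro!: smult_closed)
    then show "x = y" by (rule trans[OF c[OF x, THEN conjunct2] trans[OF _ c[OF y, THEN conjunct2, symmetric]]])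
  qed
qed

lemma fg_image:
  assumes X: "left_module R X" and Y: "left_module R Y" and f: "lin R X Y f"
    and s: "f ` carrier X = carrier Y" and g: "fg R X"
  shows "fg R Y"
proof -
  obtain B where B: "finite B" "B \<subseteq> carrier X" "carrier X \<subseteq> gen R X B" using g unfolding fg_def by blast
  have "carrier Y \<subseteq> gen R Y (f ` B)"
  proof
    fix y assume "y \<in> carrier Y"
    then obtain x where x: "x \<in> carrier X" "y = f x" unfolding s[symmetric] by auto
    then have "x \<in> gen R X B" using B(3) by auto
    then show "y \<in> gen R Y (f ` B)" unfolding x(2) by (rule gen_lin[OF X Y f B(2)])
  qed
  moreover have "f ` B \<subseteq> carrier Y" using lin_closed[OF f] B(2) by blast
  ultimately show ?thesis using fgI[of "f ` B"] B(1) by simp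
qed

lemma fg_in_add:
  assumes Z: "left_module R Z" and X: "in_add R Z X" and g: "fg R Z"
  shows "fg R X"
proof -
  note XM = in_add_left_module[OF X]
  obtain B where B: "finite B" "B \<subseteq> carrier Z" "carrier Z \<subseteq> gen R Z B" using g unfolding fg_def by blast
  obtain r i p where D: "add_data R Z X r i p" using in_addE[OF X Z] by blast
  note i = add_dataD(1)[OF D] and p = add_dataD(2)[OF D] and id = add_dataD(3)[OF D]
  let ?C = "\<Union>j \<in> {..<r}. p j ` B"
  have "carrier X \<subseteq> gen R X ?C"
  proof
    fix x assume x: "x \<in> carrier X"
    have "msum X (\<lambda>j. p j (i j x)) r \<in> gen R X ?C"
    proof (rule gen_msum)
      fix j assume j: "j < r"
      have "i j x \<in> gen R Z B" using B(3) lin_closed[OF i[OF j] x] by blast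
      then have "p j (i j x) \<in> gen R X (p j ` B)" by (rule gen_lin[OF Z XM p[OF j] B(2)])
      then show "p j (i j x) \<in> gen R X ?C" by (rule gen_mono[rotated]) (use j in auto)
    qed
    then show "x \<in> gen R X ?C" using id[OF x] by simp
  qed
  moreover have "?C \<subseteq> carrier X" using lin_closed[OF p] B(2) by auto
  ultimately show ?thesis using fgI[of ?C] B(1) by simp
qed

lemma fg_extension:
  assumes X: "left_module R X" and Y: "left_module R Y" and f: "lin R X Y f"
    and k: "fg R (X\<lparr>carrier := {x \<in> carrier X. f x = \<zero>\<^bsub>Y\<^esub>}\<rparr>)"
    and i: "fg R (Y\<lparr>carrier := f ` carrier X\<rparr>)"
  shows "fg R X"
proof -
  obtain B where B: "finite B" "B \<subseteq> {x \<in> carrier X. f x = \<zero>\<^bsub>Y\<^esub>}"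
    "{x \<in> carrier X. f x = \<zero>\<^bsub>Y\<^esub>} \<subseteq> gen R X B"
    using k unfolding fg_def gen_carrier_update by auto
  obtain C' where C': "finite C'" "C' \<subseteq> f ` carrier X" "f ` carrier X \<subseteq> gen R Y C'"
    using i unfolding fg_def gen_carrier_update by auto
  obtain C where C: "finite C" "C \<subseteq> carrier X" "C' = f ` C"
    using finite_subset_image[OF C'(1,2)] by blast
  have BC: "B \<union> C \<subseteq> carrier X" using B(2) C(2) by blast
  have lift: "\<exists>x \<in> gen R X C. f x = y" if "y \<in> gen R Y C'" for y
    using that
  proof induction
    case gen_zero
    show ?case by (intro bexI[of _ "\<zero>\<^bsub>X\<^esub>"] lin_zero[OF X Y f] gen.gen_zero)
  next
    case (gen_base b)
    then obtain c where "c \<in> C" "b = f c" unfolding C(3) by auto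
    then show ?case by (intro bexI[of _ c] gen.gen_base) auto
  next
    case (gen_add y z)
    then obtain u v where u: "u \<in> gen R X C" "f u = y" and v: "v \<in> gen R X C" "f v = z" by auto
    have "f (u \<oplus>\<^bsub>X\<^esub> v) = y \<oplus>\<^bsub>Y\<^esub> z"
      using lin_add[OF f gen_subset[OF X C(2) u(1)] gen_subset[OF X C(2) v(1)]] u(2) v(2) by simp
    then show ?case using gen.gen_add[OF u(1) v(1)] by (rule bexI)
  next
    case (gen_smult a y)
    then obtain u where u: "u \<in> gen R X C" "f u = y" by auto
    have "f (a \<odot>\<^bsub>X\<^esub> u) = a \<odot>\<^bsub>Y\<^esub> y"
      using lin_smult[OF f gen_smult(1) gen_subset[OF X C(2) u(1)]] u(2) by simp
    then show ?case using gen.gen_smult[OF gen_smult(1) u(1)] by (rule bexI)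
  qed
  have "carrier X \<subseteq> gen R X (B \<union> C)"
  proof
    fix x assume x: "x \<in> carrier X"
    then have "f x \<in> gen R Y C'" using C'(3) by auto
    from lift[OF this] obtain u where u: "u \<in> gen R X C" "f u = f x" by auto
    have uX: "u \<in> carrier X" by (rule gen_subset[OF X C(2) u(1)])
    have xu: "x \<oplus>\<^bsub>X\<^esub> mneg R X u \<in> gen R X B"
      using B(3) lin_eq_if_diff_zero[OF X Y f x uX] u(2) left_module_closed(2)[OF X x mneg_closed[OF X uX]] by auto
    have "(x \<oplus>\<^bsub>X\<^esub> mneg R X u) \<oplus>\<^bsub>X\<^esub> u \<in> gen R X (B \<union> C)"
      by (rule gen.gen_add[OF gen_mono[OF _ xu] gen_mono[OF _ u(1)]]) auto
    then show "x \<in> gen R X (B \<union> C)" using add_diff_cancel(2)[OF X x uX] by simp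
  qed
  then show ?thesis using fgI[of "B \<union> C"] B(1) C(1) BC by simp
qed

lemma gen_insert:
  assumes M: "left_module R M" and b: "b \<in> carrier M" and B: "B \<subseteq> carrier M"
    and x: "x \<in> gen R M (insert b B)"
  shows "\<exists>a \<in> carrier R. \<exists>y \<in> gen R M B. x = a \<odot>\<^bsub>M\<^esub> b \<oplus>\<^bsub>M\<^esub> y"
  using x
proof induction
  interpret left_module R M by (rule M)
  note s = gen_subset[OF M B]
  {
    case gen_zero
    show ?case
      using left_module_smult_zero(2)[OF M b] by (intro bexI[of _ "\<zero>\<^bsub>R\<^esub>"] bexI[of _ "\<zero>\<^bsub>M\<^esub>"]) (auto intro: gen.intros)
  next
    case (gen_base b')
    show ?case
    proof (cases "b' = b")
      case True
      then show ?thesis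
        using smult_one[OF b] b by (intro bexI[of _ "\<one>\<^bsub>R\<^esub>"] bexI[of _ "\<zero>\<^bsub>M\<^esub>"]) (auto intro: gen.intros)
    next
      case False
      then have "b' \<in> B" using gen_base by simp
      then show ?thesis
        using left_module_smult_zero(2)[OF M b] B
        by (intro bexI[of _ "\<zero>\<^bsub>R\<^esub>"] bexI[of _ b']) (auto intro: gen.intros)
    qed
  next
    case (gen_add x y)
    then obtain a u a' u' where d: "a \<in> carrier R" "u \<in> gen R M B" "x = a \<odot>\<^bsub>M\<^esub> b \<oplus>\<^bsub>M\<^esub> u"
      "a' \<in> carrier R" "u' \<in> gen R M B" "y = a' \<odot>\<^bsub>M\<^esub> b \<oplus>\<^bsub>M\<^esub> u'" by blast
    have "x \<oplus>\<^bsub>M\<^esub> y = (a \<oplus>\<^bsub>R\<^esub> a') \<odot>\<^bsub>M\<^esub> b \<oplus>\<^bsub>M\<^esub> (u \<oplus>\<^bsub>M\<^esub> u')"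
      using d s b by (simp add: smult_l_distr smult_closed M.a_ac)
    then show ?case
      using R.add.m_closed[OF d(1,4)] gen.gen_add[OF d(2,5)] by (intro bexI[rotated])
  next
    case (gen_smult c x)
    then obtain a u where d: "a \<in> carrier R" "u \<in> gen R M B" "x = a \<odot>\<^bsub>M\<^esub> b \<oplus>\<^bsub>M\<^esub> u" by blast
    have "c \<odot>\<^bsub>M\<^esub> x = (c \<otimes>\<^bsub>R\<^esub> a) \<odot>\<^bsub>M\<^esub> b \<oplus>\<^bsub>M\<^esub> c \<odot>\<^bsub>M\<^esub> u"
      using d s b gen_smult(1) by (simp add: smult_r_distr smult_closed smult_assoc)
    then show ?case
      using R.m_closed[OF gen_smult(1) d(1)] gen.gen_smult[OF gen_smult(1) d(2)] by (intro bexI[rotated])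
  }
qed

text \<open>
  Induction on the generating set. If some \<open>u \<in> U\<close> involves the new generator \<open>b\<close>, then, the coefficient
  being invertible, \<open>u\<close> can take the role of \<open>b\<close>, and \<open>U\<close> is generated by \<open>u\<close> and the part of \<open>U\<close> in the
  span of the old generators.
\<close>

lemma fg_subspace:
  assumes K: "field K" and V: "left_module K V" and "finite B" "B \<subseteq> carrier V"
    and "left_module K (V\<lparr>carrier := U\<rparr>)" "U \<subseteq> carrier V" "U \<subseteq> gen K V B"
  shows "fg K (V\<lparr>carrier := U\<rparr>)"
  using assms(3-)
proof (induction B arbitrary: U)
  case empty
  have "x = \<zero>\<^bsub>V\<^esub>" if "x \<in> gen K V {}" for x
    using that by induction (auto simp: left_module_add_ac[OF V] left_module_closed[OF V] left_module_smult_zero[OF V])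
  then show ?case unfolding fg_def gen_carrier_update using empty
    by (intro exI[of _ "{}"]) (auto intro: gen.intros)
next
  case (insert b B)
  interpret K: field K by (rule K)
  interpret V: left_module K V by (rule V)
  note U = left_module_closed[OF insert.prems(2), simplified]
  have b: "b \<in> carrier V" and B: "B \<subseteq> carrier V" using insert.prems(1) by auto
  note gB = gen_subset[OF V B]
  show ?case
  proof (cases "U \<subseteq> gen K V B")
    case True
    then show ?thesis using insert.IH[OF B insert.prems(2,3)] by blast
  next
    case False
    then obtain u where u: "u \<in> U" "u \<notin> gen K V B" by blast
    have uV: "u \<in> carrier V" using u(1) insert.prems(3) by blast
    obtain c y where c: "c \<in> carrier K" "y \<in> gen K V B" "u = c \<odot>\<^bsub>V\<^esub> b \<oplus>\<^bsub>V\<^esub> y"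
      using gen_insert[OF V b B, of u] u(1) insert.prems(4) by blast
    have yV: "y \<in> carrier V" by (rule gB[OF c(2)])
    have "c \<noteq> \<zero>\<^bsub>K\<^esub>" using u(2) c left_module_smult_zero(2)[OF V b] yV by auto
    then have ci: "inv\<^bsub>K\<^esub> c \<in> carrier K" "inv\<^bsub>K\<^esub> c \<otimes>\<^bsub>K\<^esub> c = \<one>\<^bsub>K\<^esub>"
      using c(1) K.field_Units by auto
    have bu: "b = inv\<^bsub>K\<^esub> c \<odot>\<^bsub>V\<^esub> u \<oplus>\<^bsub>V\<^esub> mneg K V (inv\<^bsub>K\<^esub> c \<odot>\<^bsub>V\<^esub> y)"
    proof -
      have "inv\<^bsub>K\<^esub> c \<odot>\<^bsub>V\<^esub> u = b \<oplus>\<^bsub>V\<^esub> inv\<^bsub>K\<^esub> c \<odot>\<^bsub>V\<^esub> y"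
        using c(1,3) ci b yV by (simp add: V.smult_r_distr V.smult_closed V.smult_assoc[symmetric] V.smult_one)
      then show ?thesis using add_diff_cancel(3)[OF V b V.smult_closed[OF ci(1) yV]] by simp
    qed
    let ?W = "U \<inter> gen K V B"
    have W: "left_module K (V\<lparr>carrier := ?W\<rparr>)"
      by (rule left_module_carrier_update[OF V]) (use insert.prems(3) U in \<open>auto intro: gen.intros\<close>)
    have "fg K (V\<lparr>carrier := ?W\<rparr>)"
      by (rule insert.IH[OF B W]) (use insert.prems(3) in auto)
    then obtain C where C: "finite C" "C \<subseteq> ?W" "?W \<subseteq> gen K V C"
      unfolding fg_def gen_carrier_update by auto
    have "U \<subseteq> gen K V (insert u C)"
    proof
      fix x assume x: "x \<in> U"
      have xV: "x \<in> carrier V" using x insert.prems(3) by blast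
      obtain a z where a: "a \<in> carrier K" "z \<in> gen K V B" "x = a \<odot>\<^bsub>V\<^esub> b \<oplus>\<^bsub>V\<^esub> z"
        using gen_insert[OF V b B, of x] x insert.prems(4) by blast
      have zV: "z \<in> carrier V" by (rule gB[OF a(2)])
      define t where "t = a \<otimes>\<^bsub>K\<^esub> inv\<^bsub>K\<^esub> c"
      have t: "t \<in> carrier K" using a(1) ci(1) by (simp add: t_def)
      have "t \<odot>\<^bsub>V\<^esub> u = a \<odot>\<^bsub>V\<^esub> b \<oplus>\<^bsub>V\<^esub> t \<odot>\<^bsub>V\<^esub> y"
      proof -
        have "t \<otimes>\<^bsub>K\<^esub> c = a" using a(1) c(1) ci by (simp add: t_def K.m_assoc)
        then show ?thesis using t c b yV by (simp add: V.smult_r_distr V.smult_closed V.smult_assoc[symmetric])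
      qed
      then have ab: "a \<odot>\<^bsub>V\<^esub> b = t \<odot>\<^bsub>V\<^esub> u \<oplus>\<^bsub>V\<^esub> mneg K V (t \<odot>\<^bsub>V\<^esub> y)"
        using add_diff_cancel(3)[OF V V.smult_closed[OF a(1) b] V.smult_closed[OF t yV]] by simp
      let ?w = "z \<oplus>\<^bsub>V\<^esub> mneg K V (t \<odot>\<^bsub>V\<^esub> y)"
      have tu: "t \<odot>\<^bsub>V\<^esub> u \<in> carrier V" and ty: "mneg K V (t \<odot>\<^bsub>V\<^esub> y) \<in> carrier V"
        using V.smult_closed[OF t uV] mneg_closed[OF V V.smult_closed[OF t yV]] by auto
      have xw: "x = t \<odot>\<^bsub>V\<^esub> u \<oplus>\<^bsub>V\<^esub> ?w"
        unfolding a(3) ab using tu ty zV by (simp add: V.M.a_ac)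
      have wB: "?w \<in> gen K V B"
        unfolding mneg_def
        by (rule gen.gen_add[OF a(2) gen.gen_smult[OF minus_one_closed[OF K.ring_axioms] gen.gen_smult[OF t c(2)]]])
      have "?w = mneg K V (t \<odot>\<^bsub>V\<^esub> u) \<oplus>\<^bsub>V\<^esub> x"
        using add_diff_cancel(5)[OF V tu gB[OF wB]] xw by simp
      moreover have "mneg K V (t \<odot>\<^bsub>V\<^esub> u) \<in> U"
        using U(3)[OF minus_one_closed[OF K.ring_axioms] U(3)[OF t u(1)]] by (simp add: mneg_def)
      ultimately have "?w \<in> U" using U(2) x by simp
      then have "?w \<in> gen K V C" using wB C(3) by blast
      then have "?w \<in> gen K V (insert u C)" by (rule gen_mono[rotated]) auto
      moreover have "t \<odot>\<^bsub>V\<^esub> u \<in> gen K V (insert u C)" using t by (auto intro: gen.intros)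
      ultimately show "x \<in> gen K V (insert u C)" unfolding xw by (rule gen.gen_add[rotated])
    qed
    then show ?thesis unfolding fg_def gen_carrier_update using C(1,2) u(1)
      by (intro exI[of _ "insert u C"]) auto
  qed
qed

text \<open>
  This is finite-dimensionality of the subspaces of \<open>V\<^sup>s\<close>, stated so that it applies to endomorphisms and
  their values at finitely many generators. Induction on \<open>s\<close>: the kernel of the last map is covered by
  the remaining ones, and its image lies in \<open>V\<close>.
\<close>

lemma fg_jointly_injective:
  fixes s :: nat
  assumes K: "field K" and V: "left_module K V" and Vfg: "fg K V"
    and "left_module K U" and "\<And>j. j < s \<Longrightarrow> lin K U V (\<phi> j)"
    and "\<And>x. x \<in> carrier U \<Longrightarrow> (\<And>j. j < s \<Longrightarrow> \<phi> j x = \<zero>\<^bsub>V\<^esub>) \<Longrightarrow> x = \<zero>\<^bsub>U\<^esub>"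
  shows "fg K U"
  using assms(4-)
proof (induction s arbitrary: U)
  case 0
  then have "carrier U \<subseteq> {\<zero>\<^bsub>U\<^esub>}" by auto
  then show ?case unfolding fg_def by (intro exI[of _ "{}"]) (auto intro: gen.intros)
next
  case (Suc s)
  obtain B where B: "finite B" "B \<subseteq> carrier V" "carrier V \<subseteq> gen K V B" using Vfg unfolding fg_def by blast
  have l: "lin K U V (\<phi> s)" using Suc.prems(2) by simp
  show ?case
  proof (rule fg_extension[OF Suc.prems(1) V l])
    show "fg K (U\<lparr>carrier := {x \<in> carrier U. \<phi> s x = \<zero>\<^bsub>V\<^esub>}\<rparr>)"
    proof (rule Suc.IH[OF left_module_kernel[OF Suc.prems(1) V l]])
      show "lin K (U\<lparr>carrier := {x \<in> carrier U. \<phi> s x = \<zero>\<^bsub>V\<^esub>}\<rparr>) V (\<phi> j)" if "j < s" for j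
        using Suc.prems(2)[of j] that by (intro lin_domain) auto
      show "x = \<zero>\<^bsub>U\<lparr>carrier := {x \<in> carrier U. \<phi> s x = \<zero>\<^bsub>V\<^esub>}\<rparr>\<^esub>"
        if "x \<in> carrier (U\<lparr>carrier := {x \<in> carrier U. \<phi> s x = \<zero>\<^bsub>V\<^esub>}\<rparr>)" "\<And>j. j < s \<Longrightarrow> \<phi> j x = \<zero>\<^bsub>V\<^esub>" for x
        using Suc.prems(3)[of x] that by (auto simp: less_Suc_eq)
    qed
    show "fg K (V\<lparr>carrier := \<phi> s ` carrier U\<rparr>)"
      by (rule fg_subspace[OF K V B(1,2) left_module_image[OF Suc.prems(1) V l]])
        (use lin_closed[OF l] B(3) in auto)
  qed
qed

section \<open>Finite-dimensional algebras\<close>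

lemma fd_algebraD:
  assumes "fd_algebra K A"
  shows "field K" "ring A" "left_module K A" "finitely_generated K A"
    "\<And>c x y. c \<in> carrier K \<Longrightarrow> x \<in> carrier A \<Longrightarrow> y \<in> carrier A \<Longrightarrow>
       (c \<odot>\<^bsub>A\<^esub> x) \<otimes>\<^bsub>A\<^esub> y = c \<odot>\<^bsub>A\<^esub> (x \<otimes>\<^bsub>A\<^esub> y)"
    "\<And>c x y. c \<in> carrier K \<Longrightarrow> x \<in> carrier A \<Longrightarrow> y \<in> carrier A \<Longrightarrow>
       x \<otimes>\<^bsub>A\<^esub> (c \<odot>\<^bsub>A\<^esub> y) = c \<odot>\<^bsub>A\<^esub> (x \<otimes>\<^bsub>A\<^esub> y)"
  using assms unfolding fd_algebra_def by auto

text \<open>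
  \<open>M\<close> as a vector space: the ground field acts through the multiples of the unit of \<open>A\<close>.
\<close>

definition scalars :: "('k, 'a) module \<Rightarrow> ('a, 'm) module \<Rightarrow> ('k, 'm) module" where
  "scalars A M = \<lparr>carrier = carrier M, monoid.mult = undefined, one = undefined,
     ring.zero = \<zero>\<^bsub>M\<^esub>, ring.add = ring.add M, smult = (\<lambda>c x. (c \<odot>\<^bsub>A\<^esub> \<one>\<^bsub>A\<^esub>) \<odot>\<^bsub>M\<^esub> x)\<rparr>"

lemma scalars_simps [simp]:
  "carrier (scalars A M) = carrier M" "\<zero>\<^bsub>scalars A M\<^esub> = \<zero>\<^bsub>M\<^esub>" "ring.add (scalars A M) = ring.add M"
  "c \<odot>\<^bsub>scalars A M\<^esub> x = (c \<odot>\<^bsub>A\<^esub> \<one>\<^bsub>A\<^esub>) \<odot>\<^bsub>M\<^esub> x"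
  by (simp_all add: scalars_def)

text \<open>
  The multiples of the unit are central in \<open>A\<close>.
\<close>

lemma commuting_scalars:
  assumes A: "fd_algebra K A" and M: "left_module A M"
  shows "commuting A M K (scalars A M)"
proof -
  note a = fd_algebraD[OF A]
  interpret A: ring A by (rule a(2))
  interpret KA: left_module K A by (rule a(3))
  interpret M: left_module A M by (rule M)
  have one: "c \<odot>\<^bsub>A\<^esub> \<one>\<^bsub>A\<^esub> \<in> carrier A" if "c \<in> carrier K" for c using KA.smult_closed[OF that] by simp
  have "left_module K (scalars A M)"
  proof (rule left_moduleI)
    show "(c \<otimes>\<^bsub>K\<^esub> c') \<odot>\<^bsub>scalars A M\<^esub> x = c \<odot>\<^bsub>scalars A M\<^esub> (c' \<odot>\<^bsub>scalars A M\<^esub> x)"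
      if "c \<in> carrier K" "c' \<in> carrier K" "x \<in> carrier (scalars A M)" for c c' x
      using that one a(5)[of c "\<one>\<^bsub>A\<^esub>" "c' \<odot>\<^bsub>A\<^esub> \<one>\<^bsub>A\<^esub>"]
      by (simp add: M.smult_assoc[symmetric] KA.smult_assoc)
  qed (use one in \<open>auto simp: KA.R.ring_axioms M.smult_closed M.smult_l_distr M.smult_r_distr M.M.a_ac
      KA.smult_l_distr KA.smult_one M.smult_one left_module_smult_zero[OF M] left_module_smult_zero[OF a(3)]\<close>)
  moreover have "x \<odot>\<^bsub>M\<^esub> ((c \<odot>\<^bsub>A\<^esub> \<one>\<^bsub>A\<^esub>) \<odot>\<^bsub>M\<^esub> u) = (c \<odot>\<^bsub>A\<^esub> \<one>\<^bsub>A\<^esub>) \<odot>\<^bsub>M\<^esub> (x \<odot>\<^bsub>M\<^esub> u)"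
    if "x \<in> carrier A" "c \<in> carrier K" "u \<in> carrier M" for x c u
    using that one a(5)[of c "\<one>\<^bsub>A\<^esub>" x] a(6)[of c x "\<one>\<^bsub>A\<^esub>"] by (simp add: M.smult_assoc[symmetric])
  ultimately show ?thesis unfolding commuting_def using M by simp
qed

lemma left_module_scalars: "fd_algebra K A \<Longrightarrow> left_module A M \<Longrightarrow> left_module K (scalars A M)"
  using commutingD(2)[OF commuting_scalars] .

text \<open>
  In one direction, the products of generators of \<open>A\<close> over \<open>K\<close> with generators of \<open>M\<close> over \<open>A\<close>
  generate \<open>M\<close> over \<open>K\<close>.
\<close>

lemma fg_scalars:
  assumes A: "fd_algebra K A" and M: "left_module A M"
  shows "fg K (scalars A M) \<longleftrightarrow> fg A M"
proof
  note a = fd_algebraD[OF A]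
  interpret KA: left_module K A by (rule a(3))
  interpret A: ring A by (rule a(2))
  interpret M: left_module A M by (rule M)
  note S = left_module_scalars[OF A M]
  {
    assume "fg K (scalars A M)"
    then obtain B where B: "finite B" "B \<subseteq> carrier M" "carrier M \<subseteq> gen K (scalars A M) B"
      unfolding fg_def by auto
    have "x \<in> gen A M B" if "x \<in> gen K (scalars A M) B" for x
      using that
    proof induction
      case (gen_smult c x)
      then show ?case using KA.smult_closed[OF gen_smult(1)] by (auto intro: gen.intros)
    qed (auto intro: gen.intros)
    then show "fg A M" using fgI[OF B(1,2)] B(3) by blast
  next
    assume "fg A M"
    then obtain B where B: "finite B" "B \<subseteq> carrier M" "carrier M \<subseteq> gen A M B"
      unfolding fg_def by blast
    obtain C where C: "finite C" "C \<subseteq> carrier A" "carrier A \<subseteq> gen K A C"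
      using a(4) finitely_generated_iff[OF a(3)] unfolding fg_def by blast
    let ?D = "(\<lambda>(c, b). c \<odot>\<^bsub>M\<^esub> b) ` (C \<times> B)"
    have D: "?D \<subseteq> carrier (scalars A M)" using B(2) C(2) M.smult_closed by auto
    have ab: "x \<odot>\<^bsub>M\<^esub> b \<in> gen K (scalars A M) ?D" if b: "b \<in> B" and x: "x \<in> gen K A C" for x b
    proof -
      have bM: "b \<in> carrier M" using b B(2) by blast
      have l: "lin K A (scalars A M) (\<lambda>x. x \<odot>\<^bsub>M\<^esub> b)"
      proof (rule linI)
        fix c y assume "c \<in> carrier K" "y \<in> carrier A"
        then show "(c \<odot>\<^bsub>A\<^esub> y) \<odot>\<^bsub>M\<^esub> b = c \<odot>\<^bsub>scalars A M\<^esub> (y \<odot>\<^bsub>M\<^esub> b)"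
          using a(5)[of c "\<one>\<^bsub>A\<^esub>" y] bM KA.smult_closed[of c "\<one>\<^bsub>A\<^esub>"] by (simp add: M.smult_assoc[symmetric])
      qed (use bM in \<open>auto simp: M.smult_closed M.smult_l_distr\<close>)
      have "x \<odot>\<^bsub>M\<^esub> b \<in> gen K (scalars A M) ((\<lambda>x. x \<odot>\<^bsub>M\<^esub> b) ` C)" by (rule gen_lin[OF a(3) S l C(2) x])
      then show ?thesis by (rule gen_mono[rotated]) (use b in auto)
    qed
    have "x \<in> gen K (scalars A M) ?D" if "x \<in> gen A M B" for x
      using that
    proof induction
      case gen_zero then show ?case using gen.gen_zero[of "scalars A M"] by simp
    next
      case (gen_base b)
      then have "\<one>\<^bsub>A\<^esub> \<odot>\<^bsub>M\<^esub> b \<in> gen K (scalars A M) ?D" using ab C(3) A.one_closed by blast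
      then show ?case using M.smult_one gen_base B(2) by auto
    next
      case (gen_add x y) then show ?case using gen.gen_add[of x K "scalars A M"] by simp
    next
      case (gen_smult r x)
      have l: "lin K (scalars A M) (scalars A M) (\<lambda>x. r \<odot>\<^bsub>M\<^esub> x)"
        using lin_commuting[OF commuting_sym[OF commuting_scalars[OF A M]] gen_smult(1)] .
      have "r \<odot>\<^bsub>M\<^esub> x \<in> gen K (scalars A M) ((\<lambda>x. r \<odot>\<^bsub>M\<^esub> x) ` ?D)"
        by (rule gen_lin[OF S S l D gen_smult(3)])
      then show ?case
      proof (rule gen_trans[rotated])
        fix v assume "v \<in> (\<lambda>x. r \<odot>\<^bsub>M\<^esub> x) ` ?D"
        then obtain c b where cb: "c \<in> C" "b \<in> B" "v = r \<odot>\<^bsub>M\<^esub> (c \<odot>\<^bsub>M\<^esub> b)" by auto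
        have cA: "c \<in> carrier A" and bM: "b \<in> carrier M" using cb(1,2) B(2) C(2) by auto
        have "v = (r \<otimes>\<^bsub>A\<^esub> c) \<odot>\<^bsub>M\<^esub> b" using M.smult_assoc[OF gen_smult(1) cA bM] cb(3) by simp
        moreover have "r \<otimes>\<^bsub>A\<^esub> c \<in> gen K A C" using A.m_closed[OF gen_smult(1) cA] C(3) by auto
        ultimately show "v \<in> gen K (scalars A M) ?D" using ab[OF cb(2)] by simp
      qed
    qed
    then show "fg K (scalars A M)" using fgI[OF _ D] B(1,3) C(1) by auto
  }
qed

text \<open>
  Finite-dimensional algebras are noetherian: a submodule is in particular a subspace.
\<close>

lemma fg_submodule:
  assumes A: "fd_algebra K A" and Y: "left_module A Y" and f: "fg A Y"
    and U: "left_module A (Y\<lparr>carrier := U\<rparr>)" and sub: "U \<subseteq> carrier Y"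
  shows "fg A (Y\<lparr>carrier := U\<rparr>)"
proof -
  note S = left_module_scalars[OF A Y]
  obtain B where B: "finite B" "B \<subseteq> carrier (scalars A Y)" "carrier (scalars A Y) \<subseteq> gen K (scalars A Y) B"
    using f fg_scalars[OF A Y] unfolding fg_def by blast
  have eq: "scalars A (Y\<lparr>carrier := U\<rparr>) = (scalars A Y)\<lparr>carrier := U\<rparr>" by (simp add: scalars_def)
  have "fg K ((scalars A Y)\<lparr>carrier := U\<rparr>)"
    by (rule fg_subspace[OF fd_algebraD(1)[OF A] S B(1,2)])
      (use left_module_scalars[OF A U] eq sub B(3) in auto)
  then show ?thesis using fg_scalars[OF A U] eq by simp
qed

lemma projective_surjection_exists:
  fixes Z :: "('a, 'z) module"
  assumes Z: "left_module A Z" and f: "fg A Z"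
  obtains P :: "('a, nat \<Rightarrow> 'a) module" and g where
    "in_add A (regular_module A) P" "lin A P Z g" "g ` carrier P = carrier Z"
proof -
  note RA = left_module_regular[OF left_module_ring[OF Z]]
  interpret A: ring A by (rule left_module_ring[OF Z])
  obtain B where B: "finite B" "B \<subseteq> carrier Z" "carrier Z \<subseteq> gen A Z B" using f unfolding fg_def by blast
  define r where "r = card B"
  obtain b :: "nat \<Rightarrow> 'z" where b: "bij_betw b {0..<r} B" using ex_bij_betw_nat_finite[OF B(1)] unfolding r_def by blast
  have bZ: "b j \<in> carrier Z" if "j < r" for j using b that B(2) unfolding bij_betw_def by auto
  let ?P = "direct_power (regular_module A) r"
  note PM = left_module_direct_power[OF RA, of r]
  define g where "g w = msum Z (\<lambda>j. w j \<odot>\<^bsub>Z\<^esub> b j) r" for w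
  have g: "lin A ?P Z g" unfolding g_def
    by (rule lin_msum_map[OF Z]) (rule lin_comp[OF lin_regular[OF Z bZ] lin_proj])
  have P: "in_add A (regular_module A) ?P"
    by (rule in_addI[OF PM RA lin_proj lin_unit_inj[OF RA] direct_power_decompose[OF RA]])
  have Bim: "b k \<in> g ` carrier ?P" if k: "k < r" for k
  proof -
    let ?w = "unit_inj (regular_module A) r k \<one>\<^bsub>A\<^esub>"
    have w: "?w \<in> carrier ?P" by (rule lin_closed[OF lin_unit_inj[OF RA]]) simp
    have "g ?w = msum Z (\<lambda>j. if k = j then b k else \<zero>\<^bsub>Z\<^esub>) r"
      unfolding g_def
      by (rule msum_cong)
        (use bZ left_module.smult_one[OF Z] left_module_smult_zero(2)[OF Z] in \<open>auto simp: unit_inj_def\<close>)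
    also have "\<dots> = b k" by (rule msum_single[OF Z k bZ[OF k]])
    finally show ?thesis using w by (metis imageI)
  qed
  note im = left_module_closed[OF left_module_image[OF PM Z g], simplified]
  have "x \<in> g ` carrier ?P" if "x \<in> gen A Z B" for x
    using that
  proof induction
    case gen_zero then show ?case using im(1) by simp
  next
    case (gen_base x)
    then obtain k where "k < r" "x = b k" using b unfolding bij_betw_def by auto
    then show ?case using Bim by blast
  next
    case (gen_add x y) then show ?case using im(2) by simp
  next
    case (gen_smult a x) then show ?case using im(3) by simp
  qed
  then have "g ` carrier ?P = carrier Z" using B(3) lin_closed[OF g] by blast
  then show thesis using that[OF P g] by blast
qed

lemma fg_regular: "ring A \<Longrightarrow> fg A (regular_module A)"
proof -
  assume "ring A"
  then interpret ring A .
  have "x \<in> gen A (regular_module A) {\<one>\<^bsub>A\<^esub>}" if "x \<in> carrier A" for x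
    using gen_smult[OF that gen_base[of "\<one>\<^bsub>A\<^esub>" "{\<one>\<^bsub>A\<^esub>}" A "regular_module A"]] that by simp
  then show "fg A (regular_module A)" unfolding fg_def by (intro exI[of _ "{\<one>\<^bsub>A\<^esub>}"]) auto
qed

text \<open>
  The recursion runs over pairs \<open>(P, U)\<close> of a projective module and a submodule of it, the next syzygy.
  All syzygies after the first are thereby carried by the one type \<open>nat \<Rightarrow> 'a\<close>.
\<close>

lemma projective_resolution_exists:
  fixes A :: "('k, 'a) module" and Z :: "('a, 'z) module"
  assumes A: "fd_algebra K A" and Z: "left_module A Z" and f: "fg A Z"
  obtains P :: "nat \<Rightarrow> ('a, nat \<Rightarrow> 'a) module" and \<epsilon> \<delta> where
    "resol A Z P \<epsilon> \<delta>" "\<forall>i. in_add A (regular_module A) (P i)"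
proof -
  note RA = left_module_regular[OF left_module_ring[OF Z]]
  define sub where "sub u = (fst u)\<lparr>carrier := snd u\<rparr>"
    for u :: "('a, nat \<Rightarrow> 'a) module \<times> (nat \<Rightarrow> 'a) set"
  define good where "good u \<longleftrightarrow> in_add A (regular_module A) (fst u) \<and> snd u \<subseteq> carrier (fst u) \<and>
    left_module A (sub u) \<and> fg A (sub u)" for u
  have kgood: "good (P, {x \<in> carrier P. g x = \<zero>\<^bsub>Y\<^esub>})"
    if P: "in_add A (regular_module A) P" and g: "lin A P Y g" and Y: "left_module A Y"
    for P and g :: "(nat \<Rightarrow> 'a) \<Rightarrow> 'y" and Y :: "('a, 'y) module"
  proof -
    note PM = in_add_left_module[OF P]
    note k = left_module_kernel[OF PM Y g]
    have "fg A P" by (rule fg_in_add[OF RA P fg_regular[OF left_module_ring[OF Z]]])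
    then show ?thesis unfolding good_def sub_def using P k fg_submodule[OF A PM _ k] by auto
  qed
  define rel where "rel u v \<longleftrightarrow> (\<exists>g. lin A (fst v) (sub u) g \<and> g ` carrier (fst v) = snd u \<and>
    snd v = {x \<in> carrier (fst v). g x = \<zero>\<^bsub>fst u\<^esub>})" for u v :: "('a, nat \<Rightarrow> 'a) module \<times> (nat \<Rightarrow> 'a) set"
  obtain P0 :: "('a, nat \<Rightarrow> 'a) module" and \<epsilon> where P0: "in_add A (regular_module A) P0" "lin A P0 Z \<epsilon>"
    "\<epsilon> ` carrier P0 = carrier Z" using projective_surjection_exists[OF Z f] by metis
  define u0 where "u0 = (P0, {x \<in> carrier P0. \<epsilon> x = \<zero>\<^bsub>Z\<^esub>})"
  have g0: "good u0" unfolding u0_def by (rule kgood[OF P0(1,2) Z])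
  have step: "\<exists>v. good v \<and> rel u v" if u: "good u" for u
  proof -
    have us: "left_module A (sub u)" "fg A (sub u)" using u unfolding good_def by auto
    obtain P :: "('a, nat \<Rightarrow> 'a) module" and g where P: "in_add A (regular_module A) P" "lin A P (sub u) g"
      "g ` carrier P = carrier (sub u)" using projective_surjection_exists[OF us] by metis
    have "good (P, {x \<in> carrier P. g x = \<zero>\<^bsub>sub u\<^esub>})" by (rule kgood[OF P(1,2) us(1)])
    moreover have "rel u (P, {x \<in> carrier P. g x = \<zero>\<^bsub>sub u\<^esub>})"
      unfolding rel_def using P(2,3) by (intro exI[of _ g]) (simp add: sub_def)
    ultimately show ?thesis by blast
  qed
  have "\<exists>s. \<forall>i. (good (s i) \<and> (i = 0 \<longrightarrow> s i = u0)) \<and> rel (s i) (s (Suc i))"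
  proof (rule dependent_nat_choice[where P = "\<lambda>i u. good u \<and> (i = 0 \<longrightarrow> u = u0)"])
    show "\<exists>u. good u \<and> (0 = 0 \<longrightarrow> u = u0)" using g0 by blast
    show "\<exists>v. (good v \<and> (Suc i = 0 \<longrightarrow> v = u0)) \<and> rel u v" if "good u \<and> (i = 0 \<longrightarrow> u = u0)" for u i
      using step[of u] that by blast
  qed
  then obtain s where s: "\<And>i. good (s i)" "s 0 = u0" "\<And>i. rel (s i) (s (Suc i))" by blast
  define P where "P i = fst (s i)" for i
  have "\<forall>i. \<exists>g. lin A (P (Suc i)) (sub (s i)) g \<and> g ` carrier (P (Suc i)) = snd (s i) \<and>
    snd (s (Suc i)) = {x \<in> carrier (P (Suc i)). g x = \<zero>\<^bsub>P i\<^esub>}"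
    using s(3) unfolding rel_def P_def by blast
  from choice[OF this] obtain \<delta> where \<delta>: "\<And>i. lin A (P (Suc i)) (sub (s i)) (\<delta> i)"
    "\<And>i. \<delta> i ` carrier (P (Suc i)) = snd (s i)"
    "\<And>i. snd (s (Suc i)) = {x \<in> carrier (P (Suc i)). \<delta> i x = \<zero>\<^bsub>P i\<^esub>}" by blast
  have Padd: "in_add A (regular_module A) (P i)" and sP: "snd (s i) \<subseteq> carrier (P i)" for i
    using s(1) by (auto simp: good_def P_def)
  have P00: "P 0 = P0" and s0: "snd (s 0) = {x \<in> carrier P0. \<epsilon> x = \<zero>\<^bsub>Z\<^esub>}"
    using s(2) by (simp_all add: P_def u0_def)
  have "resol A Z P \<epsilon> \<delta>"
    unfolding resol_def
  proof (intro conjI allI ballI)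
    show "lin A (P (Suc i)) (P i) (\<delta> i)" for i
      by (rule lin_codomain_extend[OF \<delta>(1)[unfolded sub_def, folded P_def] sP])
    show "\<epsilon> x = \<zero>\<^bsub>Z\<^esub> \<longleftrightarrow> x \<in> \<delta> 0 ` carrier (P 1)" if "x \<in> carrier (P 0)" for x
      using \<delta>(2)[of 0] s0 that P00 by simp
    show "\<delta> i x = \<zero>\<^bsub>P i\<^esub> \<longleftrightarrow> x \<in> \<delta> (Suc i) ` carrier (P (Suc (Suc i)))" if "x \<in> carrier (P (Suc i))" for i x
      using \<delta>(2)[of "Suc i"] \<delta>(3)[of i] that by simp
  qed (use Z P0 P00 in_add_left_module[OF Padd] in auto)
  then show thesis using that Padd by blast
qed

section \<open>The endomorphism algebra\<close>

text \<open>
  The additive structure and the scalars are those of the dual of \<open>M\<close> with respect to the commuting action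
  of the ground field.
\<close>

definition endo_algebra :: "('k, 'a) module \<Rightarrow> ('a, 'm) module \<Rightarrow> ('k, 'm \<Rightarrow> 'm) module" where
  "endo_algebra A M = (dual A M (scalars A M) M)
     \<lparr>monoid.mult := (\<lambda>f g. compose (carrier M) f g), one := (\<lambda>x \<in> carrier M. x)\<rparr>"

lemma endo_algebra_simps [simp]:
  "carrier (endo_algebra A M) = Hom A M M" "\<zero>\<^bsub>endo_algebra A M\<^esub> = zero_hom M M"
  "f \<oplus>\<^bsub>endo_algebra A M\<^esub> g = (\<lambda>x \<in> carrier M. f x \<oplus>\<^bsub>M\<^esub> g x)"
  "c \<odot>\<^bsub>endo_algebra A M\<^esub> f = (\<lambda>x \<in> carrier M. (c \<odot>\<^bsub>A\<^esub> \<one>\<^bsub>A\<^esub>) \<odot>\<^bsub>M\<^esub> f x)"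
  "f \<otimes>\<^bsub>endo_algebra A M\<^esub> g = compose (carrier M) f g" "\<one>\<^bsub>endo_algebra A M\<^esub> = (\<lambda>x \<in> carrier M. x)"
  by (simp_all add: endo_algebra_def)

lemma left_module_record_cong:
  assumes M: "left_module R M" and "carrier M' = carrier M" "\<zero>\<^bsub>M'\<^esub> = \<zero>\<^bsub>M\<^esub>" "ring.add M' = ring.add M"
    "module.smult M' = module.smult M"
  shows "left_module R M'"
proof -
  interpret left_module R M by (rule M)
  show ?thesis
    by (rule left_moduleI)
      (auto simp: assms(2-) left_module_ring[OF M] left_module_smult_zero[OF M] smult_closed smult_l_distr
        smult_r_distr smult_assoc smult_one M.a_ac)
qed

text \<open>
  An endomorphism is determined by its values at generators \<open>b j\<close> of \<open>M\<close>, which lie in the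
  finite-dimensional space \<open>M\<close>.
\<close>

lemma fd_algebra_endo:
  assumes A: "fd_algebra K A" and M: "left_module A M" and f: "fg A M"
  shows "fd_algebra K (endo_algebra A M)"
proof -
  let ?E = "endo_algebra A M"
  note c = commuting_scalars[OF A M] and a = fd_algebraD[OF A]
  note S = left_module_scalars[OF A M]
  have E: "left_module K ?E"
    by (rule left_module_record_cong[OF left_module_dual[OF c M]]) (auto simp: endo_algebra_def)
  have v: "f x \<in> carrier M" if "f \<in> Hom A M M" "x \<in> carrier M" for f x
    using lin_closed[OF Hom_lin[OF that(1)] that(2)] .
  have comp: "compose (carrier M) f g \<in> Hom A M M" if "f \<in> Hom A M M" "g \<in> Hom A M M" for f g
    unfolding compose_def using restrict_Hom[OF M lin_comp[OF Hom_lin[OF that(1)] Hom_lin[OF that(2)]]] .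
  have one: "(\<lambda>x \<in> carrier M. x) \<in> Hom A M M" by (rule restrict_Hom[OF M lin_id])
  have Mc: "x \<oplus>\<^bsub>M\<^esub> y \<in> carrier M" if "x \<in> carrier M" "y \<in> carrier M" for x y
    using left_module_closed(2)[OF M that] .
  have ad: "f (x \<oplus>\<^bsub>M\<^esub> y) = f x \<oplus>\<^bsub>M\<^esub> f y" if "f \<in> Hom A M M" "x \<in> carrier M" "y \<in> carrier M" for f x y
    using lin_add[OF Hom_lin[OF that(1)] that(2,3)] .
  have ext: "f = restrict f (carrier M)" if "f \<in> Hom A M M" for f
    using that by (auto simp: Hom_iff extensional_restrict)
  have R: "ring ?E"
  proof (rule ringI)
    show "abelian_group ?E" by (rule left_module_group[OF E])
    show "monoid ?E"
    proof (rule monoidI)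
      fix f g h assume "f \<in> carrier ?E" "g \<in> carrier ?E" "h \<in> carrier ?E"
      then show "f \<otimes>\<^bsub>?E\<^esub> g \<otimes>\<^bsub>?E\<^esub> h = f \<otimes>\<^bsub>?E\<^esub> (g \<otimes>\<^bsub>?E\<^esub> h)"
        using v by (simp add: fun_eq_iff compose_def)
    next
      fix f assume "f \<in> carrier ?E"
      then have f: "f \<in> Hom A M M" by simp
      show "\<one>\<^bsub>?E\<^esub> \<otimes>\<^bsub>?E\<^esub> f = f"
        by (subst (2) ext[OF f]) (use v[OF f] in \<open>simp add: fun_eq_iff compose_def\<close>)
      show "f \<otimes>\<^bsub>?E\<^esub> \<one>\<^bsub>?E\<^esub> = f"
        by (subst (2) ext[OF f]) (simp add: fun_eq_iff compose_def)
    qed (use comp one in auto)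
    fix f g h assume "f \<in> carrier ?E" "g \<in> carrier ?E" "h \<in> carrier ?E"
    then have fgh: "f \<in> Hom A M M" "g \<in> Hom A M M" "h \<in> Hom A M M" by auto
    show "(f \<oplus>\<^bsub>?E\<^esub> g) \<otimes>\<^bsub>?E\<^esub> h = f \<otimes>\<^bsub>?E\<^esub> h \<oplus>\<^bsub>?E\<^esub> g \<otimes>\<^bsub>?E\<^esub> h"
      using v[OF fgh(3)] by (simp add: fun_eq_iff compose_def)
    show "h \<otimes>\<^bsub>?E\<^esub> (f \<oplus>\<^bsub>?E\<^esub> g) = h \<otimes>\<^bsub>?E\<^esub> f \<oplus>\<^bsub>?E\<^esub> h \<otimes>\<^bsub>?E\<^esub> g"
      using v fgh ad by (simp add: fun_eq_iff compose_def)
  qed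
  obtain G where G: "finite G" "G \<subseteq> carrier M" "carrier M \<subseteq> gen A M G" using f unfolding fg_def by blast
  obtain b :: "nat \<Rightarrow> _" where b: "bij_betw b {0..<card G} G" using ex_bij_betw_nat_finite[OF G(1)] by blast
  have bM: "b j \<in> carrier M" if "j < card G" for j using b that G(2) unfolding bij_betw_def by auto
  have Sfg: "fg K (scalars A M)" using fg_scalars[OF A M] f by simp
  have Efg: "fg K ?E"
  proof (rule fg_jointly_injective[OF a(1) S Sfg E])
    show "lin K ?E (scalars A M) (\<lambda>f. f (b j))" if "j < card G" for j
      by (rule linI) (use bM[OF that] v in auto)
    fix f assume "f \<in> carrier ?E" and 0: "\<And>j. j < card G \<Longrightarrow> f (b j) = \<zero>\<^bsub>scalars A M\<^esub>"
    then have f: "f \<in> Hom A M M" by simp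
    have G0: "f y = \<zero>\<^bsub>M\<^esub>" if "y \<in> G" for y
    proof -
      have "y \<in> b ` {0..<card G}" using b that by (simp add: bij_betw_def)
      then obtain j where "j < card G" "y = b j" by auto
      then show ?thesis using 0 by simp
    qed
    have "f x = \<zero>\<^bsub>M\<^esub>" if "x \<in> gen A M G" for x
      using that
    proof induction
      case gen_zero then show ?case by (rule lin_zero[OF M M Hom_lin[OF f]])
    next
      case (gen_base y) then show ?case by (rule G0)
    next
      case (gen_add x y)
      then show ?case
        using ad[OF f gen_subset[OF M G(2)] gen_subset[OF M G(2)]] left_module_add_ac(1)[OF M left_module_closed(1)[OF M]] by simp
    next
      case (gen_smult r x)
      then show ?case
        using lin_smult[OF Hom_lin[OF f] gen_smult(1) gen_subset[OF M G(2) gen_smult(2)]]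
          left_module_smult_zero(1)[OF M gen_smult(1)] by simp
    qed
    then have "f x = zero_hom M M x" if "x \<in> carrier M" for x
      using that G(3) by (auto simp: zero_hom_def)
    then have "f = zero_hom M M" by (rule Hom_eqI[OF f zero_hom_Hom[OF M M]])
    then show "f = \<zero>\<^bsub>?E\<^esub>" by simp
  qed
  have one': "r \<odot>\<^bsub>A\<^esub> \<one>\<^bsub>A\<^esub> \<in> carrier A" if "r \<in> carrier K" for r
    using left_module_closed(3)[OF a(3) that] a(2) by (simp add: ring.ring_simprules)
  have "(r \<odot>\<^bsub>?E\<^esub> f) \<otimes>\<^bsub>?E\<^esub> g = r \<odot>\<^bsub>?E\<^esub> (f \<otimes>\<^bsub>?E\<^esub> g) \<and> f \<otimes>\<^bsub>?E\<^esub> (r \<odot>\<^bsub>?E\<^esub> g) = r \<odot>\<^bsub>?E\<^esub> (f \<otimes>\<^bsub>?E\<^esub> g)"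
    if r: "r \<in> carrier K" and "f \<in> carrier ?E" "g \<in> carrier ?E" for r f g
  proof -
    have f: "f \<in> Hom A M M" and g: "g \<in> Hom A M M" using that by auto
    show ?thesis
      using v[OF g] lin_smult[OF Hom_lin[OF f] one'[OF r]] by (simp add: fun_eq_iff compose_def)
  qed
  then show ?thesis
    unfolding fd_algebra_def using a(1) R E Efg finitely_generated_iff[OF E] by blast
qed

lemma ring_copy:
  assumes h: "inj_on h (carrier R)" and R: "ring R"
  shows "ring (copy h R)"
proof -
  interpret ring R by (rule R)
  show ?thesis
  proof (rule ringI)
    show "abelian_group (copy h R)"
    proof (rule abelian_groupI)
      fix x assume "x \<in> carrier (copy h R)"
      then obtain y where y: "y \<in> carrier R" "x = h y" by auto
      then show "\<exists>z \<in> carrier (copy h R). z \<oplus>\<^bsub>copy h R\<^esub> x = \<zero>\<^bsub>copy h R\<^esub>"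
        using h by (intro bexI[of _ "h (\<ominus>\<^bsub>R\<^esub> y)"]) (auto simp: l_neg)
    qed (use h in \<open>auto simp: a_ac\<close>)
    show "monoid (copy h R)" by (rule monoidI) (use h in \<open>auto simp: m_assoc\<close>)
  qed (use h in \<open>auto simp: l_distr r_distr\<close>)
qed

lemma fd_algebra_copy:
  assumes E: "fd_algebra K E" and h: "inj_on h (carrier E)"
  shows "fd_algebra K (copy h E)"
proof -
  note e = fd_algebraD[OF E]
  interpret E: ring E by (rule e(2))
  note C = left_module_copy[OF h e(3)]
  note i = mod_iso_copy[OF h e(3)]
  have "fg K (copy h E)"
    using fg_image[OF e(3) C mod_isoD(3)[OF i] mod_iso_image[OF i]] e(4) finitely_generated_iff[OF e(3)] by blast
  moreover have "(r \<odot>\<^bsub>copy h E\<^esub> x) \<otimes>\<^bsub>copy h E\<^esub> y = r \<odot>\<^bsub>copy h E\<^esub> (x \<otimes>\<^bsub>copy h E\<^esub> y) \<and>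
      x \<otimes>\<^bsub>copy h E\<^esub> (r \<odot>\<^bsub>copy h E\<^esub> y) = r \<odot>\<^bsub>copy h E\<^esub> (x \<otimes>\<^bsub>copy h E\<^esub> y)"
    if r: "r \<in> carrier K" and "x \<in> carrier (copy h E)" "y \<in> carrier (copy h E)" for r x y
  proof -
    obtain u w where u: "u \<in> carrier E" "x = h u" and w: "w \<in> carrier E" "y = h w" using \<open>x \<in> _\<close> \<open>y \<in> _\<close> by auto
    show ?thesis
      using u w r h e(5)[OF r u(1) w(1)] e(6)[OF r u(1) w(1)] left_module_closed(3)[OF e(3) r u(1)]
        left_module_closed(3)[OF e(3) r w(1)] by simp
  qed
  ultimately show ?thesis
    unfolding fd_algebra_def using e(1) ring_copy[OF h e(2)] C finitely_generated_iff[OF C] by blast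
qed

text \<open>
  A copy \<open>B\<close> of the endomorphism algebra on the type \<open>nat \<Rightarrow> 'k\<close>, where \<open>K\<close> is carried by \<open>'k\<close>; this is the
  type of algebras for which the tilting hypothesis is stated. An element of \<open>B\<close> acts as the endomorphism
  of which it is the copy.
\<close>

lemma centralizer_exists:
  fixes K :: "'k ring" and A :: "('k, 'a) module" and M :: "('a, 'v) module"
  assumes A: "fd_algebra K A" and M: "left_module A M" and f: "fg A M"
  obtains B :: "('k, nat \<Rightarrow> 'k) module" and N :: "(nat \<Rightarrow> 'k, 'v) module" where
    "fd_algebra K B" "commuting A M B N" "centralizes A M B N" "fg B N"
proof -
  let ?E = "endo_algebra A M"
  note E = fd_algebra_endo[OF A M f] and a = fd_algebraD[OF A]
  note e = fd_algebraD[OF E]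
  obtain \<kappa> :: "('v \<Rightarrow> 'v) \<Rightarrow> nat \<Rightarrow> 'k" where \<kappa>': "inj_on \<kappa> (carrier ?E)"
    by (rule finitely_generated_inj[OF e(3,4)])
  then have \<kappa>: "inj_on \<kappa> (Hom A M M)" by simp
  define B where "B = copy \<kappa> ?E"
  define N :: "(nat \<Rightarrow> 'k, 'v) module" where
    "N = \<lparr>carrier = carrier M, monoid.mult = undefined, one = undefined, ring.zero = \<zero>\<^bsub>M\<^esub>,
      ring.add = ring.add M, smult = (\<lambda>b x. inv_into (Hom A M M) \<kappa> b x)\<rparr>"
  have Nc: "carrier N = carrier M" "\<zero>\<^bsub>N\<^esub> = \<zero>\<^bsub>M\<^esub>" "ring.add N = ring.add M" by (simp_all add: N_def)
  have Ns: "\<kappa> f \<odot>\<^bsub>N\<^esub> x = f x" if "f \<in> Hom A M M" for f x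
    using \<kappa> that by (simp add: N_def)
  have B: "fd_algebra K B" unfolding B_def by (rule fd_algebra_copy[OF E \<kappa>'])
  have Bc: "carrier B = \<kappa> ` Hom A M M" by (simp add: B_def)
  have add: "\<kappa> f \<oplus>\<^bsub>B\<^esub> \<kappa> g = \<kappa> (f \<oplus>\<^bsub>?E\<^esub> g)" and mult: "\<kappa> f \<otimes>\<^bsub>B\<^esub> \<kappa> g = \<kappa> (f \<otimes>\<^bsub>?E\<^esub> g)"
    if "f \<in> Hom A M M" "g \<in> Hom A M M" for f g
    using copy_ops(1,2)[OF \<kappa>', of f g] that unfolding B_def by simp_all
  have zero: "\<zero>\<^bsub>B\<^esub> = \<kappa> (zero_hom M M)" and one: "\<one>\<^bsub>B\<^esub> = \<kappa> (\<lambda>x \<in> carrier M. x)" by (simp_all add: B_def)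
  have v: "f x \<in> carrier M" if "f \<in> Hom A M M" "x \<in> carrier M" for f x
    using lin_closed[OF Hom_lin[OF that(1)] that(2)] .
  have addH: "f \<oplus>\<^bsub>?E\<^esub> g \<in> Hom A M M" and multH: "f \<otimes>\<^bsub>?E\<^esub> g \<in> Hom A M M"
    if "f \<in> Hom A M M" "g \<in> Hom A M M" for f g
    using left_module_closed(2)[OF e(3), of f g] monoid.m_closed[OF ring.is_monoid[OF e(2)], of f g] that by simp_all
  have oneH: "(\<lambda>x \<in> carrier M. x) \<in> Hom A M M" by (rule restrict_Hom[OF M lin_id])
  note Mac = left_module_add_ac[OF M] and Mcl = left_module_closed[OF M]
  have NM: "left_module B N"
  proof (rule left_moduleI)
    show "ring B" by (rule fd_algebraD(2)[OF B])
    show "b \<odot>\<^bsub>N\<^esub> x \<in> carrier N" if "b \<in> carrier B" "x \<in> carrier N" for b x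
      using that v Ns by (auto simp: Bc Nc)
    show "\<zero>\<^bsub>B\<^esub> \<odot>\<^bsub>N\<^esub> x = \<zero>\<^bsub>N\<^esub>" if "x \<in> carrier N" for x
      using that Ns[OF zero_hom_Hom[OF M M]] by (simp add: zero Nc zero_hom_def)
    show "(b \<oplus>\<^bsub>B\<^esub> b') \<odot>\<^bsub>N\<^esub> x = b \<odot>\<^bsub>N\<^esub> x \<oplus>\<^bsub>N\<^esub> b' \<odot>\<^bsub>N\<^esub> x"
      if "b \<in> carrier B" "b' \<in> carrier B" "x \<in> carrier N" for b b' x
      using that addH by (auto simp: Bc Nc add Ns simp del: endo_algebra_simps) simp
    show "b \<odot>\<^bsub>N\<^esub> (x \<oplus>\<^bsub>N\<^esub> y) = b \<odot>\<^bsub>N\<^esub> x \<oplus>\<^bsub>N\<^esub> b \<odot>\<^bsub>N\<^esub> y"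
      if "b \<in> carrier B" "x \<in> carrier N" "y \<in> carrier N" for b x y
      using that lin_add[OF Hom_lin] by (auto simp: Bc Nc Ns)
    show "(b \<otimes>\<^bsub>B\<^esub> b') \<odot>\<^bsub>N\<^esub> x = b \<odot>\<^bsub>N\<^esub> (b' \<odot>\<^bsub>N\<^esub> x)"
      if "b \<in> carrier B" "b' \<in> carrier B" "x \<in> carrier N" for b b' x
      using that multH by (auto simp: Bc Nc mult Ns simp del: endo_algebra_simps) (simp add: compose_def)
    show "\<one>\<^bsub>B\<^esub> \<odot>\<^bsub>N\<^esub> x = x" if "x \<in> carrier N" for x
      using that Ns[OF oneH] by (simp add: one Nc)
  qed (auto simp: Nc Mac Mcl)
  have "a \<odot>\<^bsub>M\<^esub> (b \<odot>\<^bsub>N\<^esub> x) = b \<odot>\<^bsub>N\<^esub> (a \<odot>\<^bsub>M\<^esub> x)"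
    if a: "a \<in> carrier A" and b: "b \<in> carrier B" and x: "x \<in> carrier M" for a b x
  proof -
    obtain f where f: "f \<in> Hom A M M" "b = \<kappa> f" using b by (auto simp: Bc)
    show ?thesis using lin_smult[OF Hom_lin[OF f(1)] a x] Ns[OF f(1)] f(2) by simp
  qed
  then have comm: "commuting A M B N" unfolding commuting_def using M NM Nc by simp
  have cent: "centralizes A M B N"
    unfolding centralizes_def
  proof (intro conjI allI impI ballI)
    fix f assume f: "lin A M M f"
    have r: "restrict f (carrier M) \<in> Hom A M M" by (rule restrict_Hom[OF M f])
    show "\<exists>b \<in> carrier B. \<forall>x \<in> carrier M. f x = b \<odot>\<^bsub>N\<^esub> x"
      by (intro bexI[of _ "\<kappa> (restrict f (carrier M))"]) (use r in \<open>auto simp: Bc Ns\<close>)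
  next
    fix b assume "b \<in> carrier B" and 0: "\<forall>x \<in> carrier M. b \<odot>\<^bsub>N\<^esub> x = \<zero>\<^bsub>M\<^esub>"
    then obtain f where f: "f \<in> Hom A M M" "b = \<kappa> f" by (auto simp: Bc)
    have "f = zero_hom M M"
      by (rule Hom_eqI[OF f(1) zero_hom_Hom[OF M M]]) (use 0 f Ns in \<open>auto simp: zero_hom_def\<close>)
    then show "b = \<zero>\<^bsub>B\<^esub>" using f(2) zero by simp
  qed
  have "fg B N"
  proof -
    obtain G where G: "finite G" "G \<subseteq> carrier M" "carrier M \<subseteq> gen K (scalars A M) G"
      using f fg_scalars[OF A M] unfolding fg_def by auto
    have "x \<in> gen B N G" if "x \<in> gen K (scalars A M) G" for x
      using that
    proof induction
      case gen_zero then show ?case using gen.gen_zero[of N B G] by (simp add: Nc)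
    next
      case (gen_base b) then show ?case by (rule gen.gen_base)
    next
      case (gen_add x y) then show ?case using gen.gen_add[of x B N G y] by (simp add: Nc)
    next
      case (gen_smult c x)
      have xM: "x \<in> carrier M"
        using gen_subset[OF left_module_scalars[OF A M] _ gen_smult(2)] G(2) by simp
      have l: "lin A M M (\<lambda>x. c \<odot>\<^bsub>scalars A M\<^esub> x)" by (rule lin_commuting[OF commuting_scalars[OF A M] gen_smult(1)])
      let ?h = "restrict (\<lambda>x. c \<odot>\<^bsub>scalars A M\<^esub> x) (carrier M)"
      have h: "?h \<in> Hom A M M" by (rule restrict_Hom[OF M l])
      have "\<kappa> ?h \<odot>\<^bsub>N\<^esub> x \<in> gen B N G"
        by (rule gen.gen_smult[OF _ gen_smult(3)]) (use h in \<open>simp add: Bc\<close>)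
      then show ?case using Ns[OF h] xM by simp
    qed
    then show ?thesis using fgI[of G N B] G by (auto simp: Nc)
  qed
  then show thesis using that B comm cent by blast
qed

lemma fd_algebra_opposite:
  assumes "fd_algebra K A" shows "fd_algebra K (opposite A)"
proof -
  note a = fd_algebraD[OF assms]
  interpret A: ring A by (rule a(2))
  have o [simp]: "carrier (opposite A) = carrier A" "\<zero>\<^bsub>opposite A\<^esub> = \<zero>\<^bsub>A\<^esub>" "\<one>\<^bsub>opposite A\<^esub> = \<one>\<^bsub>A\<^esub>"
    "ring.add (opposite A) = ring.add A" "module.smult (opposite A) = module.smult A"
    "x \<otimes>\<^bsub>opposite A\<^esub> y = y \<otimes>\<^bsub>A\<^esub> x" for x y
    by (simp_all add: opposite_def)
  have M: "left_module K (opposite A)" by (rule left_module_record_cong[OF a(3)]) simp_all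
  have R: "ring (opposite A)"
  proof (rule ringI)
    show "abelian_group (opposite A)" by (rule left_module_group[OF M])
    show "monoid (opposite A)" by (rule monoidI) (simp_all add: A.m_assoc)
  qed (simp_all add: A.l_distr A.r_distr)
  have "fg K (opposite A)"
  proof (rule fg_image[OF a(3) M])
    show "lin K A (opposite A) (\<lambda>x. x)" by (rule linI) simp_all
    show "fg K A" using a(4) finitely_generated_iff[OF a(3)] by simp
  qed simp
  then show ?thesis
    unfolding fd_algebra_def using a(1,5,6) M R finitely_generated_iff[OF M] by simp
qed

section \<open>Self-orthogonal quasi-generators\<close>

lemma dual_zero_carrier:
  assumes M: "left_module A M" and X: "left_module A X" and z: "carrier X = {\<zero>\<^bsub>X\<^esub>}"
  shows "carrier (dual A M N X) = {\<zero>\<^bsub>dual A M N X\<^esub>}"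
proof -
  have "f = zero_hom X M" if "f \<in> Hom A X M" for f
  proof (rule Hom_eqI[OF that zero_hom_Hom[OF X M]])
    fix x assume x: "x \<in> carrier X"
    then have "x = \<zero>\<^bsub>X\<^esub>" unfolding z by simp
    then have "f x = \<zero>\<^bsub>M\<^esub>" using lin_zero[OF X M Hom_lin[OF that]] by simp
    then show "f x = zero_hom X M x" using x by (simp add: zero_hom_def)
  qed
  then have "Hom A X M = {zero_hom X M}" using zero_hom_Hom[OF X M] by blast
  then show ?thesis by simp
qed

text \<open>
  If \<open>M\<close> is carried by \<open>nat \<Rightarrow> 'k\<close>, then so is \<open>N\<close>, and the tilting hypothesis can be applied to it. The
  terms of the resolution are submodules of duals of the terms of the tilting coresolution, which
  explains their type.
\<close>

lemma projective_resolution_of_quasi_generator: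
  fixes K :: "'k ring" and A :: "('k, 'a) module" and M :: "('a, nat \<Rightarrow> 'k) module"
  assumes hyp: "finite_pd_domdim_infinite_imp_tilting TYPE('k)"
    and A: "fd_algebra K A" and M: "left_module A M" and f: "fg A M"
    and P: "resol A M P \<epsilon> \<delta>" and projP: "\<And>i. in_add A (regular_module A) (P i)"
    and aP: "\<And>k. acyc_at A P \<delta> M k"
    and X: "coexact A (regular_module A) X e d" and Xadd: "\<And>i. in_add A M (X i)"
    and X0: "\<And>i. i > n \<Longrightarrow> carrier (X i) = {\<zero>\<^bsub>X i\<^esub>}"
    and hX: "hom_exact A (regular_module A) X e d M"
  shows "\<exists>(W :: nat \<Rightarrow> ('a, (nat \<Rightarrow> nat \<Rightarrow> 'k) \<Rightarrow> nat \<Rightarrow> 'k) module) \<epsilon> \<delta>. resol A M W \<epsilon> \<delta> \<and>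
    (\<forall>i. in_add A (regular_module A) (W i)) \<and> (\<forall>i > n. carrier (W i) = {\<zero>\<^bsub>W i\<^esub>})"
proof -
  obtain B :: "('k, nat \<Rightarrow> 'k) module" and N :: "(nat \<Rightarrow> 'k, nat \<Rightarrow> 'k) module" where
    B: "fd_algebra K B" and c: "commuting A M B N" and z: "centralizes A M B N" and Nfg: "fg B N"
    by (rule centralizer_exists[OF A M f])
  note NM = commutingD(2)[OF c] and x = coexactD[OF X]
  have RB: "left_module B (regular_module B)" by (rule left_module_regular[OF fd_algebraD(2)[OF B]])
  have rX: "reflexive A M B N (X i)" for i by (rule reflexive_in_add[OF c M Xadd reflexive_self[OF c z]])
  \<comment> \<open>Now \<open>A\<close> and \<open>B\<close> are each other's centralizers, and both dualities are available.\<close>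
  have z': "centralizes B N A M" by (rule double_centralizer[OF c X hX rX])
  have rP: "reflexive A M B N (P i)" for i
    by (rule reflexive_in_add[OF c x(1) projP reflexive_regular[OF c z']])
  \<comment> \<open>a projective resolution of \<open>N\<close> of length \<open>n\<close>, witnessing also that \<open>N\<close> is self-orthogonal\<close>
  note DX = resol_dual[OF c X hX]
  have projDX: "in_add B (regular_module B) (dual A M N (X i))" for i by (rule dual_in_add_self[OF c z Xadd])
  note aDX = acyc_dual[OF c X rX]
  have "self_orthogonal B N" using self_orthogonal_iff[OF DX projDX] aDX by simp
  moreover have "proj_dim B N < \<infinity>"
  proof -
    have "proj_dim B N \<le> enat n"
      by (rule proj_dim_le[OF DX projDX dual_zero_carrier[OF M x(2) X0]])
    then show ?thesis using enat_ord_simps(4) le_less_trans by blast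
  qed
  moreover have "domdim_infinite B N (regular_module B)"
    by (rule domdim_infiniteI[OF coexact_dual[OF c z P rP aP] dual_in_add_regular[OF c projP] NM])
  moreover have "finitely_generated B N" using finitely_generated_iff[OF NM] Nfg by simp
  ultimately have "tilting B N"
    using hyp B NM unfolding finite_pd_domdim_infinite_imp_tilting_def by blast
  then obtain m and Y :: "nat \<Rightarrow> (nat \<Rightarrow> 'k, nat \<Rightarrow> nat \<Rightarrow> 'k) module" and e' d' where
    Y: "\<And>i. i \<le> m \<Longrightarrow> in_add B N (Y i)" "exact_upto B (regular_module B) Y e' d' m"
      "image_in (regular_module B) Y e' d' m = carrier (Y m)"
    unfolding tilting_def n_tilting_def by blast
  obtain Z :: "nat \<Rightarrow> (nat \<Rightarrow> 'k, nat \<Rightarrow> nat \<Rightarrow> 'k) module" and dZ where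
    Z: "coexact B (regular_module B) Z e' dZ" and Zadd: "\<And>i. in_add B N (Z i)"
    and Z0: "\<And>i. i > m \<Longrightarrow> carrier (Z i) = {\<zero>\<^bsub>Z i\<^esub>}"
  proof (rule coexact_of_exact_upto[OF RB NM Y], goal_cases)
    case (2 Z dZ)
    show ?case by (rule 2(1)[OF 2(2-4)])
  qed auto
  have hZ: "hom_exact B (regular_module B) Z e' dZ N"
  proof (rule hom_exact_finite_coresolution[OF Z Zadd Z0 DX projDX aDX NM])
    fix i U assume U: "left_module B (Z i\<lparr>carrier := U\<rparr>)" "U \<subseteq> carrier (Z i)"
    have "fg B (Z i\<lparr>carrier := U\<rparr>)"
      by (rule fg_submodule[OF B in_add_left_module[OF Zadd] fg_in_add[OF NM Zadd Nfg] U])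
    then show "\<exists>(P :: nat \<Rightarrow> (nat \<Rightarrow> 'k, nat \<Rightarrow> nat \<Rightarrow> 'k) module) \<epsilon> \<delta>.
        resol B (Z i\<lparr>carrier := U\<rparr>) P \<epsilon> \<delta> \<and> (\<forall>i. in_add B (regular_module B) (P i))"
      by (rule projective_resolution_exists[OF B U(1)]) blast
  qed
  note c' = commuting_sym[OF c]
  \<comment> \<open>The tilting coresolution of \<open>B\<close>, dualized back to \<open>A\<close>, is a finite projective resolution of \<open>M\<close>.\<close>
  note W = resol_dual[OF c' Z hZ]
  have projW: "in_add A (regular_module A) (dual B N M (Z i))" for i by (rule dual_in_add_self[OF c' z' Zadd])
  have W0: "carrier (dual B N M (Z i)) = {\<zero>\<^bsub>dual B N M (Z i)\<^esub>}" if "i > m" for i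
    by (rule dual_zero_carrier[OF NM in_add_left_module[OF Zadd] Z0[OF that]])
  have aW: "acyc_at A (\<lambda>i. dual B N M (Z i)) (\<lambda>i g. compose (carrier (Z i)) g (dZ i)) M k" for k
    by (rule acyc_at_in_add[OF W projW P projP in_add_self[OF M] M aP])
  show ?thesis
    by (rule projective_truncation[OF W projW W0 aW X Xadd X0]) blast+
qed

text \<open>
  \<open>M\<close> is finite-dimensional over \<open>K\<close>, so it has a copy \<open>M'\<close> on the type \<open>nat \<Rightarrow> 'k\<close>. Its resolutions and
  coresolutions are those of \<open>M\<close> up to the identification of \<open>M\<close> with \<open>M'\<close>.
\<close>

lemma proj_dim_quasi_generator:
  fixes K :: "'k ring" and A :: "('k, 'a) module" and M :: "('a, 'm) module"
  assumes hyp: "finite_pd_domdim_infinite_imp_tilting TYPE('k)"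
    and A: "fd_algebra K A" and M: "left_module A M" and fin: "finitely_generated A M"
    and so: "self_orthogonal A M" and q: "quasi_generating_sequence A n M"
  shows "proj_dim A M \<le> enat n"
proof -
  have f: "fg A M" using fin finitely_generated_iff[OF M] by simp
  have RA: "left_module A (regular_module A)" by (rule left_module_regular[OF fd_algebraD(2)[OF A]])
  have S: "left_module K (scalars A M)" by (rule left_module_scalars[OF A M])
  have "finitely_generated K (scalars A M)"
    using finitely_generated_iff[OF S] fg_scalars[OF A M] f by simp
  then obtain \<iota> :: "'m \<Rightarrow> nat \<Rightarrow> 'k" where "inj_on \<iota> (carrier (scalars A M))"
    using finitely_generated_inj[OF S] by blast
  then have \<iota>: "inj_on \<iota> (carrier M)" by simp
  define M' where "M' = copy \<iota> M"
  obtain h g where i: "mod_iso A M M' h g" using mod_iso_copy[OF \<iota> M] unfolding M'_def by blast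
  note M'M = mod_isoD(2)[OF i]
  have M'add: "in_add A M M'" by (rule in_add_iso[OF i M in_add_self[OF M]])
  obtain P :: "nat \<Rightarrow> ('a, nat \<Rightarrow> 'a) module" and \<epsilon> \<delta> where P: "resol A M P \<epsilon> \<delta>"
    and projP: "\<forall>i. in_add A (regular_module A) (P i)" by (rule projective_resolution_exists[OF A M f])
  have aP: "acyc_at A P \<delta> M' k" for k
    using acyc_at_add[OF P M M'add] self_orthogonal_iff[OF P] projP so by blast
  obtain X :: "nat \<Rightarrow> ('a, nat \<Rightarrow> 'm) module" and e d where
    X: "\<And>i. i \<le> n \<Longrightarrow> in_add A M (X i)" "exact_upto A (regular_module A) X e d n"
      "image_in (regular_module A) X e d n = carrier (X n)"
    and hX: "Hom_exact_upto A (regular_module A) X e d M n"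
      "Hom_kernel A (regular_module A) X e d M n = {zero_hom (X n) M}"
    using q unfolding quasi_generating_sequence_def by blast
  obtain X' :: "nat \<Rightarrow> ('a, nat \<Rightarrow> 'm) module" and d' where
    X': "coexact A (regular_module A) X' e d'" and X'add: "\<And>i. in_add A M (X' i)"
    and X'0: "\<And>i. i > n \<Longrightarrow> carrier (X' i) = {\<zero>\<^bsub>X' i\<^esub>}"
    and hX': "hom_exact A (regular_module A) X' e d' M"
  proof (rule coexact_of_exact_upto[OF RA M X], goal_cases)
    case (2 X' d')
    show ?case by (rule 2(1)[OF 2(2-4) 2(5)[OF hX]])
  qed auto
  obtain W :: "nat \<Rightarrow> ('a, (nat \<Rightarrow> nat \<Rightarrow> 'k) \<Rightarrow> nat \<Rightarrow> 'k) module" and \<epsilon>' \<delta>' where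
    W: "resol A M' W \<epsilon>' \<delta>'" and projW: "\<forall>i. in_add A (regular_module A) (W i)"
    and W0: "\<forall>i > n. carrier (W i) = {\<zero>\<^bsub>W i\<^esub>}"
    using projective_resolution_of_quasi_generator[OF hyp A M'M fg_image[OF M M'M mod_isoD(3)[OF i] mod_iso_image[OF i] f]
      resol_augmentation_iso[OF P i] projP[rule_format] aP X' in_add_base_iso[OF i X'add] X'0
      hom_exact_target_iso[OF hX' i]] by blast
  show ?thesis
    by (rule proj_dim_le[OF resol_augmentation_iso[OF W mod_iso_sym[OF i]] projW[rule_format]])
      (use W0 in blast)
qed

theorem proposition4p4:
  fixes K :: "'k ring" and A :: "('k, 'a) module" and n :: nat
  assumes "finite_pd_domdim_infinite_imp_tilting TYPE('k)"
    and "fd_algebra K A"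
  shows
    "(\<forall>M :: ('a, 'm) module.
        left_module A M \<longrightarrow> finitely_generated A M \<longrightarrow>
        self_orthogonal A M \<longrightarrow> quasi_generator A n M \<longrightarrow> proj_dim A M \<le> enat n) \<and>
     (\<forall>M :: ('a, 'm) module.
        left_module (opposite A) M \<longrightarrow> finitely_generated (opposite A) M \<longrightarrow>
        self_orthogonal (opposite A) M \<longrightarrow> quasi_generator (opposite A) n M \<longrightarrow>
        proj_dim (opposite A) M \<le> enat n)"
proof (intro conjI allI impI)
  fix M :: "('a, 'm) module"
  assume "left_module A M" "finitely_generated A M" "self_orthogonal A M" "quasi_generator A n M"
  then show "proj_dim A M \<le> enat n"
    by (intro proj_dim_quasi_generator[OF assms]) (simp_all add: quasi_generator_def)
next
  fix M :: "('a, 'm) module"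
  assume "left_module (opposite A) M" "finitely_generated (opposite A) M"
    "self_orthogonal (opposite A) M" "quasi_generator (opposite A) n M"
  then show "proj_dim (opposite A) M \<le> enat n"
    by (intro proj_dim_quasi_generator[OF assms(1) fd_algebra_opposite[OF assms(2)]])
      (simp_all add: quasi_generator_def)
qed

end
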